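(* Let $\lambda,\mu\in\Lambda_n$, $x\in\mathfrak R(\lambda)$, $y\in\mathfrak R(\mu)$. Then $x\le_{\mathcal{LR}}y$ if and only if $\mu\trianglelefteq\lambda$. In particular $w_\lambda\le_{\mathcal{LR}}w_\mu$ iff $\mu\trianglelefteq\lambda$, and the sets $\mathfrak R(\lambda)$, $\lambda\in\Lambda_n$, are precisely the two-sided cells of $\mathfrak S_n$.
   Context: Let $W=\mathfrak S_n$ with Coxeter generators $s_i=(i,i+1)$, $1\le i<n$, length $l$, $\varepsilon_w=(-1)^{l(w)}$. $A=\mathbb Z[v,v^{-1}]$, $\bar{\ }$ the involution $v\mapsto v^{-1}$. $\mathcal H$ is the Iwahori–Hecke algebra over $A$ with basis $\{T_w\}$, $T_sT_w=T_{sw}$ if $l(sw)>l(w)$ and $T_sT_w=T_{sw}+(v-v^{-1})T_w$ otherwise. The involution $\overline{\sum a_wT_w}=\sum\bar a_wT_{w^{-1}}^{-1}$; $C_w$ (resp. $C'_w$) is the unique bar-invariant element with $C_w-T_w\in\sum_y v\mathbb Z[v]T_y$ (resp. $C'_w-T_w\in\sum_y v^{-1}\mathbb Z[v^{-1}]T_y$). Define $h_{x,y,z}$ by $C'_xC'_y=\sum_z h_{x,y,z}C'_z$. Write $x\leftarrow_{\mathcal L}y$ if $h_{s,y,x}\ne0$ for some generator $s$; $\le_{\mathcal L}$ is its reflexive–transitive closure; $x\le_{\mathcal R}y$ iff $x^{-1}\le_{\mathcal L}y^{-1}$; $\le_{\mathcal{LR}}$ is the pre-order generated by $\le_{\mathcal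 L}$ and $\le_{\mathcal R}$; the classes of the associated equivalence $\sim_{\mathcal{LR}}$ are the two-sided cells. $\Lambda_n$ = partitions of $n$ with dominance order $\trianglelefteq$ (partial sums). $\mathfrak S_\lambda$ is the Young subgroup generated by the $s_k$ with $k\notin\{\lambda_1+\dots+\lambda_i\}$, $w_\lambda$ its longest element. Over $K=\mathbb R(v)$, the irreducible characters $\chi_\lambda$ of $\mathcal H_K$ are labelled so that the character induced from the sign representation $T_u\mapsto\varepsilon_uv^{-l(u)}$ of the parabolic subalgebra of $\mathfrak S_\lambda$ equals $\chi_\lambda$ plus a sum of $\chi_\mu$ with $\lambda\triangleleft\mu$; $d_\lambda=\chi_\lambda(T_1)$, $a(\lambda)=l(w_\lambda)$. Let $\mathcal O$ be the localization of $\mathbb R[v]$ at $(v)$. For each $\lambda$ fix an orthogonal matrix representation $\mathfrak X_\lambda$ affording $\chi_\lambda$ (i.e. $\mathfrak X_\lambda(T_{w^{-1}})=P^{-1}\mathfrak X_\lambda(T_w)^{tr}P$ with $P$ invertible diagonal, entries in $1+v\mathbb R[v]$); the constant term at $v=0$ of $v^{a(\lambda)}\mathfrak X^{ij}_\lambda(T_w)\in\mathcal O$ is written $\varepsilon_wc^{ij}_{w,\lambda}$, and the $\mathfrak X_\lambda$ are chosen with all $c^{ij}_{w,\lambda}\in\mathbb Z$. Then for each $\lambda$ and $1\le i,j\le d_\lambda$ there is a unique $w=\mathbf w_\lambda(i,j)$ with $c^{ij}_{w,\lambda}\ne0$, these give a bijection onto $\mathfrak S_n$, and $\mathfrak R(\lambda):=\{\mathbf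 w_\lambda(i,j)\}$; so $\mathfrak S_n=\coprod_\lambda\mathfrak R(\lambda)$, and $w_\lambda\in\mathfrak R(\lambda)$. *)

theory Defs
  imports "HOL-Combinatorics.Permutations" "HOL-Computational_Algebra.Fraction_Field"
    "HOL-Computational_Algebra.Polynomial" "Jordan_Normal_Form.Matrix"
begin

type_synonym perm = "nat \<Rightarrow> nat"

definition Wn :: "nat \<Rightarrow> perm set" where
  "Wn n = {w. w permutes {1..n}}"

definition gen :: "nat \<Rightarrow> perm" where
  "gen i = Transposition.transpose i (Suc i)"

definition len :: "nat \<Rightarrow> perm \<Rightarrow> nat" where
  "len n w = (LEAST k. \<exists>ws. length ws = k \<and> set ws \<subseteq> {1..<n} \<and> w = foldr (\<circ>) (map gen ws) id)"

type_synonym K = "real poly fract"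

definition vK :: K where "vK = Fraction_Field.Fract [:0, 1:] 1"

text \<open>A = Z[v,v^-1], and v^-1 Z[v^-1].\<close>
definition Aset :: "K set" where
  "Aset = {Fraction_Field.Fract (map_poly of_int p) (monom 1 k) | p k. True}"

definition negA :: "K set" where
  "negA = {Fraction_Field.Fract (map_poly of_int p) (monom 1 k) | p k. degree p < k}"

text \<open>The bar involution v \<mapsto> v^-1 (on K; restricts to the involution of A).\<close>
definition barK :: "K \<Rightarrow> K" where
  "barK f = (THE g. \<exists>p q. q \<noteq> 0 \<and> f = Fraction_Field.Fract p q \<and>
      g = Fraction_Field.Fract (reflect_poly p * monom 1 (degree q)) (reflect_poly q * monom 1 (degree p)))"

section \<open>The Iwahori-Hecke algebra (elements: coefficient functions on W in the T-basis)\<close>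

type_synonym hk = "perm \<Rightarrow> K"

definition hk_on :: "nat \<Rightarrow> hk \<Rightarrow> bool" where
  "hk_on n h \<longleftrightarrow> (\<forall>u. u \<notin> Wn n \<longrightarrow> h u = 0)"

definition Tb :: "perm \<Rightarrow> hk" where
  "Tb w = (\<lambda>u. if u = w then 1 else 0)"

text \<open>Left multiplication by T_s, from T_s T_w = T_sw (l(sw)>l(w)), T_sw + (v-v^-1)T_w otherwise.\<close>
definition tsmul :: "nat \<Rightarrow> perm \<Rightarrow> hk \<Rightarrow> hk" where
  "tsmul n s h = (\<lambda>u. h (s \<circ> u) + (if len n (s \<circ> u) < len n u then (vK - inverse vK) * h u else 0))"

text \<open>Left multiplication by T_x, via T_x = T_s T_{sx} whenever l(sx) < l(x).\<close>
fun tmul :: "nat \<Rightarrow> nat \<Rightarrow> perm \<Rightarrow> hk \<Rightarrow> hk" where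
  "tmul n 0 x h = h"
| "tmul n (Suc k) x h =
     (let i = (SOME i. i \<in> {1..<n} \<and> len n (gen i \<circ> x) < len n x)
      in tsmul n (gen i) (tmul n k (gen i \<circ> x) h))"

definition Tmult :: "nat \<Rightarrow> perm \<Rightarrow> hk \<Rightarrow> hk" where
  "Tmult n x h = tmul n (len n x) x h"

definition hmult :: "nat \<Rightarrow> hk \<Rightarrow> hk \<Rightarrow> hk" where
  "hmult n a b = (\<lambda>z. \<Sum>x\<in>Wn n. a x * Tmult n x b z)"

definition Tinv :: "nat \<Rightarrow> perm \<Rightarrow> hk" where
  "Tinv n w = (THE h. hk_on n h \<and> hmult n h (Tb w) = Tb id)"

definition hbar :: "nat \<Rightarrow> hk \<Rightarrow> hk" where
  "hbar n a = (\<lambda>z. \<Sum>w\<in>Wn n. barK (a w) * Tinv n (inv_into UNIV w) z)"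

definition KLp :: "nat \<Rightarrow> perm \<Rightarrow> hk" where
  "KLp n w = (THE c. hk_on n c \<and> (\<forall>u. c u \<in> Aset) \<and> hbar n c = c \<and>
                     (\<forall>u. c u - Tb w u \<in> negA))"

definition hcoef :: "nat \<Rightarrow> perm \<Rightarrow> perm \<Rightarrow> perm \<Rightarrow> K" where
  "hcoef n x y = (THE f. (\<forall>z. z \<notin> Wn n \<longrightarrow> f z = 0) \<and>
        hmult n (KLp n x) (KLp n y) = (\<lambda>u. \<Sum>z\<in>Wn n. f z * KLp n z u))"

definition arrL :: "nat \<Rightarrow> perm \<Rightarrow> perm \<Rightarrow> bool" where
  "arrL n x y \<longleftrightarrow> x \<in> Wn n \<and> y \<in> Wn n \<and> (\<exists>i\<in>{1..<n}. hcoef n (gen i) y x \<noteq> 0)"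

definition leL :: "nat \<Rightarrow> perm \<Rightarrow> perm \<Rightarrow> bool" where
  "leL n x y \<longleftrightarrow> x \<in> Wn n \<and> y \<in> Wn n \<and> (arrL n)\<^sup>*\<^sup>* x y"

definition leR :: "nat \<Rightarrow> perm \<Rightarrow> perm \<Rightarrow> bool" where
  "leR n x y \<longleftrightarrow> leL n (inv_into UNIV x) (inv_into UNIV y)"

definition leLR :: "nat \<Rightarrow> perm \<Rightarrow> perm \<Rightarrow> bool" where
  "leLR n x y \<longleftrightarrow> x \<in> Wn n \<and> y \<in> Wn n \<and> (\<lambda>a b. leL n a b \<or> leR n a b)\<^sup>*\<^sup>* x y"

definition two_sided_cells :: "nat \<Rightarrow> perm set set" where
  "two_sided_cells n = {{y \<in> Wn n. leLR n x y \<and> leLR n y x} | x. x \<in> Wn n}"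

definition Par :: "nat \<Rightarrow> nat list set" where
  "Par n = {lam. sorted_wrt (\<ge>) lam \<and> 0 \<notin> set lam \<and> sum_list lam = n}"

text \<open>dominates mu lam: mu \<unlhd> lam in the dominance order.\<close>
definition dominates :: "nat list \<Rightarrow> nat list \<Rightarrow> bool" where
  "dominates mu lam \<longleftrightarrow> (\<forall>k. sum_list (take k mu) \<le> sum_list (take k lam))"

inductive_set young :: "nat \<Rightarrow> nat list \<Rightarrow> perm set" for n lam where
  young_id: "id \<in> young n lam"
| young_step: "w \<in> young n lam \<Longrightarrow> k \<in> {1..<n} \<Longrightarrow> k \<notin> {sum_list (take i lam) | i. 1 \<le> i}
     \<Longrightarrow> gen k \<circ> w \<in> young n lam"

definition wlam :: "nat \<Rightarrow> nat list \<Rightarrow> perm" where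
  "wlam n lam = (THE w. w \<in> young n lam \<and> (\<forall>u\<in>young n lam. len n u \<le> len n w))"

definition aval :: "nat \<Rightarrow> nat list \<Rightarrow> nat" where
  "aval n lam = len n (wlam n lam)"

definition repH :: "nat \<Rightarrow> nat \<Rightarrow> (perm \<Rightarrow> K mat) \<Rightarrow> hk \<Rightarrow> K mat" where
  "repH n d X h = mat d d (\<lambda>(i, j). \<Sum>w\<in>Wn n. h w * X w $$ (i, j))"

text \<open>X w is the matrix of T_w; the linear extension is an algebra homomorphism H_K \<rightarrow> K^{d\<times>d}.\<close>
definition is_rep :: "nat \<Rightarrow> nat \<Rightarrow> (perm \<Rightarrow> K mat) \<Rightarrow> bool" where
  "is_rep n d X \<longleftrightarrow> (\<forall>w\<in>Wn n. X w \<in> carrier_mat d d) \<and> repH n d X (Tb id) = 1\<^sub>m d \<and>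
     (\<forall>a b. hk_on n a \<longrightarrow> hk_on n b \<longrightarrow> repH n d X (hmult n a b) = repH n d X a * repH n d X b)"

definition is_subspace :: "nat \<Rightarrow> K vec set \<Rightarrow> bool" where
  "is_subspace d U \<longleftrightarrow> U \<subseteq> carrier_vec d \<and> 0\<^sub>v d \<in> U \<and>
     (\<forall>u\<in>U. \<forall>u'\<in>U. u + u' \<in> U) \<and> (\<forall>c. \<forall>u\<in>U. c \<cdot>\<^sub>v u \<in> U)"

definition irreducible_rep :: "nat \<Rightarrow> nat \<Rightarrow> (perm \<Rightarrow> K mat) \<Rightarrow> bool" where
  "irreducible_rep n d X \<longleftrightarrow> is_rep n d X \<and> d > 0 \<and>
     \<not> (\<exists>U. is_subspace d U \<and> U \<noteq> {0\<^sub>v d} \<and> U \<noteq> carrier_vec d \<and>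
            (\<forall>w\<in>Wn n. \<forall>u\<in>U. X w *\<^sub>v u \<in> U))"

text \<open>Character, as function w \<mapsto> \<chi>(T_w) (determines \<chi> by linearity).\<close>
definition charX :: "nat \<Rightarrow> (perm \<Rightarrow> K mat) \<Rightarrow> perm \<Rightarrow> K" where
  "charX n X = (\<lambda>w. if w \<in> Wn n then (\<Sum>i<dim_row (X w). X w $$ (i, i)) else 0)"

text \<open>Orthogonal: X(T_{w^-1}) = P^-1 X(T_w)^tr P, P diagonal with entries in 1 + vR[v].\<close>
definition orthogonal_rep :: "nat \<Rightarrow> nat \<Rightarrow> (perm \<Rightarrow> K mat) \<Rightarrow> bool" where
  "orthogonal_rep n d X \<longleftrightarrow> (\<exists>p :: nat \<Rightarrow> real poly. (\<forall>i<d. poly (p i) 0 = 1) \<and>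
     (let P = mat d d (\<lambda>(i,j). if i = j then Fraction_Field.Fract (p i) 1 else 0) in
      \<forall>w\<in>Wn n. P * X (inv_into UNIV w) = transpose_mat (X w) * P))"

text \<open>Character of H_K induced from the sign representation T_u \<mapsto> \<epsilon>_u v^{-l(u)} of the parabolic
  subalgebra of S_lam, computed in the basis T_d \<otimes> 1 (d distinguished left coset representatives).\<close>
definition sgnK :: "nat \<Rightarrow> perm \<Rightarrow> K" where
  "sgnK n u = (-1) ^ len n u * inverse vK ^ len n u"

definition distinguished :: "nat \<Rightarrow> nat list \<Rightarrow> perm set" where
  "distinguished n lam = {d \<in> Wn n. \<forall>u\<in>young n lam. len n d \<le> len n (d \<circ> u)}"

definition indchar :: "nat \<Rightarrow> nat list \<Rightarrow> perm \<Rightarrow> K" where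
  "indchar n lam w = (if w \<in> Wn n then
      (\<Sum>d\<in>distinguished n lam. \<Sum>u\<in>young n lam. Tmult n w (Tb d) (d \<circ> u) * sgnK n u) else 0)"

text \<open>f lies in O (localisation of R[v] at (v)) with value c at v = 0.\<close>
definition const0 :: "K \<Rightarrow> real \<Rightarrow> bool" where
  "const0 f c \<longleftrightarrow> (\<exists>p q. poly q 0 \<noteq> 0 \<and> f = Fraction_Field.Fract p q \<and> c = poly p 0 / poly q 0)"

definition cval :: "nat \<Rightarrow> nat list \<Rightarrow> (perm \<Rightarrow> K mat) \<Rightarrow> perm \<Rightarrow> nat \<Rightarrow> nat \<Rightarrow> real \<Rightarrow> bool" where
  "cval n lam X w i j c \<longleftrightarrow> const0 (vK ^ aval n lam * X w $$ (i, j)) ((-1) ^ len n w * c)"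

definition Rset :: "nat \<Rightarrow> nat list \<Rightarrow> nat \<Rightarrow> (perm \<Rightarrow> K mat) \<Rightarrow> perm set" where
  "Rset n lam d X = {w \<in> Wn n. \<exists>i<d. \<exists>j<d. \<exists>c. cval n lam X w i j c \<and> c \<noteq> 0}"

end

theory Submission
  imports Defs "Jordan_Normal_Form.Determinant"
begin

text \<open>
  Write C for the Kazhdan-Lusztig basis congruent to T modulo v; it gives the same preorder as C'.

  The sandwich of a column symmetrizer and a row antisymmetrizer of the same shape is one-dimensional, so the given irreducible
  representations are absolutely irreducible, and the Schur relations hold over K. Their leading terms at v = 0 make the matrices of
  leading coefficients integral and orthonormal; hence each w occurs at exactly one position of one shape.

  An induction from the top of the dominance order shows that the representation of shape mu kills C_z for z in R(lam) unless
  mu dominates lam. So for every mu the C_z with z in some R(nu), nu dominating mu, span a two-sided ideal, and going down in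
  the preorder can only increase the shape.

  Conversely, if C_y acts nontrivially in shape lam, the two-sided ideal generated by C_y contains the full matrix block of lam, hence,
  by comparing leading terms, involves every C_x with x in R(lam). For y the longest element of the Young subgroup of mu this
  nontriviality is the positivity of a Kostka number: a sign vector for the Young subgroup of lam is transformed into one for mu
  by moving boxes between adjacent rows, where nonvanishing follows from the positivity at v = 0 of the invariant form.
\<close>

section \<open>The field of fractions at v = 0 and the bar involution\<close>

text \<open>The data are thin: matrices over \<open>K\<close>, forms known only to be 1 at v = 0,
  and an identity of characters. Two orders on \<open>K\<close> make up for this. In the library
  order, by leading coefficients of polynomials, squares are nonnegative; together with the form for
  which the T_w are orthonormal, this turns the labelling identity into a statement about
  annihilation (\<open>ind_zero\<close>), and no induced module has to be built. The invariant forms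
  of the representations need not be positive in that order, since only their values at v = 0 are
  controlled; this is why the second order \<open>pos0\<close> exists. Integrality alone gives that
  the norm \<open>fa\<close> of a leading coefficient is an integer at least 1. That it equals 1 is
  a separate argument with the trace, and everything about unique positions rests on it. The
  remaining obstacle is that leading terms determine products only modulo v. They become exact
  equalities because an element of A that is bar-invariant and regular at 0 is constant
  (\<open>Aset_bar_const\<close>). No positivity of structure constants enters.\<close>

definition kp :: "real poly \<Rightarrow> K" where "kp p = Fraction_Field.Fract p 1"

lemma kp_simps [simp]: "kp 0 = 0" "kp 1 = 1" "kp (p + q) = kp p + kp q" "kp (p * q) = kp p * kp q"
  "kp (- p) = - kp p" "kp (p - q) = kp p - kp q"
  by (simp_all add: kp_def Zero_fract_def One_fract_def)

lemma kp_eq_iff [simp]: "kp p = kp q \<longleftrightarrow> p = q" by (simp add: kp_def eq_fract)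
lemma kp_eq_0_iff [simp]: "kp p = 0 \<longleftrightarrow> p = 0" using kp_eq_iff[of p 0] by simp

lemma Fract_kp: "q \<noteq> 0 \<Longrightarrow> Fraction_Field.Fract p q = kp p / kp q"
  by (simp add: kp_def)

lemma kp_cases: obtains p q where "q \<noteq> 0" "f = kp p / kp q"
proof (cases f)
  case (Fract a b)
  then show ?thesis using that[of b a] Fract_kp[of b a] by auto
qed

lemma vK_kp: "vK = kp [:0,1:]" by (simp add: vK_def kp_def)
lemma vK_nz [simp]: "vK \<noteq> 0" by (simp add: vK_kp)
lemma kp_monom: "kp (monom 1 k) = vK ^ k"
proof (induction k)
  case (Suc k)
  have "monom (1::real) (Suc k) = [:0,1:] * monom 1 k" by (simp add: monom_Suc)
  then show ?case using Suc by (simp only: kp_simps vK_kp power_Suc)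
qed (simp add: monom_0 flip: one_pCons)

lemma const0_iff: "const0 f c \<longleftrightarrow> (\<exists>p q. poly q 0 \<noteq> 0 \<and> f = kp p / kp q \<and> c = poly p 0 / poly q 0)"
proof -
  have "q \<noteq> 0" if "poly q 0 \<noteq> 0" for q :: "real poly" using that by auto
  then show ?thesis unfolding const0_def by (metis Fract_kp)
qed

text \<open>Cross-multiplication and evaluation at 0. Every later comparison of two leading terms of
  one element ends here.\<close>

lemma const0_unique: assumes "const0 f c" "const0 f c'" shows "c = c'"
proof -
  obtain p q where pq: "poly q 0 \<noteq> 0" "f = kp p / kp q" "c = poly p 0 / poly q 0"
    using assms(1) const0_iff by auto
  obtain p' q' where pq': "poly q' 0 \<noteq> 0" "f = kp p' / kp q'" "c' = poly p' 0 / poly q' 0"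
    using assms(2) const0_iff by auto
  have nz: "q \<noteq> 0" "q' \<noteq> 0" using pq(1) pq'(1) by auto
  have "kp (p * q') = kp (p' * q)" using pq(2) pq'(2) nz by (simp add: field_simps)
  then have "p * q' = p' * q" by (simp only: kp_eq_iff)
  then have "poly p 0 * poly q' 0 = poly p' 0 * poly q 0" by (metis poly_mult)
  then show ?thesis using pq(1,3) pq'(1,3) by (simp add: frac_eq_eq)
qed

lemma const0_kp: "const0 (kp p) (poly p 0)"
  unfolding const0_iff by (rule exI[of _ p], rule exI[of _ 1]) simp

lemma const0_0 [simp]: "const0 0 0" using const0_kp[of 0] by simp
lemma const0_1 [simp]: "const0 1 1" using const0_kp[of 1] by simp
lemma const0_vK [simp]: "const0 vK 0" using const0_kp[of "[:0,1:]"] by (simp add: vK_kp)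

lemma const0_add: assumes "const0 f c" "const0 g e" shows "const0 (f + g) (c + e)"
proof -
  obtain p q where pq: "poly q 0 \<noteq> 0" "f = kp p / kp q" "c = poly p 0 / poly q 0"
    using assms(1) const0_iff by auto
  obtain p' q' where pq': "poly q' 0 \<noteq> 0" "g = kp p' / kp q'" "e = poly p' 0 / poly q' 0"
    using assms(2) const0_iff by auto
  have nz: "q \<noteq> 0" "q' \<noteq> 0" using pq(1) pq'(1) by auto
  show ?thesis unfolding const0_iff
    by (rule exI[of _ "p * q' + p' * q"], rule exI[of _ "q * q'"])
      (use pq pq' nz in \<open>simp add: add_frac_eq\<close>)
qed

lemma const0_mult: assumes "const0 f c" "const0 g e" shows "const0 (f * g) (c * e)"
proof -
  obtain p q where pq: "poly q 0 \<noteq> 0" "f = kp p / kp q" "c = poly p 0 / poly q 0"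
    using assms(1) const0_iff by auto
  obtain p' q' where pq': "poly q' 0 \<noteq> 0" "g = kp p' / kp q'" "e = poly p' 0 / poly q' 0"
    using assms(2) const0_iff by auto
  show ?thesis unfolding const0_iff
    by (rule exI[of _ "p * p'"], rule exI[of _ "q * q'"])
      (use pq pq' in simp)
qed

lemma const0_minus: assumes "const0 f c" shows "const0 (- f) (- c)"
  using const0_mult[OF const0_kp[of "-1"] assms] by simp

lemma const0_diff: "const0 f c \<Longrightarrow> const0 g e \<Longrightarrow> const0 (f - g) (c - e)"
  using const0_add[OF _ const0_minus, of f c g e] by simp

lemma const0_sum: "(\<And>i. i \<in> I \<Longrightarrow> const0 (f i) (c i)) \<Longrightarrow> const0 (sum f I) (sum c I)"
  by (induction I rule: infinite_finite_induct) (auto intro: const0_add)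

lemma const0_power: "const0 f c \<Longrightarrow> const0 (f ^ k) (c ^ k)"
  by (induction k) (auto intro: const0_mult)

lemma const0_inverse: assumes "const0 f c" "c \<noteq> 0" shows "const0 (inverse f) (inverse c)"
proof -
  obtain p q where pq: "poly q 0 \<noteq> 0" "f = kp p / kp q" "c = poly p 0 / poly q 0"
    using assms(1) const0_iff by auto
  show ?thesis unfolding const0_iff
    by (rule exI[of _ q], rule exI[of _ p]) (use pq assms in auto)
qed

lemma const0_nat_power_v: "const0 (vK ^ k) (if k = 0 then 1 else 0)"
  using const0_power[OF const0_vK, of k] by (simp add: power_0_left)

lemma const0_powi_v: "k \<ge> 0 \<Longrightarrow> const0 (vK powi k) (if k = 0 then 1 else 0)"
  using const0_nat_power_v[of "nat k"] by (auto simp: power_int_def split: if_splits)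

lemma const0_zero_mult_powi: assumes "const0 f c" "0 < k" shows "const0 (vK powi k * f) 0"
  using const0_mult[OF const0_powi_v[of k] assms(1)] assms(2) by simp

lemma poly_scale_v: assumes "p \<noteq> 0" shows "\<exists>k. \<exists>r. p = monom 1 k * r \<and> poly r 0 \<noteq> (0::real)"
proof -
  obtain r where r: "p = [:- 0, 1:] ^ order 0 p * r \<and> \<not> [:- 0, 1:] dvd r"
    using order_decomp[OF assms] by blast
  have "[:0, 1:] ^ m = monom (1::real) m" for m by (induction m) (auto simp: monom_Suc monom_0)
  then show ?thesis using r poly_eq_0_iff_dvd[of r 0] by auto
qed

lemma const0_scale: assumes "f \<noteq> 0" shows "\<exists>k::int. \<exists>c. c \<noteq> 0 \<and> const0 (vK powi k * f) c"
proof -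
  obtain p q where pq: "q \<noteq> 0" "f = kp p / kp q" by (rule kp_cases)
  with assms have "p \<noteq> 0" by auto
  then obtain k r where r: "p = monom 1 k * r" "poly r 0 \<noteq> 0" using poly_scale_v by blast
  obtain l s where s: "q = monom 1 l * s" "poly s 0 \<noteq> 0" using poly_scale_v[OF pq(1)] by blast
  have "vK powi (int l - int k) * f = kp r / kp s"
    using pq(2) unfolding r(1) s(1) by (simp add: kp_monom power_int_diff)
  then show ?thesis using r s const0_iff[of "kp r / kp s"] by (metis divide_eq_0_iff)
qed

text \<open>The common exponent is that of the worst pole: all members become regular, and the one
  attaining it keeps a nonzero constant term. Arguments by leading terms start here whenever nothing
  is known about poles.\<close>

lemma const0_scale_family:
  assumes "finite I" "\<exists>i\<in>I. f i \<noteq> 0"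
  shows "\<exists>k::int. \<exists>c. (\<forall>i\<in>I. const0 (vK powi k * f i) (c i)) \<and> (\<exists>i\<in>I. c i \<noteq> 0)"
proof -
  define I' where "I' = {i \<in> I. f i \<noteq> 0}"
  have "\<forall>i\<in>I'. \<exists>k::int. \<exists>c. c \<noteq> 0 \<and> const0 (vK powi k * f i) c"
    using const0_scale unfolding I'_def by blast
  then obtain K C where KC: "\<And>i. i \<in> I' \<Longrightarrow> C i \<noteq> 0 \<and> const0 (vK powi K i * f i) (C i)" by metis
  have fin: "finite (K ` I')" and ne: "K ` I' \<noteq> {}" using assms unfolding I'_def by auto
  \<comment> \<open>\<open>K i\<close> is the exponent that makes \<open>f i\<close> a unit at 0, so
    the largest one belongs to the lowest valuation.\<close>
  define k where "k = Max (K ` I')"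
  obtain i0 where i0: "i0 \<in> I'" "K i0 = k" using Max_in[OF fin ne] unfolding k_def by auto
  have "\<exists>c. const0 (vK powi k * f i) c" if "i \<in> I" for i
  proof (cases "f i = 0")
    case True
    then have "const0 (vK powi k * f i) 0" by simp
    then show ?thesis ..
  next
    case False
    then have i: "i \<in> I'" using that I'_def by auto
    then have le: "K i \<le> k" using fin k_def by auto
    have e: "vK powi k * f i = vK powi (k - K i) * (vK powi K i * f i)" by (simp add: power_int_diff)
    have "const0 (vK powi (k - K i) * (vK powi K i * f i)) ((if k - K i = 0 then 1 else 0) * C i)"
      using le KC[OF i] by (intro const0_mult const0_powi_v) auto
    then show ?thesis unfolding e ..
  qed
  then obtain c where c: "\<forall>i\<in>I. const0 (vK powi k * f i) (c i)" by metis
  have "i0 \<in> I" using i0 I'_def by auto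
  then have "const0 (vK powi k * f i0) (c i0)" using c by auto
  moreover have "const0 (vK powi k * f i0) (C i0)" using KC[OF i0(1)] i0(2) by simp
  ultimately have "c i0 = C i0" by (rule const0_unique)
  then have "c i0 \<noteq> 0" using KC[OF i0(1)] by simp
  then show ?thesis using c \<open>i0 \<in> I\<close> by (intro exI[of _ k] exI[of _ c] conjI bexI[of _ i0])
qed

text \<open>The order of the formal Laurent series field at v = 0: an element is positive iff its lowest coefficient is.\<close>
definition pos0 :: "K \<Rightarrow> bool" where
  "pos0 f \<longleftrightarrow> (\<exists>k::int. \<exists>c>0. const0 (vK powi k * f) c)"

definition nonneg0 :: "K \<Rightarrow> bool" where "nonneg0 f \<longleftrightarrow> f = 0 \<or> pos0 f"

lemma pos0_const0: "const0 f c \<Longrightarrow> c > 0 \<Longrightarrow> pos0 f"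
  unfolding pos0_def by (rule exI[of _ 0]) auto

lemma pos0_nz: "pos0 f \<Longrightarrow> f \<noteq> 0"
  unfolding pos0_def using const0_unique[OF const0_0] by fastforce

lemma pos0_add: assumes "pos0 f" "pos0 g" shows "pos0 (f + g)"
proof -
  have *: "pos0 (f + g)" if "const0 (vK powi k * f) c" "c > 0" "const0 (vK powi l * g) e" "e > 0" "l \<le> k"
    for f g c e and k l :: int
  proof -
    have "vK powi k * (f + g) = vK powi k * f + vK powi (k - l) * (vK powi l * g)"
      by (simp add: power_int_diff distrib_left)
    moreover have "const0 (vK powi (k - l) * (vK powi l * g)) ((if k - l = 0 then 1 else 0) * e)"
      using const0_mult[OF const0_powi_v[of "k - l"] that(3)] that(5) by simp
    ultimately have "const0 (vK powi k * (f + g)) (c + (if k - l = 0 then 1 else 0) * e)"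
      using const0_add[OF that(1)] by metis
    then show ?thesis unfolding pos0_def using that by (intro exI[of _ k]) (auto intro!: exI[of _ "c + (if k - l = 0 then 1 else 0) * e"])
  qed
  obtain k c where 1: "const0 (vK powi k * f) c" "c > 0" using assms(1) pos0_def by auto
  obtain l e where 2: "const0 (vK powi l * g) e" "e > 0" using assms(2) pos0_def by auto
  show ?thesis using *[OF 1 2] *[OF 2 1] by (cases "l \<le> k") (auto simp: add.commute)
qed

lemma pos0_mult: assumes "pos0 f" "pos0 g" shows "pos0 (f * g)"
proof -
  obtain k c where 1: "const0 (vK powi k * f) c" "c > 0" using assms(1) pos0_def by auto
  obtain l e where 2: "const0 (vK powi l * g) e" "e > 0" using assms(2) pos0_def by auto
  have "vK powi (k + l) * (f * g) = (vK powi k * f) * (vK powi l * g)" by (simp add: power_int_add)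
  then show ?thesis unfolding pos0_def using const0_mult[OF 1(1) 2(1)] 1(2) 2(2)
    by (metis mult_pos_pos)
qed

lemma pos0_square: assumes "f \<noteq> 0" shows "pos0 (f * f)"
proof -
  obtain k c where 1: "const0 (vK powi k * f) c" "c \<noteq> 0" using const0_scale[OF assms] by auto
  have "vK powi (k + k) * (f * f) = (vK powi k * f) * (vK powi k * f)"
    by (simp only: power_int_add[OF disjI1[OF vK_nz]] mult_ac)
  then show ?thesis unfolding pos0_def using const0_mult[OF 1(1) 1(1)] 1(2)
    by (metis not_real_square_gt_zero)
qed

lemma pos0_inverse: assumes "pos0 f" shows "pos0 (inverse f)"
proof -
  have nz: "f \<noteq> 0" by (rule pos0_nz[OF assms])
  then have "pos0 (f * (inverse f * inverse f))" by (intro pos0_mult assms pos0_square) simp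
  moreover have "f * (inverse f * inverse f) = inverse f" using nz by simp
  ultimately show ?thesis by (simp only:)
qed

lemma pos0_not_neg: "pos0 f \<Longrightarrow> \<not> nonneg0 (- f)"
  using pos0_nz[of "f + - f"] pos0_add[of f "- f"] pos0_nz[of f] by (auto simp: nonneg0_def)

lemma pos0_1 [simp]: "pos0 1" by (rule pos0_const0[OF const0_1]) simp
lemma pos0_vK [simp]: "pos0 vK" unfolding pos0_def by (rule exI[of _ "-1"]) (auto simp: power_int_minus intro!: exI[of _ 1])
lemma pos0_power: "pos0 f \<Longrightarrow> pos0 (f ^ k)" by (induction k) (auto intro: pos0_mult)

lemma nonneg0_0 [simp]: "nonneg0 0" by (simp add: nonneg0_def)
lemma pos0_nonneg0: "pos0 f \<Longrightarrow> nonneg0 f" by (simp add: nonneg0_def)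
lemma nonneg0_add: "nonneg0 f \<Longrightarrow> nonneg0 g \<Longrightarrow> nonneg0 (f + g)"
  by (auto simp: nonneg0_def intro: pos0_add)
lemma nonneg0_mult: "nonneg0 f \<Longrightarrow> nonneg0 g \<Longrightarrow> nonneg0 (f * g)"
  by (auto simp: nonneg0_def intro: pos0_mult)
lemma nonneg0_square: "nonneg0 (f * f)" by (cases "f = 0") (auto simp: nonneg0_def intro: pos0_square)
lemma nonneg0_sum: "(\<And>i. i \<in> I \<Longrightarrow> nonneg0 (f i)) \<Longrightarrow> nonneg0 (sum f I)"
  by (induction I rule: infinite_finite_induct) (auto intro: nonneg0_add)
lemma pos0_add_nonneg0: "pos0 f \<Longrightarrow> nonneg0 g \<Longrightarrow> pos0 (f + g)"
  by (auto simp: nonneg0_def intro: pos0_add)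

lemma pos0_sum: assumes "finite I" "\<And>i. i \<in> I \<Longrightarrow> nonneg0 (f i)" "\<exists>i\<in>I. pos0 (f i)" shows "pos0 (sum f I)"
proof -
  obtain i where i: "i \<in> I" "pos0 (f i)" using assms by auto
  have "sum f I = f i + sum f (I - {i})" using assms(1) i(1) by (simp add: sum.remove)
  then show ?thesis using pos0_add_nonneg0[OF i(2) nonneg0_sum[of "I - {i}" f]] assms(2) by auto
qed

lemma nonneg0_const0_ge: assumes "nonneg0 f" "const0 f c" shows "c \<ge> 0"
proof (rule ccontr)
  assume "\<not> c \<ge> 0"
  then have "pos0 (- f)" using pos0_const0[OF const0_minus[OF assms(2)]] by simp
  then show False using pos0_not_neg[of "- f"] assms(1) by simp
qed

section \<open>Substitution of 1/v and the bar involution\<close>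

definition kc :: "real \<Rightarrow> K" where "kc r = kp [:r:]"

lemma kc_simps [simp]: "kc 0 = 0" "kc 1 = 1" "kc (a + b) = kc a + kc b" "kc (a * b) = kc a * kc b"
     apply (simp_all add: kc_def one_pCons[symmetric])
   apply (metis add_0 add_pCons kp_simps(3))
  by (metis kp_simps(4) mult_smult_left mult_1 smult_pCons smult_0_right one_pCons mult.right_neutral)
lemma const0_kc: "const0 (kc r) r" using const0_kp[of "[:r:]"] by (simp add: kc_def)
lemma kc_uminus: "kc (- r) = - kc r" by (metis kc_simps(1,3) add.right_inverse eq_neg_iff_add_eq_0 add.commute)
lemma kc_of_nat: "kc (of_nat m) = of_nat m" by (induction m) auto
lemma kc_of_int: "kc (of_int m) = of_int m"
  by (cases m) (auto simp: kc_of_nat kc_uminus simp del: of_nat_Suc)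
text \<open>Evaluation of a polynomial at 1/v. It is visibly a ring homomorphism, which the
  reflected polynomials in the definition of \<open>barK\<close> conceal.\<close>

definition evb :: "real poly \<Rightarrow> K" where "evb p = poly (map_poly kc p) (inverse vK)"

lemma evb_pCons: "evb (pCons a p) = kc a + inverse vK * evb p"
  by (simp add: evb_def map_poly_pCons)
lemma evb_0 [simp]: "evb 0 = 0" by (simp add: evb_def)
lemma evb_add: "evb (p + q) = evb p + evb q"
  by (induction p q rule: poly_induct2) (auto simp: evb_pCons algebra_simps)
lemma evb_smult: "evb (Polynomial.smult a p) = kc a * evb p"
  by (induction p) (auto simp: evb_pCons algebra_simps)
lemma evb_mult: "evb (p * q) = evb p * evb q"
  by (induction p) (auto simp: evb_pCons evb_add evb_smult algebra_simps)
lemma evb_1 [simp]: "evb 1 = 1" using evb_pCons[of 1 0] by (simp add: one_pCons)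

lemma kp_pCons: "kp (pCons a p) = kc a + vK * kp p"
proof -
  have "pCons a p = [:a:] + [:0,1:] * p" by simp
  then show ?thesis by (simp only: kp_simps vK_kp kc_def)
qed

lemma kp_poly: "kp p = poly (map_poly kc p) vK"
  by (induction p) (auto simp: kp_pCons map_poly_pCons)

lemma kc_eq_0 [simp]: "kc r = 0 \<longleftrightarrow> r = 0" by (simp add: kc_def)

lemma map_poly_kc: "degree (map_poly kc p) = degree p" "coeff (map_poly kc p) i = kc (coeff p i)"
  by (simp_all add: coeff_map_poly degree_map_poly)

lemma kp_sum: assumes "degree p \<le> d" shows "kp p = (\<Sum>i\<le>d. kc (coeff p i) * vK ^ i)"
proof -
  have "kp p = (\<Sum>i\<le>degree p. kc (coeff p i) * vK ^ i)"
    by (simp add: kp_poly poly_altdef map_poly_kc)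
  also have "\<dots> = (\<Sum>i\<le>d. kc (coeff p i) * vK ^ i)"
    using assms by (intro sum.mono_neutral_left) (auto simp: coeff_eq_0)
  finally show ?thesis .
qed

lemma evb_sum: assumes "degree p \<le> d" shows "vK ^ d * evb p = (\<Sum>i\<le>d. kc (coeff p i) * vK ^ (d - i))"
proof -
  have "evb p = (\<Sum>i\<le>degree p. kc (coeff p i) * inverse vK ^ i)"
    by (simp add: evb_def poly_altdef map_poly_kc)
  also have "\<dots> = (\<Sum>i\<le>d. kc (coeff p i) * inverse vK ^ i)"
    using assms by (intro sum.mono_neutral_left) (auto simp: coeff_eq_0)
  finally have "vK ^ d * evb p = (\<Sum>i\<le>d. kc (coeff p i) * (vK ^ d * inverse vK ^ i))"
    by (simp add: sum_distrib_left mult_ac)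
  also have "\<dots> = (\<Sum>i\<le>d. kc (coeff p i) * vK ^ (d - i))"
    by (intro sum.cong) (auto simp: power_diff divide_inverse power_inverse)
  finally show ?thesis .
qed

lemma kp_reflect: "kp (reflect_poly p) = vK ^ degree p * evb p"
proof -
  have "kp (reflect_poly p) = (\<Sum>i\<le>degree p. kc (coeff p (degree p - i)) * vK ^ i)"
    by (subst kp_sum[OF degree_reflect_poly_le]) (auto simp: coeff_reflect_poly intro!: sum.cong)
  also have "\<dots> = (\<Sum>i\<le>degree p. kc (coeff p i) * vK ^ (degree p - i))"
    by (rule sum.reindex_bij_witness[of _ "\<lambda>i. degree p - i" "\<lambda>i. degree p - i"]) auto
  finally show ?thesis by (simp add: evb_sum)
qed

lemma evb_eq_0 [simp]: "evb p = 0 \<longleftrightarrow> p = 0"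
  using kp_reflect[of p] by (metis evb_0 kp_eq_0_iff mult_eq_0_iff power_not_zero reflect_poly_eq_0_iff vK_nz)

text \<open>Reflection multiplies \<open>evb p\<close> by v to the degree of p. The monomials in
  \<open>barK\<close> restore equal powers of v above and below, so the value does not depend on the
  chosen fraction.\<close>

lemma barK_kp: assumes "q \<noteq> 0" shows "barK (kp p / kp q) = evb p / evb q"
proof -
  have *: "Fraction_Field.Fract (reflect_poly p * monom 1 (degree q)) (reflect_poly q * monom 1 (degree p))
      = evb p / evb q" if "q \<noteq> 0" for p q :: "real poly"
    using that by (subst Fract_kp) (auto simp: kp_reflect kp_monom)
  show ?thesis unfolding barK_def
  proof (rule the_equality)
    show "\<exists>p' q'. q' \<noteq> 0 \<and> kp p / kp q = Fraction_Field.Fract p' q' \<and> evb p / evb q =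
       Fraction_Field.Fract (reflect_poly p' * monom 1 (degree q')) (reflect_poly q' * monom 1 (degree p'))"
      using *[OF assms] Fract_kp[OF assms] assms by metis
  next
    fix g assume "\<exists>p' q'. q' \<noteq> 0 \<and> kp p / kp q = Fraction_Field.Fract p' q' \<and> g =
       Fraction_Field.Fract (reflect_poly p' * monom 1 (degree q')) (reflect_poly q' * monom 1 (degree p'))"
    then obtain p' q' where q': "q' \<noteq> 0" and e: "kp p / kp q = Fraction_Field.Fract p' q'" and g: "g = evb p' / evb q'"
      using * by metis
    have "kp (p * q') = kp (p' * q)" using e Fract_kp[OF q'] assms q' by (simp add: frac_eq_eq)
    then have "p * q' = p' * q" by (simp only: kp_eq_iff)
    then have "evb p * evb q' = evb p' * evb q" by (metis evb_mult)
    then show "g = evb p / evb q" using g assms q' by (simp add: frac_eq_eq)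
  qed
qed

lemma barK_add: "barK (f + g) = barK f + barK g"
proof -
  obtain p q where f: "q \<noteq> 0" "f = kp p / kp q" by (rule kp_cases)
  obtain p' q' where g: "q' \<noteq> 0" "g = kp p' / kp q'" by (rule kp_cases)
  have "f + g = kp (p * q' + p' * q) / kp (q * q')" using f g by (simp add: add_frac_eq)
  then have "barK (f + g) = evb (p * q' + p' * q) / evb (q * q')" using barK_kp[of "q * q'" "p * q' + p' * q"] f(1) g(1) by (simp only: mult_eq_0_iff simp_thms)
  then show ?thesis using f g by (simp add: barK_kp evb_add evb_mult add_frac_eq)
qed

lemma barK_mult: "barK (f * g) = barK f * barK g"
proof -
  obtain p q where f: "q \<noteq> 0" "f = kp p / kp q" by (rule kp_cases)
  obtain p' q' where g: "q' \<noteq> 0" "g = kp p' / kp q'" by (rule kp_cases)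
  have "f * g = kp (p * p') / kp (q * q')" using f g by simp
  then have "barK (f * g) = evb (p * p') / evb (q * q')" using barK_kp[of "q * q'" "p * p'"] f(1) g(1) by (simp only: mult_eq_0_iff simp_thms)
  then show ?thesis using f g by (simp add: barK_kp evb_mult)
qed

lemma barK_0 [simp]: "barK 0 = 0" using barK_kp[of 1 0] by simp
lemma barK_1 [simp]: "barK 1 = 1" using barK_kp[of 1 1] by simp
lemma barK_kc [simp]: "barK (kc r) = kc r" using barK_kp[of 1 "[:r:]"] by (simp add: kc_def evb_pCons)
lemma barK_vK [simp]: "barK vK = inverse vK" using barK_kp[of 1 "[:0,1:]"] by (simp add: vK_kp evb_pCons)
lemma barK_minus: "barK (- f) = - barK f"
  using barK_add[of f "- f"] by (simp add: eq_neg_iff_add_eq_0 add.commute)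
lemma barK_diff: "barK (f - g) = barK f - barK g"
  using barK_add[of f "- g"] by (simp add: barK_minus)
lemma barK_power: "barK (f ^ k) = barK f ^ k" by (induction k) (auto simp: barK_mult)
lemma barK_inverse: "barK (inverse f) = inverse (barK f)"
proof (cases "f = 0")
  case False
  then have "barK f * barK (inverse f) = 1" by (simp flip: barK_mult)
  then show ?thesis by (metis inverse_unique)
qed simp
lemma barK_sum: "barK (sum f I) = (\<Sum>i\<in>I. barK (f i))"
  by (induction I rule: infinite_finite_induct) (auto simp: barK_add)
lemma barK_of_int [simp]: "barK (of_int m) = of_int m" by (simp flip: kc_of_int)
lemma barK_evb: "barK (evb p) = kp p"
  by (induction p) (auto simp: evb_pCons kp_pCons barK_add barK_mult barK_inverse)
lemma barK_kp1: "barK (kp p) = evb p" using barK_kp[of 1 p] by simp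
lemma barK_barK [simp]: "barK (barK f) = f"
proof -
  obtain p q where f: "q \<noteq> 0" "f = kp p / kp q" by (rule kp_cases)
  then show ?thesis by (simp add: divide_inverse barK_mult barK_inverse barK_kp1 barK_evb)
qed
lemma barK_eq_0 [simp]: "barK f = 0 \<longleftrightarrow> f = 0" by (metis barK_0 barK_barK)

section \<open>Laurent polynomials with integral coefficients\<close>

abbreviation kz :: "int poly \<Rightarrow> K" where "kz p \<equiv> kp (map_poly of_int p)"

lemma Aset_iff: "f \<in> Aset \<longleftrightarrow> (\<exists>p k. f = kz p / vK ^ k)"
proof -
  have "Fraction_Field.Fract p (monom 1 k) = kp p / vK ^ k" for p and k by (subst Fract_kp) (auto simp: kp_monom)
  then show ?thesis by (auto simp: Aset_def)
qed

lemma negA_iff: "f \<in> negA \<longleftrightarrow> (\<exists>p k. degree p < k \<and> f = kz p / vK ^ k)"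
proof -
  have "Fraction_Field.Fract p (monom 1 k) = kp p / vK ^ k" for p and k by (subst Fract_kp) (auto simp: kp_monom)
  then show ?thesis by (auto simp: negA_def)
qed

lemma kz_add: "kz (p + q) = kz p + kz q"
  unfolding kp_simps(3)[symmetric] kp_eq_iff by (rule poly_eqI) (simp add: coeff_map_poly)
lemma kz_mult: "kz (p * q) = kz p * kz q"
  unfolding kp_simps(4)[symmetric] kp_eq_iff by (rule poly_eqI) (simp add: coeff_map_poly coeff_mult)
lemma kz_minus: "kz (- p) = - kz p"
  unfolding kp_simps(5)[symmetric] kp_eq_iff by (rule poly_eqI) (simp add: coeff_map_poly)
lemma kz_monom: "kz (monom 1 k) = vK ^ k" by (simp add: map_poly_monom kp_monom)
lemma kz_const: "kz [:m:] = of_int m" by (simp add: map_poly_pCons kc_of_int flip: kc_def)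

lemma negA_subset_Aset: "f \<in> negA \<Longrightarrow> f \<in> Aset" by (auto simp: Aset_iff negA_iff)

lemma Aset_add: assumes "f \<in> Aset" "g \<in> Aset" shows "f + g \<in> Aset"
proof -
  obtain p k q l where "f = kz p / vK ^ k" "g = kz q / vK ^ l" using assms Aset_iff by auto
  then have "f + g = kz (p * monom 1 l + q * monom 1 k) / vK ^ (k + l)"
    by (simp add: kz_add kz_mult kz_monom add_frac_eq power_add)
  then show ?thesis using Aset_iff by blast
qed

lemma Aset_mult: assumes "f \<in> Aset" "g \<in> Aset" shows "f * g \<in> Aset"
proof -
  obtain p k q l where "f = kz p / vK ^ k" "g = kz q / vK ^ l" using assms Aset_iff by auto
  then have "f * g = kz (p * q) / vK ^ (k + l)" by (simp add: kz_mult power_add)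
  then show ?thesis using Aset_iff by blast
qed

lemma Aset_of_int [simp]: "of_int m \<in> Aset"
  unfolding Aset_iff by (rule exI[of _ "[:m:]"], rule exI[of _ 0]) (simp add: kz_const)
lemma Aset_0 [simp]: "0 \<in> Aset" and Aset_1 [simp]: "1 \<in> Aset"
  using Aset_of_int[of 0] Aset_of_int[of 1] by simp_all
lemma Aset_v [simp]: "vK \<in> Aset"
  unfolding Aset_iff by (rule exI[of _ "monom 1 1"], rule exI[of _ 0]) (simp add: kz_monom)
lemma Aset_inv_v [simp]: "inverse vK \<in> Aset"
  unfolding Aset_iff by (rule exI[of _ 1], rule exI[of _ 1]) (simp add: divide_inverse)
lemma Aset_minus: "f \<in> Aset \<Longrightarrow> - f \<in> Aset" using Aset_mult[OF Aset_of_int[of "-1"]] by simp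
lemma Aset_diff: "f \<in> Aset \<Longrightarrow> g \<in> Aset \<Longrightarrow> f - g \<in> Aset" using Aset_add[OF _ Aset_minus] by simp
lemma Aset_sum: "(\<And>i. i \<in> I \<Longrightarrow> f i \<in> Aset) \<Longrightarrow> sum f I \<in> Aset"
  by (induction I rule: infinite_finite_induct) (auto intro: Aset_add)
lemma Aset_power: "f \<in> Aset \<Longrightarrow> f ^ k \<in> Aset" by (induction k) (auto intro: Aset_mult)

lemma negA_0 [simp]: "0 \<in> negA"
  unfolding negA_iff by (rule exI[of _ 0], rule exI[of _ 1]) simp
lemma negA_inv_v [simp]: "inverse vK \<in> negA"
  unfolding negA_iff by (rule exI[of _ 1], rule exI[of _ 1]) (simp add: divide_inverse)

lemma negA_add: assumes "f \<in> negA" "g \<in> negA" shows "f + g \<in> negA"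
proof -
  obtain p k q l where *: "f = kz p / vK ^ k" "g = kz q / vK ^ l" "degree p < k" "degree q < l"
    using assms negA_iff by auto
  then have "f + g = kz (p * monom 1 l + q * monom 1 k) / vK ^ (k + l)"
    by (simp add: kz_add kz_mult kz_monom add_frac_eq power_add)
  moreover have "degree (p * monom 1 l) < k + l" "degree (q * monom 1 k) < k + l"
    using * degree_mult_le[of p "monom 1 l"] degree_mult_le[of q "monom 1 k"]
      degree_monom_le[of "1::int" l] degree_monom_le[of "1::int" k] by linarith+
  ultimately show ?thesis using negA_iff degree_add_less by blast
qed

lemma negA_mult: assumes "f \<in> negA" "g \<in> negA" shows "f * g \<in> negA"
proof -
  obtain p k q l where *: "f = kz p / vK ^ k" "g = kz q / vK ^ l" "degree p < k" "degree q < l"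
    using assms negA_iff by auto
  then have "f * g = kz (p * q) / vK ^ (k + l)" by (simp add: kz_mult power_add)
  moreover have "degree (p * q) < k + l" using * degree_mult_le[of p q] by linarith
  ultimately show ?thesis using negA_iff by blast
qed

lemma negA_of_int_mult: assumes "f \<in> negA" shows "of_int m * f \<in> negA"
proof -
  obtain p k where *: "f = kz p / vK ^ k" "degree p < k" using assms negA_iff by auto
  then have "of_int m * f = kz ([:m:] * p) / vK ^ k" by (simp only: kz_mult kz_const times_divide_eq_right)
  moreover have "degree ([:m:] * p) < k" using * degree_mult_le[of "[:m:]" p] by simp
  ultimately show ?thesis using negA_iff by blast
qed

lemma negA_minus: "f \<in> negA \<Longrightarrow> - f \<in> negA" using negA_of_int_mult[of f "-1"] by simp
lemma negA_diff: "f \<in> negA \<Longrightarrow> g \<in> negA \<Longrightarrow> f - g \<in> negA" using negA_add[OF _ negA_minus] by simp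
lemma negA_sum: "(\<And>i. i \<in> I \<Longrightarrow> f i \<in> negA) \<Longrightarrow> sum f I \<in> negA"
  by (induction I rule: infinite_finite_induct) (auto intro: negA_add)

text \<open>The integer is the coefficient of 1/v in f. It becomes the multiplicity of a correction
  term in the construction of the basis C'.\<close>

lemma negA_v_mult: assumes "f \<in> negA" shows "\<exists>m. vK * f - of_int m \<in> negA"
proof -
  obtain p k where *: "f = kz p / vK ^ k" "degree p < k" using assms negA_iff by auto
  then obtain l where l: "k = Suc l" by (cases k) auto
  define m where "m = coeff p l"
  have "vK * f - of_int m = (kz p - of_int m * vK ^ l) / vK ^ l"
    using * unfolding l by (simp add: field_simps)
  also have "\<dots> = kz (p - monom m l) / vK ^ l"
  proof -
    have "monom m l = [:m:] * monom 1 l" by (simp add: smult_monom)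
    then have "kz (monom m l) = of_int m * vK ^ l" by (simp only: kz_mult kz_const kz_monom)
    then show ?thesis using kz_add[of p "- monom m l"] kz_minus[of "monom m l"] by simp
  qed
  also have "\<dots> = kz ((p - monom m l) * monom 1 1) / vK ^ Suc l" by (simp add: kz_mult kz_monom)
  finally have e: "vK * f - of_int m = kz ((p - monom m l) * monom 1 1) / vK ^ Suc l" .
  show ?thesis
  proof (cases "p - monom m l = 0")
    case True then show ?thesis using e by (intro exI[of _ m]) simp
  next
    case False
    have "degree (p - monom m l) \<le> l" using * l degree_monom_le[of m l] by (intro degree_diff_le) auto
    moreover have "degree (p - monom m l) \<noteq> l"
    proof
      assume "degree (p - monom m l) = l"
      then have "coeff (p - monom m l) l \<noteq> 0" using False by (metis leading_coeff_0_iff)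
      then show False by (simp add: m_def)
    qed
    ultimately have "degree (p - monom m l) < l" by simp
    moreover have "degree ((p - monom m l) * monom 1 1) \<le> degree (p - monom m l) + 1"
      using degree_mult_le[of "p - monom m l" "monom 1 1"] degree_monom_le[of "1::int" 1] by linarith
    ultimately have "degree ((p - monom m l) * monom 1 1) < Suc l" by linarith
    then show ?thesis using e negA_iff by blast
  qed
qed

lemma negA_inv_v_mult: "f \<in> negA \<Longrightarrow> inverse vK * f \<in> negA" using negA_mult[OF negA_inv_v] .

lemma const0_bar_negA: assumes "f \<in> negA" shows "const0 (barK f) 0"
proof -
  obtain p k where *: "f = kz p / vK ^ k" "degree p < k" using assms negA_iff by auto
  define P :: "real poly" where "P = map_poly of_int p"
  have dP: "degree P = degree p" unfolding P_def by (simp add: degree_map_poly)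
  have "barK f = vK ^ k * evb P"
    using * by (simp add: P_def divide_inverse barK_mult barK_inverse barK_kp1 barK_power power_inverse)
  also have "\<dots> = vK ^ (k - degree P) * kp (reflect_poly P)"
  proof -
    have "k = (k - degree P) + degree P" using *(2) dP by simp
    then have "vK ^ k = vK ^ (k - degree P) * vK ^ degree P" by (metis power_add)
    then show ?thesis by (simp only: kp_reflect mult.assoc)
  qed
  finally show ?thesis using const0_mult[OF const0_nat_power_v[of "k - degree P"] const0_kp[of "reflect_poly P"]] *(2) dP
    by simp
qed

lemma Aset_bar: assumes "f \<in> Aset" shows "barK f \<in> Aset"
proof -
  obtain p k where *: "f = kz p / vK ^ k" using assms Aset_iff by auto
  define P :: "real poly" where "P = map_poly of_int p"
  have dP: "degree P = degree p" unfolding P_def by (simp add: degree_map_poly)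
  have r: "reflect_poly P = map_poly of_int (reflect_poly p)"
    by (rule poly_eqI) (simp add: coeff_reflect_poly coeff_map_poly dP, simp add: P_def coeff_map_poly)
  have "barK f = vK ^ k * evb P"
    using * by (simp add: P_def divide_inverse barK_mult barK_inverse barK_kp1 barK_power power_inverse)
  also have "evb P = inverse vK ^ degree p * kp (reflect_poly P)"
    unfolding kp_reflect dP by (simp add: power_inverse)
  finally have e: "barK f = vK ^ k * (inverse vK ^ degree p * kz (reflect_poly p))" unfolding r .
  have "kz (reflect_poly p) \<in> Aset"
    unfolding Aset_iff by (rule exI[of _ "reflect_poly p"], rule exI[of _ 0]) simp
  then show ?thesis unfolding e by (intro Aset_mult Aset_power Aset_v Aset_inv_v)
qed

text \<open>A Laurent polynomial without pole at 0 has no negative powers of v, and invariance under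
  the exchange of v and 1/v then removes the positive ones.\<close>

lemma Aset_bar_const:
  assumes "f \<in> Aset" "barK f = f" "const0 f c" shows "f = kc c"
proof -
  obtain p k where *: "f = kz p / vK ^ k" using assms Aset_iff by auto
  define P :: "real poly" where "P = map_poly of_int p"
  have fP: "kp P = f * vK ^ k" using * by (simp add: P_def)
  have coeff_lt: "coeff P i = 0" if "i < k" for i
  proof -
    have a: "kp P = kp (monom 1 k) * f" using fP by (simp add: kp_monom mult.commute)
    obtain r s where rs: "poly s 0 \<noteq> 0" "f = kp r / kp s" using assms(3) const0_iff by auto
    have "s \<noteq> 0" using rs by auto
    then have "kp (P * s) = kp (monom 1 k * r)" using a rs by simp
    then have e: "P * s = monom 1 k * r" by (simp only: kp_eq_iff)
    show ?thesis using that
    proof (induction i rule: less_induct)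
      case (less i)
      have "coeff (P * s) i = (\<Sum>j\<le>i. coeff P j * coeff s (i - j))" by (simp add: coeff_mult)
      also have "\<dots> = (\<Sum>j\<in>{i}. coeff P j * coeff s (i - j))"
        by (rule sum.mono_neutral_right) (use less in auto)
      also have "\<dots> = coeff P i * poly s 0" by (simp add: poly_0_coeff_0)
      finally have "coeff P i * poly s 0 = 0" using less(2) unfolding e by (simp add: coeff_monom_mult)
      then show ?case using rs(1) by simp
    qed
  qed
  have coeff_gt: "coeff P i = 0" if "i > k" for i
  proof -
    have "evb P = barK f * inverse vK ^ k"
      using fP by (metis barK_kp1 barK_mult barK_power barK_vK)
    then have e1: "evb P = f * inverse vK ^ k" using assms by simp
    then have e2: "kp (reflect_poly P) = vK ^ degree P * (f * inverse vK ^ k)" by (simp add: kp_reflect)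
    \<comment> \<open>Large enough for \<open>vK ^ D * evb P\<close> to be a polynomial and for
      \<open>D - 2 * k\<close> to be a true difference. Invariance of f identifies this polynomial
      with v^(D - 2k) times P.\<close>
    define D where "D = max (degree P) (2 * k)"
    have "vK ^ D * evb P = (\<Sum>i\<le>D. kc (coeff P i) * vK ^ (D - i))" by (rule evb_sum) (simp add: D_def)
    also have "\<dots> = (\<Sum>i\<le>D. kc (coeff P (D - i)) * vK ^ i)"
      by (rule sum.reindex_bij_witness[of _ "\<lambda>i. D - i" "\<lambda>i. D - i"]) auto
    also have "\<dots> = kp (\<Sum>i\<le>D. monom (coeff P (D - i)) i)"
    proof -
      have "kp (sum g I) = (\<Sum>i\<in>I. kp (g i))" for g and I :: "nat set"
        by (induction I rule: infinite_finite_induct) auto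
      moreover have "kp (monom a i) = kc a * vK ^ i" for a i
      proof -
        have "monom a i = [:a:] * monom 1 i" by (simp add: smult_monom)
        then show ?thesis by (simp only: kp_simps kc_def kp_monom)
      qed
      ultimately show ?thesis by simp
    qed
    finally have "vK ^ D * evb P = kp (\<Sum>i\<le>D. monom (coeff P (D - i)) i)" .
    moreover have "vK ^ D * evb P = vK ^ (D - 2 * k) * kp P"
    proof -
      have "D = (D - 2 * k) + k + k" by (simp add: D_def)
      then have "vK ^ D = vK ^ (D - 2 * k) * vK ^ k * vK ^ k" by (metis power_add)
      then have "vK ^ D * evb P = (vK ^ (D - 2 * k) * (f * vK ^ k)) * (vK ^ k * inverse vK ^ k)"
        unfolding e1 by (simp only: mult_ac)
      moreover have "vK ^ k * inverse vK ^ k = 1" by (simp add: power_inverse)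
      ultimately show ?thesis using fP by simp
    qed
    ultimately have "monom 1 (D - 2 * k) * P = (\<Sum>i\<le>D. monom (coeff P (D - i)) i)"
      by (simp only: kp_monom[symmetric] kp_simps(4)[symmetric] kp_eq_iff)
    then have co: "coeff (monom 1 (D - 2 * k) * P) j = (\<Sum>i\<le>D. coeff (monom (coeff P (D - i)) i) j)" for j
      by (simp add: coeff_sum)
    show ?thesis
    proof (cases "i \<le> D")
      case True
      have "(\<Sum>l\<le>D. coeff (monom (coeff P (D - l)) l) (D - i)) = coeff P i"
        using True by (simp add: sum.delta' if_distrib cong: if_cong)
      then have "coeff P i = coeff (monom 1 (D - 2 * k) * P) (D - i)" using co[of "D - i"] by simp
      also have "\<dots> = 0" using that True by (auto simp: coeff_monom_mult intro!: coeff_lt simp: D_def)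
      finally show ?thesis .
    next
      case False then show ?thesis by (intro coeff_eq_0) (simp add: D_def)
    qed
  qed
  define a where "a = coeff P k"
  have "P = monom a k"
  proof (rule poly_eqI)
    fix i show "coeff P i = coeff (monom a k) i"
      using coeff_lt[of i] coeff_gt[of i] by (cases i k rule: linorder_cases) (auto simp: a_def)
  qed
  also have "\<dots> = [:a:] * monom 1 k" by (simp add: smult_monom)
  finally have "kp P = kp [:a:] * kp (monom 1 k)" by (simp only: kp_simps(4))
  then have "kp P = kc a * vK ^ k" by (simp only: kc_def kp_monom)
  then have "f = kc a" using fP by simp
  then show ?thesis using const0_unique[OF assms(3)] const0_kc by metis
qed

text \<open>The bar image of an element of \<open>negA\<close> has constant term 0, and here that
  image is the element itself.\<close>

lemma negA_bar_0: assumes "f \<in> negA" "barK f = f" shows "f = 0"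
  using Aset_bar_const[OF negA_subset_Aset[OF assms(1)] assms(2), of 0] const0_bar_negA[OF assms(1)] assms(2) by simp

section \<open>Permutations and the Iwahori-Hecke algebra\<close>

abbreviation ivp :: "perm \<Rightarrow> perm" where "ivp \<equiv> inv_into UNIV"

lemma gen_gen [simp]: "gen i \<circ> gen i = id" "gen i \<circ> (gen i \<circ> w) = w" "gen i (gen i a) = a"
  "(w \<circ> gen i) \<circ> gen i = w"
  by (auto simp: gen_def comp_assoc fun_eq_iff)

lemma gen_apply: "gen i a = (if a = i then Suc i else if a = Suc i then i else a)"
  by (auto simp: gen_def transpose_def)

lemma finite_Wn [simp]: "finite (Wn n)" unfolding Wn_def by (rule finite_permutations) simp
lemma id_Wn [simp]: "id \<in> Wn n" by (simp add: Wn_def permutes_id)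
lemma gen_Wn [simp]: "i \<in> {1..<n} \<Longrightarrow> gen i \<in> Wn n"
  unfolding Wn_def gen_def by (auto intro!: permutes_swap_id)
lemma comp_Wn [simp]: "v \<in> Wn n \<Longrightarrow> w \<in> Wn n \<Longrightarrow> v \<circ> w \<in> Wn n"
  unfolding Wn_def by (auto intro: permutes_compose)
lemma inv_Wn [simp]: "w \<in> Wn n \<Longrightarrow> ivp w \<in> Wn n" unfolding Wn_def by (auto intro: permutes_inv)
lemma Wn_bij: "w \<in> Wn n \<Longrightarrow> bij w" unfolding Wn_def by (auto intro: permutes_bij)
lemma Wn_inj: "w \<in> Wn n \<Longrightarrow> w a = w b \<longleftrightarrow> a = b"
  unfolding Wn_def by (auto dest: permutes_inj simp: inj_eq)
lemma inv_inv_Wn [simp]: "w \<in> Wn n \<Longrightarrow> ivp (ivp w) = w" by (simp add: Wn_bij inv_inv_eq)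
lemma inv_comp_Wn: "v \<in> Wn n \<Longrightarrow> w \<in> Wn n \<Longrightarrow> ivp (v \<circ> w) = ivp w \<circ> ivp v"
  by (simp add: Wn_bij o_inv_distrib)
lemma inv_gen [simp]: "ivp (gen i) = gen i" by (simp add: gen_def)
lemma Wn_cancel [simp]: assumes "w \<in> Wn n"
  shows "w \<circ> ivp w = id" "ivp w \<circ> w = id" "w (ivp w a) = a" "ivp w (w a) = a"
    "w \<circ> (ivp w \<circ> f) = f" "ivp w \<circ> (w \<circ> f) = f" "(f \<circ> w) \<circ> ivp w = f" "(f \<circ> ivp w) \<circ> w = f"
proof -
  have a: "w (ivp w a) = a" for a using Wn_bij[OF assms] by (simp add: bij_is_surj surj_f_inv_f)
  have b: "ivp w (w a) = a" for a using Wn_bij[OF assms] by (simp add: bij_is_inj inv_f_f)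
  show "w \<circ> ivp w = id" "ivp w \<circ> w = id" "w (ivp w a) = a" "ivp w (w a) = a"
    "w \<circ> (ivp w \<circ> f) = f" "ivp w \<circ> (w \<circ> f) = f" "(f \<circ> w) \<circ> ivp w = f" "(f \<circ> ivp w) \<circ> w = f"
    by (simp_all add: fun_eq_iff a b)
qed
lemma Wn_range: "w \<in> Wn n \<Longrightarrow> w a \<in> {1..n} \<longleftrightarrow> a \<in> {1..n}"
  unfolding Wn_def using permutes_in_image[of w "{1..n}" a] by blast
lemma gen_comp_Wn_iff [simp]: assumes "i \<in> {1..<n}" shows "gen i \<circ> w \<in> Wn n \<longleftrightarrow> w \<in> Wn n"
proof
  assume "gen i \<circ> w \<in> Wn n"
  then have "gen i \<circ> (gen i \<circ> w) \<in> Wn n" by (rule comp_Wn[OF gen_Wn[OF assms]])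
  then show "w \<in> Wn n" by (simp only: gen_gen)
qed (rule comp_Wn[OF gen_Wn[OF assms]])
lemma comp_gen_Wn_iff [simp]: assumes "i \<in> {1..<n}" shows "w \<circ> gen i \<in> Wn n \<longleftrightarrow> w \<in> Wn n"
proof
  assume "w \<circ> gen i \<in> Wn n"
  then have "(w \<circ> gen i) \<circ> gen i \<in> Wn n" by (rule comp_Wn[OF _ gen_Wn[OF assms]])
  then show "w \<in> Wn n" by (simp only: gen_gen)
qed (rule comp_Wn[OF _ gen_Wn[OF assms]])

section \<open>Length as the number of inversions\<close>

definition Invs :: "nat \<Rightarrow> perm \<Rightarrow> (nat \<times> nat) set" where
  "Invs n w = {(a, b). 1 \<le> a \<and> a < b \<and> b \<le> n \<and> w b < w a}"

lemma finite_Invs [simp]: "finite (Invs n w)"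
  by (rule finite_subset[of _ "{1..n} \<times> {1..n}"]) (auto simp: Invs_def)

text \<open>Applying \<open>gen i\<close> to both positions of a pair keeps their order unless the
  pair is i, i + 1, and that pair is the one new inversion.\<close>

lemma card_Invs_asc:
  assumes i: "i \<in> {1..<n}" and asc: "w i < w (Suc i)"
  shows "card (Invs n (w \<circ> gen i)) = Suc (card (Invs n w))"
proof -
  have "Invs n (w \<circ> gen i) = insert (i, Suc i) (map_prod (gen i) (gen i) ` Invs n w)"
  proof (rule Set.set_eqI)
    fix p :: "nat \<times> nat"
    obtain a b where p: "p = (a, b)" by (cases p)
    have *: "(a, b) \<in> map_prod (gen i) (gen i) ` Invs n w \<longleftrightarrow> (gen i a, gen i b) \<in> Invs n w"
    proof
      assume "(gen i a, gen i b) \<in> Invs n w"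
      then have "map_prod (gen i) (gen i) (gen i a, gen i b) \<in> map_prod (gen i) (gen i) ` Invs n w" by (rule imageI)
      then show "(a, b) \<in> map_prod (gen i) (gen i) ` Invs n w" by simp
    qed auto
    consider "a = i \<and> b = Suc i" | "a = Suc i \<and> b = i"
      | "\<not> (a = i \<and> b = Suc i)" "\<not> (a = Suc i \<and> b = i)" by blast
    then show "p \<in> Invs n (w \<circ> gen i) \<longleftrightarrow> p \<in> insert (i, Suc i) (map_prod (gen i) (gen i) ` Invs n w)"
      unfolding p insert_iff *
    proof cases
      case 1 then show "(a, b) \<in> Invs n (w \<circ> gen i) \<longleftrightarrow> (a, b) = (i, Suc i) \<or> (gen i a, gen i b) \<in> Invs n w"
        using i asc by (simp add: Invs_def gen_apply)
    next
      case 2 then show "(a, b) \<in> Invs n (w \<circ> gen i) \<longleftrightarrow> (a, b) = (i, Suc i) \<or> (gen i a, gen i b) \<in> Invs n w"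
        using i asc by (simp add: Invs_def gen_apply)
    next
      case 3
      have "1 \<le> a \<and> a < b \<and> b \<le> n \<longleftrightarrow> 1 \<le> gen i a \<and> gen i a < gen i b \<and> gen i b \<le> n"
        using i 3 unfolding gen_apply atLeastLessThan_iff by presburger
      then show "(a, b) \<in> Invs n (w \<circ> gen i) \<longleftrightarrow> (a, b) = (i, Suc i) \<or> (gen i a, gen i b) \<in> Invs n w"
        using 3 unfolding Invs_def by auto
    qed
  qed
  moreover have "(i, Suc i) \<notin> map_prod (gen i) (gen i) ` Invs n w"
    by (auto simp: Invs_def gen_apply split: if_splits)
  moreover have "inj_on (map_prod (gen i) (gen i)) (Invs n w)"
    by (rule inj_on_inverseI[of _ "map_prod (gen i) (gen i)"]) auto
  ultimately show ?thesis by (simp add: card_image)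
qed

lemma card_Invs_desc:
  assumes i: "i \<in> {1..<n}" and desc: "w (Suc i) < w i"
  shows "card (Invs n w) = Suc (card (Invs n (w \<circ> gen i)))"
  using card_Invs_asc[OF i, of "w \<circ> gen i"] desc by (simp add: gen_apply)

text \<open>The value at k is at least k by induction upward from 1 and at most k by induction
  downward from n.\<close>

lemma Wn_mono_id:
  assumes w: "w \<in> Wn n" and asc: "\<And>i. i \<in> {1..<n} \<Longrightarrow> w i < w (Suc i)" shows "w = id"
proof -
  have wk: "w k = k" if "1 \<le> k" "k \<le> n" for k
  proof -
    have ge: "m \<le> w m" if "1 \<le> m" "m \<le> n" for m
      using that
    proof (induction m)
      case (Suc m)
      show ?case
      proof (cases "m = 0")
        case True then show ?thesis using Wn_range[OF w, of "Suc m"] Suc by auto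
      next
        case False then show ?thesis using Suc asc[of m] by auto
      qed
    qed simp
    have le: "w (n - m) \<le> n - m" if "m < n" for m
      using that
    proof (induction m)
      case 0 then show ?case using Wn_range[OF w, of n] by auto
    next
      case (Suc m)
      have "Suc (n - Suc m) = n - m" using Suc by simp
      then have "w (n - Suc m) < w (n - m)" using asc[of "n - Suc m"] Suc by auto
      then show ?case using Suc by auto
    qed
    have "n - (n - k) = k" using that by simp
    then show ?thesis using ge[OF that] le[of "n - k"] that by auto
  qed
  show ?thesis
  proof
    fix k show "w k = id k"
      using wk[of k] w unfolding Wn_def permutes_def by (cases "k \<in> {1..n}") auto
  qed
qed

definition wprod :: "nat list \<Rightarrow> perm" where "wprod ws = foldr (\<circ>) (map gen ws) id"

lemma wprod_simps [simp]: "wprod [] = id" "wprod (i # ws) = gen i \<circ> wprod ws"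
  by (simp_all add: wprod_def)

lemma wprod_append: "wprod (us @ ws) = wprod us \<circ> wprod ws"
  by (induction us) (auto simp: comp_assoc)

lemma wprod_snoc: "wprod (ws @ [i]) = wprod ws \<circ> gen i" unfolding wprod_append by simp

lemma wprod_Wn: "set ws \<subseteq> {1..<n} \<Longrightarrow> wprod ws \<in> Wn n"
  by (induction ws) auto

lemma wprod_rev: "set ws \<subseteq> {1..<n} \<Longrightarrow> wprod (rev ws) = ivp (wprod ws)"
proof (induction ws)
  case Nil then show ?case by simp
next
  case (Cons i ws)
  have "wprod (rev (i # ws)) = wprod (rev ws) \<circ> gen i" unfolding rev.simps wprod_snoc ..
  also have "\<dots> = ivp (wprod ws) \<circ> gen i" using Cons by simp
  also have "\<dots> = ivp (gen i \<circ> wprod ws)" using Cons wprod_Wn[of ws n] by (simp add: inv_comp_Wn[of _ n])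
  finally show ?case unfolding wprod_simps .
qed

lemma card_Invs_le: "set ws \<subseteq> {1..<n} \<Longrightarrow> card (Invs n (wprod ws)) \<le> length ws"
proof (induction ws rule: rev_induct)
  case Nil
  have "Invs n id = {}" by (auto simp: Invs_def)
  then show ?case unfolding wprod_simps by (simp only: card.empty)
next
  case (snoc i ws)
  let ?w = "wprod ws"
  have i: "i \<in> {1..<n}" and "?w \<in> Wn n" using snoc.prems wprod_Wn[of ws n] by auto
  then have "?w i \<noteq> ?w (Suc i)" by (simp add: Wn_inj)
  then have "card (Invs n (?w \<circ> gen i)) \<le> Suc (card (Invs n ?w))"
    using card_Invs_asc[OF i, of ?w] card_Invs_desc[OF i, of ?w] by (cases "?w i < ?w (Suc i)") auto
  moreover have "card (Invs n ?w) \<le> length ws" using snoc by simp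
  ultimately have "card (Invs n (?w \<circ> gen i)) \<le> Suc (length ws)" by linarith
  then show ?case unfolding wprod_snoc by (simp only: length_append_singleton)
qed

lemma word_exists: "w \<in> Wn n \<Longrightarrow> \<exists>ws. length ws = card (Invs n w) \<and> set ws \<subseteq> {1..<n} \<and> w = wprod ws"
proof (induction "card (Invs n w)" arbitrary: w rule: less_induct)
  case less
  show ?case
  proof (cases "w = id")
    case True
    moreover have "Invs n id = {}" by (auto simp: Invs_def)
    ultimately show ?thesis by auto
  next
    case False
    then obtain i where i: "i \<in> {1..<n}" "\<not> w i < w (Suc i)" using Wn_mono_id less by blast
    then have "w (Suc i) < w i" using Wn_inj[OF less(2), of i "Suc i"] by auto
    then have c: "card (Invs n w) = Suc (card (Invs n (w \<circ> gen i)))" by (rule card_Invs_desc[OF i(1)])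
    then obtain ws where ws: "length ws = card (Invs n (w \<circ> gen i))" "set ws \<subseteq> {1..<n}" "w \<circ> gen i = wprod ws"
      using less(1)[of "w \<circ> gen i"] less(2) i by auto
    have "w = wprod (ws @ [i])" unfolding wprod_snoc ws(3)[symmetric] by simp
    then show ?thesis using ws c i by (intro exI[of _ "ws @ [i]"]) auto
  qed
qed

text \<open>A word of k generators produces at most k inversions, and removing right descents one by
  one yields a word with exactly as many letters as inversions.\<close>

lemma len_card: assumes "w \<in> Wn n" shows "len n w = card (Invs n w)"
  unfolding len_def wprod_def[symmetric]
proof (rule Least_equality)
  show "\<exists>ws. length ws = card (Invs n w) \<and> set ws \<subseteq> {1..<n} \<and> w = wprod ws" using word_exists[OF assms] .
qed (use card_Invs_le in auto)

lemma len_id [simp]: "len n id = 0" by (simp add: len_card) (auto simp: Invs_def)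

lemma len_comp_gen:
  assumes "w \<in> Wn n" "i \<in> {1..<n}"
  shows "w i < w (Suc i) \<Longrightarrow> len n (w \<circ> gen i) = Suc (len n w)"
    "w (Suc i) < w i \<Longrightarrow> len n w = Suc (len n (w \<circ> gen i))"
  using assms card_Invs_asc[of i n w] card_Invs_desc[of i n w] by (auto simp: len_card)

lemma len_comp_gen_less:
  assumes "w \<in> Wn n" "i \<in> {1..<n}"
  shows "len n (w \<circ> gen i) < len n w \<longleftrightarrow> w (Suc i) < w i"
  using len_comp_gen[OF assms] Wn_inj[OF assms(1), of i "Suc i"] by (cases "w i < w (Suc i)") auto

lemma len_inv: assumes "w \<in> Wn n" shows "len n (ivp w) = len n w"
proof -
  have *: "len n (ivp w) \<le> len n w" if w: "w \<in> Wn n" for w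
  proof -
    obtain ws where ws: "length ws = len n w" "set ws \<subseteq> {1..<n}" "w = wprod ws"
      using word_exists[OF w] unfolding len_card[OF w] by blast
    then have "ivp w = wprod (rev ws)" by (simp add: wprod_rev)
    then show ?thesis using card_Invs_le[of "rev ws" n] ws len_card[OF inv_Wn[OF w]] by simp
  qed
  show ?thesis using *[OF assms] *[OF inv_Wn[OF assms]] assms by simp
qed

lemma len_gen_comp_inv: assumes "w \<in> Wn n" "i \<in> {1..<n}" shows "len n (gen i \<circ> w) = len n (ivp w \<circ> gen i)"
proof -
  have "ivp (gen i \<circ> w) = ivp w \<circ> gen i" using assms by (simp add: inv_comp_Wn[of _ n])
  then show ?thesis using len_inv[of "gen i \<circ> w" n] assms by simp
qed

lemma len_gen_comp:
  assumes "w \<in> Wn n" "i \<in> {1..<n}"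
  shows "ivp w i < ivp w (Suc i) \<Longrightarrow> len n (gen i \<circ> w) = Suc (len n w)"
    "ivp w (Suc i) < ivp w i \<Longrightarrow> len n w = Suc (len n (gen i \<circ> w))"
  using len_comp_gen[of "ivp w" n i] assms by (simp_all add: len_gen_comp_inv len_inv)

lemma len_gen_comp_less:
  assumes "w \<in> Wn n" "i \<in> {1..<n}"
  shows "len n (gen i \<circ> w) < len n w \<longleftrightarrow> ivp w (Suc i) < ivp w i"
  using len_comp_gen_less[of "ivp w" n i] assms by (simp add: len_gen_comp_inv len_inv)

lemma len_gen_comp_cases:
  assumes "w \<in> Wn n" "i \<in> {1..<n}"
  obtains "len n (gen i \<circ> w) = Suc (len n w)" | "len n w = Suc (len n (gen i \<circ> w))"
  using len_gen_comp[OF assms] Wn_inj[OF inv_Wn[OF assms(1)], of i "Suc i"]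
  by (metis n_not_Suc_n linorder_neqE_nat)

lemma len_comp_gen_cases:
  assumes "w \<in> Wn n" "i \<in> {1..<n}"
  obtains "len n (w \<circ> gen i) = Suc (len n w)" | "len n w = Suc (len n (w \<circ> gen i))"
  using len_comp_gen[OF assms] Wn_inj[OF assms(1), of i "Suc i"]
  by (metis n_not_Suc_n linorder_neqE_nat)

lemma right_descent_exists: assumes "w \<in> Wn n" "w \<noteq> id" obtains i where "i \<in> {1..<n}" "len n w = Suc (len n (w \<circ> gen i))"
proof -
  obtain i where i: "i \<in> {1..<n}" "\<not> w i < w (Suc i)" using Wn_mono_id assms by blast
  then have "w (Suc i) < w i" using Wn_inj[OF assms(1), of i "Suc i"] by auto
  then show ?thesis using that[OF i(1)] len_comp_gen(2)[OF assms(1) i(1)] by simp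
qed

lemma left_descent_exists: assumes "w \<in> Wn n" "w \<noteq> id" obtains i where "i \<in> {1..<n}" "len n w = Suc (len n (gen i \<circ> w))"
proof -
  have "ivp w \<noteq> id" using assms by (metis inv_id inv_inv_Wn)
  then obtain i where "i \<in> {1..<n}" "len n (ivp w) = Suc (len n (ivp w \<circ> gen i))"
    using right_descent_exists[OF inv_Wn[OF assms(1)]] by blast
  then show ?thesis using that assms by (simp add: len_gen_comp_inv len_inv)
qed

lemma len_0_iff: "w \<in> Wn n \<Longrightarrow> len n w = 0 \<longleftrightarrow> w = id"
  by (metis len_id nat.distinct(1) right_descent_exists)

lemma len_gen: "i \<in> {1..<n} \<Longrightarrow> len n (gen i) = 1"
  using len_comp_gen(1)[of id n i] by simp

text \<open>If u maps the pair j, j + 1 onto i, i + 1 in some order, then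
  \<open>gen i \<circ> u = u \<circ> gen j\<close>. Otherwise exchanging the values i and i + 1 does
  not affect the order of \<open>u j\<close> and \<open>u (Suc j)\<close>, so both elements have the
  same descent at j.\<close>

lemma exchange:
  assumes u: "u \<in> Wn n" and i: "i \<in> {1..<n}" and j: "j \<in> {1..<n}" and ne: "gen i \<circ> u \<noteq> u \<circ> gen j"
  shows "len n (gen i \<circ> u \<circ> gen j) < len n (gen i \<circ> u) \<longleftrightarrow> len n (u \<circ> gen j) < len n u"
proof -
  have iu: "gen i \<circ> u \<in> Wn n" using u i by simp
  have "\<not> (u j = i \<and> u (Suc j) = Suc i) \<and> \<not> (u j = Suc i \<and> u (Suc j) = i)"
  proof (rule ccontr)
    assume "\<not> (\<not> (u j = i \<and> u (Suc j) = Suc i) \<and> \<not> (u j = Suc i \<and> u (Suc j) = i))"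
    then have a: "(u j = i \<and> u (Suc j) = Suc i) \<or> (u j = Suc i \<and> u (Suc j) = i)" by blast
    have "(gen i \<circ> u) a = (u \<circ> gen j) a" for a
    proof -
      have 1: "u a = u j \<longleftrightarrow> a = j" and 2: "u a = u (Suc j) \<longleftrightarrow> a = Suc j" by (rule Wn_inj[OF u])+
      consider "a = j" | "a = Suc j" | "a \<noteq> j" "a \<noteq> Suc j" by blast
      then show ?thesis
      proof cases
        case 3
        then have "u a \<noteq> i" "u a \<noteq> Suc i" using a 1 2 by auto
        then show ?thesis using 3 unfolding comp_apply gen_apply by presburger
      qed (use a in \<open>auto simp: gen_apply\<close>)
    qed
    then show False using ne by blast
  qed
  moreover have "u j \<noteq> u (Suc j)" using Wn_inj[OF u, of j "Suc j"] by simp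
  ultimately have "(gen i \<circ> u) (Suc j) < (gen i \<circ> u) j \<longleftrightarrow> u (Suc j) < u j"
    unfolding comp_apply gen_apply by presburger
  then show ?thesis using len_comp_gen_less[OF iu j] len_comp_gen_less[OF u j] by simp
qed

lemma exchange':
  assumes u: "u \<in> Wn n" and i: "i \<in> {1..<n}" and j: "j \<in> {1..<n}" and ne: "gen i \<circ> u \<noteq> u \<circ> gen j"
  shows "len n (gen i \<circ> u \<circ> gen j) < len n (u \<circ> gen j) \<longleftrightarrow> len n (gen i \<circ> u) < len n u"
proof -
  have "gen j \<circ> ivp u \<noteq> ivp u \<circ> gen i"
  proof
    assume e: "gen j \<circ> ivp u = ivp u \<circ> gen i"
    have "(gen i \<circ> u) a = (u \<circ> gen j) a" for a
    proof -
      have "gen j (ivp u (u a)) = ivp u (gen i (u a))" using fun_cong[OF e, of "u a"] by simp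
      then have "u (gen j a) = u (ivp u (gen i (u a)))" using u by simp
      then show ?thesis using u by simp
    qed
    then show False using ne by blast
  qed
  then have "len n (gen j \<circ> ivp u \<circ> gen i) < len n (gen j \<circ> ivp u) \<longleftrightarrow> len n (ivp u \<circ> gen i) < len n (ivp u)"
    using exchange[of "ivp u" n j i] u i j by simp
  moreover have "ivp (gen i \<circ> u \<circ> gen j) = gen j \<circ> ivp u \<circ> gen i"
    using u i j by (simp add: inv_comp_Wn[of _ n] comp_assoc)
  moreover have "ivp (u \<circ> gen j) = gen j \<circ> ivp u" using u j by (simp add: inv_comp_Wn[of _ n])
  ultimately show ?thesis using u i j len_inv[of "gen i \<circ> u \<circ> gen j" n] len_inv[of "u \<circ> gen j" n]
    by (simp add: len_gen_comp_inv len_inv)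
qed

lemma tmul_Suc_eq: "tmul n (Suc k) x h =
   tsmul n (gen (SOME i. i \<in> {1..<n} \<and> len n (gen i \<circ> x) < len n x))
    (tmul n k (gen (SOME i. i \<in> {1..<n} \<and> len n (gen i \<circ> x) < len n x) \<circ> x) h)"
  by (simp add: Let_def)

section \<open>Multiplication of the Hecke algebra\<close>

locale hecke = fixes n :: nat
begin

abbreviation "W \<equiv> Wn n"
abbreviation "S \<equiv> {1..<n}"
abbreviation "l \<equiv> len n"
abbreviation "hk \<equiv> hk_on n"
abbreviation hm (infixl "\<star>" 70) where "a \<star> b \<equiv> hmult n a b"
abbreviation "zt \<equiv> vK - inverse vK"
abbreviation "L i \<equiv> tsmul n (gen i)"

text \<open>Right multiplication by a generator in coordinates. It is introduced before the
  multiplication is known to be associative; \<open>hm_gen_right\<close> identifies it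
  afterwards.\<close>

definition R :: "nat \<Rightarrow> hk \<Rightarrow> hk" where
  "R j h = (\<lambda>u. h (u \<circ> gen j) + (if l (u \<circ> gen j) < l u then zt * h u else 0))"

lemma L_apply: "L i h u = h (gen i \<circ> u) + (if l (gen i \<circ> u) < l u then zt * h u else 0)"
  by (simp add: tsmul_def)

lemma hkD: "hk h \<Longrightarrow> u \<notin> W \<Longrightarrow> h u = 0" by (simp add: hk_on_def)
lemma hkI: "(\<And>u. u \<notin> W \<Longrightarrow> h u = 0) \<Longrightarrow> hk h" by (simp add: hk_on_def)
lemma hk_Tb [simp]: "w \<in> W \<Longrightarrow> hk (Tb w)" by (auto simp: hk_on_def Tb_def)
lemma hk_add: "hk a \<Longrightarrow> hk b \<Longrightarrow> hk (\<lambda>u. a u + b u)" by (simp add: hk_on_def)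
lemma hk_scale: "hk a \<Longrightarrow> hk (\<lambda>u. c * a u)" by (simp add: hk_on_def)
lemma hk_lc: "(\<And>i. i \<in> I \<Longrightarrow> hk (b i)) \<Longrightarrow> hk (\<lambda>u. \<Sum>i\<in>I. c i * b i u)" by (simp add: hk_on_def)
lemma hk_eqI: "hk a \<Longrightarrow> hk b \<Longrightarrow> (\<And>u. u \<in> W \<Longrightarrow> a u = b u) \<Longrightarrow> a = b"
  by (rule ext) (metis hkD)
lemma hk_0 [simp]: "hk (\<lambda>u. 0)" by (simp add: hk_on_def)

lemma hk_L: "i \<in> S \<Longrightarrow> hk h \<Longrightarrow> hk (L i h)" by (auto simp: hk_on_def L_apply)
lemma hk_R: "i \<in> S \<Longrightarrow> hk h \<Longrightarrow> hk (R i h)" by (auto simp: hk_on_def R_def)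

lemma hk_expand: "hk h \<Longrightarrow> h = (\<lambda>u. \<Sum>w\<in>W. h w * Tb w u)"
  by (rule ext) (auto simp: Tb_def hkD if_distrib cong: if_cong)

text \<open>The two sides differ only in which descents are tested. By the exchange lemmas the tests
  agree, except when \<open>gen i \<circ> u = u \<circ> gen j\<close>, where both sides reduce to
  the same expression.\<close>

lemma L_R_commute:
  assumes i: "i \<in> S" and j: "j \<in> S" and h: "hk h" shows "L i (R j h) = R j (L i h)"
proof (rule hk_eqI)
  fix u assume u: "u \<in> W"
  have 1: "L i (R j h) u = h (gen i \<circ> u \<circ> gen j) + (if l (gen i \<circ> u \<circ> gen j) < l (gen i \<circ> u) then zt * h (gen i \<circ> u) else 0)
     + (if l (gen i \<circ> u) < l u then zt * (h (u \<circ> gen j) + (if l (u \<circ> gen j) < l u then zt * h u else 0)) else 0)"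
    by (simp add: L_apply R_def)
  have 2: "R j (L i h) u = h (gen i \<circ> u \<circ> gen j) + (if l (gen i \<circ> u \<circ> gen j) < l (u \<circ> gen j) then zt * h (u \<circ> gen j) else 0)
     + (if l (u \<circ> gen j) < l u then zt * (h (gen i \<circ> u) + (if l (gen i \<circ> u) < l u then zt * h u else 0)) else 0)"
    by (simp add: L_apply R_def comp_assoc)
  show "L i (R j h) u = R j (L i h) u"
  proof (cases "gen i \<circ> u = u \<circ> gen j")
    case True
    then have "gen i \<circ> u \<circ> gen j = u" by (simp add: comp_assoc)
    then show ?thesis unfolding 1 2 using True by (auto simp: algebra_simps)
  next
    case False
    then show ?thesis unfolding 1 2 using exchange[OF u i j False] exchange'[OF u i j False]
      by (auto simp: algebra_simps)
  qed
qed (intro hk_L hk_R assms)+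

text \<open>Operators commuting with all right multiplications by generators are determined by their value at the unit;
  this is what makes the multiplication associative.\<close>
definition lop :: "(hk \<Rightarrow> hk) \<Rightarrow> bool" where
  "lop F \<longleftrightarrow> (\<forall>h. hk h \<longrightarrow> hk (F h)) \<and> (\<forall>a b. F (\<lambda>u. a u + b u) = (\<lambda>u. F a u + F b u)) \<and>
     (\<forall>c a. F (\<lambda>u. c * a u) = (\<lambda>u. c * F a u)) \<and> (\<forall>j\<in>S. \<forall>h. hk h \<longrightarrow> F (R j h) = R j (F h))"

lemma lop_lc: assumes "lop F" shows "F (\<lambda>u. \<Sum>i\<in>I. c i * b i u) = (\<lambda>u. \<Sum>i\<in>I. c i * F (b i) u)"
proof (induction I rule: infinite_finite_induct)
  case (insert x I)
  have "F (\<lambda>u. \<Sum>i\<in>insert x I. c i * b i u) = F (\<lambda>u. (c x * b x u) + (\<Sum>i\<in>I. c i * b i u))"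
    using insert by simp
  also have "\<dots> = (\<lambda>u. F (\<lambda>u. c x * b x u) u + F (\<lambda>u. \<Sum>i\<in>I. c i * b i u) u)"
    using assms by (auto simp: lop_def)
  also have "\<dots> = (\<lambda>u. \<Sum>i\<in>insert x I. c i * F (b i) u)"
    using assms insert by (simp add: lop_def)
  finally show ?case .
next
  case (infinite A)
  have "F (\<lambda>u. 0 * b undefined u) = (\<lambda>u. 0 * F (b undefined) u)" using assms unfolding lop_def by blast
  then show ?case using infinite by simp
next
  case empty
  have "F (\<lambda>u. 0 * b undefined u) = (\<lambda>u. 0 * F (b undefined) u)" using assms unfolding lop_def by blast
  then show ?case by simp
qed

lemma lop_L: "i \<in> S \<Longrightarrow> lop (L i)"
  unfolding lop_def by (auto simp: hk_L L_R_commute) (auto simp: L_apply fun_eq_iff algebra_simps)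

lemma lop_comp: "lop F \<Longrightarrow> lop G \<Longrightarrow> lop (\<lambda>h. F (G h))" unfolding lop_def by auto

lemma lop_id: "lop (\<lambda>h. h)" unfolding lop_def by auto

lemma lop_sum: assumes "\<And>x. x \<in> I \<Longrightarrow> lop (F x)" shows "lop (\<lambda>h z. \<Sum>x\<in>I. c x * F x h z)"
proof -
  have a: "F x (\<lambda>u. a u + b u) z = F x a z + F x b z" if "x \<in> I" for x a b z using assms[OF that] unfolding lop_def by metis
  have b: "F x (\<lambda>u. c * a u) z = c * F x a z" if "x \<in> I" for x a c z using assms[OF that] unfolding lop_def by metis
  have r: "F x (R j h) z = R j (F x h) z" if "x \<in> I" "j \<in> S" "hk h" for x j h z using assms[OF that(1)] that unfolding lop_def by metis
  have k: "hk (F x h)" if "x \<in> I" "hk h" for x h using assms[OF that(1)] that unfolding lop_def by metis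
  show ?thesis unfolding lop_def
  proof (intro conjI allI impI ballI)
    fix j h assume jh: "j \<in> S" "hk h"
    show "(\<lambda>z. \<Sum>x\<in>I. c x * F x (R j h) z) = R j (\<lambda>z. \<Sum>x\<in>I. c x * F x h z)"
      using r[OF _ jh] by (auto simp: R_def sum.distrib distrib_left sum_distrib_left mult_ac fun_eq_iff cong: sum.cong)
  qed (auto simp: a b k algebra_simps sum.distrib sum_distrib_left hk_on_def[of n "\<lambda>z. \<Sum>x\<in>I. c x * F x h z" for h] hkD[OF k])
qed

lemma R_Tb: assumes "w \<in> W" "j \<in> S" "l (w \<circ> gen j) = Suc (l w)" shows "R j (Tb w) = Tb (w \<circ> gen j)"
proof
  fix u
  have "u \<circ> gen j = w \<longleftrightarrow> u = w \<circ> gen j" by auto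
  then show "R j (Tb w) u = Tb (w \<circ> gen j) u" using assms by (auto simp: R_def Tb_def)
qed

lemma lop_eq_Tb: assumes "lop F" "lop G" "F (Tb id) = G (Tb id)" "w \<in> W" shows "F (Tb w) = G (Tb w)"
  using assms(4)
proof (induction "l w" arbitrary: w rule: less_induct)
  case less
  show ?case
  proof (cases "w = id")
    case True then show ?thesis using assms by simp
  next
    case False
    then obtain j where j: "j \<in> S" "l w = Suc (l (w \<circ> gen j))" using right_descent_exists less by blast
    then have wj: "w \<circ> gen j \<in> W" using less by simp
    have "Tb w = R j (Tb (w \<circ> gen j))" using R_Tb[OF wj j(1)] j by simp
    then show ?thesis using less(1)[of "w \<circ> gen j"] assms(1,2) j wj unfolding lop_def by simp
  qed
qed

lemma lop_eq: assumes "lop F" "lop G" "F (Tb id) = G (Tb id)" "hk h" shows "F h = G h"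
proof -
  have "F h = (\<lambda>u. \<Sum>w\<in>W. h w * F (Tb w) u)" by (subst hk_expand[OF assms(4)]) (rule lop_lc[OF assms(1)])
  also have "\<dots> = (\<lambda>u. \<Sum>w\<in>W. h w * G (Tb w) u)" using lop_eq_Tb[OF assms(1-3)] by simp
  also have "\<dots> = G h" by (subst (2) hk_expand[OF assms(4)]) (rule lop_lc[OF assms(2), symmetric])
  finally show ?thesis .
qed

lemma L_Tb: assumes "i \<in> S" "w \<in> W"
  shows "L i (Tb w) = (\<lambda>u. Tb (gen i \<circ> w) u + (if l (gen i \<circ> w) < l w then zt * Tb w u else 0))"
proof
  fix u
  have "gen i \<circ> u = w \<longleftrightarrow> u = gen i \<circ> w" by auto
  then show "L i (Tb w) u = Tb (gen i \<circ> w) u + (if l (gen i \<circ> w) < l w then zt * Tb w u else 0)"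
    by (auto simp: L_apply Tb_def)
qed

lemma L_Tb_asc: assumes "i \<in> S" "w \<in> W" "l (gen i \<circ> w) = Suc (l w)" shows "L i (Tb w) = Tb (gen i \<circ> w)"
  using L_Tb[OF assms(1,2)] assms(3) by simp

text \<open>The definition of \<open>tmul\<close> chooses an arbitrary left descent at each stage.
  As all operators involved are \<open>lop\<close>, the value \<open>Tb x\<close> at the unit
  determines the result whatever the choices were.\<close>

lemma lop_Tmult: assumes "x \<in> W" shows "lop (Tmult n x)" "Tmult n x (Tb id) = Tb x"
proof -
  have "lop (tmul n k x) \<and> tmul n k x (Tb id) = Tb x" if "l x = k" "x \<in> W" for k x
    using that
  proof (induction k arbitrary: x)
    case 0
    then have "x = id" by (simp add: len_0_iff)
    then show ?case using lop_id by simp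
  next
    case (Suc k)
    let ?P = "\<lambda>i. i \<in> S \<and> l (gen i \<circ> x) < l x"
    define i where "i = (SOME i. ?P i)"
    have "x \<noteq> id"
    proof
      assume "x = id"
      then have "l x = 0" by (simp only: len_id)
      then show False using Suc by simp
    qed
    then obtain i' where "i' \<in> S" "l x = Suc (l (gen i' \<circ> x))" using left_descent_exists Suc by blast
    then have "?P i'" by simp
    then have i: "?P i" unfolding i_def by (rule someI)
    then have lx: "l x = Suc (l (gen i \<circ> x))" using len_gen_comp_cases[of x n i] Suc by (metis less_Suc_eq not_less_eq)
    have gx: "gen i \<circ> x \<in> W" using i Suc by simp
    have "l (gen i \<circ> x) = k" using lx Suc by simp
    from Suc.IH[OF this gx]
    have IH: "lop (tmul n k (gen i \<circ> x))" "tmul n k (gen i \<circ> x) (Tb id) = Tb (gen i \<circ> x)" by blast+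
    have e: "tmul n (Suc k) x = (\<lambda>h. L i (tmul n k (gen i \<circ> x) h))"
      by (rule ext) (simp only: tmul_Suc_eq i_def)
    have Lx: "L i (Tb (gen i \<circ> x)) = Tb x" using L_Tb_asc[of i "gen i \<circ> x"] i gx lx by simp
    have "lop (\<lambda>h. L i (tmul n k (gen i \<circ> x) h))" by (rule lop_comp[OF lop_L IH(1)]) (use i in simp)
    then show ?case unfolding e IH(2) Lx by simp
  qed
  then show "lop (Tmult n x)" "Tmult n x (Tb id) = Tb x" using assms unfolding Tmult_def by auto
qed

lemma lop_hm: "lop (hmult n a)"
proof -
  have "hmult n a = (\<lambda>b z. \<Sum>x\<in>W. a x * Tmult n x b z)" by (simp add: hmult_def fun_eq_iff)
  then show ?thesis using lop_sum[of W "Tmult n" a] lop_Tmult by simp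
qed

lemma hk_hm: "hk b \<Longrightarrow> hk (a \<star> b)" using lop_hm unfolding lop_def by blast

lemma hm_1 [simp]: assumes "hk a" shows "a \<star> Tb id = a"
proof -
  have "a \<star> Tb id = (\<lambda>z. \<Sum>x\<in>W. a x * Tb x z)"
    unfolding hmult_def using lop_Tmult(2) by (auto simp: fun_eq_iff intro!: sum.cong)
  then show ?thesis using hk_expand[OF assms] by simp
qed

lemma hm_Tb: "x \<in> W \<Longrightarrow> Tb x \<star> b = Tmult n x b"
  by (rule ext) (auto simp: hmult_def Tb_def if_distrib[of "\<lambda>c. c * _"] cong: if_cong)

lemma hm_1_left [simp]: assumes "hk b" shows "Tb id \<star> b = b"
  using lop_eq[OF lop_hm lop_id _ assms] by simp

lemma hm_assoc: assumes "hk a" "hk b" "hk c" shows "(a \<star> b) \<star> c = a \<star> (b \<star> c)"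
proof (rule lop_eq[OF lop_hm lop_comp[OF lop_hm[of a] lop_hm[of b]] _ assms(3)])
  show "(a \<star> b) \<star> Tb id = a \<star> (b \<star> Tb id)" using assms by (simp add: hk_hm)
qed

lemma hm_lc_right: "a \<star> (\<lambda>u. \<Sum>i\<in>I. c i * b i u) = (\<lambda>u. \<Sum>i\<in>I. c i * (a \<star> b i) u)"
  by (rule lop_lc[OF lop_hm])
lemma hm_add_right: "a \<star> (\<lambda>u. b u + c u) = (\<lambda>u. (a \<star> b) u + (a \<star> c) u)"
  using lop_hm unfolding lop_def by blast
lemma hm_scale_right: "a \<star> (\<lambda>u. c * b u) = (\<lambda>u. c * (a \<star> b) u)"
  using lop_hm unfolding lop_def by blast
lemma hm_lc_left: "(\<lambda>u. \<Sum>i\<in>I. c i * a i u) \<star> b = (\<lambda>u. \<Sum>i\<in>I. c i * (a i \<star> b) u)"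
  unfolding hmult_def sum_distrib_left sum_distrib_right by (subst sum.swap) (simp add: mult_ac)
lemma hm_add_left: "(\<lambda>u. b u + c u) \<star> a = (\<lambda>u. (b \<star> a) u + (c \<star> a) u)"
  by (simp add: hmult_def distrib_right sum.distrib)
lemma hm_scale_left: "(\<lambda>u. c * b u) \<star> a = (\<lambda>u. c * (b \<star> a) u)"
  by (simp add: hmult_def sum_distrib_left mult_ac)
lemma hm_gen: assumes "i \<in> S" "hk b" shows "Tb (gen i) \<star> b = L i b"
proof (rule lop_eq[OF lop_hm lop_L[OF assms(1)] _ assms(2)])
  show "Tb (gen i) \<star> Tb id = L i (Tb id)" using assms L_Tb_asc[of i id] by (simp add: len_gen)
qed

lemma hm_gen_right: assumes "i \<in> S" "hk a" shows "a \<star> Tb (gen i) = R i a"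
proof -
  have "R i (Tb id) = Tb (gen i)" using R_Tb[of id i] assms by (simp add: len_gen)
  then have "a \<star> Tb (gen i) = R i (a \<star> Tb id)" using lop_hm assms unfolding lop_def by (metis hk_Tb id_Wn)
  then show ?thesis using assms by simp
qed

lemma Tb_mult_gen: "i \<in> S \<Longrightarrow> w \<in> W \<Longrightarrow> l (gen i \<circ> w) = Suc (l w) \<Longrightarrow> Tb (gen i) \<star> Tb w = Tb (gen i \<circ> w)"
  using L_Tb_asc by (simp add: hm_gen)
lemma Tb_mult_gen_right: "i \<in> S \<Longrightarrow> w \<in> W \<Longrightarrow> l (w \<circ> gen i) = Suc (l w) \<Longrightarrow> Tb w \<star> Tb (gen i) = Tb (w \<circ> gen i)"
  using R_Tb by (simp add: hm_gen_right)

lemma len_comp_le: assumes "x \<in> W" "y \<in> W" shows "l (x \<circ> y) \<le> l x + l y"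
  using assms(1)
proof (induction "l x" arbitrary: x rule: less_induct)
  case less
  show ?case
  proof (cases "x = id")
    case False
    then obtain i where i: "i \<in> S" "l x = Suc (l (gen i \<circ> x))" using left_descent_exists less by blast
    then have "l (gen i \<circ> x \<circ> y) \<le> l (gen i \<circ> x) + l y" using less by simp
    moreover have "l (x \<circ> y) \<le> Suc (l (gen i \<circ> x \<circ> y))"
      using len_gen_comp_cases[of "x \<circ> y" n i] less i assms by (metis comp_Wn comp_assoc le_SucI order_refl Suc_leD le_refl)
    ultimately show ?thesis using i by simp
  qed simp
qed

lemma Tb_mult: assumes "x \<in> W" "y \<in> W" "l (x \<circ> y) = l x + l y" shows "Tb x \<star> Tb y = Tb (x \<circ> y)"
  using assms(1,3)
proof (induction "l x" arbitrary: x rule: less_induct)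
  case less
  show ?case
  proof (cases "x = id")
    case False
    then obtain i where i: "i \<in> S" "l x = Suc (l (gen i \<circ> x))" using left_descent_exists less by blast
    have gx: "gen i \<circ> x \<in> W" using less i by simp
    have le: "l (gen i \<circ> x \<circ> y) \<le> l (gen i \<circ> x) + l y" by (rule len_comp_le[OF gx assms(2)])
    have e: "gen i \<circ> (gen i \<circ> x \<circ> y) = x \<circ> y" by (simp add: comp_assoc)
    then have s: "l (x \<circ> y) = Suc (l (gen i \<circ> x \<circ> y))"
      using len_gen_comp_cases[of "gen i \<circ> x \<circ> y" n i] le i less gx assms(2)
      by (metis comp_Wn add_Suc not_less_eq_eq le_SucI Suc_n_not_le_n)
    then have "Tb (gen i \<circ> x) \<star> Tb y = Tb (gen i \<circ> x \<circ> y)" using less(1)[of "gen i \<circ> x"] gx i less(3) by simp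
    moreover have "Tb x = Tb (gen i) \<star> Tb (gen i \<circ> x)" using Tb_mult_gen[OF i(1) gx] i by simp
    moreover have "Tb (gen i) \<star> Tb (gen i \<circ> x \<circ> y) = Tb (x \<circ> y)"
      using Tb_mult_gen[OF i(1) comp_Wn[OF gx assms(2)]] s unfolding e by simp
    ultimately show ?thesis using gx assms(2) i(1) by (simp add: hm_assoc)
  qed (use assms in simp)
qed

section \<open>The bilinear form, the anti-involution and the trace\<close>

definition ip :: "hk \<Rightarrow> hk \<Rightarrow> K" where "ip a b = (\<Sum>w\<in>W. a w * b w)"

definition star :: "hk \<Rightarrow> hk" where "star h = (\<lambda>w. if w \<in> W then h (ivp w) else 0)"

lemma hk_star [simp]: "hk (star h)" by (simp add: star_def hk_on_def)
lemma star_star [simp]: "hk h \<Longrightarrow> star (star h) = h" by (rule hk_eqI[OF hk_star]) (auto simp: star_def)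
lemma star_Tb [simp]: "w \<in> W \<Longrightarrow> star (Tb w) = Tb (ivp w)"
  by (rule hk_eqI[OF hk_star hk_Tb]) (auto simp: star_def Tb_def)
lemma star_lc: "star (\<lambda>u. \<Sum>i\<in>I. c i * b i u) = (\<lambda>u. \<Sum>i\<in>I. c i * star (b i) u)"
  by (auto simp: star_def)

lemma star_expand: assumes "hk a" shows "star a = (\<lambda>u. \<Sum>x\<in>W. a x * Tb (ivp x) u)"
proof -
  have "star a = (\<lambda>u. \<Sum>x\<in>W. a x * star (Tb x) u)" by (subst hk_expand[OF assms]) (rule star_lc)
  also have "\<dots> = (\<lambda>u. \<Sum>x\<in>W. a x * Tb (ivp x) u)" by simp
  finally show ?thesis .
qed

lemma star_L: assumes "i \<in> S" "hk h" shows "star (L i h) = R i (star h)"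
proof (rule hk_eqI)
  fix u assume u: "u \<in> W"
  have "ivp (u \<circ> gen i) = gen i \<circ> ivp u" using assms u by (simp add: inv_comp_Wn[of _ n])
  moreover have "l (gen i \<circ> ivp u) = l (u \<circ> gen i)" using assms u by (simp add: len_gen_comp_inv)
  ultimately show "star (L i h) u = R i (star h) u" using u assms by (simp add: star_def L_apply R_def len_inv)
qed (use assms in \<open>auto intro: hk_R\<close>)

lemma star_hm: assumes "hk a" "hk b" shows "star (a \<star> b) = star b \<star> star a"
proof -
  have *: "star (Tb x \<star> b) = star b \<star> Tb (ivp x)" if "x \<in> W" for x
    using that
  proof (induction "l x" arbitrary: x rule: less_induct)
    case less
    show ?case
    proof (cases "x = id")
      case True then show ?thesis using assms by simp
    next
      case False
      then obtain i where i: "i \<in> S" "l x = Suc (l (gen i \<circ> x))" using left_descent_exists less by blast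
      have gx: "gen i \<circ> x \<in> W" using less i by simp
      have "Tb x = Tb (gen i) \<star> Tb (gen i \<circ> x)" using Tb_mult_gen[OF i(1) gx] i by simp
      then have "Tb x \<star> b = Tb (gen i) \<star> Tb (gen i \<circ> x) \<star> b" by (rule arg_cong)
      also have "\<dots> = Tb (gen i) \<star> (Tb (gen i \<circ> x) \<star> b)" using i gx assms by (intro hm_assoc) auto
      also have "\<dots> = L i (Tb (gen i \<circ> x) \<star> b)" using i gx assms by (intro hm_gen hk_hm)
      finally have "star (Tb x \<star> b) = star (L i (Tb (gen i \<circ> x) \<star> b))" by (rule arg_cong)
      also have "\<dots> = R i (star b \<star> Tb (ivp (gen i \<circ> x)))"
        using star_L[OF i(1)] less(1)[of "gen i \<circ> x"] gx i assms by (simp add: hk_hm)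
      also have "\<dots> = star b \<star> R i (Tb (ivp (gen i \<circ> x)))"
        using lop_hm[of "star b"] i gx unfolding lop_def by simp
      also have "R i (Tb (ivp (gen i \<circ> x))) = Tb (ivp x)"
      proof -
        have e: "ivp (gen i \<circ> x) \<circ> gen i = ivp x" using less i by (simp add: inv_comp_Wn[of _ n])
        have "l (ivp (gen i \<circ> x) \<circ> gen i) = Suc (l (ivp (gen i \<circ> x)))"
          unfolding e using i gx less len_inv[OF gx] len_inv[OF less(2)] by simp
        then show ?thesis using R_Tb[of "ivp (gen i \<circ> x)" i] gx i e by simp
      qed
      finally show ?thesis .
    qed
  qed
  have "star (a \<star> b) = star ((\<lambda>u. \<Sum>x\<in>W. a x * Tb x u) \<star> b)" using hk_expand[OF assms(1)] by simp
  also have "\<dots> = (\<lambda>u. \<Sum>x\<in>W. a x * (star b \<star> Tb (ivp x)) u)" using * by (simp add: hm_lc_left star_lc)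
  also have "\<dots> = star b \<star> (\<lambda>u. \<Sum>x\<in>W. a x * Tb (ivp x) u)" by (simp only: hm_lc_right)
  also have "\<dots> = star b \<star> star a" by (simp only: star_expand[OF assms(1)])
  finally show ?thesis .
qed

lemma sum_W_gen_left: "i \<in> S \<Longrightarrow> (\<Sum>w\<in>W. f (gen i \<circ> w)) = (\<Sum>w\<in>W. f w)"
  by (rule sum.reindex_bij_witness[of _ "\<lambda>w. gen i \<circ> w" "\<lambda>w. gen i \<circ> w"]) auto

lemma sum_W_inv: "(\<Sum>w\<in>W. f (ivp w)) = (\<Sum>w\<in>W. f w)"
  by (rule sum.reindex_bij_witness[of _ ivp ivp]) auto

lemma ip_commute: "ip a b = ip b a" by (simp add: ip_def mult.commute)
lemma ip_lc_left: "ip (\<lambda>u. \<Sum>i\<in>I. c i * b i u) a = (\<Sum>i\<in>I. c i * ip (b i) a)"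
  unfolding ip_def sum_distrib_left sum_distrib_right by (subst sum.swap) (simp add: mult_ac)
lemma ip_lc_right: "ip a (\<lambda>u. \<Sum>i\<in>I. c i * b i u) = (\<Sum>i\<in>I. c i * ip a (b i))"
  using ip_lc_left ip_commute by simp
lemma ip_scale_right: "ip a (\<lambda>u. c * b u) = c * ip a b" by (simp add: ip_def sum_distrib_left mult_ac)
lemma ip_Tb: "w \<in> W \<Longrightarrow> ip a (Tb w) = a w"
  by (simp add: ip_def Tb_def if_distrib cong: if_cong)
lemma ip_self_0: assumes "hk a" "ip a a = 0" shows "a = (\<lambda>u. 0)"
proof (rule hk_eqI)
  fix u assume "u \<in> W"
  have "(\<Sum>w\<in>W. a w * a w) = 0" using assms by (simp add: ip_def)
  \<comment> \<open>This uses the order of \<open>K\<close> as fraction field of the ordered ring of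
    polynomials, where squares are nonnegative; it is not the order at v = 0.\<close>
  then have "\<forall>w\<in>W. a w * a w = 0" by (subst (asm) sum_nonneg_eq_0_iff) auto
  then show "a u = 0" using \<open>u \<in> W\<close> by auto
qed (use assms in auto)
lemma ip_self_nonneg: "ip a a \<ge> 0" unfolding ip_def by (intro sum_nonneg) auto

lemma ip_L: assumes "i \<in> S" shows "ip (L i a) b = ip a (L i b)"
proof -
  have "(\<Sum>w\<in>W. a (gen i \<circ> w) * b w) = (\<Sum>w\<in>W. a w * b (gen i \<circ> w))"
    using sum_W_gen_left[OF assms, of "\<lambda>w. a (gen i \<circ> w) * b w"] by simp
  moreover have "ip (L i a) b = (\<Sum>w\<in>W. a (gen i \<circ> w) * b w) + (\<Sum>w\<in>W. if l (gen i \<circ> w) < l w then zt * a w * b w else 0)"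
    unfolding ip_def L_apply sum.distrib[symmetric] by (rule sum.cong) (auto simp: algebra_simps)
  moreover have "ip a (L i b) = (\<Sum>w\<in>W. a w * b (gen i \<circ> w)) + (\<Sum>w\<in>W. if l (gen i \<circ> w) < l w then zt * a w * b w else 0)"
    unfolding ip_def L_apply sum.distrib[symmetric] by (rule sum.cong) (auto simp: algebra_simps)
  ultimately show ?thesis by simp
qed

lemma ip_star: "ip (star a) (star b) = ip a b"
  using sum_W_inv[of "\<lambda>w. a w * b w"] by (simp add: ip_def star_def)

text \<open>Left multiplication by a generator is self-adjoint (\<open>ip_L\<close>): it is the sum
  of an involutive permutation of the basis and a diagonal operator. Products of generators are
  reversed, as by \<open>star\<close>.\<close>

lemma ip_hm_left: assumes "hk a" "hk b" "hk c" shows "ip (a \<star> b) c = ip b (star a \<star> c)"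
proof -
  have *: "ip (Tb x \<star> b) c = ip b (Tb (ivp x) \<star> c)" if "x \<in> W" "hk b" "hk c" for x b c
    using that
  proof (induction "l x" arbitrary: x b c rule: less_induct)
    case less
    show ?case
    proof (cases "x = id")
      case True then show ?thesis using less by simp
    next
      case False
      then obtain i where i: "i \<in> S" "l x = Suc (l (gen i \<circ> x))" using left_descent_exists less by blast
      have gx: "gen i \<circ> x \<in> W" using less i by simp
      have t: "Tb x = Tb (gen i) \<star> Tb (gen i \<circ> x)" using Tb_mult_gen[OF i(1) gx] i by simp
      have "Tb (ivp x) = star (Tb x)" using less by simp
      also have "\<dots> = star (Tb (gen i) \<star> Tb (gen i \<circ> x))" using t by (rule arg_cong)
      also have "\<dots> = Tb (ivp (gen i \<circ> x)) \<star> Tb (gen i)"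
        using star_hm[of "Tb (gen i)" "Tb (gen i \<circ> x)"] i gx by simp
      finally have t': "Tb (ivp x) = Tb (ivp (gen i \<circ> x)) \<star> Tb (gen i)" .
      have "Tb x \<star> b = Tb (gen i) \<star> Tb (gen i \<circ> x) \<star> b" using t by (rule arg_cong)
      also have "\<dots> = Tb (gen i) \<star> (Tb (gen i \<circ> x) \<star> b)" using i gx less by (intro hm_assoc) auto
      also have "\<dots> = L i (Tb (gen i \<circ> x) \<star> b)" using i gx less by (intro hm_gen hk_hm)
      finally have "ip (Tb x \<star> b) c = ip (L i (Tb (gen i \<circ> x) \<star> b)) c" by (rule arg_cong)
      also have "\<dots> = ip b (Tb (ivp (gen i \<circ> x)) \<star> L i c)"
        using ip_L[OF i(1)] less(1)[of "gen i \<circ> x" b "L i c"] gx i less by (simp add: hk_L)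
      also have "\<dots> = ip b (Tb (ivp x) \<star> c)"
      proof -
        have "Tb (ivp x) \<star> c = Tb (ivp (gen i \<circ> x)) \<star> (Tb (gen i) \<star> c)"
          unfolding t' using i gx less by (intro hm_assoc) auto
        then show ?thesis using i less by (simp add: hm_gen)
      qed
      finally show ?thesis .
    qed
  qed
  have "ip (a \<star> b) c = ip ((\<lambda>u. \<Sum>x\<in>W. a x * Tb x u) \<star> b) c" using hk_expand[OF assms(1)] by simp
  also have "\<dots> = (\<Sum>x\<in>W. a x * ip b (Tb (ivp x) \<star> c))" using * assms by (simp add: hm_lc_left ip_lc_left)
  also have "\<dots> = ip b ((\<lambda>u. \<Sum>x\<in>W. a x * Tb (ivp x) u) \<star> c)" by (simp only: hm_lc_left ip_lc_right)
  also have "\<dots> = ip b (star a \<star> c)" by (simp only: star_expand[OF assms(1)])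
  finally show ?thesis .
qed

lemma ip_hm_right: assumes "hk a" "hk b" "hk c" shows "ip (b \<star> a) c = ip b (c \<star> star a)"
proof -
  have "ip (b \<star> a) c = ip (star a \<star> star b) (star c)"
    using ip_star[of "b \<star> a" c] star_hm assms by simp
  also have "\<dots> = ip (star b) (a \<star> star c)" using ip_hm_left[of "star a"] assms by simp
  also have "\<dots> = ip b (star (a \<star> star c))" using ip_star[of b "star (a \<star> star c)"] assms by (simp add: hk_hm)
  also have "\<dots> = ip b (c \<star> star a)" using assms by (simp add: star_hm)
  finally show ?thesis .
qed

definition tau :: "hk \<Rightarrow> K" where "tau h = h id"

text \<open>Adjointness moves b to the other side of the form at the unit. Hence the T_w and the
  T_(w^-1) are dual bases for the trace, which is what the Schur sums need.\<close>

lemma tau_hm: assumes "hk a" "hk b" shows "tau (a \<star> b) = (\<Sum>w\<in>W. a w * b (ivp w))"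
proof -
  have "tau (a \<star> b) = ip (a \<star> b) (Tb id)" by (simp add: tau_def ip_Tb)
  also have "\<dots> = ip a (star b)" using ip_hm_right[OF assms(2,1), of "Tb id"] by simp
  finally show ?thesis by (simp add: ip_def star_def)
qed

lemma tau_commute: assumes "hk a" "hk b" shows "tau (a \<star> b) = tau (b \<star> a)"
  using sum_W_inv[of "\<lambda>w. a w * b (ivp w)"] assms by (simp add: tau_hm mult.commute)

lemma tau_Tb_inv: assumes "hk a" "y \<in> W" shows "tau (a \<star> Tb (ivp y)) = a y"
proof -
  have "ivp w = ivp y \<longleftrightarrow> w = y" if "w \<in> W" for w using that assms(2) by (metis inv_inv_Wn)
  then have "tau (a \<star> Tb (ivp y)) = (\<Sum>w\<in>W. if w = y then a w else 0)"
    unfolding tau_hm[OF assms(1) hk_Tb[OF inv_Wn[OF assms(2)]]] by (intro sum.cong) (auto simp: Tb_def)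
  then show ?thesis using assms by simp
qed

end

section \<open>Kazhdan-Lusztig bases\<close>

context hecke
begin

lemma L_add_scale: "L i (\<lambda>u. a u + c * b u) = (\<lambda>u. L i a u + c * L i b u)"
  by (auto simp: L_apply fun_eq_iff algebra_simps)
lemma L_scale: "L i (\<lambda>u. c * b u) = (\<lambda>u. c * L i b u)"
  by (auto simp: L_apply fun_eq_iff algebra_simps)

lemma L_L: assumes "i \<in> S" shows "L i (L i a) = (\<lambda>u. if u \<in> W then a u + zt * L i a u else L i (L i a) u)"
proof
  fix u
  show "L i (L i a) u = (if u \<in> W then a u + zt * L i a u else L i (L i a) u)"
  proof (cases "u \<in> W")
    case True
    have "l (gen i \<circ> u) < l u \<longleftrightarrow> \<not> l u < l (gen i \<circ> u)"
      using len_gen_comp_cases[OF True assms] by (metis lessI less_asym)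
    then show ?thesis using True by (auto simp: L_apply algebra_simps)
  qed simp
qed

lemma L_L_hk: assumes "i \<in> S" "hk a" shows "L i (L i a) u = a u + zt * L i a u"
proof (cases "u \<in> W")
  case True then show ?thesis using L_L[OF assms(1), of a] by metis
next
  case False then show ?thesis using hkD[OF hk_L[OF assms(1) hk_L[OF assms]]] hkD[OF hk_L[OF assms]] hkD[OF assms(2)] by simp
qed

text \<open>The inverse of T_s, read off from the quadratic relation.\<close>

definition Tsi :: "nat \<Rightarrow> hk" where "Tsi i = (\<lambda>u. Tb (gen i) u + (- zt) * Tb id u)"

lemma hk_Tsi: "i \<in> S \<Longrightarrow> hk (Tsi i)"
  unfolding Tsi_def by (intro hk_add hk_scale hk_Tb gen_Wn id_Wn)

lemma hm_Tsi: assumes "i \<in> S" "hk b" shows "Tsi i \<star> b = (\<lambda>u. L i b u - zt * b u)"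
  unfolding Tsi_def hm_add_left hm_scale_left hm_gen[OF assms] hm_1_left[OF assms(2)] by (simp add: fun_eq_iff algebra_simps)

lemma Tsi_inv: assumes "i \<in> S" shows "Tb (gen i) \<star> Tsi i = Tb id" "Tsi i \<star> Tb (gen i) = Tb id"
proof -
  have g: "hk (Tb (gen i))" "hk (Tb id)" using assms by auto
  have L1: "L i (Tb id) = Tb (gen i)" using hm_gen[OF assms g(2)] g by simp
  have LL: "L i (Tb (gen i)) u = Tb id u + zt * Tb (gen i) u" for u
    using L_L_hk[OF assms g(2), of u] unfolding L1 .
  show "Tb (gen i) \<star> Tsi i = Tb id"
    unfolding Tsi_def hm_add_right hm_scale_right hm_gen[OF assms g(1)] hm_1[OF g(1)] LL by (simp add: fun_eq_iff algebra_simps)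
  show "Tsi i \<star> Tb (gen i) = Tb id" unfolding hm_Tsi[OF assms g(1)] LL by (simp add: fun_eq_iff)
qed

lemma Tb_inverse_exists: "w \<in> W \<Longrightarrow> \<exists>g. hk g \<and> Tb w \<star> g = Tb id \<and> g \<star> Tb w = Tb id"
proof (induction "l w" arbitrary: w rule: less_induct)
  case less
  show ?case
  proof (cases "w = id")
    case True then show ?thesis by (intro exI[of _ "Tb id"]) simp
  next
    case False
    then obtain i where i: "i \<in> S" "l w = Suc (l (gen i \<circ> w))" using left_descent_exists less by blast
    have gx: "gen i \<circ> w \<in> W" using less i by simp
    have lt: "l (gen i \<circ> w) < l w" using i by simp
    obtain g where g: "hk g" "Tb (gen i \<circ> w) \<star> g = Tb id" "g \<star> Tb (gen i \<circ> w) = Tb id"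
      using less(1)[OF lt gx] by blast
    have t: "Tb w = Tb (gen i) \<star> Tb (gen i \<circ> w)" using Tb_mult_gen[OF i(1) gx] i by simp
    have k: "hk (Tb (gen i))" "hk (Tb (gen i \<circ> w))" "hk (Tsi i)" "hk (g \<star> Tsi i)" using i gx hk_Tsi g by (auto intro: hk_hm)
    have "Tb w \<star> (g \<star> Tsi i) = Tb (gen i) \<star> (Tb (gen i \<circ> w) \<star> (g \<star> Tsi i))"
      unfolding t using k by (intro hm_assoc)
    also have "Tb (gen i \<circ> w) \<star> (g \<star> Tsi i) = Tb (gen i \<circ> w) \<star> g \<star> Tsi i"
      using k g by (intro hm_assoc[symmetric])
    also have "Tb (gen i) \<star> (Tb (gen i \<circ> w) \<star> g \<star> Tsi i) = Tb id" unfolding g(2) using k Tsi_inv[OF i(1)] by simp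
    finally have 1: "Tb w \<star> (g \<star> Tsi i) = Tb id" .
    have "(g \<star> Tsi i) \<star> Tb w = g \<star> (Tsi i \<star> Tb (gen i) \<star> Tb (gen i \<circ> w))"
      unfolding t using k g by (simp add: hm_assoc hk_hm)
    also have "\<dots> = Tb id" unfolding Tsi_inv[OF i(1)] using k g by simp
    finally show ?thesis using 1 k by blast
  qed
qed

lemma Tinv: assumes "w \<in> W"
  shows "hk (Tinv n w)" "Tinv n w \<star> Tb w = Tb id" "Tb w \<star> Tinv n w = Tb id"
    "\<And>h. hk h \<Longrightarrow> h \<star> Tb w = Tb id \<Longrightarrow> h = Tinv n w"
proof -
  obtain g where g: "hk g" "Tb w \<star> g = Tb id" "g \<star> Tb w = Tb id" using Tb_inverse_exists[OF assms] by blast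
  have u: "h = g" if "hk h" "h \<star> Tb w = Tb id" for h
  proof -
    have "h = h \<star> (Tb w \<star> g)" using g that by simp
    also have "\<dots> = (h \<star> Tb w) \<star> g" using that g assms by (intro hm_assoc[symmetric]) auto
    finally show ?thesis using that g by simp
  qed
  have e: "Tinv n w = g" unfolding Tinv_def
  proof (rule the_equality)
    show "hk g \<and> g \<star> Tb w = Tb id" using g by blast
    show "h = g" if "hk h \<and> h \<star> Tb w = Tb id" for h using u that by blast
  qed
  show "hk (Tinv n w)" "Tinv n w \<star> Tb w = Tb id" "Tb w \<star> Tinv n w = Tb id" unfolding e by (rule g)+
  show "h = Tinv n w" if "hk h" "h \<star> Tb w = Tb id" for h unfolding e by (rule u[OF that])
qed

abbreviation "bT w \<equiv> Tinv n (ivp w)"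

lemma bT_id: "bT id = Tb id"
proof -
  have "Tb id = Tinv n id" by (rule Tinv(4)) auto
  then show ?thesis by simp
qed

lemma bT_gen: assumes "i \<in> S" "w \<in> W" "l (gen i \<circ> w) = Suc (l w)" shows "bT (gen i \<circ> w) = Tsi i \<star> bT w"
proof -
  have e: "ivp (gen i \<circ> w) = ivp w \<circ> gen i" using assms by (simp add: inv_comp_Wn[of _ n])
  have "l (ivp w \<circ> gen i) = Suc (l (ivp w))" using assms by (simp add: len_gen_comp_inv len_inv)
  then have t: "Tb (ivp w \<circ> gen i) = Tb (ivp w) \<star> Tb (gen i)" using Tb_mult_gen_right[of i "ivp w"] assms by simp
  have k: "hk (Tsi i)" "hk (bT w)" "hk (Tb (ivp w))" "hk (Tb (gen i))" using hk_Tsi Tinv(1) assms by auto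
  have "(Tsi i \<star> bT w) \<star> Tb (ivp w \<circ> gen i) = Tsi i \<star> (bT w \<star> Tb (ivp w)) \<star> Tb (gen i)"
    unfolding t using k by (simp add: hm_assoc hk_hm)
  also have "\<dots> = Tb id" using Tinv(2)[of "ivp w"] assms k Tsi_inv[OF assms(1)] by simp
  finally show ?thesis unfolding e using Tinv(4)[of "ivp w \<circ> gen i" "Tsi i \<star> bT w"] k assms by (simp add: hk_hm)
qed

lemma hbar_lc: "hbar n (\<lambda>u. \<Sum>i\<in>I. c i * b i u) = (\<lambda>u. \<Sum>i\<in>I. barK (c i) * hbar n (b i) u)"
  unfolding hbar_def barK_sum barK_mult sum_distrib_left sum_distrib_right
  by (subst sum.swap) (simp add: mult_ac)

lemma hbar_add: "hbar n (\<lambda>u. a u + b u) = (\<lambda>u. hbar n a u + hbar n b u)"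
  by (simp add: hbar_def barK_add distrib_right sum.distrib)
lemma hbar_scale: "hbar n (\<lambda>u. c * a u) = (\<lambda>u. barK c * hbar n a u)"
  by (simp add: hbar_def barK_mult sum_distrib_left mult_ac)
lemma hk_hbar: "hk (hbar n a)"
  unfolding hbar_def by (rule hk_lc) (use Tinv(1) in auto)
lemma hbar_Tb: "w \<in> W \<Longrightarrow> hbar n (Tb w) = bT w"
  by (rule ext) (auto simp: hbar_def Tb_def if_distrib[of barK] if_distrib[of "\<lambda>c. c * _"] cong: if_cong)

lemma barK_zt: "barK zt = - zt" by (simp add: barK_diff barK_inverse)

lemma hbar_L: assumes "i \<in> S" "hk h" shows "hbar n (L i h) = Tsi i \<star> hbar n h"
proof -
  have *: "hbar n (L i (Tb w)) = Tsi i \<star> bT w" if w: "w \<in> W" for w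
  proof (cases rule: len_gen_comp_cases[OF w assms(1)])
    case 1
    then have "L i (Tb w) = Tb (gen i \<circ> w)" using L_Tb_asc[OF assms(1) w] by simp
    then show ?thesis using hbar_Tb[of "gen i \<circ> w"] bT_gen[OF assms(1) w 1] w assms by simp
  next
    case 2
    let ?w = "gen i \<circ> w"
    have w': "?w \<in> W" using w assms by simp
    have k: "hk (Tsi i)" "hk (bT w)" "hk (bT ?w)" using hk_Tsi Tinv(1) assms w by auto
    have b: "bT w = Tsi i \<star> bT ?w" using bT_gen[OF assms(1) w'] 2 by simp
    have "L i (Tb w) = (\<lambda>u. Tb ?w u + zt * Tb w u)" using L_Tb[OF assms(1) w] 2 by simp
    then have "hbar n (L i (Tb w)) = (\<lambda>u. bT ?w u + (- zt) * bT w u)"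
      by (simp only: hbar_add hbar_scale barK_zt hbar_Tb[OF w] hbar_Tb[OF w'])
    moreover have "(Tsi i \<star> bT w) u = bT ?w u + (- zt) * bT w u" for u
    proof -
      have e: "bT w u = L i (bT ?w) u - zt * bT ?w u" for u
        unfolding b hm_Tsi[OF assms(1) k(3)] by simp
      have "L i (bT w) u = bT ?w u" for u
      proof -
        have "L i (bT w) = (\<lambda>u. L i (L i (bT ?w)) u + (- zt) * L i (bT ?w) u)"
        proof -
          have "bT w = (\<lambda>u. L i (bT ?w) u + (- zt) * bT ?w u)" using e by (simp add: fun_eq_iff algebra_simps)
          then have "L i (bT w) = L i (\<lambda>u. L i (bT ?w) u + (- zt) * bT ?w u)" by (rule arg_cong)
          then show ?thesis unfolding L_add_scale .
        qed
        then have "L i (bT w) u = L i (L i (bT ?w)) u + (- zt) * L i (bT ?w) u" by (rule fun_cong)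
        then show ?thesis unfolding L_L_hk[OF assms(1) k(3)] by (simp add: algebra_simps)
      qed
      then show ?thesis unfolding hm_Tsi[OF assms(1) k(2)] by (simp add: algebra_simps)
    qed
    ultimately show ?thesis by (simp add: fun_eq_iff)
  qed
  have "L i h = (\<lambda>u. \<Sum>w\<in>W. h w * L i (Tb w) u)"
    by (subst hk_expand[OF assms(2)]) (rule lop_lc[OF lop_L[OF assms(1)]])
  then have "hbar n (L i h) = (\<lambda>u. \<Sum>w\<in>W. barK (h w) * (Tsi i \<star> bT w) u)"
    using * by (simp add: hbar_lc)
  also have "\<dots> = Tsi i \<star> hbar n h" unfolding hbar_def by (simp only: hm_lc_right)
  finally show ?thesis .
qed

lemma hbar_hm: assumes "hk a" "hk b" shows "hbar n (a \<star> b) = hbar n a \<star> hbar n b"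
proof -
  have *: "hbar n (Tb x \<star> b) = bT x \<star> hbar n b" if "x \<in> W" for x
    using that
  proof (induction "l x" arbitrary: x rule: less_induct)
    case less
    show ?case
    proof (cases "x = id")
      case True
      then show ?thesis using assms bT_id hk_hbar by (metis hm_1_left)
    next
      case False
      then obtain i where i: "i \<in> S" "l x = Suc (l (gen i \<circ> x))" using left_descent_exists less by blast
      have gx: "gen i \<circ> x \<in> W" using less i by simp
      have lt: "l (gen i \<circ> x) < l x" using i by simp
      have t: "Tb x = Tb (gen i) \<star> Tb (gen i \<circ> x)" using Tb_mult_gen[OF i(1) gx] i by simp
      have k: "hk (Tb (gen i))" "hk (Tb (gen i \<circ> x))" "hk (Tsi i)" "hk (bT (gen i \<circ> x))"
        using i gx hk_Tsi Tinv(1) inv_Wn by auto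
      have "Tb x \<star> b = Tb (gen i) \<star> (Tb (gen i \<circ> x) \<star> b)" unfolding t using k assms by (intro hm_assoc)
      also have "\<dots> = L i (Tb (gen i \<circ> x) \<star> b)" using i assms by (intro hm_gen hk_hm)
      finally have "hbar n (Tb x \<star> b) = Tsi i \<star> (bT (gen i \<circ> x) \<star> hbar n b)"
        using hbar_L[OF i(1) hk_hm[OF assms(2)]] less(1)[OF lt gx] by simp
      also have "\<dots> = (Tsi i \<star> bT (gen i \<circ> x)) \<star> hbar n b" using k hk_hbar by (intro hm_assoc[symmetric])
      also have "Tsi i \<star> bT (gen i \<circ> x) = bT x" using bT_gen[OF i(1) gx] i by simp
      finally show ?thesis .
    qed
  qed
  have "a \<star> b = (\<lambda>u. \<Sum>x\<in>W. a x * (Tb x \<star> b) u)"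
    by (subst hk_expand[OF assms(1)]) (rule hm_lc_left)
  then have "hbar n (a \<star> b) = (\<lambda>u. \<Sum>x\<in>W. barK (a x) * (bT x \<star> hbar n b) u)"
    using * by (simp add: hbar_lc)
  also have "\<dots> = hbar n a \<star> hbar n b" unfolding hbar_def[of n a] by (simp only: hm_lc_left)
  finally show ?thesis .
qed

lemma star_bT: assumes "w \<in> W" shows "star (bT w) = bT (ivp w)"
proof -
  have "star (bT w) \<star> Tb w = star (Tb (ivp w) \<star> bT w)" using assms Tinv(1)[of "ivp w"] by (simp add: star_hm)
  also have "\<dots> = Tb id" using Tinv(3)[of "ivp w"] assms star_Tb[of id] by simp
  finally show ?thesis using Tinv(4)[OF assms, of "star (bT w)"] assms by simp
qed

lemma hbar_star: assumes "hk h" shows "hbar n (star h) = star (hbar n h)"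
proof -
  have "hbar n (star h) = (\<lambda>u. \<Sum>x\<in>W. barK (h x) * bT (ivp x) u)"
    unfolding star_expand[OF assms] hbar_lc using hbar_Tb by simp
  also have "\<dots> = (\<lambda>u. \<Sum>x\<in>W. barK (h x) * star (bT x) u)" using star_bT by simp
  also have "\<dots> = star (hbar n h)" unfolding hbar_def by (simp only: star_lc)
  finally show ?thesis .
qed

text \<open>Each factor \<open>Tsi i\<close> is T_s plus a multiple of the unit, so the bar image of
  T_w is T_w plus strictly shorter terms.\<close>

lemma bT_triangular: "w \<in> W \<Longrightarrow> u \<in> W \<Longrightarrow> l w \<le> l u \<Longrightarrow> bT w u = (if u = w then 1 else 0)"
proof (induction "l w" arbitrary: w u rule: less_induct)
  case less
  show ?case
  proof (cases "w = id")
    case True then show ?thesis using bT_id by (simp add: Tb_def)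
  next
    case False
    then obtain i where i: "i \<in> S" "l w = Suc (l (gen i \<circ> w))" using left_descent_exists less by blast
    let ?w = "gen i \<circ> w"
    have gx: "?w \<in> W" using less i by simp
    have lt: "l ?w < l w" using i by simp
    have b: "bT w = Tsi i \<star> bT ?w" using bT_gen[OF i(1) gx] i by simp
    have "bT w u = L i (bT ?w) u - zt * bT ?w u" unfolding b using hm_Tsi[OF i(1)] Tinv(1)[OF inv_Wn[OF gx]] by simp
    moreover have "bT ?w u = 0"
    proof -
      have "l ?w \<le> l u" "u \<noteq> ?w" using lt less by auto
      then show ?thesis using less(1)[OF lt gx less(3)] by simp
    qed
    moreover have "bT ?w (gen i \<circ> u) = (if gen i \<circ> u = ?w then 1 else 0)"
    proof -
      have "l ?w \<le> l (gen i \<circ> u)" using len_gen_comp_cases[OF less(3) i(1)] i less(4) by (metis Suc_le_mono le_SucI)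
      then show ?thesis using less(1)[OF lt gx, of "gen i \<circ> u"] less(3) i by simp
    qed
    moreover have "gen i \<circ> u = ?w \<longleftrightarrow> u = w" by (metis gen_gen(2))
    ultimately show ?thesis by (simp add: L_apply)
  qed
qed

text \<open>Length replaces the Bruhat order; this weaker condition suffices for the triangularity
  arguments.\<close>

definition supp_le :: "perm \<Rightarrow> hk \<Rightarrow> bool" where
  "supp_le w c \<longleftrightarrow> (\<forall>u. c u \<noteq> 0 \<longrightarrow> u = w \<or> l u < l w)"

definition is_KL :: "perm \<Rightarrow> hk \<Rightarrow> bool" where
  "is_KL w c \<longleftrightarrow> hk c \<and> (\<forall>u. c u \<in> Aset) \<and> hbar n c = c \<and> (\<forall>u. c u - Tb w u \<in> negA)"

text \<open>By triangularity of \<open>bT\<close>, the coefficient at a longest element of the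
  support is fixed by the bar involution, and \<open>negA\<close> contains no such element except
  0.\<close>

lemma hbar_negA_0: assumes "hk d" "\<And>u. d u \<in> negA" "hbar n d = d" shows "d = (\<lambda>u. 0)"
proof (rule ccontr)
  assume "d \<noteq> (\<lambda>u. 0)"
  then obtain u where u: "d u \<noteq> 0" by (auto simp: fun_eq_iff)
  define M where "M = {u \<in> W. d u \<noteq> 0}"
  have "u \<in> M" using u assms(1) hkD M_def by auto
  then have "finite (l ` M)" "l ` M \<noteq> {}" unfolding M_def by auto
  then have "Max (l ` M) \<in> l ` M" by (rule Max_in)
  then obtain y where y: "y \<in> M" "l y = Max (l ` M)" by auto
  have le: "l w \<le> l y" if "w \<in> M" for w using that y \<open>finite (l ` M)\<close> by simp
  have "hbar n d y = (\<Sum>w\<in>W. barK (d w) * bT w y)" by (simp add: hbar_def)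
  also have "\<dots> = (\<Sum>w\<in>W. if w = y then barK (d y) else 0)"
  proof (rule sum.cong)
    fix w assume "w \<in> W"
    show "barK (d w) * bT w y = (if w = y then barK (d y) else 0)"
    proof (cases "w \<in> M")
      case True then show ?thesis using bT_triangular[OF \<open>w \<in> W\<close>, of y] le y M_def by auto
    next
      case False then show ?thesis using \<open>w \<in> W\<close> y M_def by auto
    qed
  qed simp
  also have "\<dots> = barK (d y)" using y M_def by simp
  finally have "barK (d y) = d y" using assms by simp
  then have "d y = 0" using negA_bar_0 assms(2) by blast
  then show False using y M_def by simp
qed

lemma is_KL_unique: assumes "is_KL w c" "is_KL w c'" shows "c = c'"
proof -
  let ?d = "\<lambda>u. c u + (-1) * c' u"
  have "?d = (\<lambda>u. 0)"
  proof (rule hbar_negA_0)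
    show "hk ?d" using assms unfolding is_KL_def by (intro hk_add hk_scale) auto
    show "?d u \<in> negA" for u
      using negA_diff[of "c u - Tb w u" "c' u - Tb w u"] assms unfolding is_KL_def by simp
    show "hbar n ?d = ?d" unfolding hbar_add hbar_scale using assms unfolding is_KL_def by (simp add: barK_minus)
  qed
  then show ?thesis by (simp add: fun_eq_iff)
qed

text \<open>The usual recursion: C'_s times the element of the shorter
  \<open>gen i \<circ> x\<close>, corrected by elements that also have s as a left descent. The
  eigenvector clause is part of the induction because T_s must act on every correction term by the
  same factor v.\<close>

lemma KL_exists: "w \<in> W \<Longrightarrow> \<exists>c. is_KL w c \<and> supp_le w c \<and> (\<forall>i\<in>S. l (gen i \<circ> w) < l w \<longrightarrow> L i c = (\<lambda>u. vK * c u))"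
proof (induction "l w" arbitrary: w rule: less_induct)
  case (less x)
  show ?case
  proof (cases "x = id")
    case True
    have "Tb id u \<in> Aset" for u by (auto simp: Tb_def)
    then have "is_KL id (Tb id)" unfolding is_KL_def using hbar_Tb[of id] bT_id hk_Tb[of id] by simp
    moreover have "supp_le id (Tb id)" by (auto simp: supp_le_def Tb_def)
    ultimately show ?thesis unfolding True by (intro exI[of _ "Tb id"]) auto
  next
    case False
    have step: "\<exists>c. is_KL x c \<and> supp_le x c \<and> L i c = (\<lambda>u. vK * c u)" if i: "i \<in> S" "l (gen i \<circ> x) < l x" for i
    proof -
      define w where "w = gen i \<circ> x"
      have w: "w \<in> W" and lt: "l w < l x" and xw: "x = gen i \<circ> w" using i less(2) w_def by auto
      have lx: "l x = Suc (l w)" using len_gen_comp_cases[OF less(2) i(1)] i w_def by (metis less_Suc_eq not_less_eq)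
      obtain c' where c': "is_KL w c'" "supp_le w c'" using less(1)[OF lt w] by blast
      have hk': "hk c'" and A': "\<And>u. c' u \<in> Aset" and b': "hbar n c' = c'" and N': "\<And>u. c' u - Tb w u \<in> negA"
        using c' unfolding is_KL_def by auto
      define U where "U = {u \<in> W. l (gen i \<circ> u) < l u \<and> l u < l w}"
      have "\<forall>u\<in>U. \<exists>c. is_KL u c \<and> supp_le u c \<and> L i c = (\<lambda>z. vK * c z)"
      proof
        fix u assume u: "u \<in> U"
        then have "l u < l x" "u \<in> W" "l (gen i \<circ> u) < l u" using lt unfolding U_def by auto
        then show "\<exists>c. is_KL u c \<and> supp_le u c \<and> L i c = (\<lambda>z. vK * c z)" using less(1)[of u] i(1) by blast
      qed
      then obtain C where C: "\<And>u. u \<in> U \<Longrightarrow> is_KL u (C u)" "\<And>u. u \<in> U \<Longrightarrow> supp_le u (C u)"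
        "\<And>u. u \<in> U \<Longrightarrow> L i (C u) = (\<lambda>z. vK * C u z)" by metis
      have c'U: "c' u \<in> negA" if "u \<noteq> w" for u using N'[of u] that by (auto simp: Tb_def)
      have "\<forall>u\<in>U. \<exists>m. vK * c' u - of_int m \<in> negA"
      proof
        fix u assume "u \<in> U"
        then have "u \<noteq> w" unfolding U_def by auto
        then show "\<exists>m. vK * c' u - of_int m \<in> negA" by (rule negA_v_mult[OF c'U])
      qed
      then obtain m where m: "\<And>u. u \<in> U \<Longrightarrow> vK * c' u - of_int (m u) \<in> negA" by metis
      \<comment> \<open>Multiplication by C'_s, which is T_s + 1/v.\<close>
      define h where "h = (\<lambda>u. L i c' u + inverse vK * c' u)"
      \<comment> \<open>At u in \<open>U\<close> the coefficient of \<open>h\<close> leaves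
        \<open>negA\<close> by the integer \<open>m u\<close>, the coefficient of 1/v in
        \<open>c' u\<close>; subtracting \<open>m u\<close> copies of \<open>C u\<close> removes
        it.\<close>
      define s where "s = (\<lambda>y. \<Sum>u\<in>U. of_int (m u) * C u y)"
      define c where "c = (\<lambda>y. h y + (-1) * s y)"
      have finU: "finite U" unfolding U_def by simp
      have hkh: "hk h" unfolding h_def by (intro hk_add hk_scale hk_L i hk')
      have hks: "hk s" unfolding s_def by (rule hk_lc) (use C in \<open>auto simp: is_KL_def\<close>)
      have hkc: "hk c" unfolding c_def by (intro hk_add hk_scale hkh hks)
      have hbarh: "hbar n h = h"
      proof -
        have "hbar n h = (\<lambda>u. (L i c' u - zt * c' u) + vK * c' u)"
          unfolding h_def hbar_add hbar_scale hbar_L[OF i(1) hk'] b' hm_Tsi[OF i(1) hk'] by (simp add: barK_inverse)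
        then show ?thesis unfolding h_def by (simp add: fun_eq_iff algebra_simps)
      qed
      have hbars: "hbar n s = s"
        unfolding s_def hbar_lc using C by (auto simp: is_KL_def intro!: sum.cong)
      have hbarc: "hbar n c = c" unfolding c_def hbar_add hbar_scale hbarh hbars by (simp add: barK_minus)
      have Ac: "c u \<in> Aset" for u
      proof -
        have "L i c' u \<in> Aset" unfolding L_apply using A' by (auto intro!: Aset_add Aset_mult Aset_diff)
        moreover have "s u \<in> Aset" unfolding s_def using C by (intro Aset_sum Aset_mult) (auto simp: is_KL_def)
        ultimately show ?thesis unfolding c_def h_def using A' by (intro Aset_add Aset_mult Aset_minus) auto
      qed
      have sN: "s y - (if y \<in> U then of_int (m y) else 0) \<in> negA" for y
      proof -
        have "s y - (if y \<in> U then of_int (m y) else 0) = (\<Sum>u\<in>U. of_int (m u) * (C u y - Tb u y))"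
          unfolding s_def right_diff_distrib sum_subtractf using finU by (simp add: Tb_def if_distrib cong: if_cong)
        also have "\<dots> \<in> negA" using C by (intro negA_sum negA_of_int_mult) (auto simp: is_KL_def)
        finally show ?thesis .
      qed
      have hN: "h y - Tb x y - (if y \<in> U then of_int (m y) else 0) \<in> negA" if y: "y \<in> W" for y
      proof (cases "l (gen i \<circ> y) < l y")
        case True
        have hy: "h y = c' (gen i \<circ> y) + vK * c' y" unfolding h_def L_apply using True by (simp add: algebra_simps)
        have "y \<noteq> w" using True lx xw by auto
        have "gen i \<circ> y = w \<longleftrightarrow> y = x" using xw by (metis gen_gen(2))
        then have "c' (gen i \<circ> y) - Tb x y \<in> negA" using N'[of "gen i \<circ> y"] by (auto simp: Tb_def)
        moreover have "vK * c' y - (if y \<in> U then of_int (m y) else 0) \<in> negA"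
        proof (cases "y \<in> U")
          case True then show ?thesis using m by simp
        next
          case False
          then have "\<not> l y < l w" using True y U_def by auto
          then have "c' y = 0" using c'(2) \<open>y \<noteq> w\<close> unfolding supp_le_def by blast
          then show ?thesis using False by simp
        qed
        ultimately have "(c' (gen i \<circ> y) - Tb x y) + (vK * c' y - (if y \<in> U then of_int (m y) else 0)) \<in> negA" by (rule negA_add)
        then show ?thesis unfolding hy by (simp add: algebra_simps)
      next
        case False
        have hy: "h y = c' (gen i \<circ> y) + inverse vK * c' y" unfolding h_def L_apply using False by simp
        have "y \<noteq> x" using False i by auto
        then have "gen i \<circ> y \<noteq> w" using xw by (metis gen_gen(2))
        then have "c' (gen i \<circ> y) \<in> negA" by (rule c'U)
        moreover have "inverse vK * c' y \<in> negA"
        proof (cases "y = w")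
          case True
          then have "c' y = (c' w - Tb w w) + 1" by (simp add: Tb_def)
          then have "inverse vK * c' y = inverse vK * (c' w - Tb w w) + inverse vK" by (simp only: distrib_left mult_1_right)
          moreover have "inverse vK * (c' w - Tb w w) + inverse vK \<in> negA" by (intro negA_add negA_inv_v_mult N' negA_inv_v)
          ultimately show ?thesis by (simp only:)
        qed (use c'U negA_inv_v_mult in blast)
        ultimately have "h y \<in> negA" unfolding hy by (rule negA_add)
        moreover have "y \<notin> U" using False U_def by auto
        ultimately show ?thesis using \<open>y \<noteq> x\<close> by (auto simp: Tb_def)
      qed
      have cN: "c y - Tb x y \<in> negA" for y
      proof (cases "y \<in> W")
        case True
        have "(h y - Tb x y - (if y \<in> U then of_int (m y) else 0)) - (s y - (if y \<in> U then of_int (m y) else 0)) \<in> negA"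
          by (rule negA_diff[OF hN[OF True] sN])
        then show ?thesis by (simp add: c_def algebra_simps)
      next
        case False
        then have "c y = 0" "Tb x y = 0" using hkD[OF hkc] less(2) by (auto simp: Tb_def)
        then show ?thesis by simp
      qed
      have supp: "supp_le x c" unfolding supp_le_def
      proof (intro allI impI)
        fix y assume cy: "c y \<noteq> 0"
        then have y: "y \<in> W" using hkD[OF hkc] by blast
        show "y = x \<or> l y < l x"
        proof (rule ccontr)
          assume a: "\<not> (y = x \<or> l y < l x)"
          have z: "c' u = 0" if "u \<noteq> w" "\<not> l u < l w" for u using c'(2) that unfolding supp_le_def by blast
          have "c' y = 0" using z[of y] a lx by auto
          moreover have "c' (gen i \<circ> y) = 0"
          proof (rule z)
            show "gen i \<circ> y \<noteq> w" using a xw by (metis gen_gen(2))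
            show "\<not> l (gen i \<circ> y) < l w" using a lx len_gen_comp_cases[OF y i(1)] by (metis Suc_less_eq less_SucI)
          qed
          moreover have "s y = 0" unfolding s_def
          proof (rule sum.neutral, intro ballI)
            fix u assume u: "u \<in> U"
            have "y \<noteq> u" "\<not> l y < l u" using a lx u U_def by auto
            then show "of_int (m u) * C u y = 0" using C(2)[OF u] unfolding supp_le_def by auto
          qed
          ultimately show False using cy unfolding c_def h_def L_apply by (simp split: if_splits)
        qed
      qed
      have Lh: "L i h = (\<lambda>u. vK * h u)"
      proof -
        have "L i h = (\<lambda>u. L i (L i c') u + inverse vK * L i c' u)"
          unfolding h_def by (rule L_add_scale)
        then show ?thesis using L_L_hk[OF i(1) hk'] unfolding h_def by (simp add: fun_eq_iff algebra_simps)
      qed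
      have Ls: "L i s = (\<lambda>u. vK * s u)"
      proof -
        have "L i s = (\<lambda>y. \<Sum>u\<in>U. of_int (m u) * L i (C u) y)" unfolding s_def by (rule lop_lc[OF lop_L[OF i(1)]])
        also have "\<dots> = (\<lambda>u. vK * s u)" unfolding s_def sum_distrib_left using C(3) by (auto simp: mult_ac intro!: sum.cong)
        finally show ?thesis .
      qed
      have Lc: "L i c = (\<lambda>u. vK * c u)"
      proof -
        have "L i c = (\<lambda>u. L i h u + (-1) * L i s u)"
          unfolding c_def by (rule L_add_scale)
        then show ?thesis unfolding Lh Ls c_def by (simp add: fun_eq_iff algebra_simps)
      qed
      show ?thesis using hkc Ac hbarc cN supp Lc unfolding is_KL_def by blast
    qed
    \<comment> \<open>Existence uses one descent. By uniqueness every other descent leads to the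
      same element, which is therefore an eigenvector for all of them.\<close>
    obtain i0 where "i0 \<in> S" "l x = Suc (l (gen i0 \<circ> x))" using left_descent_exists False less by blast
    then obtain c where c: "is_KL x c" "supp_le x c" using step[of i0] by auto
    have "L i c = (\<lambda>u. vK * c u)" if "i \<in> S" "l (gen i \<circ> x) < l x" for i
      using step[OF that] is_KL_unique[OF c(1)] by blast
    then show ?thesis using c by blast
  qed
qed

abbreviation "C' w \<equiv> KLp n w"

lemma KLp: assumes "w \<in> W"
  shows "is_KL w (C' w)" "supp_le w (C' w)" "\<And>i. i \<in> S \<Longrightarrow> l (gen i \<circ> w) < l w \<Longrightarrow> L i (C' w) = (\<lambda>u. vK * C' w u)"
    "\<And>c. is_KL w c \<Longrightarrow> c = C' w"
proof -
  obtain c where c: "is_KL w c" "supp_le w c" "\<forall>i\<in>S. l (gen i \<circ> w) < l w \<longrightarrow> L i c = (\<lambda>u. vK * c u)"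
    using KL_exists[OF assms] by blast
  have "C' w = c" unfolding KLp_def is_KL_def[symmetric]
    by (rule the_equality) (use c is_KL_unique in auto)
  then show "is_KL w (C' w)" "supp_le w (C' w)" "\<And>i. i \<in> S \<Longrightarrow> l (gen i \<circ> w) < l w \<Longrightarrow> L i (C' w) = (\<lambda>u. vK * C' w u)"
    "\<And>c. is_KL w c \<Longrightarrow> c = C' w" using c is_KL_unique by auto
qed

lemma KLp_hk: "w \<in> W \<Longrightarrow> hk (C' w)" and KLp_A: "w \<in> W \<Longrightarrow> C' w u \<in> Aset"
  and KLp_bar: "w \<in> W \<Longrightarrow> hbar n (C' w) = C' w" and KLp_negA: "w \<in> W \<Longrightarrow> C' w u - Tb w u \<in> negA"
  using KLp(1) unfolding is_KL_def by auto

lemma star_KLp: assumes "w \<in> W" shows "star (C' w) = C' (ivp w)"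
proof (rule KLp(4))
  show "is_KL (ivp w) (star (C' w))" unfolding is_KL_def
  proof (intro conjI allI)
    show "star (C' w) u \<in> Aset" for u using KLp_A[OF assms] by (auto simp: star_def)
    show "hbar n (star (C' w)) = star (C' w)" using hbar_star[OF KLp_hk[OF assms]] KLp_bar[OF assms] by simp
    fix u
    show "star (C' w) u - Tb (ivp w) u \<in> negA"
    proof (cases "u \<in> W")
      case True
      then have "Tb (ivp w) u = Tb w (ivp u)" using assms by (auto simp: Tb_def)
      then show ?thesis using KLp_negA[OF assms, of "ivp u"] True by (simp add: star_def)
    next
      case False then have "star (C' w) u = 0" "Tb (ivp w) u = 0" using assms by (auto simp: star_def Tb_def)
      then show ?thesis by simp
    qed
  qed simp
qed (use assms in simp)

lemma KLp_diag: assumes "w \<in> W" shows "C' w w = 1"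
proof -
  have "hbar n (C' w) w = (\<Sum>u\<in>W. if u = w then barK (C' w w) else 0)"
    unfolding hbar_def
  proof (rule sum.cong)
    fix u assume u: "u \<in> W"
    show "barK (C' w u) * bT u w = (if u = w then barK (C' w w) else 0)"
    proof (cases "C' w u = 0")
      case False
      then have "l u \<le> l w" using KLp(2)[OF assms] unfolding supp_le_def by (metis less_imp_le order_refl)
      then show ?thesis using bT_triangular[OF u assms] by auto
    qed auto
  qed simp
  then have "barK (C' w w) = C' w w" using KLp_bar[OF assms] assms by simp
  then have "barK (C' w w - 1) = C' w w - 1" by (simp add: barK_diff)
  moreover have "C' w w - 1 \<in> negA" using KLp_negA[OF assms, of w] by (simp add: Tb_def)
  ultimately show ?thesis using negA_bar_0[of "C' w w - 1"] by simp
qed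

text \<open>A unitriangular family over A, so that coordinates of elements with coefficients in A
  stay in A. Both Kazhdan-Lusztig bases are instances.\<close>

definition unitri :: "(perm \<Rightarrow> hk) \<Rightarrow> bool" where
  "unitri B \<longleftrightarrow> (\<forall>z\<in>W. hk (B z) \<and> B z z = 1 \<and> supp_le z (B z) \<and> (\<forall>u. B z u \<in> Aset))"

definition lw :: "(perm \<Rightarrow> hk) \<Rightarrow> (perm \<Rightarrow> K) \<Rightarrow> hk" where
  "lw B f = (\<lambda>u. \<Sum>z\<in>W. f z * B z u)"

lemma hk_lw: "unitri B \<Longrightarrow> hk (lw B f)" unfolding lw_def unitri_def by (intro hk_lc) auto

lemma unitri_0: assumes "unitri B" "lw B f = (\<lambda>u. 0)" "z \<in> W" shows "f z = 0"
proof (rule ccontr)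
  assume z: "f z \<noteq> 0"
  define M where "M = {u \<in> W. f u \<noteq> 0}"
  have "finite (l ` M)" "l ` M \<noteq> {}" using z assms(3) unfolding M_def by auto
  then have "Max (l ` M) \<in> l ` M" by (rule Max_in)
  then obtain y where y: "y \<in> M" "l y = Max (l ` M)" by auto
  have le: "l w \<le> l y" if "w \<in> M" for w using that y \<open>finite (l ` M)\<close> by simp
  have "lw B f y = (\<Sum>u\<in>W. if u = y then f y else 0)" unfolding lw_def
  proof (rule sum.cong)
    fix u assume u: "u \<in> W"
    show "f u * B u y = (if u = y then f y else 0)"
    proof (cases "u \<in> M \<and> u \<noteq> y")
      case True
      then have "\<not> l y < l u" using le[of u] by auto
      then have "B u y = 0" using assms(1) u True unfolding unitri_def supp_le_def by blast
      then show ?thesis using True by simp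
    next
      case False then show ?thesis using u assms(1) unfolding unitri_def M_def by auto
    qed
  qed simp
  then show False using assms(2) y M_def by simp
qed

lemma unitri_unique: assumes "unitri B" "lw B f = lw B g" "z \<in> W" shows "f z = g z"
proof -
  have "lw B (\<lambda>z. f z - g z) = (\<lambda>u. 0)" using assms(2) unfolding lw_def
    by (simp add: left_diff_distrib sum_subtractf fun_eq_iff)
  then show ?thesis using unitri_0[OF assms(1) _ assms(3)] by fastforce
qed

lemma unitri_Tb: assumes "unitri B" shows "w \<in> W \<Longrightarrow> \<exists>f. Tb w = lw B f \<and> (\<forall>z. f z \<in> Aset)"
proof (induction "l w" arbitrary: w rule: less_induct)
  case (less w)
  define V where "V = {u \<in> W. l u < l w}"
  have "\<forall>u\<in>V. \<exists>f. Tb u = lw B f \<and> (\<forall>z. f z \<in> Aset)" using less unfolding V_def by blast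
  then obtain F where F: "\<And>u. u \<in> V \<Longrightarrow> Tb u = lw B (F u)" "\<And>u z. u \<in> V \<Longrightarrow> F u z \<in> Aset" by metis
  define f where "f = (\<lambda>z. (if z = w then 1 else 0) - (\<Sum>u\<in>V. B w u * F u z))"
  have Bw: "hk (B w)" "B w w = 1" "supp_le w (B w)" "\<And>u. B w u \<in> Aset" using assms less(2) unfolding unitri_def by auto
  have "Tb w y = lw B f y" for y
  proof -
    have "lw B f y = (\<Sum>z\<in>W. (if z = w then 1 else 0) * B z y) - (\<Sum>z\<in>W. \<Sum>u\<in>V. B w u * (F u z * B z y))"
      unfolding lw_def f_def by (simp only: left_diff_distrib sum_subtractf sum_distrib_right mult.assoc)
    also have "(\<Sum>z\<in>W. (if z = w then 1 else 0) * B z y) = B w y" using less(2) by (simp add: if_distrib[of "\<lambda>c. c * _"] cong: if_cong)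
    also have "(\<Sum>z\<in>W. \<Sum>u\<in>V. B w u * (F u z * B z y)) = (\<Sum>u\<in>V. B w u * lw B (F u) y)"
      unfolding lw_def sum_distrib_left by (rule sum.swap)
    also have "\<dots> = (\<Sum>u\<in>V. B w u * Tb u y)" using F(1) by simp
    also have "\<dots> = (if y \<in> V then B w y else 0)" unfolding V_def by (simp add: Tb_def if_distrib cong: if_cong)
    finally have "lw B f y = B w y - (if y \<in> V then B w y else 0)" .
    moreover have "B w y = 0" if "y \<notin> V" "y \<noteq> w"
      using that Bw(1,3) hkD[OF Bw(1)] unfolding V_def supp_le_def by blast
    moreover have "w \<notin> V" by (simp add: V_def)
    ultimately show ?thesis using Bw(2) by (auto simp: Tb_def)
  qed
  moreover have "f z \<in> Aset" for z unfolding f_def using F(2) Bw(4) by (intro Aset_diff Aset_sum Aset_mult) auto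
  ultimately show ?case by blast
qed

lemma unitri_coords: assumes "unitri B" "hk h"
  obtains f where "h = lw B f" "(\<And>u. h u \<in> Aset) \<Longrightarrow> (\<And>z. f z \<in> Aset)"
proof -
  obtain F where F: "\<And>u. u \<in> W \<Longrightarrow> Tb u = lw B (F u)" "\<And>u z. u \<in> W \<Longrightarrow> F u z \<in> Aset"
    using unitri_Tb[OF assms(1)] by metis
  define f where "f = (\<lambda>z. \<Sum>u\<in>W. h u * F u z)"
  have "h y = lw B f y" for y
  proof -
    have "lw B f y = (\<Sum>z\<in>W. \<Sum>u\<in>W. h u * (F u z * B z y))" by (simp add: lw_def f_def sum_distrib_right mult.assoc)
    also have "\<dots> = (\<Sum>u\<in>W. h u * lw B (F u) y)" unfolding lw_def sum_distrib_left by (rule sum.swap)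
    also have "\<dots> = (\<Sum>u\<in>W. h u * Tb u y)" using F(1) by simp
    also have "\<dots> = h y" by (rule fun_cong[OF hk_expand[OF assms(2)], symmetric])
    finally show ?thesis by simp
  qed
  then have "h = lw B f" by (rule ext)
  moreover have "(\<And>u. h u \<in> Aset) \<Longrightarrow> (\<And>z. f z \<in> Aset)" unfolding f_def using F(2) by (intro Aset_sum Aset_mult) auto
  ultimately show ?thesis using that by blast
qed

lemma unitri_KLp: "unitri C'"
  unfolding unitri_def using KLp_hk KLp_diag KLp(2) KLp_A by blast

lemma hcoef: assumes "x \<in> W" "y \<in> W"
  shows "C' x \<star> C' y = lw C' (hcoef n x y)" "z \<notin> W \<Longrightarrow> hcoef n x y z = 0"
proof -
  obtain f where f: "C' x \<star> C' y = lw C' f" using unitri_coords[OF unitri_KLp hk_hm[OF KLp_hk[OF assms(2)]]] by metis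
  define g where "g = (\<lambda>z. if z \<in> W then f z else 0)"
  have g: "C' x \<star> C' y = lw C' g" unfolding f lw_def g_def by (rule ext, rule sum.cong) auto
  have "hcoef n x y = g" unfolding hcoef_def lw_def[symmetric]
  proof (rule the_equality)
    show "(\<forall>z. z \<notin> W \<longrightarrow> g z = 0) \<and> C' x \<star> C' y = lw C' g" using g by (auto simp: g_def)
    fix f' assume f': "(\<forall>z. z \<notin> W \<longrightarrow> f' z = 0) \<and> C' x \<star> C' y = lw C' f'"
    have "f' z = g z" for z
      using unitri_unique[OF unitri_KLp, of f' g z] f' g by (cases "z \<in> W") (auto simp: g_def)
    then show "f' = g" by (rule ext)
  qed
  then show "C' x \<star> C' y = lw C' (hcoef n x y)" "z \<notin> W \<Longrightarrow> hcoef n x y z = 0" using g by (auto simp: g_def)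
qed

lemma hcoef_bar: assumes "x \<in> W" "y \<in> W" "z \<in> W" shows "barK (hcoef n x y z) = hcoef n x y z"
proof -
  have "lw C' (hcoef n x y) = C' x \<star> C' y" by (rule hcoef(1)[OF assms(1,2), symmetric])
  also have "\<dots> = hbar n (C' x \<star> C' y)"
    using hbar_hm[OF KLp_hk[OF assms(1)] KLp_hk[OF assms(2)]] KLp_bar assms by simp
  also have "\<dots> = lw C' (\<lambda>z. barK (hcoef n x y z))"
    unfolding hcoef(1)[OF assms(1,2)] lw_def hbar_lc using KLp_bar by (auto intro!: sum.cong)
  finally show ?thesis using unitri_unique[OF unitri_KLp _ assms(3)] by metis
qed

definition sg :: "perm \<Rightarrow> K" where "sg w = (-1) ^ l w"

lemma sg_sq [simp]: "sg w * sg w = 1" by (simp add: sg_def power_mult_distrib[symmetric])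
lemma sg_sq' [simp]: "sg w * (sg w * c) = c" by (simp add: mult.assoc[symmetric])
lemma sg_nz [simp]: "sg w \<noteq> 0" by (simp add: sg_def)
lemma sg_bar [simp]: "barK (sg w) = sg w" by (simp add: sg_def barK_power barK_minus)
lemma sg_A: "sg w \<in> Aset" unfolding sg_def by (intro Aset_power Aset_minus Aset_1)
lemma sg_id [simp]: "sg id = 1" by (simp add: sg_def)
lemma sg_gen: assumes "i \<in> S" "w \<in> W" shows "sg (gen i \<circ> w) = - sg w"
  by (cases rule: len_gen_comp_cases[OF assms(2,1)]) (simp_all add: sg_def)

text \<open>The semilinear ring automorphism sending the generator T_s to -T_s; it exchanges the bases C and C' up to sign.\<close>
definition jj :: "hk \<Rightarrow> hk" where "jj h = (\<lambda>w. sg w * barK (h w))"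

lemma hk_jj: "hk h \<Longrightarrow> hk (jj h)" by (simp add: hk_on_def jj_def)

lemma jj_L: assumes "i \<in> S" "hk h" shows "jj (L i h) = (\<lambda>u. - L i (jj h) u)"
proof (rule hk_eqI)
  fix u assume u: "u \<in> W"
  show "jj (L i h) u = - L i (jj h) u"
    using sg_gen[OF assms(1) u] by (auto simp: jj_def L_apply barK_add barK_mult barK_diff barK_inverse algebra_simps)
next
  show "hk (jj (L i h))" by (intro hk_jj hk_L assms)
  have "hk (\<lambda>u. (-1) * L i (jj h) u)" by (intro hk_scale hk_jj hk_L assms)
  then show "hk (\<lambda>u. - L i (jj h) u)" by simp
qed

lemma jj_lc: "jj (\<lambda>u. \<Sum>i\<in>I. c i * b i u) = (\<lambda>u. \<Sum>i\<in>I. barK (c i) * jj (b i) u)"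
  by (simp add: jj_def barK_sum barK_mult sum_distrib_left mult_ac)
lemma jj_hm: assumes "hk a" "hk b" shows "jj (a \<star> b) = jj a \<star> jj b"
proof -
  have *: "jj (Tb x \<star> b) = (\<lambda>u. sg x * (Tb x \<star> jj b) u)" if "x \<in> W" for x
    using that
  proof (induction "l x" arbitrary: x rule: less_induct)
    case less
    show ?case
    proof (cases "x = id")
      case True
      have "sg x = 1" unfolding True by simp
      then show ?thesis using assms hk_jj True by (metis (no_types) hm_1_left mult_1)
    next
      case False
      then obtain i where i: "i \<in> S" "l x = Suc (l (gen i \<circ> x))" using left_descent_exists less by blast
      have gx: "gen i \<circ> x \<in> W" using less i by simp
      have lt: "l (gen i \<circ> x) < l x" using i by simp
      have t: "Tb x = Tb (gen i) \<star> Tb (gen i \<circ> x)" using Tb_mult_gen[OF i(1) gx] i by simp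
      have k: "hk (Tb (gen i))" "hk (Tb (gen i \<circ> x))" using i gx by auto
      have e: "Tb x \<star> b = L i (Tb (gen i \<circ> x) \<star> b)" if "hk b" for b
      proof -
        have "Tb x \<star> b = Tb (gen i) \<star> (Tb (gen i \<circ> x) \<star> b)" unfolding t using k that by (intro hm_assoc)
        also have "\<dots> = L i (Tb (gen i \<circ> x) \<star> b)" using i that by (intro hm_gen hk_hm)
        finally show ?thesis .
      qed
      have "jj (Tb x \<star> b) = (\<lambda>u. - L i (jj (Tb (gen i \<circ> x) \<star> b)) u)"
        unfolding e[OF assms(2)] by (intro jj_L i hk_hm assms)
      also have "\<dots> = (\<lambda>u. - (sg (gen i \<circ> x) * L i (Tb (gen i \<circ> x) \<star> jj b) u))"
        unfolding less(1)[OF lt gx] L_scale ..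
      also have "\<dots> = (\<lambda>u. sg x * (Tb x \<star> jj b) u)"
        unfolding e[OF hk_jj[OF assms(2)]] sg_gen[OF i(1) less(2)] by simp
      finally show ?thesis .
    qed
  qed
  have "a \<star> b = (\<lambda>u. \<Sum>x\<in>W. a x * (Tb x \<star> b) u)"
    by (subst hk_expand[OF assms(1)]) (rule hm_lc_left)
  then have "jj (a \<star> b) = (\<lambda>u. \<Sum>x\<in>W. barK (a x) * (sg x * (Tb x \<star> jj b) u))"
    using * by (simp add: jj_lc)
  also have "\<dots> = (\<lambda>u. \<Sum>x\<in>W. jj a x * (Tb x \<star> jj b) u)" by (simp add: jj_def mult_ac)
  also have "\<dots> = jj a \<star> jj b" using hm_lc_left[where I=W and c="jj a" and a=Tb and b="jj b"] hk_expand[OF hk_jj[OF assms(1)]] by simp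
  finally show ?thesis .
qed

text \<open>The basis C of the paper, congruent to T modulo v; its structure constants are those of C' up to sign.\<close>
definition CC :: "perm \<Rightarrow> hk" where "CC w = (\<lambda>u. sg w * jj (C' w) u)"

lemma hk_CC: "w \<in> W \<Longrightarrow> hk (CC w)" unfolding CC_def by (intro hk_scale hk_jj KLp_hk)
lemma CC_A: "w \<in> W \<Longrightarrow> CC w u \<in> Aset" unfolding CC_def jj_def by (intro Aset_mult sg_A Aset_bar KLp_A)

lemma unitri_CC: "unitri CC"
  unfolding unitri_def
proof (intro ballI conjI allI)
  fix z assume z: "z \<in> W"
  show "CC z z = 1" using KLp_diag[OF z] by (simp add: CC_def jj_def)
  show "supp_le z (CC z)" using KLp(2)[OF z] by (auto simp: supp_le_def CC_def jj_def)
qed (simp_all add: hk_CC CC_A)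

lemma CC_const: assumes "w \<in> W" shows "const0 (CC w u) (if u = w then 1 else 0)"
proof (cases "u = w")
  case True then show ?thesis using unitri_CC assms unfolding unitri_def by simp
next
  case False
  have e: "C' w u \<in> negA" using KLp_negA[OF assms, of u] False by (simp add: Tb_def)
  have "const0 (sg w * sg u) ((-1) ^ l w * (-1) ^ l u)"
    unfolding sg_def by (intro const0_mult const0_power const0_minus[of 1 1, simplified] const0_1)
  from const0_mult[OF this const0_bar_negA[OF e]] show ?thesis using False by (simp add: CC_def jj_def mult.assoc)
qed

lemma CC_mult: assumes "x \<in> W" "y \<in> W"
  shows "CC x \<star> CC y = lw CC (\<lambda>z. sg x * sg y * sg z * hcoef n x y z)"
proof -
  have "CC x \<star> CC y = (\<lambda>u. sg x * (sg y * jj (C' x \<star> C' y) u))"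
    unfolding CC_def hm_scale_left hm_scale_right jj_hm[OF KLp_hk[OF assms(1)] KLp_hk[OF assms(2)]] ..
  also have "jj (C' x \<star> C' y) = (\<lambda>u. \<Sum>z\<in>W. hcoef n x y z * jj (C' z) u)"
    unfolding hcoef(1)[OF assms] lw_def jj_lc using hcoef_bar[OF assms] by (auto intro!: sum.cong)
  also have "(\<lambda>u. sg x * (sg y * (\<Sum>z\<in>W. hcoef n x y z * jj (C' z) u))) = lw CC (\<lambda>z. sg x * sg y * sg z * hcoef n x y z)"
    unfolding lw_def CC_def sum_distrib_left by (rule ext, rule sum.cong) (auto simp: mult_ac)
  finally show ?thesis .
qed

text \<open>Under \<open>jj\<close> the eigenvalue v of C' turns into -1/v: for C, descents are sign
  eigenvalues, as for the antisymmetrizers.\<close>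

lemma L_CC: assumes "w \<in> W" "i \<in> S" "l (gen i \<circ> w) < l w" shows "L i (CC w) = (\<lambda>u. (- inverse vK) * CC w u)"
proof -
  have "L i (CC w) = (\<lambda>u. sg w * L i (jj (C' w)) u)" unfolding CC_def by (rule L_scale)
  also have "L i (jj (C' w)) = (\<lambda>u. - jj (L i (C' w)) u)" using jj_L[OF assms(2) KLp_hk[OF assms(1)]] by (simp add: fun_eq_iff)
  also have "jj (L i (C' w)) = (\<lambda>u. inverse vK * jj (C' w) u)"
    unfolding KLp(3)[OF assms] by (auto simp: jj_def barK_mult)
  finally show ?thesis by (simp add: CC_def fun_eq_iff mult_ac)
qed

lemma star_CC: assumes "w \<in> W" shows "star (CC w) = CC (ivp w)"
  using star_KLp[OF assms] assms by (auto simp: CC_def jj_def star_def sg_def len_inv fun_eq_iff split: if_splits)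

lemma R_star: "i \<in> S \<Longrightarrow> hk h \<Longrightarrow> R i h = star (L i (star h))" using star_L[of i "star h"] by simp

lemma R_CC: assumes "w \<in> W" "i \<in> S" "l (w \<circ> gen i) < l w" shows "R i (CC w) = (\<lambda>u. (- inverse vK) * CC w u)"
proof -
  have "l (gen i \<circ> ivp w) < l (ivp w)" using assms by (simp add: len_gen_comp_inv len_inv)
  then have "R i (CC w) = star (\<lambda>u. (- inverse vK) * CC (ivp w) u)"
    using L_CC[of "ivp w" i] assms R_star[OF assms(2) hk_CC[OF assms(1)]] star_CC[OF assms(1)] by simp
  also have "\<dots> = (\<lambda>u. (- inverse vK) * star (CC (ivp w)) u)" by (auto simp: star_def)
  finally show ?thesis using star_CC[of "ivp w"] assms by simp
qed

text \<open>Modulo v the elements \<open>CC z\<close> are the T_z, so coordinates in both bases have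
  the same leading terms. What needs proof is that the coordinates have no pole when the
  coefficients have none.\<close>

lemma coord_const:
  assumes "\<And>w. w \<in> W \<Longrightarrow> const0 (lw CC g w) (r w)" "z \<in> W"
  shows "const0 (g z) (r z)"
proof (cases "\<exists>w\<in>W. g w \<noteq> 0")
  case False
  then have "g z = 0" "lw CC g z = 0" using assms(2) by (auto simp: lw_def)
  then show ?thesis using assms(1)[OF assms(2)] by simp
next
  case True
  then obtain k c where kc: "\<And>w. w \<in> W \<Longrightarrow> const0 (vK powi k * g w) (c w)" "\<exists>w\<in>W. c w \<noteq> 0"
    using const0_scale_family[OF finite_Wn, of n g] by metis
  have a: "const0 (vK powi k * lw CC g w) (c w)" if "w \<in> W" for w
  proof -
    have "vK powi k * lw CC g w = (\<Sum>z\<in>W. (vK powi k * g z) * CC z w)" by (simp add: lw_def sum_distrib_left mult_ac)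
    moreover have "const0 (\<Sum>z\<in>W. (vK powi k * g z) * CC z w) (\<Sum>z\<in>W. c z * (if w = z then 1 else 0))"
      by (intro const0_sum const0_mult kc CC_const)
    moreover have "(\<Sum>z\<in>W. c z * (if w = z then 1 else 0)) = c w" using that by (simp add: if_distrib cong: if_cong)
    ultimately show ?thesis by simp
  qed
  \<comment> \<open>A positive \<open>k\<close> would mean a pole among the coordinates; then the
    rescaled leading terms, being those of a regular element multiplied by a positive power of v,
    would all vanish.\<close>
  have "k \<le> 0"
  proof (rule ccontr)
    assume "\<not> k \<le> 0"
    then have "const0 (vK powi k * lw CC g w) 0" if "w \<in> W" for w using const0_zero_mult_powi[OF assms(1)[OF that], of k] by simp
    then have "c w = 0" if "w \<in> W" for w using a that const0_unique by blast
    then show False using kc(2) by blast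
  qed
  have g: "g w = vK powi (- k) * (vK powi k * g w)" for w by (simp add: power_int_minus)
  have "\<exists>c. const0 (g w) c" if "w \<in> W" for w
  proof -
    have "const0 (vK powi (- k) * (vK powi k * g w)) ((if - k = 0 then 1 else 0) * c w)"
      using \<open>k \<le> 0\<close> by (intro const0_mult const0_powi_v kc that) simp
    then show ?thesis unfolding g[of w, symmetric] by blast
  qed
  then obtain e where e: "\<And>w. w \<in> W \<Longrightarrow> const0 (g w) (e w)" by metis
  have "const0 (lw CC g z) (\<Sum>y\<in>W. e y * (if z = y then 1 else 0))" unfolding lw_def
    by (intro const0_sum const0_mult e CC_const)
  moreover have "(\<Sum>y\<in>W. e y * (if z = y then 1 else 0)) = e z" using assms(2) by (simp add: if_distrib cong: if_cong)
  ultimately have "e z = r z" using assms const0_unique by metis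
  then show ?thesis using e[OF assms(2)] by simp
qed

end

section \<open>Parabolic subgroups\<close>

text \<open>The recursion of \<open>young\<close>, indexed by the set of generators instead of a
  shape, so that column groups are covered without forming the conjugate partition as a
  list.\<close>

inductive_set WJ :: "nat set \<Rightarrow> perm set" for J where
  WJ_id: "id \<in> WJ J"
| WJ_step: "w \<in> WJ J \<Longrightarrow> k \<in> J \<Longrightarrow> gen k \<circ> w \<in> WJ J"

lemma WJ_comp: "u \<in> WJ J \<Longrightarrow> w \<in> WJ J \<Longrightarrow> u \<circ> w \<in> WJ J"
proof (induction u rule: WJ.induct)
  case WJ_id then show ?case by simp
next
  case (WJ_step u k)
  have "u \<circ> w \<in> WJ J" by (rule WJ_step.IH[OF WJ_step.prems])
  then have "gen k \<circ> (u \<circ> w) \<in> WJ J" by (rule WJ.WJ_step[OF _ WJ_step.hyps(2)])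
  then show ?case by (simp only: comp_assoc)
qed

lemma WJ_gen: "k \<in> J \<Longrightarrow> gen k \<in> WJ J" using WJ_step[OF WJ_id, of k J] by simp

lemma WJ_comp_gen_iff: assumes "k \<in> J" shows "u \<circ> gen k \<in> WJ J \<longleftrightarrow> u \<in> WJ J"
proof
  assume "u \<circ> gen k \<in> WJ J"
  then have "(u \<circ> gen k) \<circ> gen k \<in> WJ J" by (rule WJ_comp[OF _ WJ_gen[OF assms]])
  then show "u \<in> WJ J" by (simp only: gen_gen)
qed (rule WJ_comp[OF _ WJ_gen[OF assms]])

lemma young_WJ: "young n lam = WJ {k \<in> {1..<n}. k \<notin> {sum_list (take i lam) | i. 1 \<le> i}}"
proof (rule Set.set_eqI)
  fix w
  show "w \<in> young n lam \<longleftrightarrow> w \<in> WJ {k \<in> {1..<n}. k \<notin> {sum_list (take i lam) | i. 1 \<le> i}}" (is "_ \<longleftrightarrow> w \<in> WJ ?J")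
  proof
    show "w \<in> WJ ?J" if "w \<in> young n lam" using that
    proof (induction rule: young.induct)
      case young_id show ?case by (rule WJ_id)
    next
      case (young_step w k)
      show ?case by (rule WJ_step[OF young_step.IH]) (use young_step.hyps in simp)
    qed
    show "w \<in> young n lam" if "w \<in> WJ ?J" using that
    proof (induction rule: WJ.induct)
      case WJ_id show ?case by (rule young_id)
    next
      case (WJ_step w k)
      show ?case by (rule young_step[OF WJ_step.IH]) (use WJ_step.hyps in simp_all)
    qed
  qed
qed

lemma mono_interval: assumes "\<And>j. a \<le> j \<Longrightarrow> j < b \<Longrightarrow> d j < (d (Suc j) :: nat)" "a < b" shows "d a < d b"
  using assms
proof (induction b)
  case (Suc b)
  show ?case
  proof (cases "a = b")
    case True then show ?thesis using Suc.prems(1)[of b] by simp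
  next
    case False
    then have "a < b" using Suc.prems(2) by simp
    then have "d a < d b" using Suc.prems(1) by (intro Suc.IH) auto
    also have "d b < d (Suc b)" using Suc.prems(1)[of b] \<open>a < b\<close> by simp
    finally show ?thesis .
  qed
qed simp

context hecke
begin

context
  fixes J :: "nat set" assumes J: "J \<subseteq> S"
begin

lemma JS: "k \<in> J \<Longrightarrow> k \<in> S" using J by blast

lemma WJ_W: "w \<in> WJ J \<Longrightarrow> w \<in> W"
proof (induction rule: WJ.induct)
  case (WJ_step w k)
  show ?case by (rule comp_Wn[OF gen_Wn[OF JS[OF WJ_step(2)]] WJ_step(3)])
qed (rule id_Wn)

lemma finite_WJ: "finite (WJ J)" by (rule finite_subset[OF _ finite_Wn[of n]]) (use WJ_W in blast)

lemma WJ_inv: "w \<in> WJ J \<Longrightarrow> ivp w \<in> WJ J"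
proof (induction rule: WJ.induct)
  case WJ_id then show ?case unfolding inv_id by (rule WJ.WJ_id)
next
  case (WJ_step w k)
  have "ivp (gen k \<circ> w) = ivp w \<circ> ivp (gen k)"
    by (rule inv_comp_Wn[OF gen_Wn[OF JS[OF WJ_step(2)]] WJ_W[OF WJ_step(1)]])
  also have "\<dots> \<in> WJ J" unfolding inv_gen by (rule WJ_comp[OF WJ_step(3) WJ_gen[OF WJ_step(2)]])
  finally show ?case .
qed

text \<open>An index outside J is a wall: no generator of the subgroup moves a number across
  it.\<close>

lemma WJ_le: assumes "w \<in> WJ J" "j \<notin> J" shows "w a \<le> j \<longleftrightarrow> a \<le> j"
  using assms(1)
proof (induction arbitrary: a rule: WJ.induct)
  case (WJ_step w k)
  have "k \<noteq> j" using WJ_step(2) assms(2) by auto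
  then have "gen k b \<le> j \<longleftrightarrow> b \<le> j" for b unfolding gen_apply by presburger
  then show ?case using WJ_step(3)[of a] by simp
qed simp

lemma WJ_block: assumes "w \<in> WJ J" "k \<in> J" "w k \<le> j" "j < w (Suc k)" shows "j \<in> J"
proof (rule ccontr)
  assume "j \<notin> J"
  then have "k \<le> j" "\<not> Suc k \<le> j"
    using WJ_le[OF assms(1), of j k] WJ_le[OF assms(1), of j "Suc k"] assms(3,4) by linarith+
  then have "j = k" by simp
  then show False using \<open>j \<notin> J\<close> assms(2) by simp
qed

lemma WJ_descent: assumes "u \<in> WJ J" "u \<noteq> id" obtains k where "k \<in> J" "u (Suc k) < u k"
proof -
  obtain k where k: "k \<in> S" "\<not> u k < u (Suc k)" using Wn_mono_id[OF WJ_W[OF assms(1)]] assms(2) by blast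
  then have lt: "u (Suc k) < u k" using Wn_inj[OF WJ_W[OF assms(1)], of k "Suc k"] by auto
  have "k \<in> J"
  proof (rule ccontr)
    assume "k \<notin> J"
    then have "u k \<le> k" "\<not> u (Suc k) \<le> k" using WJ_le[OF assms(1)] by auto
    then show False using lt by simp
  qed
  then show ?thesis using that lt by blast
qed

text \<open>Representatives d of minimal, respectively maximal, length in the coset d W_J.\<close>
definition rmin :: "perm \<Rightarrow> bool" where "rmin d \<longleftrightarrow> d \<in> W \<and> (\<forall>k\<in>J. d k < d (Suc k))"
definition rmax :: "perm \<Rightarrow> bool" where "rmax d \<longleftrightarrow> d \<in> W \<and> (\<forall>k\<in>J. d (Suc k) < d k)"

text \<open>Induction along the right descents of u. The numbers between the two values of u at a
  descent lie in one block of J, on which d is increasing, so d preserves their order and the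
  descent persists in \<open>d \<circ> u\<close>.\<close>

lemma len_rmin: assumes "rmin d" shows "u \<in> WJ J \<Longrightarrow> l (d \<circ> u) = l d + l u"
proof (induction "l u" arbitrary: u rule: less_induct)
  case less
  show ?case
  proof (cases "u = id")
    case True then show ?thesis by simp
  next
    case False
    then obtain k where k: "k \<in> J" "u (Suc k) < u k" using WJ_descent less(2) by blast
    have kS: "k \<in> S" by (rule JS[OF k(1)])
    let ?u = "u \<circ> gen k"
    have u': "?u \<in> WJ J" using WJ_comp_gen_iff[OF k(1)] less(2) by blast
    have lu: "l u = Suc (l ?u)" by (rule len_comp_gen(2)[OF WJ_W[OF less(2)] kS k(2)])
    have dW: "d \<in> W" using assms rmin_def by blast
    have lt: "?u k < ?u (Suc k)" using k(2) by (simp add: gen_apply)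
    have "d (?u k) < d (?u (Suc k))"
    proof (rule mono_interval[OF _ lt])
      fix j assume "?u k \<le> j" "j < ?u (Suc k)"
      then have "j \<in> J" by (rule WJ_block[OF u' k(1)])
      then show "d j < d (Suc j)" using assms rmin_def by blast
    qed
    then have "(d \<circ> ?u) k < (d \<circ> ?u) (Suc k)" by simp
    then have "l ((d \<circ> ?u) \<circ> gen k) = Suc (l (d \<circ> ?u))"
      by (intro len_comp_gen(1) kS comp_Wn dW WJ_W[OF u'])
    moreover have "(d \<circ> ?u) \<circ> gen k = d \<circ> u" by (simp add: comp_assoc)
    moreover have "l (d \<circ> ?u) = l d + l ?u" using less(1)[OF _ u'] lu by simp
    ultimately show ?thesis using lu by simp
  qed
qed

lemma len_rmax: assumes "rmax d" shows "u \<in> WJ J \<Longrightarrow> l (d \<circ> u) + l u = l d"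
proof (induction "l u" arbitrary: u rule: less_induct)
  case less
  show ?case
  proof (cases "u = id")
    case True then show ?thesis by simp
  next
    case False
    then obtain k where k: "k \<in> J" "u (Suc k) < u k" using WJ_descent less(2) by blast
    have kS: "k \<in> S" by (rule JS[OF k(1)])
    let ?u = "u \<circ> gen k"
    have u': "?u \<in> WJ J" using WJ_comp_gen_iff[OF k(1)] less(2) by blast
    have lu: "l u = Suc (l ?u)" by (rule len_comp_gen(2)[OF WJ_W[OF less(2)] kS k(2)])
    have dW: "d \<in> W" using assms rmax_def by blast
    have lt: "?u k < ?u (Suc k)" using k(2) by (simp add: gen_apply)
    have le: "d a \<le> n" if "a \<le> n" for a
    proof (cases "a \<in> {1..n}")
      case True then show ?thesis using Wn_range[OF dW, of a] by auto
    next
      case False then show ?thesis using dW that unfolding Wn_def permutes_def by auto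
    qed
    \<comment> \<open>Passing to \<open>n - d\<close> makes the decreasing d increasing, so that
      \<open>mono_interval\<close> applies; the values are at most n, hence nothing is
      truncated.\<close>
    have "n - d (?u k) < n - d (?u (Suc k))"
    proof (rule mono_interval[OF _ lt])
      fix j assume "?u k \<le> j" "j < ?u (Suc k)"
      then have jJ: "j \<in> J" by (rule WJ_block[OF u' k(1)])
      then have "d (Suc j) < d j" "d j \<le> n" using assms rmax_def le[of j] JS[OF jJ] by auto
      then show "n - d j < n - d (Suc j)" by simp
    qed
    then have "(d \<circ> ?u) (Suc k) < (d \<circ> ?u) k" by simp
    then have "l (d \<circ> ?u) = Suc (l ((d \<circ> ?u) \<circ> gen k))"
      by (intro len_comp_gen(2) kS comp_Wn dW WJ_W[OF u'])
    moreover have "(d \<circ> ?u) \<circ> gen k = d \<circ> u" by (simp add: comp_assoc)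
    moreover have "l (d \<circ> ?u) + l ?u = l d" using less(1)[OF _ u'] lu by simp
    ultimately show ?thesis using lu by simp
  qed
qed

lemma coset_decomp: "w \<in> W \<Longrightarrow> \<exists>d u. rmin d \<and> u \<in> WJ J \<and> w = d \<circ> u"
proof (induction "l w" arbitrary: w rule: less_induct)
  case less
  show ?case
  proof (cases "rmin w")
    case True then show ?thesis using WJ_id[of J] by (intro exI[of _ w] exI[of _ id]) simp
  next
    case False
    then obtain k where k: "k \<in> J" "\<not> w k < w (Suc k)" using less(2) rmin_def by blast
    then have lt: "w (Suc k) < w k" using Wn_inj[OF less(2), of k "Suc k"] by auto
    have kS: "k \<in> S" by (rule JS[OF k(1)])
    have "l (w \<circ> gen k) < l w" using len_comp_gen(2)[OF less(2) kS lt] by simp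
    moreover have "w \<circ> gen k \<in> W" using less(2) kS by simp
    ultimately obtain d u where du: "rmin d" "u \<in> WJ J" "w \<circ> gen k = d \<circ> u" using less(1) by blast
    have "w = (w \<circ> gen k) \<circ> gen k" by simp
    also have "\<dots> = d \<circ> (u \<circ> gen k)" unfolding du(3) comp_assoc ..
    finally show ?thesis using du(1,2) WJ_comp_gen_iff[OF k(1)] by blast
  qed
qed

text \<open>Each representative is the other one times an element of the subgroup. Lengths add up in
  both directions, so that element has length 0.\<close>

lemma coset_unique: assumes "rmin d" "rmin e" "u \<in> WJ J" "w \<in> WJ J" "d \<circ> u = e \<circ> w" shows "d = e" "u = w"
proof -
  have dW: "d \<in> W" "e \<in> W" using assms rmin_def by auto
  have r: "u \<circ> ivp w \<in> WJ J" "w \<circ> ivp u \<in> WJ J" by (intro WJ_comp WJ_inv assms)+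
  have "d \<circ> (u \<circ> ivp w) = (e \<circ> w) \<circ> ivp w" using assms(5) by (simp only: comp_assoc[symmetric])
  also have "\<dots> = e" using WJ_W[OF assms(4)] by simp
  finally have 1: "d \<circ> (u \<circ> ivp w) = e" .
  have "e \<circ> (w \<circ> ivp u) = (d \<circ> u) \<circ> ivp u" using assms(5) by (simp only: comp_assoc[symmetric])
  also have "\<dots> = d" using WJ_W[OF assms(3)] by simp
  finally have 2: "e \<circ> (w \<circ> ivp u) = d" .
  have "l e = l d + l (u \<circ> ivp w)" "l d = l e + l (w \<circ> ivp u)"
    using len_rmin[OF assms(1) r(1)] len_rmin[OF assms(2) r(2)] 1 2 by simp_all
  then have "l (u \<circ> ivp w) = 0" by simp
  then have i: "u \<circ> ivp w = id" using len_0_iff[OF WJ_W[OF r(1)]] by simp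
  then show "d = e" using 1 by simp
  have "u = (u \<circ> ivp w) \<circ> w" using WJ_W[OF assms(4)] by simp
  then show "u = w" unfolding i by simp
qed

lemma sum_coset: "(\<Sum>w\<in>W. f w) = (\<Sum>d\<in>Collect rmin. \<Sum>u\<in>WJ J. f (d \<circ> u))"
proof -
  have "(\<Sum>d\<in>Collect rmin. \<Sum>u\<in>WJ J. f (d \<circ> u)) = (\<Sum>p\<in>Collect rmin \<times> WJ J. f (fst p \<circ> snd p))"
    by (simp add: sum.cartesian_product case_prod_beta)
  also have "\<dots> = (\<Sum>w\<in>W. f w)"
  proof (rule sum.reindex_bij_betw[of "\<lambda>p. fst p \<circ> snd p" "Collect rmin \<times> WJ J" W f])
    show "bij_betw (\<lambda>p. fst p \<circ> snd p) (Collect rmin \<times> WJ J) W"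
      unfolding bij_betw_def
    proof
      show "inj_on (\<lambda>p. fst p \<circ> snd p) (Collect rmin \<times> WJ J)"
      proof (rule inj_onI)
        fix p q assume "p \<in> Collect rmin \<times> WJ J" "q \<in> Collect rmin \<times> WJ J" "fst p \<circ> snd p = fst q \<circ> snd q"
        then show "p = q" using coset_unique[of "fst p" "fst q" "snd p" "snd q"] by (auto simp: prod_eq_iff)
      qed
      show "(\<lambda>p. fst p \<circ> snd p) ` (Collect rmin \<times> WJ J) = W"
      proof
        show "(\<lambda>p. fst p \<circ> snd p) ` (Collect rmin \<times> WJ J) \<subseteq> W"
          using WJ_W by (auto simp: rmin_def intro!: comp_Wn)
        show "W \<subseteq> (\<lambda>p. fst p \<circ> snd p) ` (Collect rmin \<times> WJ J)"
        proof
          fix w assume "w \<in> W"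
          then obtain d u where "rmin d" "u \<in> WJ J" "w = d \<circ> u" using coset_decomp by blast
          then show "w \<in> (\<lambda>p. fst p \<circ> snd p) ` (Collect rmin \<times> WJ J)" by (intro image_eqI[of _ _ "(d, u)"]) auto
        qed
      qed
    qed
  qed
  finally show ?thesis ..
qed

text \<open>A longest element is a maximal representative of its coset, and its translate by u loses
  exactly \<open>l u\<close>. A second element of maximal length is thus a translate by an element
  of length 0.\<close>

lemma longest_exists: "\<exists>!w. w \<in> WJ J \<and> (\<forall>u\<in>WJ J. l u \<le> l w)"
  and longest_props: "w \<in> WJ J \<Longrightarrow> (\<forall>u\<in>WJ J. l u \<le> l w) \<Longrightarrow> rmax w"
proof -
  have mx: "rmax w" if w: "w \<in> WJ J" "\<forall>u\<in>WJ J. l u \<le> l w" for w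
    unfolding rmax_def
  proof (intro conjI ballI)
    show "w \<in> W" by (rule WJ_W[OF w(1)])
    fix k assume k: "k \<in> J"
    show "w (Suc k) < w k"
    proof (rule ccontr)
      assume "\<not> w (Suc k) < w k"
      then have "w k < w (Suc k)" using Wn_inj[OF WJ_W[OF w(1)], of k "Suc k"] by auto
      then have "l (w \<circ> gen k) = Suc (l w)" by (rule len_comp_gen(1)[OF WJ_W[OF w(1)] JS[OF k]])
      moreover have "w \<circ> gen k \<in> WJ J" using WJ_comp_gen_iff[OF k] w(1) by blast
      ultimately show False using w(2) by force
    qed
  qed
  then show "w \<in> WJ J \<Longrightarrow> (\<forall>u\<in>WJ J. l u \<le> l w) \<Longrightarrow> rmax w" .
  have "finite (l ` WJ J)" "l ` WJ J \<noteq> {}" using finite_WJ WJ_id by auto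
  then have "Max (l ` WJ J) \<in> l ` WJ J" by (rule Max_in)
  then obtain w where w: "w \<in> WJ J" "l w = Max (l ` WJ J)" by auto
  have wm: "\<forall>u\<in>WJ J. l u \<le> l w" using w finite_WJ by simp
  show "\<exists>!w. w \<in> WJ J \<and> (\<forall>u\<in>WJ J. l u \<le> l w)"
  proof (rule ex1I[of _ w])
    show "w \<in> WJ J \<and> (\<forall>u\<in>WJ J. l u \<le> l w)" using w wm by blast
    fix w' assume w': "w' \<in> WJ J \<and> (\<forall>u\<in>WJ J. l u \<le> l w')"
    have u: "ivp w \<circ> w' \<in> WJ J" using w w' by (intro WJ_comp WJ_inv) auto
    have e: "w \<circ> (ivp w \<circ> w') = w'" using WJ_W[OF w(1)] by simp
    have "l w = l w'" using w' w wm by (meson le_antisym)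
    then have "l (ivp w \<circ> w') = 0" using len_rmax[OF mx[OF w(1) wm] u] e by simp
    then have "ivp w \<circ> w' = id" using len_0_iff[OF WJ_W[OF u]] by simp
    then show "w' = w" using e by simp
  qed
qed

definition wJ :: perm where "wJ = (THE w. w \<in> WJ J \<and> (\<forall>u\<in>WJ J. l u \<le> l w))"

lemma wJ: "wJ \<in> WJ J" "\<And>u. u \<in> WJ J \<Longrightarrow> l u \<le> l wJ" "rmax wJ"
proof -
  have *: "wJ \<in> WJ J \<and> (\<forall>u\<in>WJ J. l u \<le> l wJ)" unfolding wJ_def by (rule theI'[OF longest_exists])
  then show "wJ \<in> WJ J" "\<And>u. u \<in> WJ J \<Longrightarrow> l u \<le> l wJ" "rmax wJ" using longest_props by auto
qed

lemma wJ_eq: assumes "u \<in> WJ J" "l u = l wJ" shows "u = wJ"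
proof -
  have "\<forall>u'\<in>WJ J. l u' \<le> l u" using wJ(2) assms by auto
  then show ?thesis using longest_exists assms(1) wJ(1,2) by blast
qed

lemma ivp_wJ: "ivp wJ = wJ"
  by (rule wJ_eq[OF WJ_inv[OF wJ(1)]]) (use len_inv WJ_W[OF wJ(1)] in blast)

lemma len_wJ_comp: "u \<in> WJ J \<Longrightarrow> l (wJ \<circ> u) + l u = l wJ" by (rule len_rmax[OF wJ(3)])

text \<open>For a root q of the quadratic relation, this is the eigenvector of the parabolic
  subalgebra on which each T_s acts by q: the symmetrizer for q = v, the antisymmetrizer for q =
  -1/v. The scalar \<open>PJ q\<close> is the Poincare polynomial at q^2; it satisfies
  \<open>xJ_xJ\<close>.\<close>

definition xJ :: "K \<Rightarrow> hk" where "xJ q = (\<lambda>u. if u \<in> WJ J then q ^ l u else 0)"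
definition PJ :: "K \<Rightarrow> K" where "PJ q = (\<Sum>u\<in>WJ J. q ^ l u * q ^ l u)"

lemma hk_xJ: "hk (xJ q)" unfolding xJ_def by (rule hkI) (use WJ_W in auto)

lemma xJ_lc: "xJ q = (\<lambda>u. \<Sum>w\<in>WJ J. q ^ l w * Tb w u)"
  by (rule ext) (use finite_WJ in \<open>simp add: xJ_def Tb_def if_distrib cong: if_cong\<close>)

lemma star_xJ: "star (xJ q) = xJ q"
proof (rule hk_eqI[OF hk_star hk_xJ])
  fix u assume u: "u \<in> W"
  have "ivp u \<in> WJ J \<longleftrightarrow> u \<in> WJ J" using WJ_inv[of u] WJ_inv[of "ivp u"] u by auto
  then show "star (xJ q) u = xJ q u" using u by (simp add: star_def xJ_def len_inv)
qed

context
  fixes q :: K assumes q: "q * q = zt * q + 1"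
begin

lemma R_xJ: assumes "k \<in> J" shows "R k (xJ q) = (\<lambda>u. q * xJ q u)"
proof
  fix u
  show "R k (xJ q) u = q * xJ q u"
  proof (cases "u \<in> WJ J")
    case True
    then have u': "u \<circ> gen k \<in> WJ J" using WJ_comp_gen_iff[OF assms] by blast
    show ?thesis
    proof (cases rule: len_comp_gen_cases[OF WJ_W[OF True] JS[OF assms]])
      case 1 then show ?thesis using True u' by (simp add: R_def xJ_def)
    next
      case 2
      have "q ^ l (u \<circ> gen k) + zt * (q * q ^ l (u \<circ> gen k)) = (zt * q + 1) * q ^ l (u \<circ> gen k)" by (simp add: algebra_simps)
      then show ?thesis using True u' 2 unfolding q[symmetric] by (simp add: R_def xJ_def mult.assoc)
    qed
  next
    case False
    then have u': "u \<circ> gen k \<notin> WJ J" using WJ_comp_gen_iff[OF assms] by blast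
    then show ?thesis using False by (simp add: R_def xJ_def)
  qed
qed

lemma L_xJ: assumes "k \<in> J" shows "L k (xJ q) = (\<lambda>u. q * xJ q u)"
proof -
  have "star (\<lambda>u. q * xJ q u) = (\<lambda>u. q * star (xJ q) u)" by (auto simp: star_def)
  then have "star (L k (xJ q)) = star (\<lambda>u. q * xJ q u)"
    using star_L[OF JS[OF assms] hk_xJ, of q] R_xJ[OF assms] star_xJ[of q] by simp
  then have "star (star (L k (xJ q))) = star (star (\<lambda>u. q * xJ q u))" by simp
  then show ?thesis using hk_L[OF JS[OF assms] hk_xJ] hk_scale[OF hk_xJ] by simp
qed

lemma eigen_Tb: assumes h: "hk h" and e: "\<And>k. k \<in> J \<Longrightarrow> R k h = (\<lambda>u. q * h u)"
  shows "u \<in> WJ J \<Longrightarrow> h \<star> Tb u = (\<lambda>w. q ^ l u * h w)"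
proof (induction "l u" arbitrary: u rule: less_induct)
  case less
  show ?case
  proof (cases "u = id")
    case True
    have "l u = 0" unfolding True by simp
    moreover have "h \<star> Tb u = h" unfolding True by (rule hm_1[OF h])
    ultimately show ?thesis by simp
  next
    case False
    then obtain k where k: "k \<in> J" "u (Suc k) < u k" using WJ_descent less(2) by blast
    have kS: "k \<in> S" by (rule JS[OF k(1)])
    let ?u = "u \<circ> gen k"
    have u': "?u \<in> WJ J" using WJ_comp_gen_iff[OF k(1)] less(2) by blast
    have lu: "l u = Suc (l ?u)" by (rule len_comp_gen(2)[OF WJ_W[OF less(2)] kS k(2)])
    have uW: "?u \<in> W" by (rule WJ_W[OF u'])
    have t: "Tb ?u \<star> Tb (gen k) = Tb u" using Tb_mult_gen_right[OF kS uW] lu by simp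
    have "h \<star> Tb u = (h \<star> Tb ?u) \<star> Tb (gen k)" unfolding t[symmetric] using h uW kS by (intro hm_assoc[symmetric] hk_Tb) auto
    also have "\<dots> = (\<lambda>w. q ^ l ?u * R k h w)"
    proof -
      have "h \<star> Tb ?u = (\<lambda>w. q ^ l ?u * h w)" using less(1)[OF _ u'] lu by simp
      then show ?thesis by (simp only: hm_scale_left hm_gen_right[OF kS h])
    qed
    also have "\<dots> = (\<lambda>w. q ^ l u * h w)" unfolding e[OF k(1)] lu by (simp add: mult_ac)
    finally show ?thesis .
  qed
qed

lemma eigen_xJ: assumes "hk h" "\<And>k. k \<in> J \<Longrightarrow> R k h = (\<lambda>u. q * h u)"
  shows "h \<star> xJ q = (\<lambda>w. PJ q * h w)"
  unfolding xJ_lc hm_lc_right PJ_def sum_distrib_right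
  by (rule ext, rule sum.cong) (use eigen_Tb[OF assms] in \<open>auto simp: mult.assoc\<close>)

lemma xJ_xJ: "xJ q \<star> xJ q = (\<lambda>w. PJ q * xJ q w)" by (rule eigen_xJ[OF hk_xJ R_xJ])

lemma eigen_coset: assumes h: "hk h" and e: "\<And>k. k \<in> J \<Longrightarrow> R k h = (\<lambda>u. q * h u)" and d: "rmin d"
  shows "u \<in> WJ J \<Longrightarrow> h (d \<circ> u) = q ^ l u * h d"
proof (induction "l u" arbitrary: u rule: less_induct)
  case less
  show ?case
  proof (cases "u = id")
    case True
    have "l u = 0" unfolding True by simp
    then show ?thesis using True by simp
  next
    case False
    then obtain k where k: "k \<in> J" "u (Suc k) < u k" using WJ_descent less(2) by blast
    have kS: "k \<in> S" by (rule JS[OF k(1)])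
    let ?u = "u \<circ> gen k"
    have u': "?u \<in> WJ J" using WJ_comp_gen_iff[OF k(1)] less(2) by blast
    have lu: "l u = Suc (l ?u)" by (rule len_comp_gen(2)[OF WJ_W[OF less(2)] kS k(2)])
    have e1: "(d \<circ> ?u) \<circ> gen k = d \<circ> u" by (simp add: comp_assoc)
    have "R k h (d \<circ> ?u) = q * h (d \<circ> ?u)" by (rule fun_cong[OF e[OF k(1)]])
    moreover have "R k h (d \<circ> ?u) = h (d \<circ> u)"
      unfolding R_def e1 using len_rmin[OF d u'] len_rmin[OF d less(2)] lu by simp
    moreover have "h (d \<circ> ?u) = q ^ l ?u * h d" using less(1)[OF _ u'] lu by simp
    ultimately show ?thesis using lu by simp
  qed
qed

text \<open>For h = h' * x_J and a left eigenvector g of the generators in J, this is h' * g.\<close>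
definition cofac :: "hk \<Rightarrow> hk \<Rightarrow> hk" where "cofac h g = (\<lambda>u. \<Sum>d\<in>Collect rmin. h d * (Tb d \<star> g) u)"

lemma hk_cofac: "hk g \<Longrightarrow> hk (cofac h g)" unfolding cofac_def by (intro hk_lc hk_hm)

lemma Tb_rmin: "rmin d \<Longrightarrow> u \<in> WJ J \<Longrightarrow> Tb d \<star> Tb u = Tb (d \<circ> u)"
  using Tb_mult[of d u] len_rmin[of d u] WJ_W[of u] by (simp add: rmin_def)

lemma eigen_left_Tb: assumes g: "hk g" and e: "\<And>k. k \<in> J \<Longrightarrow> L k g = (\<lambda>u. q * g u)" and u: "u \<in> WJ J"
  shows "Tb u \<star> g = (\<lambda>w. q ^ l u * g w)"
proof -
  have uW: "u \<in> W" by (rule WJ_W[OF u])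
  have "R k (star g) = (\<lambda>u. q * star g u)" if "k \<in> J" for k
    unfolding star_L[OF JS[OF that] g, symmetric] e[OF that] by (auto simp: star_def)
  from eigen_Tb[OF hk_star this WJ_inv[OF u]]
  have "star g \<star> Tb (ivp u) = (\<lambda>w. q ^ l (ivp u) * star g w)" .
  then have "star (star g \<star> Tb (ivp u)) = star (\<lambda>w. q ^ l u * star g w)" using len_inv[OF uW] by simp
  moreover have "star (star g \<star> Tb (ivp u)) = Tb u \<star> g" using star_hm[of "star g" "Tb (ivp u)"] g uW by simp
  moreover have "star (\<lambda>w. q ^ l u * star g w) = (\<lambda>w. q ^ l u * star (star g) w)" by (auto simp: star_def)
  ultimately show ?thesis using g by simp
qed

text \<open>Sum over the cosets of the subgroup: the term of \<open>d \<circ> u\<close> receives one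
  factor \<open>q ^ l u\<close> from h and another from g, so each coset contributes
  \<open>PJ q\<close> times its term at d.\<close>

lemma eigen_mult: assumes h: "hk h" and e: "\<And>k. k \<in> J \<Longrightarrow> R k h = (\<lambda>u. q * h u)"
  and g: "hk g" and e': "\<And>k. k \<in> J \<Longrightarrow> L k g = (\<lambda>u. q * g u)"
  shows "h \<star> g = (\<lambda>u. PJ q * cofac h g u)"
proof
  fix z
  have "(h \<star> g) z = (\<Sum>w\<in>W. h w * (Tb w \<star> g) z)"
    using fun_cong[OF hm_lc_left[where I=W and c=h and a=Tb and b=g], of z] hk_expand[OF h] by simp
  also have "\<dots> = (\<Sum>d\<in>Collect rmin. \<Sum>u\<in>WJ J. h (d \<circ> u) * (Tb (d \<circ> u) \<star> g) z)" by (rule sum_coset)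
  also have "\<dots> = (\<Sum>d\<in>Collect rmin. \<Sum>u\<in>WJ J. (q ^ l u * q ^ l u) * (h d * (Tb d \<star> g) z))"
  proof (intro sum.cong refl)
    fix d u assume d: "d \<in> Collect rmin" and u: "u \<in> WJ J"
    have dW: "hk (Tb d)" "hk (Tb u)" using d WJ_W[OF u] rmin_def by auto
    have "Tb (d \<circ> u) \<star> g = Tb d \<star> (Tb u \<star> g)" using Tb_rmin[of d u] d u hm_assoc[OF dW g] by simp
    also have "\<dots> = (\<lambda>w. q ^ l u * (Tb d \<star> g) w)" by (subst eigen_left_Tb[OF g e' u]) (assumption, rule hm_scale_right)
    finally show "h (d \<circ> u) * (Tb (d \<circ> u) \<star> g) z = (q ^ l u * q ^ l u) * (h d * (Tb d \<star> g) z)"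
      using eigen_coset[OF h e, of d u] d u by (simp add: mult_ac)
  qed
  also have "\<dots> = PJ q * cofac h g z"
    unfolding PJ_def cofac_def sum_product by (subst sum.swap) simp
  finally show "(h \<star> g) z = PJ q * cofac h g z" .
qed

lemma eigen_factor: assumes h: "hk h" and e: "\<And>k. k \<in> J \<Longrightarrow> R k h = (\<lambda>u. q * h u)" and P: "PJ q \<noteq> 0"
  shows "h = cofac h (xJ q)"
proof
  fix z
  have "PJ q * h z = PJ q * cofac h (xJ q) z"
    using fun_cong[OF eigen_mult[OF h e hk_xJ L_xJ], of z] fun_cong[OF eigen_xJ[OF h e], of z] by simp
  then show "h z = cofac h (xJ q) z" using P by simp
qed

end

lemma finite_rmin: "finite (Collect rmin)" by (rule finite_subset[OF _ finite_Wn[of n]]) (auto simp: rmin_def)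

end

lemma qsign: "(- inverse vK) * (- inverse vK) = zt * (- inverse vK) + 1"
  by (simp add: algebra_simps)
lemma qindex: "vK * vK = zt * vK + 1" by (simp add: algebra_simps)

abbreviation "qs \<equiv> - inverse vK"

lemma PJ_qs: "J \<subseteq> S \<Longrightarrow> PJ J qs = (\<Sum>u\<in>WJ J. (inverse vK) ^ (2 * l u))"
  by (simp add: PJ_def power_mult_distrib[symmetric] power_mult power2_eq_square)

text \<open>Among the powers v^(-2 l(u)), the longest element contributes the lowest one, exactly
  once.\<close>

lemma PJ_const: assumes "J \<subseteq> S" shows "const0 (vK ^ (2 * l (wJ J)) * PJ J qs) 1"
proof -
  have e: "vK ^ (2 * l (wJ J)) * PJ J qs = (\<Sum>u\<in>WJ J. vK ^ (2 * (l (wJ J) - l u)))"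
    unfolding PJ_qs[OF assms] sum_distrib_left
  proof (rule sum.cong[OF refl])
    fix u assume "u \<in> WJ J"
    then have "l u \<le> l (wJ J)" by (rule wJ(2)[OF assms])
    then have "2 * l (wJ J) = 2 * (l (wJ J) - l u) + 2 * l u" by simp
    then have "vK ^ (2 * l (wJ J)) = vK ^ (2 * (l (wJ J) - l u)) * vK ^ (2 * l u)" by (metis power_add)
    then show "vK ^ (2 * l (wJ J)) * inverse vK ^ (2 * l u) = vK ^ (2 * (l (wJ J) - l u))"
      by (simp add: power_inverse)
  qed
  have "const0 (\<Sum>u\<in>WJ J. vK ^ (2 * (l (wJ J) - l u))) (\<Sum>u\<in>WJ J. if 2 * (l (wJ J) - l u) = 0 then 1 else 0)"
    by (intro const0_sum const0_nat_power_v)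
  moreover have "(\<Sum>u\<in>WJ J. if 2 * (l (wJ J) - l u) = 0 then 1 else 0) = (\<Sum>u\<in>WJ J. if u = wJ J then 1 else (0::real))"
  proof (rule sum.cong[OF refl])
    fix u assume u: "u \<in> WJ J"
    then have "l u \<le> l (wJ J)" by (rule wJ(2)[OF assms])
    then have "2 * (l (wJ J) - l u) = 0 \<longleftrightarrow> u = wJ J" using wJ_eq[OF assms u] by auto
    then show "(if 2 * (l (wJ J) - l u) = 0 then 1 else 0) = (if u = wJ J then 1 else (0::real))" by simp
  qed
  ultimately show ?thesis unfolding e using wJ(1)[OF assms] finite_WJ[OF assms] by simp
qed

lemma PJ_nz: assumes "J \<subseteq> S" shows "PJ J qs \<noteq> 0"
  using PJ_const[OF assms] const0_unique[OF const0_0] by fastforce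

text \<open>Translation by the longest element replaces each length by its complement, which inverts
  every power of v in the normalized sum.\<close>

lemma pJ_bar: assumes "J \<subseteq> S" shows "barK (vK ^ l (wJ J) * PJ J qs) = vK ^ l (wJ J) * PJ J qs"
proof -
  have t: "vK ^ l (wJ J) * inverse vK ^ (2 * l u) = vK powi (int (l (wJ J)) - 2 * int (l u))" for u
  proof -
    have "int (l (wJ J)) - 2 * int (l u) = int (l (wJ J)) - int (2 * l u)" by simp
    then show ?thesis
      by (simp only: power_int_diff[OF disjI1[OF vK_nz]] power_int_of_nat divide_inverse power_inverse)
  qed
  have e: "vK ^ l (wJ J) * PJ J qs = (\<Sum>u\<in>WJ J. vK powi (int (l (wJ J)) - 2 * int (l u)))"
    unfolding PJ_qs[OF assms] sum_distrib_left t ..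
  have b: "barK (vK powi k) = vK powi (- k)" for k
    by (cases k) (auto simp: power_int_def barK_power barK_inverse power_inverse)
  have "barK (vK ^ l (wJ J) * PJ J qs) = (\<Sum>u\<in>WJ J. vK powi (- (int (l (wJ J)) - 2 * int (l u))))"
    unfolding e barK_sum b ..
  also have "\<dots> = (\<Sum>u\<in>WJ J. vK powi (int (l (wJ J)) - 2 * int (l u)))"
  proof (rule sum.reindex_bij_witness[of _ "\<lambda>u. wJ J \<circ> u" "\<lambda>u. wJ J \<circ> u"])
    fix u assume u: "u \<in> WJ J"
    have "wJ J \<circ> wJ J = id" using Wn_cancel(1)[OF WJ_W[OF assms wJ(1)[OF assms]]] ivp_wJ[OF assms] by simp
    then show "wJ J \<circ> (wJ J \<circ> u) = u" by (simp add: comp_assoc[symmetric])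
    then show "wJ J \<circ> (wJ J \<circ> u) = u" .
    show "wJ J \<circ> u \<in> WJ J" by (rule WJ_comp[OF wJ(1)[OF assms] u])
    then show "wJ J \<circ> u \<in> WJ J" .
    have "int (l (wJ J \<circ> u)) = int (l (wJ J)) - int (l u)" using len_wJ_comp[OF assms u] by simp
    then have "int (l (wJ J)) - 2 * int (l (wJ J \<circ> u)) = - (int (l (wJ J)) - 2 * int (l u))" by simp
    then show "vK powi (int (l (wJ J)) - 2 * int (l (wJ J \<circ> u))) = vK powi - (int (l (wJ J)) - 2 * int (l u))" by (simp only:)
  qed
  finally show ?thesis unfolding e .
qed

text \<open>Its right descents make \<open>CC (wJ J)\<close> an eigenvector, determined by its
  values at the minimal coset representatives. Those away from the unit vanish, because the longest
  element of such a coset is longer than \<open>wJ J\<close> and hence outside the support.\<close>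

lemma CC_wJ: assumes "J \<subseteq> S" shows "\<exists>c. c \<noteq> 0 \<and> CC (wJ J) = (\<lambda>u. c * xJ J qs u)"
proof -
  let ?w = "wJ J"
  note wj = wJ[OF assms]
  have wW: "?w \<in> W" by (rule WJ_W[OF assms wj(1)])
  have e: "R k (CC ?w) = (\<lambda>u. qs * CC ?w u)" if k: "k \<in> J" for k
  proof (rule R_CC[OF wW])
    show kS: "k \<in> S" using k assms by blast
    show "l (?w \<circ> gen k) < l ?w"
      unfolding len_comp_gen_less[OF wW kS] using wj(3) k unfolding rmax_def[OF assms] by blast
  qed
  have z: "CC ?w d = 0" if d: "rmin J d" "d \<noteq> id" for d
  proof -
    have dW: "d \<in> W" using d rmin_def[OF assms] by blast
    have ld: "l (d \<circ> ?w) = l d + l ?w" by (rule len_rmin[OF assms d(1) wj(1)])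
    have "l d \<noteq> 0" using d(2) len_0_iff[OF dW] by simp
    then have "d \<circ> ?w \<noteq> ?w" "\<not> l (d \<circ> ?w) < l ?w" using ld by auto
    then have "CC ?w (d \<circ> ?w) = 0" using unitri_CC wW unfolding unitri_def supp_le_def by blast
    then show ?thesis using eigen_coset[OF assms qsign hk_CC[OF wW] e d(1) wj(1)] by simp
  qed
  have "CC ?w = cofac J (CC ?w) (xJ J qs)" by (rule eigen_factor[OF assms qsign hk_CC[OF wW] e PJ_nz[OF assms]])
  also have "\<dots> = (\<lambda>u. CC ?w id * xJ J qs u)"
  proof
    fix u
    have i: "id \<in> Collect (rmin J)" unfolding rmin_def[OF assms] by simp
    have "cofac J (CC ?w) (xJ J qs) u = (\<Sum>d\<in>Collect (rmin J). if d = id then CC ?w id * xJ J qs u else 0)"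
      unfolding cofac_def[OF assms qsign] by (rule sum.cong) (use z hk_xJ[OF assms] in auto)
    then show "cofac J (CC ?w) (xJ J qs) u = CC ?w id * xJ J qs u" using i finite_rmin[OF assms] by simp
  qed
  finally have c: "CC ?w = (\<lambda>u. CC ?w id * xJ J qs u)" .
  have "CC ?w ?w = 1" using unitri_CC wW unfolding unitri_def by blast
  then have "CC ?w id \<noteq> 0" using fun_cong[OF c, of ?w] by (metis mult_zero_left zero_neq_one)
  then show ?thesis using c by blast
qed

end

section \<open>Partitions and double cosets\<close>

definition Psum :: "nat list \<Rightarrow> nat \<Rightarrow> nat" where "Psum lam i = sum_list (take i lam)"

lemma dominates_Psum: "dominates mu lam \<longleftrightarrow> (\<forall>k. Psum mu k \<le> Psum lam k)"
  by (simp add: dominates_def Psum_def)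

lemma Psum_0 [simp]: "Psum lam 0 = 0" by (simp add: Psum_def)
lemma Psum_Suc: "Psum lam (Suc i) = Psum lam i + (if i < length lam then lam ! i else 0)"
  by (simp add: Psum_def take_Suc_conv_app_nth)
lemma Psum_mono: "i \<le> j \<Longrightarrow> Psum lam i \<le> Psum lam j"
proof (induction j)
  case (Suc j) then show ?case by (cases "i = Suc j") (auto simp: Psum_Suc)
qed simp
lemma Psum_all: "length lam \<le> i \<Longrightarrow> Psum lam i = sum_list lam" by (simp add: Psum_def)

lemma Par_length: assumes "lam \<in> Par n" shows "length lam \<le> n"
proof -
  have "length lam \<le> sum_list lam" if "0 \<notin> set lam" for lam :: "nat list"
    using that by (induction lam) auto
  then show ?thesis using assms by (auto simp: Par_def)
qed

lemma Psum_n: "lam \<in> Par n \<Longrightarrow> n \<le> i \<Longrightarrow> Psum lam i = n"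
  using Psum_all[of lam i] Par_length[of lam n] by (auto simp: Par_def)
lemma Psum_le: "lam \<in> Par n \<Longrightarrow> Psum lam i \<le> n"
  using Psum_mono[of i "max i n" lam] Psum_n[of lam n "max i n"] by simp

lemma Psum_inj: assumes "Psum lam = Psum mu" "lam \<in> Par n" "mu \<in> Par n" shows "lam = mu"
proof -
  have nz: "lam ! i > 0" if "lam \<in> Par n" "i < length lam" for lam i
  proof -
    have "lam ! i \<in> set lam" using that by simp
    moreover have "0 \<notin> set lam" using that by (simp add: Par_def)
    ultimately show ?thesis by (metis gr0I)
  qed
  have d: "(if i < length lam then lam ! i else 0) = (if i < length mu then mu ! i else 0)" for i
    using fun_cong[OF assms(1), of "Suc i"] fun_cong[OF assms(1), of i] by (simp add: Psum_Suc)
  have len: "i < length lam \<longleftrightarrow> i < length mu" for i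
    using d[of i] nz[OF assms(2), of i] nz[OF assms(3), of i] by (auto split: if_splits)
  have le: "length lam = length mu" using len[of "length lam"] len[of "length mu"] by auto
  show ?thesis
  proof (rule nth_equalityI[OF le])
    fix i assume "i < length lam"
    then show "lam ! i = mu ! i" using d[of i] le by simp
  qed
qed

lemma dominates_antisym: "dominates mu lam \<Longrightarrow> dominates lam mu \<Longrightarrow> lam \<in> Par n \<Longrightarrow> mu \<in> Par n \<Longrightarrow> lam = mu"
  by (rule Psum_inj[of lam mu n]) (auto simp: dominates_Psum fun_eq_iff intro: antisym)
lemma dominates_refl: "dominates lam lam" by (simp add: dominates_def)
lemma dominates_trans: "dominates a b \<Longrightarrow> dominates b c \<Longrightarrow> dominates a c"
  unfolding dominates_def by (meson le_trans)

lemma finite_Par: "finite (Par n)"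
proof (rule finite_subset)
  show "Par n \<subseteq> {xs. set xs \<subseteq> {0..n} \<and> length xs \<le> n}"
  proof
    fix lam assume lam: "lam \<in> Par n"
    then have "x \<le> n" if "x \<in> set lam" for x using that member_le_sum_list[of x lam] by (auto simp: Par_def)
    then show "lam \<in> {xs. set xs \<subseteq> {0..n} \<and> length xs \<le> n}" using Par_length[OF lam] by auto
  qed
  show "finite {xs. set xs \<subseteq> {0..n} \<and> length xs \<le> n}" by (rule finite_lists_length_le) simp
qed

lemma Par_sorted: assumes "lam \<in> Par n" "i \<le> j" "j < length lam" shows "lam ! j \<le> lam ! i"
  using assms sorted_wrt_nth_less[of "(\<ge>)" lam i j] by (cases "i = j") (auto simp: Par_def)

text \<open>Row and column of the entry a in the tableau of shape lam filled row by row.\<close>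
definition prow :: "nat list \<Rightarrow> nat \<Rightarrow> nat" where "prow lam a = (LEAST i. a \<le> Psum lam i)"
definition pcol :: "nat list \<Rightarrow> nat \<Rightarrow> nat" where "pcol lam a = a - Psum lam (prow lam a - 1)"

lemma row_le_iff: assumes "lam \<in> Par n" "a \<le> n" shows "prow lam a \<le> k \<longleftrightarrow> a \<le> Psum lam k"
proof
  assume "prow lam a \<le> k"
  moreover have "a \<le> Psum lam (prow lam a)" unfolding prow_def
    by (rule LeastI[of _ n]) (use assms Psum_n in auto)
  ultimately show "a \<le> Psum lam k" using Psum_mono order_trans by blast
next
  assume "a \<le> Psum lam k" then show "prow lam a \<le> k" unfolding prow_def by (rule Least_le)
qed

lemma row_props: assumes "lam \<in> Par n" "a \<in> {1..n}"
  shows "1 \<le> prow lam a" "a \<le> Psum lam (prow lam a)" "Psum lam (prow lam a - 1) < a" "prow lam a \<le> length lam"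
    "1 \<le> pcol lam a" "pcol lam a \<le> lam ! (prow lam a - 1)"
proof -
  have *: "prow lam a \<le> k \<longleftrightarrow> a \<le> Psum lam k" for k using row_le_iff[OF assms(1), of a] assms(2) by simp
  show 1: "1 \<le> prow lam a" using *[of 0] assms(2) by (cases "prow lam a") auto
  show 2: "a \<le> Psum lam (prow lam a)" using * by blast
  show 3: "Psum lam (prow lam a - 1) < a" using *[of "prow lam a - 1"] 1 by linarith
  show 4: "prow lam a \<le> length lam" using *[of "length lam"] Psum_all[of lam "length lam"] assms by (auto simp: Par_def)
  show "1 \<le> pcol lam a" using 3 by (simp add: pcol_def)
  have "Psum lam (prow lam a) = Psum lam (prow lam a - 1) + lam ! (prow lam a - 1)"
    using Psum_Suc[of lam "prow lam a - 1"] 1 4 by simp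
  then show "pcol lam a \<le> lam ! (prow lam a - 1)" using 2 3 by (simp add: pcol_def)
qed

lemma row_eqI: assumes "lam \<in> Par n" "Psum lam r < a" "a \<le> Psum lam (Suc r)" shows "prow lam a = Suc r"
proof -
  have "a \<le> n" using assms(3) Psum_le[OF assms(1)] order_trans by blast
  then have "prow lam a \<le> Suc r" "\<not> prow lam a \<le> r" using row_le_iff[OF assms(1)] assms by auto
  then show ?thesis by simp
qed

definition Jl :: "nat \<Rightarrow> nat list \<Rightarrow> nat set" where "Jl n lam = {k \<in> {1..<n}. k \<notin> range (Psum lam)}"

lemma Jl_subset: "Jl n lam \<subseteq> {1..<n}" by (auto simp: Jl_def)

lemma young_Jl: "young n lam = WJ (Jl n lam)"
proof -
  have "{k \<in> {1..<n}. k \<notin> {sum_list (take i lam) | i. 1 \<le> i}} = Jl n lam"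
  proof (rule Set.set_eqI)
    fix k
    have "k \<in> {sum_list (take i lam) | i. 1 \<le> i} \<longleftrightarrow> k \<in> range (Psum lam)" if "k \<noteq> 0"
    proof
      assume "k \<in> range (Psum lam)"
      then obtain i where i: "k = Psum lam i" by blast
      then have "1 \<le> i" using that by (cases i) auto
      then show "k \<in> {sum_list (take i lam) | i. 1 \<le> i}" using i unfolding Psum_def by blast
    qed (auto simp: Psum_def)
    then show "k \<in> {k \<in> {1..<n}. k \<notin> {sum_list (take i lam) | i. 1 \<le> i}} \<longleftrightarrow> k \<in> Jl n lam"
      unfolding Jl_def by (cases "k = 0") (simp, blast)
  qed
  then show ?thesis unfolding young_WJ by simp
qed

lemma Jl_row: assumes "lam \<in> Par n" "k \<in> Jl n lam" shows "prow lam (Suc k) = prow lam k"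
proof (rule antisym)
  have k: "k \<in> {1..<n}" "k \<notin> range (Psum lam)" using assms by (auto simp: Jl_def)
  have "k \<le> Psum lam (prow lam k)" using row_props(2)[OF assms(1), of k] k by auto
  moreover have "k \<noteq> Psum lam (prow lam k)" using k(2) by blast
  ultimately have "Suc k \<le> Psum lam (prow lam k)" by simp
  then show "prow lam (Suc k) \<le> prow lam k" using row_le_iff[OF assms(1), of "Suc k"] k by simp
  have "k \<le> Psum lam (prow lam (Suc k))" using row_props(2)[OF assms(1), of "Suc k"] k by auto
  then show "prow lam k \<le> prow lam (Suc k)" using row_le_iff[OF assms(1), of k] k by simp
qed

lemma Jl_col: assumes "lam \<in> Par n" "k \<in> Jl n lam" shows "pcol lam (Suc k) = Suc (pcol lam k)"
proof -
  have "k \<in> {1..n}" using assms(2) by (auto simp: Jl_def)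
  then show ?thesis using row_props(3)[OF assms(1), of k] by (simp add: pcol_def Jl_row[OF assms])
qed

lemma row_Jl: assumes "lam \<in> Par n" "k \<in> {1..<n}" "prow lam (Suc k) = prow lam k" shows "k \<in> Jl n lam"
proof -
  have "k \<noteq> Psum lam i" for i
  proof
    assume "k = Psum lam i"
    then have "prow lam k \<le> i" "\<not> prow lam (Suc k) \<le> i"
      using row_le_iff[OF assms(1), of k] row_le_iff[OF assms(1), of "Suc k"] assms(2) by auto
    then show False using assms(3) by simp
  qed
  then show ?thesis using assms(2) by (auto simp: Jl_def)
qed

text \<open>Partial sums of the conjugate partition, the column containing the k-th entry of the column reading,
  and the permutation from the row reading to the column reading.\<close>
definition Nc :: "nat \<Rightarrow> nat list \<Rightarrow> nat \<Rightarrow> nat" where "Nc n lam c = card {b \<in> {1..n}. pcol lam b \<le> c}"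
definition bt :: "nat \<Rightarrow> nat list \<Rightarrow> nat \<Rightarrow> nat" where "bt n lam k = (LEAST c. k \<le> Nc n lam c)"
definition Jc :: "nat \<Rightarrow> nat list \<Rightarrow> nat set" where "Jc n lam = {k \<in> {1..<n}. k \<notin> range (Nc n lam)}"
definition d0 :: "nat \<Rightarrow> nat list \<Rightarrow> perm" where
  "d0 n lam a = (if a \<in> {1..n} then card {b \<in> {1..n}. pcol lam b < pcol lam a \<or> (pcol lam b = pcol lam a \<and> b \<le> a)} else a)"

lemma Jc_subset: "Jc n lam \<subseteq> {1..<n}" by (auto simp: Jc_def)

lemma Nc_mono: "c \<le> c' \<Longrightarrow> Nc n lam c \<le> Nc n lam c'" unfolding Nc_def by (rule card_mono) auto

lemma Nc_top: "Nc n lam n = n"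
proof -
  have "{b \<in> {1..n}. pcol lam b \<le> n} = {1..n}" by (auto simp: pcol_def)
  then show ?thesis by (simp add: Nc_def)
qed

lemma bt_le_iff: assumes "k \<le> n" shows "bt n lam k \<le> c \<longleftrightarrow> k \<le> Nc n lam c"
proof
  assume "bt n lam k \<le> c"
  moreover have "k \<le> Nc n lam (bt n lam k)" unfolding bt_def by (rule LeastI[of _ n]) (use assms Nc_top in simp)
  ultimately show "k \<le> Nc n lam c" using Nc_mono order_trans by blast
next
  assume "k \<le> Nc n lam c" then show "bt n lam k \<le> c" unfolding bt_def by (rule Least_le)
qed

lemma bt_mono: "j \<le> k \<Longrightarrow> k \<le> n \<Longrightarrow> bt n lam j \<le> bt n lam k"
  using bt_le_iff[of j n lam "bt n lam k"] bt_le_iff[of k n lam "bt n lam k"] by simp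

lemma bt_Jc: assumes "k \<in> {1..<n}" shows "k \<in> Jc n lam \<longleftrightarrow> bt n lam (Suc k) = bt n lam k"
proof
  assume "k \<in> Jc n lam"
  then have "k \<noteq> Nc n lam (bt n lam k)" by (auto simp: Jc_def)
  moreover have "k \<le> Nc n lam (bt n lam k)" using bt_le_iff[of k n lam "bt n lam k"] assms by simp
  ultimately have "Suc k \<le> Nc n lam (bt n lam k)" by simp
  then have "bt n lam (Suc k) \<le> bt n lam k" using bt_le_iff[of "Suc k" n lam] assms by simp
  then show "bt n lam (Suc k) = bt n lam k" using bt_mono[of k "Suc k" n lam] assms by simp
next
  assume e: "bt n lam (Suc k) = bt n lam k"
  have "k \<noteq> Nc n lam c" for c
  proof
    assume "k = Nc n lam c"
    then have "bt n lam k \<le> c" "\<not> bt n lam (Suc k) \<le> c"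
      using bt_le_iff[of k n lam c] bt_le_iff[of "Suc k" n lam c] assms by auto
    then show False using e by simp
  qed
  then show "k \<in> Jc n lam" using assms by (auto simp: Jc_def)
qed

lemma d0_less: assumes "a \<in> {1..n}" "b \<in> {1..n}" "pcol lam b < pcol lam a \<or> (pcol lam b = pcol lam a \<and> b < a)"
  shows "d0 n lam b < d0 n lam a"
proof -
  have "{x \<in> {1..n}. pcol lam x < pcol lam b \<or> (pcol lam x = pcol lam b \<and> x \<le> b)} \<subset>
        {x \<in> {1..n}. pcol lam x < pcol lam a \<or> (pcol lam x = pcol lam a \<and> x \<le> a)}"
    using assms by auto
  then show ?thesis unfolding d0_def using assms by (simp add: psubset_card_mono)
qed

lemma d0_range: assumes "a \<in> {1..n}" shows "d0 n lam a \<in> {1..n}"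
proof -
  let ?A = "{b \<in> {1..n}. pcol lam b < pcol lam a \<or> (pcol lam b = pcol lam a \<and> b \<le> a)}"
  have e: "d0 n lam a = card ?A" using assms by (simp add: d0_def)
  have "a \<in> ?A" using assms by simp
  then have "card ?A > 0" by (subst card_gt_0_iff) auto
  then have 1: "1 \<le> card ?A" by linarith
  have cn: "card {1..n} = n" by simp
  have "card ?A \<le> card {1..n}" by (rule card_mono) auto
  then have 2: "card ?A \<le> n" unfolding cn .
  show ?thesis unfolding e by (rule iffD2[OF atLeastAtMost_iff conjI[OF 1 2]])
qed

lemma d0_Wn: "d0 n lam \<in> Wn n"
  unfolding Wn_def mem_Collect_eq
proof (rule bij_imp_permutes)
  have inj: "inj_on (d0 n lam) {1..n}"
  proof (rule inj_onI, rule ccontr)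
    fix a b assume ab: "a \<in> {1..n}" "b \<in> {1..n}" "d0 n lam a = d0 n lam b" "a \<noteq> b"
    then consider "pcol lam b < pcol lam a \<or> (pcol lam b = pcol lam a \<and> b < a)"
      | "pcol lam a < pcol lam b \<or> (pcol lam a = pcol lam b \<and> a < b)" by (metis linorder_neqE_nat)
    then show False using d0_less[of a n b lam] d0_less[of b n a lam] ab by cases auto
  qed
  have "d0 n lam ` {1..n} \<subseteq> {1..n}" using d0_range by blast
  then have "d0 n lam ` {1..n} = {1..n}" using inj by (simp add: endo_inj_surj)
  then show "bij_betw (d0 n lam) {1..n} {1..n}" using inj by (simp add: bij_betw_def)
qed (simp only: d0_def if_False)

lemma bt_d0: assumes "a \<in> {1..n}" shows "bt n lam (d0 n lam a) = pcol lam a"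
proof -
  let ?A = "{b \<in> {1..n}. pcol lam b < pcol lam a \<or> (pcol lam b = pcol lam a \<and> b \<le> a)}"
  have d: "d0 n lam a = card ?A" "d0 n lam a \<le> n" using assms d0_range[OF assms] by (auto simp: d0_def)
  have "card ?A \<le> Nc n lam (pcol lam a)" unfolding Nc_def by (rule card_mono) auto
  then have "bt n lam (d0 n lam a) \<le> pcol lam a" using bt_le_iff[OF d(2)] d by simp
  moreover have "\<not> bt n lam (d0 n lam a) \<le> c" if "c < pcol lam a" for c
  proof -
    have "{b \<in> {1..n}. pcol lam b \<le> c} \<subset> ?A" using assms that by auto
    then have "Nc n lam c < card ?A" unfolding Nc_def by (rule psubset_card_mono[rotated]) simp
    then show ?thesis using bt_le_iff[OF d(2)] d by simp
  qed
  ultimately show ?thesis by (metis linorder_neqE_nat not_le order_refl)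
qed

lemma card_Wn: assumes "w \<in> Wn n" shows "card {a \<in> {1..n}. Q (w a)} = card {b \<in> {1..n}. Q b}"
proof (rule bij_betw_same_card[of w])
  show "bij_betw w {a \<in> {1..n}. Q (w a)} {b \<in> {1..n}. Q b}"
    unfolding bij_betw_def
  proof
    show "inj_on w {a \<in> {1..n}. Q (w a)}" using Wn_inj[OF assms] by (auto intro: inj_onI)
    show "w ` {a \<in> {1..n}. Q (w a)} = {b \<in> {1..n}. Q b}"
    proof
      show "w ` {a \<in> {1..n}. Q (w a)} \<subseteq> {b \<in> {1..n}. Q b}" using Wn_range[OF assms] by blast
      show "{b \<in> {1..n}. Q b} \<subseteq> w ` {a \<in> {1..n}. Q (w a)}"
      proof
        fix b assume b: "b \<in> {b \<in> {1..n}. Q b}"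
        then have "ivp w b \<in> {a \<in> {1..n}. Q (w a)}" using Wn_range[OF inv_Wn[OF assms], of b] assms by simp
        then have "w (ivp w b) \<in> w ` {a \<in> {1..n}. Q (w a)}" by (rule imageI)
        then show "b \<in> w ` {a \<in> {1..n}. Q (w a)}" using assms by simp
      qed
    qed
  qed
qed

lemma sum_Wn: assumes "w \<in> Wn n" shows "(\<Sum>a\<in>{1..n}. f (w a)) = (\<Sum>a\<in>{1..n}. f a)"
  by (rule sum.reindex_bij_witness[of _ "ivp w" w])
    (use assms Wn_range[OF assms] Wn_range[OF inv_Wn[OF assms]] in auto)

text \<open>Distinguished double coset representatives of trivial type for the row group of mu and the
  column group of lam: the only ones that survive between a symmetrizer and an antisymmetrizer, because the
  eigenvalues v and -1/v of a common generator differ. Such a d puts the entries of each row of mu into different columns of lam.\<close>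
definition good :: "nat \<Rightarrow> nat list \<Rightarrow> nat list \<Rightarrow> perm \<Rightarrow> bool" where
  "good n lam mu d \<longleftrightarrow> d \<in> Wn n \<and> (\<forall>k\<in>Jl n mu. d k < d (Suc k)) \<and>
     (\<forall>k\<in>Jc n lam. ivp d k < ivp d (Suc k)) \<and> (\<forall>k\<in>Jl n mu. \<not> (d k \<in> Jc n lam \<and> d (Suc k) = Suc (d k)))"

lemma bt_block: assumes "bt n lam a = bt n lam b" "1 \<le> a" "b \<le> n" "a \<le> j" "j < b" shows "j \<in> Jc n lam"
proof -
  have "bt n lam a \<le> bt n lam j" "bt n lam j \<le> bt n lam (Suc j)" "bt n lam (Suc j) \<le> bt n lam b"
    using assms bt_mono[of a j n lam] bt_mono[of j "Suc j" n lam] bt_mono[of "Suc j" b n lam] by auto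
  then have "bt n lam (Suc j) = bt n lam j" using assms(1) by simp
  then show ?thesis using bt_Jc[of j n lam] assms by auto
qed

text \<open>If \<open>d k\<close> and \<open>d (Suc k)\<close> lay in one column, the inverse of d
  would increase along all values between them. Adjacent values are excluded by the last clause of
  \<open>good\<close>; otherwise the preimage of \<open>Suc (d k)\<close> would lie strictly between
  k and k + 1.\<close>

lemma good_bt: assumes g: "good n lam mu d" and k: "k \<in> Jl n mu"
  shows "bt n lam (d k) < bt n lam (d (Suc k))"
proof (rule ccontr)
  assume a: "\<not> bt n lam (d k) < bt n lam (d (Suc k))"
  have d: "d \<in> Wn n" and lt: "d k < d (Suc k)" using g k by (auto simp: good_def)
  have k': "k \<in> {1..n}" "Suc k \<in> {1..n}" using k by (auto simp: Jl_def)
  have r: "d k \<in> {1..n}" "d (Suc k) \<in> {1..n}" using Wn_range[OF d] k' by blast+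
  have e: "bt n lam (d k) = bt n lam (d (Suc k))" using a bt_mono[of "d k" "d (Suc k)" n lam] lt r by simp
  have J: "j \<in> Jc n lam" if "d k \<le> j" "j < d (Suc k)" for j
    by (rule bt_block[OF e _ _ that]) (use r in auto)
  have m: "ivp d j < ivp d (Suc j)" if "d k \<le> j" "j < d (Suc k)" for j
    using J[OF that] g by (auto simp: good_def)
  have "d (Suc k) \<noteq> Suc (d k)" using J[of "d k"] lt g k by (auto simp: good_def)
  then have lt2: "Suc (d k) < d (Suc k)" using lt by simp
  have "ivp d (d k) < ivp d (Suc (d k))" using m[of "d k"] lt by simp
  moreover have "ivp d (Suc (d k)) < ivp d (d (Suc k))"
    by (rule mono_interval[OF _ lt2]) (use m in auto)
  ultimately show False using d by simp
qed

lemma good_row_mono: assumes mu: "mu \<in> Par n" and g: "good n lam mu d" and ab: "a \<in> {1..n}" "b \<in> {1..n}" "a < b" "prow mu a = prow mu b"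
  shows "bt n lam (d a) < bt n lam (d b)"
proof (rule mono_interval[OF _ ab(3), of "\<lambda>j. bt n lam (d j)"])
  fix j assume j: "a \<le> j" "j < b"
  have "prow mu a \<le> prow mu j" "prow mu j \<le> prow mu (Suc j)" "prow mu (Suc j) \<le> prow mu b"
    using row_le_iff[OF mu, of a "prow mu j"] row_le_iff[OF mu, of j "prow mu (Suc j)"]
      row_le_iff[OF mu, of "Suc j" "prow mu b"] row_props(2)[OF mu, of j] row_props(2)[OF mu, of "Suc j"]
      row_props(2)[OF mu, of b] ab j by auto
  then have "prow mu (Suc j) = prow mu j" using ab(4) by simp
  then have "j \<in> Jl n mu" using row_Jl[OF mu, of j] ab j by auto
  then show "bt n lam (d j) < bt n lam (d (Suc j))" by (rule good_bt[OF g])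
qed

text \<open>Since the entries of a row of mu go to different columns, the first k rows of mu put at
  most k entries into column c of lam, and never more than its height. The smaller bound is the
  number of cells of that column in the first k rows of lam; then sum over c.\<close>

lemma good_dominates: assumes lam: "lam \<in> Par n" and mu: "mu \<in> Par n" and g: "good n lam mu d"
  shows "dominates mu lam"
  unfolding dominates_Psum
proof
  fix k
  have d: "d \<in> Wn n" using g by (simp add: good_def)
  have cnt: "card {a \<in> {1..n}. prow nu a \<le> k} = Psum nu k" if "nu \<in> Par n" for nu
  proof -
    have "{a \<in> {1..n}. prow nu a \<le> k} = {1..Psum nu k}"
      using row_le_iff[OF that] Psum_le[OF that, of k] by auto
    then show ?thesis by simp
  qed
  have split: "card {a \<in> {1..n}. Q a} = (\<Sum>c\<in>f ` {1..n}. card {a \<in> {1..n}. f a = c \<and> Q a})" for Q and f :: "nat \<Rightarrow> nat"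
  proof -
    have "{a \<in> {1..n}. Q a} = (\<Union>c\<in>f ` {1..n}. {a \<in> {1..n}. f a = c \<and> Q a})" by auto
    then show ?thesis by (simp only:) (rule card_UN_disjoint, auto)
  qed
  have img: "(\<lambda>a. bt n lam (d a)) ` {1..n} = pcol lam ` {1..n}"
  proof -
    have r: "w ` {1..n} = {1..n}" if "w \<in> Wn n" for w using that unfolding Wn_def by (auto simp: permutes_image)
    have "(\<lambda>a. bt n lam (d a)) ` {1..n} = bt n lam ` (d ` {1..n})" by (simp add: image_image)
    also have "\<dots> = bt n lam ` (d0 n lam ` {1..n})" using r[OF d] r[OF d0_Wn] by simp
    also have "\<dots> = pcol lam ` {1..n}" unfolding image_image by (rule image_cong) (auto simp: bt_d0)
    finally show ?thesis .
  qed
  have "Psum mu k = (\<Sum>c\<in>pcol lam ` {1..n}. card {a \<in> {1..n}. bt n lam (d a) = c \<and> prow mu a \<le> k})"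
    unfolding cnt[OF mu, symmetric] split[of "\<lambda>a. prow mu a \<le> k" "\<lambda>a. bt n lam (d a)"] img ..
  also have "\<dots> \<le> (\<Sum>c\<in>pcol lam ` {1..n}. card {a \<in> {1..n}. pcol lam a = c \<and> prow lam a \<le> k})"
  proof (rule sum_mono)
    fix c assume "c \<in> pcol lam ` {1..n}"
    then have c1: "1 \<le> c" using row_props(5)[OF lam] by auto
    let ?A = "{a \<in> {1..n}. bt n lam (d a) = c \<and> prow mu a \<le> k}"
    let ?B = "{a \<in> {1..n}. pcol lam a = c \<and> prow lam a \<le> k}"
    show "card ?A \<le> card ?B"
    \<comment> \<open>Either the column ends within the first k rows, and its height is the bound,
      or it meets each of them, and k is the bound.\<close>
    proof (cases "\<exists>b\<in>{1..n}. pcol lam b = c \<and> \<not> prow lam b \<le> k")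
      case False
      then have B: "?B = {a \<in> {1..n}. pcol lam a = c}" by auto
      have "card ?A \<le> card {a \<in> {1..n}. bt n lam (d a) = c}" by (rule card_mono) auto
      also have "\<dots> = card {a \<in> {1..n}. bt n lam (d0 n lam a) = c}"
        using card_Wn[OF d, of "\<lambda>x. bt n lam x = c"] card_Wn[OF d0_Wn, of n "\<lambda>x. bt n lam x = c" lam] by simp
      also have "{a \<in> {1..n}. bt n lam (d0 n lam a) = c} = {a \<in> {1..n}. pcol lam a = c}" by (auto simp: bt_d0)
      finally show ?thesis using B by simp
    next
      case True
      then obtain b where b: "b \<in> {1..n}" "pcol lam b = c" "k < prow lam b" by auto
      have "inj_on (prow mu) ?A"
      proof (rule inj_onI, rule ccontr)
        fix x y assume xy: "x \<in> ?A" "y \<in> ?A" "prow mu x = prow mu y" "x \<noteq> y"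
        then consider "x < y" | "y < x" by linarith
        then show False using good_row_mono[OF mu g, of x y] good_row_mono[OF mu g, of y x] xy by cases auto
      qed
      moreover have "prow mu ` ?A \<subseteq> {1..k}" using row_props(1)[OF mu] by auto
      ultimately have "card ?A \<le> card {1..k}" by (intro card_inj_on_le[of "prow mu"]) auto
      also have "\<dots> \<le> card ?B"
      \<comment> \<open>The witness is the cell of row r in column c, as a number of the row
        reading.\<close>
      proof (rule card_inj_on_le[of "\<lambda>r. Psum lam (r - 1) + c"])
        have key: "Psum lam (r - 1) + c \<le> Psum lam r \<and> prow lam (Psum lam (r - 1) + c) = r" if "r \<in> {1..k}" for r
        proof -
          have rb: "r - 1 < length lam" "prow lam b - 1 < length lam"
            using row_props(1,4)[OF lam b(1)] b(3) that by auto
          have "c \<le> lam ! (prow lam b - 1)" using row_props(6)[OF lam b(1)] b by simp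
          also have "\<dots> \<le> lam ! (r - 1)" by (rule Par_sorted[OF lam _ rb(2)]) (use that b in auto)
          finally have le: "Psum lam (r - 1) + c \<le> Psum lam (Suc (r - 1))" using rb by (simp add: Psum_Suc)
          have "prow lam (Psum lam (r - 1) + c) = Suc (r - 1)" by (rule row_eqI[OF lam _ le]) (use c1 in simp)
          then show ?thesis using le that by auto
        qed
        show "inj_on (\<lambda>r. Psum lam (r - 1) + c) {1..k}" by (rule inj_onI) (metis key)
        show "(\<lambda>r. Psum lam (r - 1) + c) ` {1..k} \<subseteq> ?B"
        proof clarify
          fix r assume r: "r \<in> {1..k}"
          have "Psum lam (r - 1) + c \<le> n" using key[OF r] Psum_le[OF lam, of r] by linarith
          then show "Psum lam (r - 1) + c \<in> {1..n} \<and> pcol lam (Psum lam (r - 1) + c) = c \<and> prow lam (Psum lam (r - 1) + c) \<le> k"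
            using key[OF r] r c1 by (auto simp: pcol_def)
        qed
      qed simp
      finally show ?thesis .
    qed
  qed
  also have "\<dots> = Psum lam k"
    unfolding cnt[OF lam, symmetric] split[of "\<lambda>a. prow lam a \<le> k" "pcol lam"] ..
  finally show "Psum mu k \<le> Psum lam k" .
qed

text \<open>Strict growth of columns along rows gives
  \<open>pcol lam a \<le> bt n lam (d a)\<close>. Both sides have the same sum over a, so they agree
  everywhere, and monotonicity of the inverse of d fixes the order inside each column.\<close>

lemma good_unique: assumes lam: "lam \<in> Par n" and g: "good n lam lam d" shows "d = d0 n lam"
proof -
  have d: "d \<in> Wn n" using g by (simp add: good_def)
  have ge: "pcol lam a \<le> bt n lam (d a)" if "a \<in> {1..n}" for a
    using that
  proof (induction a)
    case (Suc a)
    show ?case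
    proof (cases "a \<in> Jl n lam")
      case True
      then have "pcol lam a \<le> bt n lam (d a)" using Suc.IH by (auto simp: Jl_def)
      then show ?thesis using good_bt[OF g True] Jl_col[OF lam True] by simp
    next
      case False
      have "pcol lam (Suc a) \<le> 1"
      proof (cases "a = 0")
        case True then show ?thesis by (simp add: pcol_def)
      next
        case nz: False
        then have "a \<in> {1..<n}" using Suc.prems by auto
        then obtain i where i: "a = Psum lam i" using False by (auto simp: Jl_def)
        have "\<not> prow lam (Suc a) \<le> i" using row_le_iff[OF lam, of "Suc a" i] Suc.prems i by simp
        then have "Psum lam i \<le> Psum lam (prow lam (Suc a) - 1)" by (intro Psum_mono) simp
        then show ?thesis using i by (simp add: pcol_def)
      qed
      moreover have "1 \<le> bt n lam (d (Suc a))"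
      proof -
        have dr: "d (Suc a) \<in> {1..n}" using Wn_range[OF d] Suc.prems by blast
        have "{b \<in> {1..n}. pcol lam b \<le> 0} = {}" using row_props(5)[OF lam] by fastforce
        then have "Nc n lam 0 = 0" unfolding Nc_def by (simp only: card.empty)
        then show ?thesis using bt_le_iff[of "d (Suc a)" n lam 0] dr by (cases "bt n lam (d (Suc a))") auto
      qed
      ultimately show ?thesis by simp
    qed
  qed simp
  have "(\<Sum>a\<in>{1..n}. bt n lam (d a)) = (\<Sum>a\<in>{1..n}. bt n lam (d0 n lam a))"
    using sum_Wn[OF d, of "bt n lam"] sum_Wn[OF d0_Wn, of "bt n lam" n lam] by simp
  also have "\<dots> = (\<Sum>a\<in>{1..n}. pcol lam a)" by (rule sum.cong) (auto simp: bt_d0)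
  finally have se: "(\<Sum>a\<in>{1..n}. bt n lam (d a)) = (\<Sum>a\<in>{1..n}. pcol lam a)" .
  have eq: "bt n lam (d a) = pcol lam a" if "a \<in> {1..n}" for a
  proof (rule ccontr)
    assume "bt n lam (d a) \<noteq> pcol lam a"
    then have "pcol lam a < bt n lam (d a)" using ge[OF that] by simp
    then have "(\<Sum>a\<in>{1..n}. pcol lam a) < (\<Sum>a\<in>{1..n}. bt n lam (d a))"
      using ge that by (intro sum_strict_mono_ex1) auto
    then show False using se by simp
  qed
  have iff: "d b \<le> d a \<longleftrightarrow> pcol lam b < pcol lam a \<or> (pcol lam b = pcol lam a \<and> b \<le> a)" if ab: "a \<in> {1..n}" "b \<in> {1..n}" for a b
  proof -
    have r: "d a \<in> {1..n}" "d b \<in> {1..n}" using Wn_range[OF d] ab by blast+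
    have *: "b < a" if "d b < d a" "pcol lam b = pcol lam a" "a \<in> {1..n}" "b \<in> {1..n}" for a b
    proof -
      have r: "d a \<in> {1..n}" "d b \<in> {1..n}" using Wn_range[OF d] that by blast+
      have e: "bt n lam (d b) = bt n lam (d a)" using eq that by simp
      have "ivp d (d b) < ivp d (d a)"
      proof (rule mono_interval[OF _ that(1)])
        fix j assume "d b \<le> j" "j < d a"
        then have "j \<in> Jc n lam" by (intro bt_block[OF e]) (use r in auto)
        then show "ivp d j < ivp d (Suc j)" using g by (auto simp: good_def)
      qed
      then show ?thesis using d by simp
    qed
    consider "pcol lam b < pcol lam a" | "pcol lam a < pcol lam b" | "pcol lam b = pcol lam a" by linarith
    then show ?thesis
    proof cases
      case 1
      then have "bt n lam (d b) < bt n lam (d a)" using eq ab by simp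
      then have "\<not> d a \<le> d b" using bt_mono[of "d a" "d b" n lam] r by auto
      then show ?thesis using 1 by simp
    next
      case 2
      then have "bt n lam (d a) < bt n lam (d b)" using eq ab by simp
      then have "\<not> d b \<le> d a" using bt_mono[of "d b" "d a" n lam] r by auto
      then show ?thesis using 2 by simp
    next
      case 3
      have "d b = d a \<longleftrightarrow> b = a" by (rule Wn_inj[OF d])
      then show ?thesis using *[of b a] *[of a b] 3 ab by (cases "d b" "d a" rule: linorder_cases) auto
    qed
  qed
  show ?thesis
  proof
    fix a
    show "d a = d0 n lam a"
    proof (cases "a \<in> {1..n}")
      case True
      then have r: "d a \<in> {1..n}" using Wn_range[OF d] by blast
      have "d a = card {b \<in> {1..n}. b \<le> d a}"
      proof -
        have "{b \<in> {1..n}. b \<le> d a} = {1..d a}" using r by auto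
        then show ?thesis by simp
      qed
      also have "\<dots> = card {b \<in> {1..n}. d b \<le> d a}" using card_Wn[OF d, of "\<lambda>x. x \<le> d a"] by simp
      also have "{b \<in> {1..n}. d b \<le> d a} = {b \<in> {1..n}. pcol lam b < pcol lam a \<or> (pcol lam b = pcol lam a \<and> b \<le> a)}"
        using iff[OF True] by blast
      finally show ?thesis using True by (simp add: d0_def)
    next
      case False
      then show ?thesis using d unfolding Wn_def permutes_def d0_def by auto
    qed
  qed
qed

lemma d0_row: assumes "lam \<in> Par n" "k \<in> Jl n lam"
  shows "d0 n lam k < d0 n lam (Suc k)" "bt n lam (d0 n lam k) < bt n lam (d0 n lam (Suc k))"
proof -
  have k: "k \<in> {1..n}" "Suc k \<in> {1..n}" using assms(2) by (auto simp: Jl_def)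
  show "d0 n lam k < d0 n lam (Suc k)" using d0_less[OF k(2,1)] Jl_col[OF assms] by simp
  show "bt n lam (d0 n lam k) < bt n lam (d0 n lam (Suc k))" using bt_d0 k Jl_col[OF assms] by simp
qed

lemma d0_col: assumes "k \<in> Jc n lam" shows "ivp (d0 n lam) k < ivp (d0 n lam) (Suc k)"
proof (rule ccontr)
  let ?d = "d0 n lam"
  let ?a = "ivp ?d k" and ?b = "ivp ?d (Suc k)"
  assume "\<not> ?a < ?b"
  have k: "k \<in> {1..<n}" using assms by (auto simp: Jc_def)
  have dd: "?d ?a = k" "?d ?b = Suc k" using d0_Wn[of n lam] by simp_all
  have r: "?a \<in> {1..n}" "?b \<in> {1..n}" using Wn_range[OF inv_Wn[OF d0_Wn]] k by auto
  have "bt n lam (Suc k) = bt n lam k" using bt_Jc[OF k] assms by blast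
  then have c: "pcol lam ?b = pcol lam ?a" using bt_d0[OF r(1), of lam] bt_d0[OF r(2), of lam] dd by simp
  have "?a \<noteq> ?b" using dd by auto
  then have "?d ?b < ?d ?a" using d0_less[OF r, of lam] c \<open>\<not> ?a < ?b\<close> by simp
  then show False using dd by simp
qed

section \<open>Sandwiches between a column symmetrizer and a row antisymmetrizer\<close>

context hecke
begin

abbreviation "xs mu \<equiv> xJ (Jl n mu) qs"
abbreviation "xi lam \<equiv> xJ (Jc n lam) vK"

lemma Jl_S: "Jl n lam \<subseteq> S" and Jc_S: "Jc n lam \<subseteq> S" by (rule Jl_subset, rule Jc_subset)

lemma hk_xs [simp]: "hk (xs mu)" and hk_xi [simp]: "hk (xi lam)"
  by (rule hk_xJ[OF Jl_S], rule hk_xJ[OF Jc_S])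

lemma wlam_wJ: "wlam n lam = wJ (Jl n lam)"
  unfolding wlam_def wJ_def[OF Jl_S] young_Jl ..
lemma aval_wJ: "aval n lam = l (wJ (Jl n lam))" unfolding aval_def wlam_wJ ..

definition sandw :: "nat list \<Rightarrow> nat list \<Rightarrow> perm \<Rightarrow> hk" where "sandw lam mu w = xi lam \<star> (Tb w \<star> xs mu)"

lemma hk_sandw: "hk (sandw lam mu w)" unfolding sandw_def by (intro hk_hm hk_xs)

lemma Tb_gen_xs: assumes "k \<in> Jl n mu" shows "Tb (gen k) \<star> xs mu = (\<lambda>u. qs * xs mu u)"
proof -
  have "k \<in> S" using Jl_S assms by blast
  then have "Tb (gen k) \<star> xs mu = L k (xs mu)" by (rule hm_gen[OF _ hk_xs])
  also have "\<dots> = (\<lambda>u. qs * xs mu u)" by (rule L_xJ[OF Jl_S qsign assms])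
  finally show ?thesis .
qed
lemma xi_Tb_gen: assumes "k \<in> Jc n mu" shows "xi mu \<star> Tb (gen k) = (\<lambda>u. vK * xi mu u)"
proof -
  have "k \<in> S" using Jc_S assms by blast
  then have "xi mu \<star> Tb (gen k) = R k (xi mu)" by (rule hm_gen_right[OF _ hk_xi])
  also have "\<dots> = (\<lambda>u. vK * xi mu u)" by (rule R_xJ[OF Jc_S qindex assms])
  finally show ?thesis .
qed

lemma Tb_comp_gen_xs: assumes "w \<in> W" "k \<in> Jl n mu" "l (w \<circ> gen k) = Suc (l w)"
  shows "Tb (w \<circ> gen k) \<star> xs mu = (\<lambda>u. qs * (Tb w \<star> xs mu) u)"
proof -
  have kS: "k \<in> S" using assms(2) Jl_S by blast
  have "Tb (w \<circ> gen k) \<star> xs mu = (Tb w \<star> Tb (gen k)) \<star> xs mu" using Tb_mult_gen_right[OF kS assms(1,3)] by simp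
  also have "\<dots> = Tb w \<star> (Tb (gen k) \<star> xs mu)" by (rule hm_assoc) (use assms kS in auto)
  also have "\<dots> = (\<lambda>u. qs * (Tb w \<star> xs mu) u)" by (subst Tb_gen_xs[OF assms(2)]) (rule hm_scale_right)
  finally show ?thesis .
qed

lemma xi_Tb_gen_comp: assumes "w \<in> W" "k \<in> Jc n lam" "l (gen k \<circ> w) = Suc (l w)" "hk h"
  shows "xi lam \<star> (Tb (gen k \<circ> w) \<star> h) = (\<lambda>u. vK * (xi lam \<star> (Tb w \<star> h)) u)"
proof -
  have kS: "k \<in> S" using assms(2) Jc_S by blast
  have h: "hk (Tb w)" "hk (Tb (gen k))" "hk (Tb w \<star> h)" using assms kS by (auto intro: hk_hm)
  have "xi lam \<star> (Tb (gen k \<circ> w) \<star> h) = xi lam \<star> ((Tb (gen k) \<star> Tb w) \<star> h)" using Tb_mult_gen[OF kS assms(1,3)] by simp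
  also have "\<dots> = xi lam \<star> (Tb (gen k) \<star> (Tb w \<star> h))" using hm_assoc[OF h(2,1) assms(4)] by simp
  also have "\<dots> = (xi lam \<star> Tb (gen k)) \<star> (Tb w \<star> h)" by (rule hm_assoc[OF hk_xi h(2,3), symmetric])
  also have "\<dots> = (\<lambda>u. vK * (xi lam \<star> (Tb w \<star> h)) u)" by (subst xi_Tb_gen[OF assms(2)]) (rule hm_scale_left)
  finally show ?thesis .
qed

text \<open>A right descent along a row or a left descent along a column is absorbed as an
  eigenvalue. What resists reduction is either \<open>good\<close> or admits a generator with
  \<open>gen (w k) \<circ> w = w \<circ> gen k\<close>, which can be absorbed on both sides.\<close>

lemma sandw_good: assumes "w \<in> W" shows "\<exists>c d. sandw lam mu w = (\<lambda>u. c * sandw lam mu d u) \<and> (c = 0 \<or> good n lam mu d)"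
  using assms
proof (induction "l w" arbitrary: w rule: less_induct)
  case less
  consider (r) k where "k \<in> Jl n mu" "w (Suc k) < w k" | (le) k where "k \<in> Jc n lam" "ivp w (Suc k) < ivp w k"
    | (n) "\<forall>k\<in>Jl n mu. \<not> w (Suc k) < w k" "\<forall>k\<in>Jc n lam. \<not> ivp w (Suc k) < ivp w k" by blast
  then show ?case
  proof cases
    case (r k)
    have kS: "k \<in> S" using r Jl_S by blast
    let ?w = "w \<circ> gen k"
    have w': "?w \<in> W" using less(2) kS by simp
    have lw: "l w = Suc (l ?w)" by (rule len_comp_gen(2)[OF less(2) kS r(2)])
    have "Tb (?w \<circ> gen k) \<star> xs mu = (\<lambda>u. qs * (Tb ?w \<star> xs mu) u)" by (rule Tb_comp_gen_xs[OF w' r(1)]) (use lw in simp)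
    then have "Tb w \<star> xs mu = (\<lambda>u. qs * (Tb ?w \<star> xs mu) u)" by simp
    then have "sandw lam mu w = xi lam \<star> (\<lambda>u. qs * (Tb ?w \<star> xs mu) u)" unfolding sandw_def by (rule arg_cong)
    also have "\<dots> = (\<lambda>u. qs * sandw lam mu ?w u)" unfolding sandw_def by (rule hm_scale_right)
    finally have e: "sandw lam mu w = (\<lambda>u. qs * sandw lam mu ?w u)" .
    obtain c d where cd: "sandw lam mu ?w = (\<lambda>u. c * sandw lam mu d u)" "c = 0 \<or> good n lam mu d"
      using less(1)[of ?w] lw w' by auto
    have "sandw lam mu w = (\<lambda>u. (qs * c) * sandw lam mu d u)" using e fun_cong[OF cd(1)] by (simp add: fun_eq_iff mult.assoc)
    then show ?thesis using cd(2) by (intro exI[of _ "qs * c"] exI[of _ d]) auto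
  next
    case (le k)
    have kS: "k \<in> S" using le Jc_S by blast
    let ?w = "gen k \<circ> w"
    have w': "?w \<in> W" using less(2) kS by simp
    have lw: "l w = Suc (l ?w)" by (rule len_gen_comp(2)[OF less(2) kS le(2)])
    have "xi lam \<star> (Tb (gen k \<circ> ?w) \<star> xs mu) = (\<lambda>u. vK * (xi lam \<star> (Tb ?w \<star> xs mu)) u)"
      by (rule xi_Tb_gen_comp[OF w' le(1) _ hk_xs]) (use lw in simp)
    then have e: "sandw lam mu w = (\<lambda>u. vK * sandw lam mu ?w u)" unfolding sandw_def by simp
    obtain c d where cd: "sandw lam mu ?w = (\<lambda>u. c * sandw lam mu d u)" "c = 0 \<or> good n lam mu d"
      using less(1)[of ?w] lw w' by auto
    have "sandw lam mu w = (\<lambda>u. (vK * c) * sandw lam mu d u)" using e fun_cong[OF cd(1)] by (simp add: fun_eq_iff mult.assoc)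
    then show ?thesis using cd(2) by (intro exI[of _ "vK * c"] exI[of _ d]) auto
  next
    case n
    have asc: "w k < w (Suc k)" if "k \<in> Jl n mu" for k
      using n(1) that Wn_inj[OF less(2), of k "Suc k"] by (metis linorder_neqE_nat n_not_Suc_n)
    have asc': "ivp w k < ivp w (Suc k)" if "k \<in> Jc n lam" for k
      using n(2) that Wn_inj[OF inv_Wn[OF less(2)], of k "Suc k"] by (metis linorder_neqE_nat n_not_Suc_n)
    show ?thesis
    proof (cases "\<exists>k\<in>Jl n mu. w k \<in> Jc n lam \<and> w (Suc k) = Suc (w k)")
      case False
      then have "good n lam mu w" using asc asc' less(2) by (auto simp: good_def)
      then show ?thesis by (intro exI[of _ 1] exI[of _ w]) simp
    next
      case True
      then obtain k where k: "k \<in> Jl n mu" "w k \<in> Jc n lam" "w (Suc k) = Suc (w k)" by blast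
      have kS: "k \<in> S" "w k \<in> S" using k Jl_S Jc_S by blast+
      have c: "gen (w k) \<circ> w = w \<circ> gen k"
      proof
        fix a show "(gen (w k) \<circ> w) a = (w \<circ> gen k) a"
          using Wn_inj[OF less(2), of a k] Wn_inj[OF less(2), of a "Suc k"] k(3) by (simp add: gen_apply)
      qed
      have l1: "l (w \<circ> gen k) = Suc (l w)" by (rule len_comp_gen(1)[OF less(2) kS(1) asc[OF k(1)]])
      have 1: "sandw lam mu (w \<circ> gen k) u = qs * sandw lam mu w u" for u
      proof -
        have "sandw lam mu (w \<circ> gen k) = xi lam \<star> (\<lambda>u. qs * (Tb w \<star> xs mu) u)"
          unfolding sandw_def using Tb_comp_gen_xs[OF less(2) k(1) l1] by (rule arg_cong)
        also have "\<dots> = (\<lambda>u. qs * sandw lam mu w u)" unfolding sandw_def by (rule hm_scale_right)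
        finally show ?thesis by (rule fun_cong)
      qed
      have 2: "sandw lam mu (gen (w k) \<circ> w) u = vK * sandw lam mu w u" for u
        using fun_cong[OF xi_Tb_gen_comp[OF less(2) k(2) _ hk_xs[of mu]], of u] l1 c unfolding sandw_def by simp
      \<comment> \<open>The two absorptions give the factors -1/v and v, so v + 1/v annihilates the
        sandwich.\<close>
      have nz: "vK + inverse vK \<noteq> 0"
      proof
        assume "vK + inverse vK = 0"
        then have "vK * vK + 1 = 0" by (simp add: field_simps)
        moreover have "pos0 (vK * vK + 1)" by (intro pos0_add pos0_mult pos0_vK pos0_1)
        ultimately show False using pos0_nz by blast
      qed
      have "sandw lam mu w u = 0" for u
      proof -
        have "(vK + inverse vK) * sandw lam mu w u = 0" using 1[of u] 2[of u] unfolding c by (simp add: algebra_simps)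
        then show ?thesis using nz by simp
      qed
      then show ?thesis by (intro exI[of _ 0] exI[of _ id]) (simp add: fun_eq_iff)
    qed
  qed
qed

lemma sandw_expand: assumes "hk h" shows "xi lam \<star> (h \<star> xs mu) = (\<lambda>u. \<Sum>w\<in>W. h w * sandw lam mu w u)"
proof -
  have "h \<star> xs mu = (\<lambda>u. \<Sum>w\<in>W. h w * (Tb w \<star> xs mu) u)" by (subst hk_expand[OF assms]) (rule hm_lc_left)
  then have "xi lam \<star> (h \<star> xs mu) = xi lam \<star> (\<lambda>u. \<Sum>w\<in>W. h w * (Tb w \<star> xs mu) u)" by (rule arg_cong)
  also have "\<dots> = (\<lambda>u. \<Sum>w\<in>W. h w * sandw lam mu w u)" unfolding sandw_def by (rule hm_lc_right)
  finally show ?thesis .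
qed

lemma sandw_dominates: assumes "lam \<in> Par n" "mu \<in> Par n" "hk h" "xi lam \<star> (h \<star> xs mu) \<noteq> (\<lambda>u. 0)"
  shows "dominates mu lam"
proof -
  obtain u where "(\<Sum>w\<in>W. h w * sandw lam mu w u) \<noteq> 0"
    using assms(4) unfolding sandw_expand[OF assms(3)] by (auto simp: fun_eq_iff)
  then obtain w where w: "w \<in> W" "sandw lam mu w u \<noteq> 0" by (metis (no_types, lifting) mult_zero_right sum.neutral)
  obtain c d where cd: "sandw lam mu w = (\<lambda>u. c * sandw lam mu d u)" "c = 0 \<or> good n lam mu d"
    using sandw_good[OF w(1)] by blast
  have "c \<noteq> 0" using fun_cong[OF cd(1), of u] w(2) by auto
  then show ?thesis using cd(2) good_dominates[OF assms(1,2)] by blast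
qed

abbreviation "g0 lam \<equiv> sandw lam lam (d0 n lam)"

lemma sandw_1dim: assumes "lam \<in> Par n" "hk h" shows "\<exists>c. xi lam \<star> (h \<star> xs lam) = (\<lambda>u. c * g0 lam u)"
proof -
  have "\<exists>c. sandw lam lam w = (\<lambda>u. c * g0 lam u)" if w: "w \<in> W" for w
  proof -
    obtain c d where cd: "sandw lam lam w = (\<lambda>u. c * sandw lam lam d u)" "c = 0 \<or> good n lam lam d"
      using sandw_good[OF w] by blast
    show ?thesis
    proof (cases "c = 0")
      case True then show ?thesis using cd(1) by (intro exI[of _ 0]) simp
    next
      case False then show ?thesis using cd good_unique[OF assms(1)] by blast
    qed
  qed
  then obtain c where c: "\<And>w. w \<in> W \<Longrightarrow> sandw lam lam w = (\<lambda>u. c w * g0 lam u)" by metis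
  have "xi lam \<star> (h \<star> xs lam) = (\<lambda>u. (\<Sum>w\<in>W. h w * c w) * g0 lam u)"
    unfolding sandw_expand[OF assms(2)] sum_distrib_right
    by (rule ext, rule sum.cong) (use fun_cong[OF c] in \<open>auto simp: mult.assoc\<close>)
  then show ?thesis by blast
qed

lemma WJ_bt: assumes "u \<in> WJ (Jc n lam)" "a \<in> {1..n}" shows "bt n lam (u a) = bt n lam a"
proof -
  have uW: "u \<in> W" by (rule WJ_W[OF Jc_S assms(1)])
  have r: "u a \<in> {1..n}" using Wn_range[OF uW] assms(2) by blast
  have "bt n lam (u a) \<le> c \<longleftrightarrow> bt n lam a \<le> c" for c
  proof -
    have "Nc n lam c \<notin> Jc n lam" by (auto simp: Jc_def)
    then have "u a \<le> Nc n lam c \<longleftrightarrow> a \<le> Nc n lam c" by (rule WJ_le[OF Jc_S assms(1)])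
    then show ?thesis using bt_le_iff[of "u a" n lam c] bt_le_iff[of a n lam c] r assms(2) by simp
  qed
  then show ?thesis by (metis order_antisym order_refl)
qed

text \<open>Lengths add up in every product of an element u of the column group, \<open>d0\<close>
  and an element u' of the row group. Such a product equals \<open>d0\<close> only for trivial u and
  u', so T_(d0) has coefficient 1.\<close>

lemma g0_nonzero: assumes lam: "lam \<in> Par n" shows "g0 lam \<noteq> (\<lambda>u. 0)"
proof -
  let ?d = "d0 n lam"
  have dW: "?d \<in> W" by (rule d0_Wn)
  have lmin: "rmin (Jc n lam) (ivp ?d)" unfolding rmin_def[OF Jc_S] using d0_col dW by auto
  have lu: "l (u \<circ> ?d) = l u + l ?d" if u: "u \<in> WJ (Jc n lam)" for u
  proof -
    have uW: "u \<in> W" by (rule WJ_W[OF Jc_S u])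
    have "l (ivp ?d \<circ> ivp u) = l (ivp ?d) + l (ivp u)" by (rule len_rmin[OF Jc_S lmin WJ_inv[OF Jc_S u]])
    moreover have "ivp (u \<circ> ?d) = ivp ?d \<circ> ivp u" by (rule inv_comp_Wn[OF uW dW])
    moreover have "l (ivp (u \<circ> ?d)) = l (u \<circ> ?d)" by (rule len_inv[OF comp_Wn[OF uW dW]])
    ultimately show ?thesis using len_inv[OF uW] len_inv[OF dW] by simp
  qed
  have rm: "rmin (Jl n lam) (u \<circ> ?d)" if u: "u \<in> WJ (Jc n lam)" for u
    unfolding rmin_def[OF Jl_S]
  proof (intro conjI ballI)
    have uW: "u \<in> W" by (rule WJ_W[OF Jc_S u])
    show "u \<circ> ?d \<in> W" by (rule comp_Wn[OF uW dW])
    fix k assume k: "k \<in> Jl n lam"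
    have k': "k \<in> {1..n}" "Suc k \<in> {1..n}" using k by (auto simp: Jl_def)
    have dk: "?d k \<in> {1..n}" "?d (Suc k) \<in> {1..n}" using Wn_range[OF dW] k' by blast+
    have ud: "u (?d k) \<in> {1..n}" using Wn_range[OF uW] dk by blast
    have "bt n lam (u (?d k)) < bt n lam (u (?d (Suc k)))"
      using d0_row(2)[OF lam k] WJ_bt[OF u dk(1)] WJ_bt[OF u dk(2)] by simp
    then have "\<not> u (?d (Suc k)) \<le> u (?d k)" using bt_mono[of "u (?d (Suc k))" "u (?d k)" n lam] ud by auto
    then show "(u \<circ> ?d) k < (u \<circ> ?d) (Suc k)" by simp
  qed
  have t: "Tb u \<star> (Tb ?d \<star> Tb u') = Tb (u \<circ> ?d \<circ> u')" and lt: "l (u \<circ> ?d \<circ> u') = l u + l ?d + l u'"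
    if u: "u \<in> WJ (Jc n lam)" "u' \<in> WJ (Jl n lam)" for u u'
  proof -
    have uW: "u \<in> W" "u' \<in> W" using WJ_W[OF Jc_S u(1)] WJ_W[OF Jl_S u(2)] by auto
    show "l (u \<circ> ?d \<circ> u') = l u + l ?d + l u'" using len_rmin[OF Jl_S rm[OF u(1)] u(2)] lu[OF u(1)] by simp
    have "Tb u \<star> (Tb ?d \<star> Tb u') = (Tb u \<star> Tb ?d) \<star> Tb u'" by (rule hm_assoc[symmetric]) (use uW dW in auto)
    also have "Tb u \<star> Tb ?d = Tb (u \<circ> ?d)" by (rule Tb_mult[OF uW(1) dW lu[OF u(1)]])
    also have "Tb (u \<circ> ?d) \<star> Tb u' = Tb (u \<circ> ?d \<circ> u')" by (rule Tb_rmin[OF Jl_S qsign rm[OF u(1)] u(2)])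
    finally show "Tb u \<star> (Tb ?d \<star> Tb u') = Tb (u \<circ> ?d \<circ> u')" .
  qed
  have "Tb ?d \<star> xs lam = (\<lambda>z. \<Sum>u'\<in>WJ (Jl n lam). qs ^ l u' * (Tb ?d \<star> Tb u') z)"
    by (subst xJ_lc[OF Jl_S]) (rule hm_lc_right)
  then have "g0 lam = xi lam \<star> (\<lambda>z. \<Sum>u'\<in>WJ (Jl n lam). qs ^ l u' * (Tb ?d \<star> Tb u') z)"
    unfolding sandw_def by (rule arg_cong)
  also have "\<dots> = (\<lambda>z. \<Sum>u'\<in>WJ (Jl n lam). qs ^ l u' * (xi lam \<star> (Tb ?d \<star> Tb u')) z)" by (rule hm_lc_right)
  also have "\<dots> = (\<lambda>z. \<Sum>u'\<in>WJ (Jl n lam). qs ^ l u' * (\<Sum>u\<in>WJ (Jc n lam). vK ^ l u * Tb (u \<circ> ?d \<circ> u') z))"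
  proof (rule ext, rule sum.cong[OF refl])
    fix z u' assume u': "u' \<in> WJ (Jl n lam)"
    have "xi lam \<star> (Tb ?d \<star> Tb u') = (\<lambda>z. \<Sum>u\<in>WJ (Jc n lam). vK ^ l u * (Tb u \<star> (Tb ?d \<star> Tb u')) z)"
      by (subst xJ_lc[OF Jc_S]) (rule hm_lc_left)
    then have "(xi lam \<star> (Tb ?d \<star> Tb u')) z = (\<Sum>u\<in>WJ (Jc n lam). vK ^ l u * (Tb u \<star> (Tb ?d \<star> Tb u')) z)" by (rule fun_cong)
    also have "\<dots> = (\<Sum>u\<in>WJ (Jc n lam). vK ^ l u * Tb (u \<circ> ?d \<circ> u') z)"
      by (rule sum.cong) (use t[OF _ u'] in auto)
    finally show "qs ^ l u' * (xi lam \<star> (Tb ?d \<star> Tb u')) z = qs ^ l u' * (\<Sum>u\<in>WJ (Jc n lam). vK ^ l u * Tb (u \<circ> ?d \<circ> u') z)" by simp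
  qed
  finally have "g0 lam ?d = (\<Sum>u'\<in>WJ (Jl n lam). qs ^ l u' * (\<Sum>u\<in>WJ (Jc n lam). vK ^ l u * Tb (u \<circ> ?d \<circ> u') ?d))"
    by (rule fun_cong)
  also have "\<dots> = (\<Sum>u'\<in>WJ (Jl n lam). if u' = id then 1 else 0)"
  proof (rule sum.cong[OF refl])
    fix u' assume u': "u' \<in> WJ (Jl n lam)"
    have "(\<Sum>u\<in>WJ (Jc n lam). vK ^ l u * Tb (u \<circ> ?d \<circ> u') ?d) = (\<Sum>u\<in>WJ (Jc n lam). if u = id then (if u' = id then 1 else 0) else 0)"
    proof (rule sum.cong[OF refl])
      fix u assume u: "u \<in> WJ (Jc n lam)"
      show "vK ^ l u * Tb (u \<circ> ?d \<circ> u') ?d = (if u = id then (if u' = id then 1 else 0) else 0)"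
      proof (cases "u = id \<and> u' = id")
        case True
        then have "u \<circ> ?d \<circ> u' = ?d" "l u = 0" by (auto simp only: len_id comp_id id_comp)
        then show ?thesis using True by (simp add: Tb_def)
      next
        case False
        have "l (u \<circ> ?d \<circ> u') \<noteq> l ?d"
          using False lt[OF u u'] len_0_iff[OF WJ_W[OF Jc_S u]] len_0_iff[OF WJ_W[OF Jl_S u']] by auto
        then have "u \<circ> ?d \<circ> u' \<noteq> ?d" by metis
        then have "Tb (u \<circ> ?d \<circ> u') ?d = 0" unfolding Tb_def by simp
        then show ?thesis using False by auto
      qed
    qed
    also have "\<dots> = (if u' = id then 1 else 0)" using finite_WJ[OF Jc_S] WJ_id[of "Jc n lam"] by simp
    finally show "qs ^ l u' * (\<Sum>u\<in>WJ (Jc n lam). vK ^ l u * Tb (u \<circ> ?d \<circ> u') ?d) = (if u' = id then 1 else 0)" by auto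
  qed
  also have "\<dots> = 1" using finite_WJ[OF Jl_S] WJ_id[of "Jl n lam"] by simp
  finally show ?thesis by auto
qed

end

section \<open>Representations and Schur relations\<close>

text \<open>Matrices are plain functions from here on, kept zero outside their range by
  \<open>sup2\<close>; this avoids the dimension side conditions of \<open>mat\<close>.\<close>

type_synonym fm = "nat \<Rightarrow> nat \<Rightarrow> K"

definition mm :: "nat \<Rightarrow> fm \<Rightarrow> fm \<Rightarrow> fm" where "mm d A B = (\<lambda>i j. \<Sum>k<d. A i k * B k j)"
definition mv :: "nat \<Rightarrow> fm \<Rightarrow> (nat \<Rightarrow> K) \<Rightarrow> nat \<Rightarrow> K" where "mv d A u = (\<lambda>i. \<Sum>j<d. A i j * u j)"
definition one :: "nat \<Rightarrow> fm" where "one d = (\<lambda>i j. if i = j \<and> i < d then 1 else 0)"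
definition trc :: "nat \<Rightarrow> fm \<Rightarrow> K" where "trc d A = (\<Sum>i<d. A i i)"
definition sup2 :: "nat \<Rightarrow> nat \<Rightarrow> fm \<Rightarrow> bool" where "sup2 m n A \<longleftrightarrow> (\<forall>i j. \<not> (i < m \<and> j < n) \<longrightarrow> A i j = 0)"

lemma mm_assoc: "mm a (mm b A B) C = mm b A (mm a B C)"
  unfolding mm_def sum_distrib_left sum_distrib_right by (intro ext, subst sum.swap) (simp add: mult_ac)
lemma mv_mm: "mv a (mm b A B) u = mv b A (mv a B u)"
  unfolding mm_def mv_def sum_distrib_left sum_distrib_right by (intro ext, subst sum.swap) (simp add: mult_ac)
lemma trc_mm: "trc m (mm k A B) = trc k (mm m B A)"
  unfolding trc_def mm_def by (subst sum.swap) (simp add: mult_ac)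
lemma mm_one_left: assumes "sup2 m n A" shows "mm m (one m) A = A"
proof (intro ext)
  fix i j
  have "mm m (one m) A i j = (\<Sum>k<m. if k = i then A i j else 0)" unfolding mm_def one_def by (rule sum.cong) auto
  then show "mm m (one m) A i j = A i j" using assms by (auto simp: sup2_def)
qed
lemma mm_one_right: assumes "sup2 m n A" shows "mm n A (one n) = A"
proof (intro ext)
  fix i j
  have "mm n A (one n) i j = (\<Sum>k<n. if k = j then A i j else 0)" unfolding mm_def one_def by (rule sum.cong) auto
  then show "mm n A (one n) i j = A i j" using assms by (auto simp: sup2_def)
qed
lemma sup2_mm: "sup2 m k A \<Longrightarrow> sup2 k' n B \<Longrightarrow> sup2 m n (mm l A B)" by (auto simp: sup2_def mm_def)
lemma sup2_one: "sup2 d d (one d)" by (auto simp: sup2_def one_def)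
lemma mv_0: "mv d (\<lambda>i j. 0) u = (\<lambda>i. 0)" by (simp add: mv_def)
lemma mm_0_left: "mm d (\<lambda>i j. 0) B = (\<lambda>i j. 0)" by (simp add: mm_def)
lemma mm_0_right: "mm d A (\<lambda>i j. 0) = (\<lambda>i j. 0)" by (simp add: mm_def)

lemma inj_inverse:
  assumes S: "sup2 d d A" and inj: "\<And>u. (\<And>i. i < d \<Longrightarrow> mv d A u i = 0) \<Longrightarrow> (\<And>i. i < d \<Longrightarrow> u i = 0)"
  shows "\<exists>B. sup2 d d B \<and> mm d A B = one d \<and> mm d B A = one d"
proof -
  define M where "M = mat d d (\<lambda>(i, j). A i j)"
  have M: "M \<in> carrier_mat d d" by (simp add: M_def)
  have "det M \<noteq> 0"
  proof
    assume "det M = 0"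
    then obtain w where w: "w \<in> carrier_vec d" "w \<noteq> 0\<^sub>v d" "M *\<^sub>v w = 0\<^sub>v d"
      using det_0_iff_vec_prod_zero_field[OF M] by blast
    have "mv d A (\<lambda>j. w $ j) i = 0" if "i < d" for i
    proof -
      have "(M *\<^sub>v w) $ i = mv d A (\<lambda>j. w $ j) i"
        using that w(1) by (simp add: M_def mv_def scalar_prod_def atLeast0LessThan)
      then show ?thesis using w(3) that by simp
    qed
    then have "w $ i = 0" if "i < d" for i using inj that by blast
    then have "w = 0\<^sub>v d" using w(1) by (intro eq_vecI) auto
    then show False using w by simp
  qed
  then have "M \<in> Units (ring_mat TYPE(K) d ())" by (rule det_non_zero_imp_unit[OF M])
  then obtain N where N: "N \<in> carrier_mat d d" "N * M = 1\<^sub>m d" "M * N = 1\<^sub>m d"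
    by (auto simp: Units_def ring_mat_def)
  define B where "B = (\<lambda>i j. if i < d \<and> j < d then N $$ (i, j) else 0)"
  have sB: "sup2 d d B" by (auto simp: sup2_def B_def)
  have 1: "mm d A B = one d"
  proof (intro ext)
    fix i j
    show "mm d A B i j = one d i j"
    proof (cases "i < d \<and> j < d")
      case True
      have "(M * N) $$ (i, j) = mm d A B i j"
        using True N(1) by (simp add: M_def mm_def B_def scalar_prod_def atLeast0LessThan)
      then show ?thesis using N(3) True by (simp add: one_def)
    next
      case False
      then show ?thesis using sup2_mm[OF S sB, of d] by (auto simp: sup2_def one_def)
    qed
  qed
  have 2: "mm d B A = one d"
  proof (intro ext)
    fix i j
    show "mm d B A i j = one d i j"
    proof (cases "i < d \<and> j < d")
      case True
      have "(N * M) $$ (i, j) = mm d B A i j"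
        using True N(1) by (simp add: M_def mm_def B_def scalar_prod_def atLeast0LessThan)
      then show ?thesis using N(2) True by (simp add: one_def)
    next
      case False
      then show ?thesis using sup2_mm[OF sB S, of d] by (auto simp: sup2_def one_def)
    qed
  qed
  show ?thesis using sB 1 2 by blast
qed

locale reps = hecke n for n :: nat +
  fixes d :: "nat list \<Rightarrow> nat" and X :: "nat list \<Rightarrow> perm \<Rightarrow> K mat"
  assumes irr: "\<forall>lam\<in>Par n. irreducible_rep n (d lam) (X lam)"
    and orth: "\<forall>lam\<in>Par n. orthogonal_rep n (d lam) (X lam)"
    and distinct: "inj_on (\<lambda>lam. charX n (X lam)) (Par n)"
    and labelling: "\<forall>lam\<in>Par n. \<exists>m :: nat list \<Rightarrow> nat. \<forall>w\<in>Wn n.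
        indchar n lam w = charX n (X lam) w +
          (\<Sum>mu\<in>{mu\<in>Par n. dominates lam mu \<and> lam \<noteq> mu}. of_nat (m mu) * charX n (X mu) w)"
    and integral: "\<forall>lam\<in>Par n. \<forall>w\<in>Wn n. \<forall>i<d lam. \<forall>j<d lam.
        \<exists>c. cval n lam (X lam) w i j c \<and> c \<in> \<int>"
begin

definition rho :: "nat list \<Rightarrow> hk \<Rightarrow> fm" where
  "rho a h = (\<lambda>i j. if i < d a \<and> j < d a then \<Sum>w\<in>W. h w * X a w $$ (i, j) else 0)"

lemma rho_repH: "i < d a \<Longrightarrow> j < d a \<Longrightarrow> rho a h i j = repH n (d a) (X a) h $$ (i, j)"
  by (simp add: rho_def repH_def)

lemma sup2_rho: "sup2 (d a) (d a) (rho a h)" by (auto simp: sup2_def rho_def)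

lemma rho_lc: "rho a (\<lambda>u. \<Sum>i\<in>I. c i * b i u) = (\<lambda>p q. \<Sum>i\<in>I. c i * rho a (b i) p q)"
proof (intro ext)
  fix p q
  have "(\<Sum>w\<in>W. (\<Sum>i\<in>I. c i * b i w) * X a w $$ (p, q)) = (\<Sum>i\<in>I. c i * (\<Sum>w\<in>W. b i w * X a w $$ (p, q)))"
    unfolding sum_distrib_left sum_distrib_right by (subst sum.swap) (simp add: mult_ac)
  then show "rho a (\<lambda>u. \<Sum>i\<in>I. c i * b i u) p q = (\<Sum>i\<in>I. c i * rho a (b i) p q)"
    by (cases "p < d a \<and> q < d a") (auto simp: rho_def)
qed
lemma rho_scale: "rho a (\<lambda>u. c * b u) = (\<lambda>p q. c * rho a b p q)"
  by (intro ext) (auto simp: rho_def sum_distrib_left mult_ac)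
lemma rho_add: "rho a (\<lambda>u. b u + c u) = (\<lambda>p q. rho a b p q + rho a c p q)"
  by (intro ext) (auto simp: rho_def distrib_right sum.distrib)
lemma rho_0 [simp]: "rho a (\<lambda>u. 0) = (\<lambda>p q. 0)" by (intro ext) (simp add: rho_def)
lemma rho_Tb: "w \<in> W \<Longrightarrow> i < d a \<Longrightarrow> j < d a \<Longrightarrow> rho a (Tb w) i j = X a w $$ (i, j)"
  by (simp add: rho_def Tb_def if_distrib[of "\<lambda>c. c * _"] cong: if_cong)
lemma rho_expand: assumes "hk h" shows "rho a h = (\<lambda>i j. \<Sum>w\<in>W. h w * rho a (Tb w) i j)"
  by (subst hk_expand[OF assms]) (rule rho_lc)

context
  fixes a assumes a: "a \<in> Par n"
begin

lemma dpos: "d a > 0" using irr a by (auto simp: irreducible_rep_def)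

lemma is_rep: "is_rep n (d a) (X a)" using irr a by (auto simp: irreducible_rep_def)

lemma X_carrier: "w \<in> W \<Longrightarrow> X a w \<in> carrier_mat (d a) (d a)" using is_rep by (auto simp: is_rep_def)

lemma rho_1: "rho a (Tb id) = one (d a)"
proof (intro ext)
  fix i j
  show "rho a (Tb id) i j = one (d a) i j"
  proof (cases "i < d a \<and> j < d a")
    case True
    then have "rho a (Tb id) i j = (1\<^sub>m (d a)) $$ (i, j)" using rho_repH[of i a j "Tb id"] is_rep by (simp add: is_rep_def)
    then show ?thesis using True by (simp add: one_def)
  qed (auto simp: rho_def one_def)
qed

lemma rho_mult: assumes "hk x" "hk y" shows "rho a (x \<star> y) = mm (d a) (rho a x) (rho a y)"
proof (intro ext)
  fix i j
  show "rho a (x \<star> y) i j = mm (d a) (rho a x) (rho a y) i j"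
  proof (cases "i < d a \<and> j < d a")
    case True
    have "rho a (x \<star> y) i j = (repH n (d a) (X a) x * repH n (d a) (X a) y) $$ (i, j)"
      using rho_repH[of i a j "x \<star> y"] True is_rep assms by (simp add: is_rep_def)
    also have "\<dots> = (\<Sum>k<d a. repH n (d a) (X a) x $$ (i, k) * repH n (d a) (X a) y $$ (k, j))"
      using True by (simp add: repH_def scalar_prod_def atLeast0LessThan)
    also have "\<dots> = mm (d a) (rho a x) (rho a y) i j"
      unfolding mm_def by (rule sum.cong) (use True in \<open>auto simp: rho_repH\<close>)
    finally show ?thesis .
  qed (auto simp: rho_def mm_def)
qed

text \<open>The vectors obtained from u form a nonzero invariant subspace, hence everything. The
  absence of invariant subspaces enters only in this form.\<close>

lemma reach: assumes u: "i0 < d a" "u i0 \<noteq> 0"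
  shows "\<exists>h. hk h \<and> (\<forall>i<d a. mv (d a) (rho a h) u i = t i)"
proof -
  define U where "U = {vec (d a) (mv (d a) (rho a h) u) | h. hk h}"
  have "is_subspace (d a) U" unfolding is_subspace_def
  proof (intro conjI ballI allI)
    show "U \<subseteq> carrier_vec (d a)" by (auto simp: U_def)
    have "vec (d a) (mv (d a) (rho a (\<lambda>u. 0)) u) = 0\<^sub>v (d a)" by (intro eq_vecI) (auto simp: mv_def)
    then show "0\<^sub>v (d a) \<in> U" unfolding U_def using hk_0 by (metis (mono_tags, lifting) mem_Collect_eq)
  next
    fix x y assume "x \<in> U" "y \<in> U"
    then obtain h k where hk: "hk h" "x = vec (d a) (mv (d a) (rho a h) u)" "hk k" "y = vec (d a) (mv (d a) (rho a k) u)"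
      unfolding U_def by blast
    have "x + y = vec (d a) (mv (d a) (rho a (\<lambda>u. h u + k u)) u)"
      unfolding hk rho_add by (intro eq_vecI) (auto simp: mv_def distrib_right sum.distrib)
    then show "x + y \<in> U" unfolding U_def using hk_add[OF hk(1,3)] by blast
  next
    fix c x assume "x \<in> U"
    then obtain h where hk: "hk h" "x = vec (d a) (mv (d a) (rho a h) u)" unfolding U_def by blast
    have "c \<cdot>\<^sub>v x = vec (d a) (mv (d a) (rho a (\<lambda>u. c * h u)) u)"
      unfolding hk rho_scale by (intro eq_vecI) (auto simp: mv_def sum_distrib_left mult_ac)
    then show "c \<cdot>\<^sub>v x \<in> U" unfolding U_def using hk_scale[OF hk(1)] by blast
  qed
  moreover have "\<forall>w\<in>W. \<forall>x\<in>U. X a w *\<^sub>v x \<in> U"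
  proof (intro ballI)
    fix w x assume w: "w \<in> W" and "x \<in> U"
    then obtain h where hk: "hk h" "x = vec (d a) (mv (d a) (rho a h) u)" unfolding U_def by blast
    have "X a w *\<^sub>v x = vec (d a) (mv (d a) (rho a (Tb w \<star> h)) u)"
      unfolding rho_mult[OF hk_Tb[OF w] hk(1)] mv_mm hk(2)
      using X_carrier[OF w] by (intro eq_vecI) (auto simp: mv_def[of _ "rho a (Tb w)"] rho_Tb[OF w] scalar_prod_def atLeast0LessThan)
    then show "X a w *\<^sub>v x \<in> U" unfolding U_def using hk_hm[OF hk(1)] by blast
  qed
  moreover have "U \<noteq> {0\<^sub>v (d a)}"
  proof
    assume U0: "U = {0\<^sub>v (d a)}"
    have "vec (d a) (mv (d a) (rho a (Tb id)) u) \<in> U" unfolding U_def using hk_Tb[OF id_Wn] by blast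
    then have "vec (d a) (mv (d a) (one (d a)) u) = 0\<^sub>v (d a)" using U0 rho_1 by simp
    then have "mv (d a) (one (d a)) u i0 = 0" using u(1) by (metis index_vec index_zero_vec(1))
    then show False using u by (simp add: mv_def one_def if_distrib[of "\<lambda>c. c * _"] cong: if_cong)
  qed
  ultimately have "U = carrier_vec (d a)" using irr a unfolding irreducible_rep_def by blast
  then have "vec (d a) t \<in> U" by simp
  then obtain h where h: "hk h" "vec (d a) t = vec (d a) (mv (d a) (rho a h) u)" unfolding U_def by blast
  have "mv (d a) (rho a h) u i = t i" if "i < d a" for i using arg_cong[OF h(2), of "\<lambda>x. x $ i"] that by simp
  then show ?thesis using h(1) by blast
qed

text \<open>The diagonal of P as a function; of its polynomial entries only the value 1 at v = 0 is
  retained.\<close>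

definition Pd :: "nat \<Rightarrow> K" where
  "Pd = (SOME P. (\<forall>i<d a. const0 (P i) 1) \<and> (\<forall>w\<in>W. \<forall>i<d a. \<forall>j<d a. P i * X a (ivp w) $$ (i, j) = X a w $$ (j, i) * P j))"

lemma Pd: "(\<forall>i<d a. const0 (Pd i) 1) \<and> (\<forall>w\<in>W. \<forall>i<d a. \<forall>j<d a. Pd i * X a (ivp w) $$ (i, j) = X a w $$ (j, i) * Pd j)"
proof -
  obtain p where p: "\<forall>i<d a. poly (p i) 0 = 1"
    "\<forall>w\<in>W. mat (d a) (d a) (\<lambda>(i,j). if i = j then Fraction_Field.Fract (p i) 1 else 0) * X a (ivp w)
       = transpose_mat (X a w) * mat (d a) (d a) (\<lambda>(i,j). if i = j then Fraction_Field.Fract (p i) 1 else 0)"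
    using orth a unfolding orthogonal_rep_def Let_def by blast
  let ?P = "mat (d a) (d a) (\<lambda>(i,j). if i = j then Fraction_Field.Fract (p i) 1 else 0)"
  have "kp (p i) * X a (ivp w) $$ (i, j) = X a w $$ (j, i) * kp (p j)" if w: "w \<in> W" and ij: "i < d a" "j < d a" for w i j
  proof -
    have c: "X a w \<in> carrier_mat (d a) (d a)" "X a (ivp w) \<in> carrier_mat (d a) (d a)" using X_carrier w by auto
    have "(?P * X a (ivp w)) $$ (i, j) = (\<Sum>k<d a. (if i = k then kp (p i) else 0) * X a (ivp w) $$ (k, j))"
      unfolding kp_def using c ij by (simp add: scalar_prod_def atLeast0LessThan)
    also have "\<dots> = (\<Sum>k<d a. if k = i then kp (p i) * X a (ivp w) $$ (i, j) else 0)" by (rule sum.cong) auto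
    also have "\<dots> = kp (p i) * X a (ivp w) $$ (i, j)" using ij by simp
    finally have 1: "(?P * X a (ivp w)) $$ (i, j) = kp (p i) * X a (ivp w) $$ (i, j)" .
    have "(transpose_mat (X a w) * ?P) $$ (i, j) = (\<Sum>k<d a. X a w $$ (k, i) * (if k = j then kp (p k) else 0))"
      unfolding kp_def using c ij by (simp add: scalar_prod_def atLeast0LessThan)
    also have "\<dots> = (\<Sum>k<d a. if k = j then X a w $$ (j, i) * kp (p j) else 0)" by (rule sum.cong) auto
    also have "\<dots> = X a w $$ (j, i) * kp (p j)" using ij by simp
    finally show ?thesis using 1 p(2) w by simp
  qed
  moreover have "const0 (kp (p i)) 1" if "i < d a" for i using const0_kp[of "p i"] p(1) that by simp
  ultimately have "(\<forall>i<d a. const0 (kp (p i)) 1) \<and> (\<forall>w\<in>W. \<forall>i<d a. \<forall>j<d a. kp (p i) * X a (ivp w) $$ (i, j) = X a w $$ (j, i) * kp (p j))" by blast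
  then show ?thesis unfolding Pd_def by (rule someI[of _ "\<lambda>i. kp (p i)"])
qed

lemma Pd_const: "i < d a \<Longrightarrow> const0 (Pd i) 1" using Pd by blast
lemma Pd_pos: "i < d a \<Longrightarrow> pos0 (Pd i)" by (rule pos0_const0[OF Pd_const]) auto
lemma Pd_nz: "i < d a \<Longrightarrow> Pd i \<noteq> 0" using Pd_pos pos0_nz by blast

lemma rho_star: assumes "hk h" "i < d a" "j < d a" shows "Pd i * rho a (star h) i j = rho a h j i * Pd j"
proof -
  have "rho a (star h) i j = (\<Sum>w\<in>W. h w * rho a (Tb (ivp w)) i j)" unfolding star_expand[OF assms(1)] rho_lc ..
  then have "Pd i * rho a (star h) i j = (\<Sum>w\<in>W. h w * (Pd i * X a (ivp w) $$ (i, j)))"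
    using assms by (simp add: sum_distrib_left rho_Tb mult_ac)
  also have "\<dots> = (\<Sum>w\<in>W. h w * (X a w $$ (j, i) * Pd j))"
    by (rule sum.cong) (use Pd assms in auto)
  also have "\<dots> = rho a h j i * Pd j" using assms by (simp add: rho_def sum_distrib_left mult_ac)
  finally show ?thesis .
qed

definition chi :: "hk \<Rightarrow> K" where "chi h = trc (d a) (rho a h)"

lemma chi_lc: "chi (\<lambda>u. \<Sum>i\<in>I. c i * b i u) = (\<Sum>i\<in>I. c i * chi (b i))"
  unfolding chi_def trc_def rho_lc sum_distrib_left by (rule sum.swap)
lemma chi_expand: "hk h \<Longrightarrow> chi h = (\<Sum>w\<in>W. h w * chi (Tb w))"
  by (subst hk_expand) (assumption, rule chi_lc)
lemma chi_charX: "w \<in> W \<Longrightarrow> chi (Tb w) = charX n (X a) w"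
  using X_carrier[of w] by (auto simp: chi_def trc_def charX_def rho_Tb)
lemma chi_1: "chi (Tb id) = of_nat (d a)" by (simp add: chi_def rho_1 trc_def one_def)
lemma chi_star: assumes "hk h" shows "chi (star h) = chi h"
  unfolding chi_def trc_def
proof (rule sum.cong[OF refl])
  fix i assume "i \<in> {..<d a}"
  then have "Pd i * rho a (star h) i i = Pd i * rho a h i i" using rho_star[OF assms, of i i] by (simp add: mult.commute)
  then show "rho a (star h) i i = rho a h i i" using Pd_nz \<open>i \<in> {..<d a}\<close> by simp
qed
lemma chi_mult_commute: assumes "hk x" "hk y" shows "chi (x \<star> y) = chi (y \<star> x)"
  unfolding chi_def rho_mult[OF assms] rho_mult[OF assms(2,1)] by (rule trc_mm)

end

text \<open>Intertwiners from the representation b to the representation a.\<close>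
definition itw :: "nat list \<Rightarrow> nat list \<Rightarrow> fm \<Rightarrow> bool" where
  "itw a b B \<longleftrightarrow> sup2 (d a) (d b) B \<and> (\<forall>h. hk h \<longrightarrow> mm (d a) (rho a h) B = mm (d b) B (rho b h))"

text \<open>One half of Schur's lemma: the kernel is invariant, and a nonzero vector in it generates
  everything.\<close>

lemma itw_kernel: assumes "b \<in> Par n" "itw a b B" "i0 < d b" "u i0 \<noteq> 0" "\<And>i. i < d a \<Longrightarrow> mv (d b) B u i = 0"
  shows "B = (\<lambda>i j. 0)"
proof (intro ext)
  fix i j
  show "B i j = 0"
  proof (cases "i < d a \<and> j < d b")
    case True
    obtain h where h: "hk h" "\<forall>i<d b. mv (d b) (rho b h) u i = (if i = j then 1 else 0)"
      using reach[OF assms(1), of i0 u "\<lambda>i. if i = j then 1 else 0"] assms(3,4) by blast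
    have "mv (d b) B (mv (d b) (rho b h) u) i = mv (d a) (rho a h) (mv (d b) B u) i"
      using assms(2) h(1) unfolding itw_def mv_mm[symmetric] by metis
    also have "\<dots> = 0" using assms(5) by (simp add: mv_def[of "d a"])
    finally have "(\<Sum>k<d b. B i k * mv (d b) (rho b h) u k) = 0" by (simp add: mv_def[of "d b" B])
    moreover have "(\<Sum>k<d b. B i k * mv (d b) (rho b h) u k) = (\<Sum>k<d b. if k = j then B i j else 0)"
      by (rule sum.cong) (use h(2) in auto)
    ultimately show ?thesis using True by simp
  next
    case False then show ?thesis using assms(2) by (simp add: itw_def sup2_def)
  qed
qed

lemma itw_inj: assumes "b \<in> Par n" "itw a b B" "B \<noteq> (\<lambda>i j. 0)" "\<And>i. i < d a \<Longrightarrow> mv (d b) B u i = 0" "i < d b"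
  shows "u i = 0"
  using itw_kernel[OF assms(1,2,5) _ assms(4)] assms(3) by blast

lemma itw_mm: assumes "itw a b A" "itw b c B" shows "itw a c (mm (d b) A B)"
  unfolding itw_def
proof (intro conjI allI impI)
  show "sup2 (d a) (d c) (mm (d b) A B)" using assms sup2_mm unfolding itw_def by blast
  fix h assume h: "hk h"
  have "mm (d a) (rho a h) (mm (d b) A B) = mm (d b) (mm (d a) (rho a h) A) B" by (rule mm_assoc[symmetric])
  also have "\<dots> = mm (d b) (mm (d b) A (rho b h)) B" using assms h unfolding itw_def by simp
  also have "\<dots> = mm (d b) A (mm (d b) (rho b h) B)" by (rule mm_assoc)
  also have "\<dots> = mm (d b) A (mm (d c) B (rho c h))" using assms h unfolding itw_def by simp
  also have "\<dots> = mm (d c) (mm (d b) A B) (rho c h)" by (rule mm_assoc[symmetric])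
  finally show "mm (d a) (rho a h) (mm (d b) A B) = mm (d c) (mm (d b) A B) (rho c h)" .
qed

lemma itw_one: "itw a a (one (d a))"
  unfolding itw_def using sup2_one mm_one_left[OF sup2_rho] mm_one_right[OF sup2_rho] by simp

lemma itw_diff: assumes "itw a b A" "itw a b B" shows "itw a b (\<lambda>i j. A i j - c * B i j)"
proof -
  have "mm (d a) (rho a h) (\<lambda>i j. A i j - c * B i j) = (\<lambda>i j. mm (d a) (rho a h) A i j - c * mm (d a) (rho a h) B i j)" for h
    by (intro ext) (simp add: mm_def sum_subtractf[symmetric] sum_distrib_left algebra_simps)
  moreover have "mm (d b) (\<lambda>i j. A i j - c * B i j) (rho b h) = (\<lambda>i j. mm (d b) A (rho b h) i j - c * mm (d b) B (rho b h) i j)" for h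
    by (intro ext) (simp add: mm_def sum_subtractf[symmetric] sum_distrib_left algebra_simps)
  ultimately show ?thesis using assms unfolding itw_def by (simp add: sup2_def)
qed

text \<open>The adjoint of B for the invariant forms with diagonal Gram matrices \<open>Pd a\<close>
  and \<open>Pd b\<close>.\<close>

definition adj :: "nat list \<Rightarrow> nat list \<Rightarrow> fm \<Rightarrow> fm" where
  "adj a b B = (\<lambda>j i. if i < d a \<and> j < d b then inverse (Pd b j) * B i j * Pd a i else 0)"

lemma itw_adj: assumes a: "a \<in> Par n" and b: "b \<in> Par n" and B: "itw a b B" shows "itw b a (adj a b B)"
  unfolding itw_def
proof (intro conjI allI impI)
  show "sup2 (d b) (d a) (adj a b B)" by (auto simp: sup2_def adj_def)
  fix h assume h: "hk h"
  show "mm (d b) (rho b h) (adj a b B) = mm (d a) (adj a b B) (rho a h)"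
  proof (intro ext)
    fix j i
    show "mm (d b) (rho b h) (adj a b B) j i = mm (d a) (adj a b B) (rho a h) j i"
    proof (cases "i < d a \<and> j < d b")
      case True
      then have i: "i < d a" and j: "j < d b" by auto
      have c: "mm (d a) (rho a (star h)) B i j = mm (d b) B (rho b (star h)) i j"
        using B unfolding itw_def by simp
      have "mm (d b) (rho b h) (adj a b B) j i = (\<Sum>k<d b. inverse (Pd b j) * Pd a i * (B i k * rho b (star h) k j))"
        unfolding mm_def
      proof (rule sum.cong[OF refl])
        fix k assume "k \<in> {..<d b}"
        then have k: "k < d b" by simp
        have "Pd b k * rho b (star h) k j = rho b h j k * Pd b j" by (rule rho_star[OF b h k j])
        then have "rho b h j k * inverse (Pd b k) = inverse (Pd b j) * rho b (star h) k j"
          using Pd_nz[OF b k] Pd_nz[OF b j] by (simp add: field_simps)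
        then show "rho b h j k * adj a b B k i = inverse (Pd b j) * Pd a i * (B i k * rho b (star h) k j)"
          using i k by (simp add: adj_def mult_ac)
      qed
      also have "\<dots> = inverse (Pd b j) * Pd a i * mm (d b) B (rho b (star h)) i j"
        by (simp add: mm_def sum_distrib_left)
      also have "\<dots> = inverse (Pd b j) * Pd a i * mm (d a) (rho a (star h)) B i j" using c by simp
      also have "\<dots> = (\<Sum>k<d a. inverse (Pd b j) * (Pd a i * rho a (star h) i k) * B k j)"
        by (simp add: mm_def sum_distrib_left mult_ac)
      also have "\<dots> = mm (d a) (adj a b B) (rho a h) j i"
        unfolding mm_def by (rule sum.cong) (use rho_star[OF a h i] j in \<open>auto simp: adj_def mult_ac\<close>)
      finally show ?thesis .
    next
      case False then show ?thesis by (auto simp: mm_def adj_def rho_def)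
    qed
  qed
qed

text \<open>The trace is the sum of the squares of the entries of B, with weights that are 1 at v =
  0.\<close>

lemma adj_pos: assumes a: "a \<in> Par n" and b: "b \<in> Par n" and s: "sup2 (d a) (d b) B" and nz: "B \<noteq> (\<lambda>i j. 0)"
  shows "pos0 (trc (d b) (mm (d a) (adj a b B) B))"
proof -
  have e: "mm (d a) (adj a b B) B j j = (\<Sum>i<d a. (inverse (Pd b j) * Pd a i) * (B i j * B i j))" if "j < d b" for j
    unfolding mm_def by (rule sum.cong) (use that in \<open>auto simp: adj_def mult_ac\<close>)
  have w: "pos0 (inverse (Pd b j) * Pd a i)" if "i < d a" "j < d b" for i j
    using that Pd_pos a b by (intro pos0_mult pos0_inverse) auto
  have nn: "nonneg0 (mm (d a) (adj a b B) B j j)" if "j < d b" for j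
    unfolding e[OF that] by (intro nonneg0_sum nonneg0_mult nonneg0_square pos0_nonneg0 w that) simp
  obtain i j where ij: "B i j \<noteq> 0" using nz by (auto simp: fun_eq_iff)
  then have r: "i < d a" "j < d b" using s by (auto simp: sup2_def)
  have "pos0 (mm (d a) (adj a b B) B j j)" unfolding e[OF r(2)]
  proof (rule pos0_sum)
    show "\<exists>i\<in>{..<d a}. pos0 (inverse (Pd b j) * Pd a i * (B i j * B i j))"
      using r ij by (intro bexI[of _ i] pos0_mult[OF w] pos0_square) auto
    show "nonneg0 (inverse (Pd b j) * Pd a i * (B i j * B i j))" if "i \<in> {..<d a}" for i
      using that r by (intro nonneg0_mult nonneg0_square pos0_nonneg0 w) auto
  qed simp
  then show ?thesis unfolding trc_def by (intro pos0_sum) (use nn r in auto)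
qed

text \<open>The composite \<open>Sm\<close> of B with its adjoint is nonzero by positivity, hence
  injective and invertible. Its inverse gives a self-intertwiner E with E B = B; as E fixes a
  nonzero column of B it is the identity, and cyclicity of the trace equates the characters. No
  dimensions are compared.\<close>

lemma itw_chars: assumes a: "a \<in> Par n" and b: "b \<in> Par n" and B: "itw a b B" and nz: "B \<noteq> (\<lambda>i j. 0)"
  shows "a = b"
proof -
  let ?D = "adj a b B"
  have D: "itw b a ?D" by (rule itw_adj[OF a b B])
  define Sm where "Sm = mm (d a) ?D B"
  have Sm: "itw b b Sm" unfolding Sm_def by (rule itw_mm[OF D B])
  have sB: "sup2 (d a) (d b) B" using B unfolding itw_def by blast
  have "Sm \<noteq> (\<lambda>i j. 0)"
  proof
    assume "Sm = (\<lambda>i j. 0)"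
    then have "trc (d b) Sm = 0" by (simp add: trc_def)
    then show False using adj_pos[OF a b sB nz] pos0_nz unfolding Sm_def by blast
  qed
  then have "\<exists>C. sup2 (d b) (d b) C \<and> mm (d b) Sm C = one (d b) \<and> mm (d b) C Sm = one (d b)"
    using Sm itw_inj[OF b Sm] by (intro inj_inverse) (auto simp: itw_def)
  then obtain C where C: "sup2 (d b) (d b) C" "mm (d b) Sm C = one (d b)" "mm (d b) C Sm = one (d b)" by blast
  have Ci: "itw b b C" unfolding itw_def
  proof (intro conjI allI impI)
    fix h assume h: "hk h"
    have r: "sup2 (d b) (d b) (rho b h)" by (rule sup2_rho)
    have "mm (d b) (rho b h) C = mm (d b) (mm (d b) C Sm) (mm (d b) (rho b h) C)"
      unfolding C(3) by (rule mm_one_left[OF sup2_mm[OF r C(1)], symmetric])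
    also have "\<dots> = mm (d b) C (mm (d b) (mm (d b) Sm (rho b h)) C)" by (simp only: mm_assoc)
    also have "\<dots> = mm (d b) C (mm (d b) (mm (d b) (rho b h) Sm) C)" using Sm h unfolding itw_def by simp
    also have "\<dots> = mm (d b) (mm (d b) C (rho b h)) (mm (d b) Sm C)" by (simp only: mm_assoc)
    also have "\<dots> = mm (d b) C (rho b h)" unfolding C(2) by (rule mm_one_right[OF sup2_mm[OF C(1) r]])
    finally show "mm (d b) (rho b h) C = mm (d b) C (rho b h)" .
  qed (rule C(1))
  define E where "E = mm (d b) B (mm (d b) C ?D)"
  have E: "itw a a E" unfolding E_def by (rule itw_mm[OF B itw_mm[OF Ci D]])
  have EB: "mm (d a) E B = B"
  proof -
    have "mm (d a) E B = mm (d b) B (mm (d b) C Sm)" unfolding E_def Sm_def by (simp only: mm_assoc)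
    then show ?thesis unfolding C(3) by (simp only: mm_one_right[OF sB])
  qed
  have "(\<lambda>i j. one (d a) i j - 1 * E i j) = (\<lambda>i j. 0)"
  proof -
    obtain i j where ij: "B i j \<noteq> 0" using nz by (auto simp: fun_eq_iff)
    have r: "i < d a" using ij sB by (auto simp: sup2_def)
    show ?thesis
    proof (rule itw_kernel[OF a itw_diff[OF itw_one E] r, of "\<lambda>k. B k j"])
      show "B i j \<noteq> 0" by (rule ij)
      fix k assume "k < d a"
      have "mv (d a) (\<lambda>i j. one (d a) i j - 1 * E i j) (\<lambda>k. B k j) k = mm (d a) (one (d a)) B k j - mm (d a) E B k j"
        by (simp add: mv_def mm_def left_diff_distrib sum_subtractf)
      then show "mv (d a) (\<lambda>i j. one (d a) i j - 1 * E i j) (\<lambda>k. B k j) k = 0"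
        unfolding EB mm_one_left[OF sB] by simp
    qed
  qed
  then have E1: "E = one (d a)" by (simp add: fun_eq_iff)
  have "chi a h = chi b h" if h: "hk h" for h
  proof -
    have "chi a h = trc (d a) (mm (d a) (rho a h) E)" unfolding chi_def[OF a] E1 mm_one_right[OF sup2_rho] ..
    also have "\<dots> = trc (d a) (mm (d b) (mm (d a) (rho a h) B) (mm (d b) C ?D))" unfolding E_def by (simp only: mm_assoc)
    also have "\<dots> = trc (d a) (mm (d b) B (mm (d b) (rho b h) (mm (d b) C ?D)))"
      using B h unfolding itw_def by (simp add: mm_assoc)
    also have "\<dots> = trc (d b) (mm (d a) (mm (d b) (rho b h) (mm (d b) C ?D)) B)" by (rule trc_mm)
    also have "mm (d a) (mm (d b) (rho b h) (mm (d b) C ?D)) B = mm (d b) (rho b h) (mm (d b) C Sm)"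
      unfolding Sm_def by (simp only: mm_assoc)
    also have "trc (d b) (mm (d b) (rho b h) (mm (d b) C Sm)) = chi b h" unfolding C(3) chi_def[OF b] mm_one_right[OF sup2_rho] ..
    finally show ?thesis .
  qed
  then have "charX n (X a) w = charX n (X b) w" for w
    using chi_charX[OF a, of w] chi_charX[OF b, of w] by (cases "w \<in> W") (auto simp: charX_def)
  then have "charX n (X a) = charX n (X b)" by (rule ext)
  then show ?thesis using distinct a b by (auto dest: inj_onD)
qed

section \<open>Schur sums and central elements\<close>

definition sc :: "nat list \<Rightarrow> nat list \<Rightarrow> nat \<Rightarrow> nat \<Rightarrow> nat \<Rightarrow> nat \<Rightarrow> K" where
  "sc a b i j k m = (\<Sum>w\<in>W. rho a (Tb w) i j * rho b (Tb (ivp w)) k m)"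

text \<open>Both sides are the trace of the same three factors in cyclic order.\<close>

lemma hm_swap: assumes "hk h" "w \<in> W" "y \<in> W" shows "(h \<star> Tb w) y = (Tb (ivp y) \<star> h) (ivp w)"
proof -
  have k: "hk (Tb (ivp y))" "hk (Tb w)" using assms by auto
  have "(h \<star> Tb w) y = tau ((h \<star> Tb w) \<star> Tb (ivp y))" by (rule tau_Tb_inv[symmetric]) (use assms hk_hm in auto)
  also have "\<dots> = tau (Tb (ivp y) \<star> (h \<star> Tb w))" by (rule tau_commute) (use assms hk_hm in auto)
  also have "Tb (ivp y) \<star> (h \<star> Tb w) = (Tb (ivp y) \<star> h) \<star> Tb w" by (rule hm_assoc[symmetric]) (use assms in auto)
  also have "tau ((Tb (ivp y) \<star> h) \<star> Tb w) = tau ((Tb (ivp y) \<star> h) \<star> Tb (ivp (ivp w)))" using assms by simp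
  also have "\<dots> = (Tb (ivp y) \<star> h) (ivp w)" by (rule tau_Tb_inv) (use assms hk_hm in auto)
  finally show ?thesis .
qed

text \<open>Averaging over the dual bases T_w and T_(w^-1): by \<open>hm_swap\<close>, a factor h
  passes from the first representation to the second.\<close>

lemma sc_itw: assumes a: "a \<in> Par n" and b: "b \<in> Par n" shows "itw a b (\<lambda>i m. sc a b i j k m)"
  unfolding itw_def
proof (intro conjI allI impI)
  show "sup2 (d a) (d b) (\<lambda>i m. sc a b i j k m)" by (auto simp: sup2_def sc_def rho_def)
  fix h assume h: "hk h"
  show "mm (d a) (rho a h) (\<lambda>i m. sc a b i j k m) = mm (d b) (\<lambda>i m. sc a b i j k m) (rho b h)"
  proof (intro ext)
    fix i m
    have "mm (d a) (rho a h) (\<lambda>i m. sc a b i j k m) i m = (\<Sum>w\<in>W. mm (d a) (rho a h) (rho a (Tb w)) i j * rho b (Tb (ivp w)) k m)"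
      unfolding mm_def sc_def sum_distrib_left sum_distrib_right by (subst sum.swap) (simp add: mult_ac)
    also have "\<dots> = (\<Sum>w\<in>W. rho a (h \<star> Tb w) i j * rho b (Tb (ivp w)) k m)"
      by (rule sum.cong) (use rho_mult[OF a h] in auto)
    also have "\<dots> = (\<Sum>w\<in>W. \<Sum>y\<in>W. (h \<star> Tb w) y * rho a (Tb y) i j * rho b (Tb (ivp w)) k m)"
    proof (rule sum.cong[OF refl])
      fix w assume w: "w \<in> W"
      show "rho a (h \<star> Tb w) i j * rho b (Tb (ivp w)) k m = (\<Sum>y\<in>W. (h \<star> Tb w) y * rho a (Tb y) i j * rho b (Tb (ivp w)) k m)"
        by (subst rho_expand[OF hk_hm[OF hk_Tb[OF w]]]) (simp add: sum_distrib_right)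
    qed
    also have "\<dots> = (\<Sum>y\<in>W. \<Sum>w\<in>W. rho a (Tb y) i j * ((Tb (ivp y) \<star> h) (ivp w) * rho b (Tb (ivp w)) k m))"
      by (subst sum.swap) (intro sum.cong refl, simp add: hm_swap[OF h] mult_ac)
    also have "\<dots> = (\<Sum>y\<in>W. rho a (Tb y) i j * rho b (Tb (ivp y) \<star> h) k m)"
    proof (rule sum.cong[OF refl])
      fix y assume y: "y \<in> W"
      have "(\<Sum>w\<in>W. (Tb (ivp y) \<star> h) (ivp w) * rho b (Tb (ivp w)) k m) = (\<Sum>w\<in>W. (Tb (ivp y) \<star> h) w * rho b (Tb w) k m)"
        by (rule sum_W_inv[of "\<lambda>w. (Tb (ivp y) \<star> h) w * rho b (Tb w) k m"])
      also have "\<dots> = rho b (Tb (ivp y) \<star> h) k m" 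
        using fun_cong[OF fun_cong[OF rho_expand[OF hk_hm[OF h, of "Tb (ivp y)"], of b], of k], of m] by simp
      finally show "(\<Sum>w\<in>W. rho a (Tb y) i j * ((Tb (ivp y) \<star> h) (ivp w) * rho b (Tb (ivp w)) k m)) = rho a (Tb y) i j * rho b (Tb (ivp y) \<star> h) k m"
        by (simp flip: sum_distrib_left)
    qed
    also have "\<dots> = (\<Sum>y\<in>W. rho a (Tb y) i j * mm (d b) (rho b (Tb (ivp y))) (rho b h) k m)"
      by (rule sum.cong) (use rho_mult[OF b _ h] in auto)
    also have "\<dots> = mm (d b) (\<lambda>i m. sc a b i j k m) (rho b h) i m"
      unfolding mm_def sc_def sum_distrib_left sum_distrib_right by (subst sum.swap) (simp add: mult_ac)
    finally show "mm (d a) (rho a h) (\<lambda>i m. sc a b i j k m) i m = mm (d b) (\<lambda>i m. sc a b i j k m) (rho b h) i m" .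
  qed
qed

lemma schur_distinct: assumes "a \<in> Par n" "b \<in> Par n" "a \<noteq> b" shows "sc a b i j k m = 0"
proof -
  have "(\<lambda>i m. sc a b i j k m) = (\<lambda>i m. 0)" using itw_chars[OF assms(1,2) sc_itw[OF assms(1,2)]] assms(3) by blast
  then show ?thesis by (metis (no_types))
qed

text \<open>Up to a scalar this is the matrix unit at position (m, k) of the block of b, see
  \<open>rho_hN_same\<close>.\<close>

definition hN :: "nat list \<Rightarrow> nat \<Rightarrow> nat \<Rightarrow> hk" where
  "hN b k m = (\<lambda>u. \<Sum>w\<in>W. rho b (Tb (ivp w)) k m * Tb w u)"

lemma hk_hN: "hk (hN b k m)" unfolding hN_def by (rule hk_lc) simp
lemma hN_apply: "y \<in> W \<Longrightarrow> hN b k m y = rho b (Tb (ivp y)) k m"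
  by (simp add: hN_def Tb_def if_distrib cong: if_cong)
lemma rho_hN: "rho a (hN b k m) i j = sc a b i j k m" unfolding hN_def rho_lc sc_def by (simp add: mult.commute)

text \<open>The element that represents the character of b with respect to the trace; it turns out
  to be a multiple of the central idempotent of the block.\<close>

definition zz :: "nat list \<Rightarrow> hk" where "zz b = (\<lambda>u. \<Sum>w\<in>W. chi b (Tb (ivp w)) * Tb w u)"

lemma hk_zz: "hk (zz b)" unfolding zz_def by (rule hk_lc) simp
lemma rho_zz: assumes "b \<in> Par n" shows "rho a (zz b) i j = (\<Sum>k<d b. sc a b i j k k)"
proof -
  have "rho a (zz b) i j = (\<Sum>w\<in>W. chi b (Tb (ivp w)) * rho a (Tb w) i j)" unfolding zz_def rho_lc ..
  also have "\<dots> = (\<Sum>k<d b. sc a b i j k k)"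
    unfolding sc_def chi_def[OF assms] trc_def sum_distrib_right by (subst sum.swap) (simp add: mult.commute)
  finally show ?thesis .
qed

lemma rho_zz_distinct: "a \<in> Par n \<Longrightarrow> b \<in> Par n \<Longrightarrow> a \<noteq> b \<Longrightarrow> rho a (zz b) = (\<lambda>i j. 0)"
  by (intro ext) (simp add: rho_zz schur_distinct)

lemma itw_zz: assumes a: "a \<in> Par n" shows "itw a a (rho a (zz a))"
  unfolding itw_def
proof (intro conjI allI impI)
  show "sup2 (d a) (d a) (rho a (zz a))" by (rule sup2_rho)
  fix h assume h: "hk h"
  have e: "mm (d a) (rho a h) (\<lambda>i m. sc a a i j k m) = mm (d a) (\<lambda>i m. sc a a i j k m) (rho a h)" for j k
    using sc_itw[OF a a] h unfolding itw_def by blast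
  have z: "chi a (Tb w \<star> h) = chi a (h \<star> Tb w)" if "w \<in> W" for w using chi_mult_commute[OF a hk_Tb[OF that] h] .
  have zc: "zz a \<star> h = h \<star> zz a"
  proof (rule hk_eqI)
    show "hk (zz a \<star> h)" "hk (h \<star> zz a)" by (intro hk_hm h hk_zz)+
    fix y assume y: "y \<in> W"
    \<comment> \<open>Pairing with \<open>zz a\<close> under the trace gives the character;
      centrality follows because trace and character are both symmetric.\<close>
    have zt: "tau (zz a \<star> g) = chi a g" if g: "hk g" for g
    proof -
      have "tau (zz a \<star> g) = (\<Sum>w\<in>W. zz a w * g (ivp w))" by (rule tau_hm[OF hk_zz g])
      also have "\<dots> = (\<Sum>w\<in>W. g (ivp w) * chi a (Tb (ivp w)))"
        by (rule sum.cong) (auto simp: zz_def Tb_def if_distrib mult.commute cong: if_cong)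
      also have "\<dots> = (\<Sum>w\<in>W. g w * chi a (Tb w))" by (rule sum_W_inv[of "\<lambda>w. g w * chi a (Tb w)"])
      finally show ?thesis using chi_expand[OF a g] by simp
    qed
    let ?T = "Tb (ivp y)"
    have T: "hk ?T" using y by simp
    have "(zz a \<star> h) y = tau ((zz a \<star> h) \<star> ?T)" by (rule tau_Tb_inv[symmetric]) (use y hk_hm[OF h] in auto)
    also have "\<dots> = tau (zz a \<star> (h \<star> ?T))" using hm_assoc[OF hk_zz h T] by simp
    also have "\<dots> = chi a (h \<star> ?T)" by (rule zt[OF hk_hm[OF T]])
    also have "\<dots> = chi a (?T \<star> h)" by (rule chi_mult_commute[OF a h T])
    also have "\<dots> = tau (zz a \<star> (?T \<star> h))" by (rule zt[OF hk_hm[OF h], symmetric])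
    also have "\<dots> = tau ((zz a \<star> ?T) \<star> h)" using hm_assoc[OF hk_zz T h] by simp
    also have "\<dots> = tau (h \<star> (zz a \<star> ?T))" by (rule tau_commute[OF hk_hm[OF T] h])
    also have "\<dots> = tau ((h \<star> zz a) \<star> ?T)" using hm_assoc[OF h hk_zz T] by simp
    also have "\<dots> = (h \<star> zz a) y" by (rule tau_Tb_inv[OF hk_hm[OF hk_zz] y])
    finally show "(zz a \<star> h) y = (h \<star> zz a) y" .
  qed
  show "mm (d a) (rho a h) (rho a (zz a)) = mm (d a) (rho a (zz a)) (rho a h)"
    by (simp only: rho_mult[OF a h hk_zz[of a], symmetric] rho_mult[OF a hk_zz[of a] h, symmetric] zc)
qed

text \<open>The character of \<open>zz a\<close> is the sum of the squares of all
  \<open>chi a (Tb w)\<close>, one of which is the square of the dimension.\<close>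

lemma chi_zz_nz: assumes a: "a \<in> Par n" shows "rho a (zz a) \<noteq> (\<lambda>i j. 0)"
proof
  assume z: "rho a (zz a) = (\<lambda>i j. 0)"
  have "chi a (zz a) = (\<Sum>w\<in>W. chi a (Tb (ivp w)) * chi a (Tb w))" unfolding zz_def by (rule chi_lc[OF a])
  also have "\<dots> = (\<Sum>w\<in>W. chi a (Tb w) * chi a (Tb w))"
  proof (rule sum.cong[OF refl])
    fix w assume w: "w \<in> W"
    then show "chi a (Tb (ivp w)) * chi a (Tb w) = chi a (Tb w) * chi a (Tb w)"
      using chi_star[OF a hk_Tb[OF w]] by simp
  qed
  finally have "(\<Sum>w\<in>W. chi a (Tb w) * chi a (Tb w)) = 0" using z unfolding chi_def[OF a] trc_def by simp
  then have "\<forall>w\<in>W. chi a (Tb w) * chi a (Tb w) = 0" by (subst (asm) sum_nonneg_eq_0_iff) auto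
  then have "chi a (Tb id) = 0" by (metis id_Wn mult_eq_0_iff)
  then show False using chi_1[OF a] dpos[OF a] by simp
qed

section \<open>Induced sign characters\<close>

lemma distinguished_rmin: assumes "e \<in> distinguished n lam" shows "rmin (Jl n lam) e"
  unfolding rmin_def[OF Jl_S]
proof (intro conjI ballI)
  show eW: "e \<in> W" using assms by (simp add: distinguished_def)
  fix k assume k: "k \<in> Jl n lam"
  have kS: "k \<in> S" using k Jl_S by blast
  have "l e \<le> l (e \<circ> gen k)" using assms WJ_gen[OF k] unfolding distinguished_def young_Jl by blast
  then have "\<not> e (Suc k) < e k" using len_comp_gen_less[OF eW kS] by simp
  then show "e k < e (Suc k)" using Wn_inj[OF eW, of k "Suc k"] by auto
qed

text \<open>Up to the factor \<open>PJ\<close>, the induced character at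
  \<open>star h \<star> h\<close> is the sum of the norms of h T_e x over the coset representatives
  e, with x the antisymmetrizer. Norms are nonnegative, so each vanishes, in particular the one for
  the unit.\<close>

lemma ind_zero:
  assumes h: "hk h" and z: "(\<Sum>w\<in>W. (star h \<star> h) w * indchar n lam w) = 0"
  shows "h \<star> xs lam = (\<lambda>u. 0)"
proof -
  let ?g = "star h \<star> h"
  let ?D = "distinguished n lam"
  have g: "hk ?g" by (rule hk_hm[OF h])
  have finD: "finite ?D" by (rule finite_subset[OF _ finite_Wn[of n]]) (auto simp: distinguished_def)
  have hx: "hk (Tb e \<star> xs lam)" for e by (intro hk_hm hk_xs)
  have eW: "e \<in> W" if "e \<in> ?D" for e using that by (simp add: distinguished_def)
  have tx: "Tb e \<star> xs lam = (\<lambda>z. \<Sum>u\<in>WJ (Jl n lam). qs ^ l u * Tb (e \<circ> u) z)" if e: "e \<in> ?D" for e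
  proof -
    have "Tb e \<star> xs lam = (\<lambda>z. \<Sum>u\<in>WJ (Jl n lam). qs ^ l u * (Tb e \<star> Tb u) z)"
      by (subst xJ_lc[OF Jl_S]) (rule hm_lc_right)
    also have "\<dots> = (\<lambda>z. \<Sum>u\<in>WJ (Jl n lam). qs ^ l u * Tb (e \<circ> u) z)"
      by (rule ext, rule sum.cong) (use Tb_rmin[OF Jl_S qsign distinguished_rmin[OF e]] in auto)
    finally show ?thesis .
  qed
  have sg: "sgnK n u = qs ^ l u" for u
    by (simp add: sgnK_def power_mult_distrib[symmetric])
  have "(\<Sum>w\<in>W. ?g w * indchar n lam w) = (\<Sum>w\<in>W. \<Sum>e\<in>?D. \<Sum>u\<in>WJ (Jl n lam). ?g w * ((Tb w \<star> Tb e) (e \<circ> u) * qs ^ l u))"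
    by (rule sum.cong) (auto simp: indchar_def young_Jl sg hm_Tb sum_distrib_left)
  also have "\<dots> = (\<Sum>e\<in>?D. \<Sum>u\<in>WJ (Jl n lam). \<Sum>w\<in>W. ?g w * ((Tb w \<star> Tb e) (e \<circ> u) * qs ^ l u))"
    by (subst sum.swap) (intro sum.cong refl sum.swap)
  also have "\<dots> = (\<Sum>e\<in>?D. ip (?g \<star> Tb e) (Tb e \<star> xs lam))"
  proof (rule sum.cong[OF refl])
    fix e assume e: "e \<in> ?D"
    have "(\<Sum>w\<in>W. ?g w * ((Tb w \<star> Tb e) z * c)) = c * (?g \<star> Tb e) z" for z c
    proof -
      have "?g \<star> Tb e = (\<lambda>z. \<Sum>w\<in>W. ?g w * (Tb w \<star> Tb e) z)" by (subst hk_expand[OF g]) (rule hm_lc_left)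
      then have "(?g \<star> Tb e) z = (\<Sum>w\<in>W. ?g w * (Tb w \<star> Tb e) z)" by (rule fun_cong)
      then show ?thesis by (simp add: sum_distrib_left mult_ac)
    qed
    then have "(\<Sum>u\<in>WJ (Jl n lam). \<Sum>w\<in>W. ?g w * ((Tb w \<star> Tb e) (e \<circ> u) * qs ^ l u)) = (\<Sum>u\<in>WJ (Jl n lam). qs ^ l u * (?g \<star> Tb e) (e \<circ> u))" by simp
    also have "\<dots> = (\<Sum>u\<in>WJ (Jl n lam). qs ^ l u * ip (?g \<star> Tb e) (Tb (e \<circ> u)))"
      by (rule sum.cong) (use eW[OF e] WJ_W[OF Jl_S] in \<open>auto simp: ip_Tb\<close>)
    also have "\<dots> = ip (?g \<star> Tb e) (Tb e \<star> xs lam)" unfolding tx[OF e] ip_lc_right ..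
    finally show "(\<Sum>u\<in>WJ (Jl n lam). \<Sum>w\<in>W. ?g w * ((Tb w \<star> Tb e) (e \<circ> u) * qs ^ l u)) = ip (?g \<star> Tb e) (Tb e \<star> xs lam)" .
  qed
  finally have s0: "(\<Sum>e\<in>?D. ip (?g \<star> Tb e) (Tb e \<star> xs lam)) = 0" using z by simp
  let ?P = "PJ (Jl n lam) qs"
  have key: "?P * ip (?g \<star> Tb e) (Tb e \<star> xs lam) = ip (h \<star> (Tb e \<star> xs lam)) (h \<star> (Tb e \<star> xs lam))" if e: "e \<in> ?D" for e
  proof -
    have T: "hk (Tb e)" using eW[OF e] by simp
    have "ip (?g \<star> Tb e) (Tb e \<star> xs lam) = ip (star h \<star> (h \<star> Tb e)) (Tb e \<star> xs lam)"
      using hm_assoc[of "star h" h "Tb e"] h T by simp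
    also have "\<dots> = ip (h \<star> Tb e) (h \<star> (Tb e \<star> xs lam))"
      using ip_hm_left[of "star h" "h \<star> Tb e" "Tb e \<star> xs lam"] h T hx hk_hm by simp
    finally have 1: "ip (?g \<star> Tb e) (Tb e \<star> xs lam) = ip (h \<star> Tb e) (h \<star> (Tb e \<star> xs lam))" .
    have hTx: "h \<star> (Tb e \<star> xs lam) = (h \<star> Tb e) \<star> xs lam" by (rule hm_assoc[symmetric, OF h T hk_xs])
    have hTe: "hk (h \<star> Tb e)" by (rule hk_hm[OF T])
    have "ip (h \<star> (Tb e \<star> xs lam)) (h \<star> (Tb e \<star> xs lam)) = ip (h \<star> Tb e) (((h \<star> Tb e) \<star> xs lam) \<star> xs lam)"
      unfolding hTx using ip_hm_right[OF hk_xs hTe hk_hm[OF hk_xs], of lam "h \<star> Tb e" lam] star_xJ[OF Jl_S] by simp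
    also have "((h \<star> Tb e) \<star> xs lam) \<star> xs lam = (h \<star> Tb e) \<star> (xs lam \<star> xs lam)" by (rule hm_assoc[OF hTe hk_xs hk_xs])
    also have "\<dots> = (\<lambda>u. ?P * ((h \<star> Tb e) \<star> xs lam) u)"
      by (subst xJ_xJ[OF Jl_S qsign]) (rule hm_scale_right)
    finally show ?thesis unfolding 1 hTx ip_scale_right by simp
  qed
  have "(\<Sum>e\<in>?D. ip (h \<star> (Tb e \<star> xs lam)) (h \<star> (Tb e \<star> xs lam))) = ?P * (\<Sum>e\<in>?D. ip (?g \<star> Tb e) (Tb e \<star> xs lam))"
    using key by (simp add: sum_distrib_left)
  then have "(\<Sum>e\<in>?D. ip (h \<star> (Tb e \<star> xs lam)) (h \<star> (Tb e \<star> xs lam))) = 0" using s0 by simp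
  then have "\<forall>e\<in>?D. ip (h \<star> (Tb e \<star> xs lam)) (h \<star> (Tb e \<star> xs lam)) = 0"
    by (subst (asm) sum_nonneg_eq_0_iff) (use finD ip_self_nonneg in auto)
  moreover have "id \<in> ?D" by (simp add: distinguished_def)
  ultimately have "ip (h \<star> (Tb id \<star> xs lam)) (h \<star> (Tb id \<star> xs lam)) = 0" by blast
  then have "ip (h \<star> xs lam) (h \<star> xs lam) = 0" unfolding hm_1_left[OF hk_xs] .
  then show ?thesis by (rule ip_self_0[OF hk_hm[OF hk_xs]])
qed

lemma ind_chi: assumes lam: "lam \<in> Par n" and h: "hk h" and z: "\<And>mu. mu \<in> Par n \<Longrightarrow> dominates lam mu \<Longrightarrow> chi mu h = 0"
  shows "(\<Sum>w\<in>W. h w * indchar n lam w) = 0"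
proof -
  obtain m :: "nat list \<Rightarrow> nat" where m: "\<forall>w\<in>W. indchar n lam w = charX n (X lam) w +
          (\<Sum>mu\<in>{mu\<in>Par n. dominates lam mu \<and> lam \<noteq> mu}. of_nat (m mu) * charX n (X mu) w)"
    using labelling lam by blast
  let ?M = "{mu\<in>Par n. dominates lam mu \<and> lam \<noteq> mu}"
  have c: "(\<Sum>w\<in>W. h w * charX n (X mu) w) = chi mu h" if mu: "mu \<in> Par n" for mu
    unfolding chi_expand[OF mu h] by (rule sum.cong) (use chi_charX[OF mu] in auto)
  have "(\<Sum>w\<in>W. h w * indchar n lam w) = (\<Sum>w\<in>W. h w * charX n (X lam) w + (\<Sum>mu\<in>?M. of_nat (m mu) * (h w * charX n (X mu) w)))"
    by (rule sum.cong) (use m in \<open>auto simp: distrib_left sum_distrib_left mult_ac\<close>)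
  also have "\<dots> = (\<Sum>w\<in>W. h w * charX n (X lam) w) + (\<Sum>mu\<in>?M. of_nat (m mu) * (\<Sum>w\<in>W. h w * charX n (X mu) w))"
    unfolding sum.distrib sum_distrib_left by (subst (2) sum.swap) simp
  also have "\<dots> = chi lam h + (\<Sum>mu\<in>?M. of_nat (m mu) * chi mu h)" using c lam by simp
  also have "\<dots> = 0" using z lam dominates_refl by simp
  finally show ?thesis .
qed

lemma ones_Par: "replicate n 1 \<in> Par n" by (auto simp: Par_def sum_list_replicate sorted_wrt_iff_nth_less)

lemma Jl_ones: "Jl n (replicate n 1) = {}"
proof -
  have "k = Psum (replicate n 1) k" if "k \<in> S" for k using that by (simp add: Psum_def sum_list_replicate)
  then show ?thesis unfolding Jl_def by auto
qed

lemma xs_ones: "xs (replicate n 1) = Tb id"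
proof -
  have "WJ {} = {id}"
  proof
    show "WJ {} \<subseteq> {id}"
    proof
      fix w assume "w \<in> WJ {}" then show "w \<in> {id}" by (induction rule: WJ.induct) auto
    qed
  qed (use WJ_id in auto)
  moreover have "{} \<subseteq> S" by simp
  ultimately have "xJ {} qs = Tb id" by (auto simp: xJ_def Tb_def)
  then show ?thesis unfolding Jl_ones .
qed

text \<open>The shape with n rows of length 1 has trivial Young subgroup and antisymmetrizer 1, so
  its induced character is the regular one.\<close>

lemma rho_faithful: assumes h: "hk h" and z: "\<And>a. a \<in> Par n \<Longrightarrow> rho a h = (\<lambda>i j. 0)" shows "h = (\<lambda>u. 0)"
proof -
  have "(\<Sum>w\<in>W. (star h \<star> h) w * indchar n (replicate n 1) w) = 0"
  proof (rule ind_chi[OF ones_Par hk_hm[OF h]])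
    fix mu assume mu: "mu \<in> Par n"
    show "chi mu (star h \<star> h) = 0" unfolding chi_def[OF mu] rho_mult[OF mu hk_star h] z[OF mu] mm_0_right trc_def by simp
  qed
  then have "h \<star> xs (replicate n 1) = (\<lambda>u. 0)" by (rule ind_zero[OF h])
  then show ?thesis unfolding xs_ones hm_1[OF h] .
qed

text \<open>Apply \<open>ind_zero\<close> to \<open>zz a\<close>, which acts as zero in every shape
  other than a. If a is not above lam, then \<open>zz a\<close> annihilates \<open>xs lam\<close>,
  although it acts injectively in shape a.\<close>

lemma rho_xs_dominates: assumes a: "a \<in> Par n" and lam: "lam \<in> Par n" and nz: "rho a (xs lam) \<noteq> (\<lambda>i j. 0)"
  shows "dominates lam a"
proof (rule ccontr)
  assume nd: "\<not> dominates lam a"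
  have "(\<Sum>w\<in>W. (star (zz a) \<star> zz a) w * indchar n lam w) = 0"
  proof (rule ind_chi[OF lam hk_hm[OF hk_zz]])
    fix mu assume mu: "mu \<in> Par n" "dominates lam mu"
    then have "mu \<noteq> a" using nd by blast
    then have "rho mu (zz a) = (\<lambda>i j. 0)" by (rule rho_zz_distinct[OF mu(1) a])
    then show "chi mu (star (zz a) \<star> zz a) = 0"
      unfolding chi_def[OF mu(1)] rho_mult[OF mu(1) hk_star hk_zz] by (simp add: mm_0_right trc_def)
  qed
  then have "zz a \<star> xs lam = (\<lambda>u. 0)" by (rule ind_zero[OF hk_zz])
  then have "rho a (zz a \<star> xs lam) = (\<lambda>i j. 0)" by simp
  then have e: "mm (d a) (rho a (zz a)) (rho a (xs lam)) = (\<lambda>i j. 0)" using rho_mult[OF a hk_zz hk_xs] by simp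
  have "rho a (xs lam) i j = 0" for i j
  proof (cases "i < d a")
    case True
    have "mv (d a) (rho a (zz a)) (\<lambda>k. rho a (xs lam) k j) i' = 0" for i'
      using fun_cong[OF fun_cong[OF e, of i'], of j] by (simp add: mm_def mv_def)
    then show ?thesis using itw_inj[OF a itw_zz[OF a] chi_zz_nz[OF a], of "\<lambda>k. rho a (xs lam) k j" i] True by blast
  qed (simp add: rho_def)
  then show False using nz by (simp add: fun_eq_iff)
qed

end

section \<open>Schur elements and leading coefficients\<close>

text \<open>By symmetry the diagonal of the square of the leading matrix consists of sums of real
  squares, not all zero. Idempotency therefore excludes a pole, and it also excludes that all
  entries vanish at v = 0. The leading matrix is then a symmetric idempotent over the reals, of
  positive trace.\<close>

lemma const0_sym_idem:
  assumes idem: "mm m E E = E" and s: "sup2 m m E"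
    and sym: "\<And>i j. i < m \<Longrightarrow> j < m \<Longrightarrow> p i * E i j = E j i * p j" and p: "\<And>i. i < m \<Longrightarrow> const0 (p i) 1"
    and nz: "E \<noteq> (\<lambda>i j. 0)"
  shows "\<exists>A r. (\<forall>i<m. \<forall>j<m. const0 (E i j) (A i j)) \<and> const0 (trc m E) r \<and> r > 0"
proof -
  let ?I = "{..<m} \<times> {..<m}"
  obtain i0 j0 where "E i0 j0 \<noteq> 0" using nz by (auto simp: fun_eq_iff)
  then have r0: "i0 < m" "j0 < m" using s by (auto simp: sup2_def)
  then have "\<exists>x\<in>?I. E (fst x) (snd x) \<noteq> 0" using \<open>E i0 j0 \<noteq> 0\<close> by (intro bexI[of _ "(i0, j0)"]) auto
  then obtain k c where kc: "\<forall>x\<in>?I. const0 (vK powi k * E (fst x) (snd x)) (c x)" "\<exists>x\<in>?I. c x \<noteq> 0"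
    using const0_scale_family[of ?I "\<lambda>x. E (fst x) (snd x)"] by auto
  define A where "A = (\<lambda>i j. c (i, j))"
  have A: "const0 (vK powi k * E i j) (A i j)" if "i < m" "j < m" for i j using kc(1) that by (force simp: A_def)
  have Asym: "A i j = A j i" if "i < m" "j < m" for i j
  proof -
    have "const0 (p i * (vK powi k * E i j)) (1 * A i j)" by (intro const0_mult p A that)
    moreover have "const0 ((vK powi k * E j i) * p j) (A j i * 1)" by (intro const0_mult p A that)
    moreover have "p i * (vK powi k * E i j) = (vK powi k * E j i) * p j"
      using sym[OF that] by (simp add: mult_ac)
    ultimately show ?thesis using const0_unique by fastforce
  qed
  have sq: "const0 (vK powi k * (vK powi k * E i j)) (\<Sum>l<m. A i l * A l j)" if "i < m" "j < m" for i j
  proof -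
    have gen: "c * (c * (\<Sum>l<m. f l * g l)) = (\<Sum>l<m. (c * f l) * (c * g l))" for c :: K and f g
      by (simp add: sum_distrib_left mult_ac)
    have e: "E i j = (\<Sum>l<m. E i l * E l j)" using fun_cong[OF fun_cong[OF idem, of i], of j] by (simp add: mm_def)
    have "vK powi k * (vK powi k * E i j) = (\<Sum>l<m. (vK powi k * E i l) * (vK powi k * E l j))"
      by (subst e) (rule gen)
    moreover have "const0 (\<Sum>l<m. (vK powi k * E i l) * (vK powi k * E l j)) (\<Sum>l<m. A i l * A l j)"
      by (intro const0_sum const0_mult A that) auto
    ultimately show ?thesis by simp
  qed
  obtain i1 j1 where ij1: "i1 < m" "j1 < m" "A i1 j1 \<noteq> 0" using kc(2) by (auto simp: A_def)
  have pos: "(\<Sum>l<m. A i1 l * A l i1) > 0"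
  proof -
    have "(\<Sum>l<m. A i1 l * A l i1) = (\<Sum>l<m. (A i1 l)\<^sup>2)" by (rule sum.cong) (use Asym ij1 in \<open>auto simp: power2_eq_square\<close>)
    moreover have "(\<Sum>l<m. (A i1 l)\<^sup>2) > 0" using ij1 by (intro sum_pos2[of _ j1]) auto
    ultimately show ?thesis by simp
  qed
  have "\<not> k > 0"
  proof
    assume "k > 0"
    then have "const0 (vK powi k * (vK powi k * E i1 i1)) 0" using const0_zero_mult_powi[OF A[OF ij1(1,1)]] by blast
    then show False using const0_unique[OF sq[OF ij1(1,1)]] pos by simp
  qed
  moreover have "\<not> k < 0"
  proof
    assume "k < 0"
    then have "const0 (vK powi (- k) * (vK powi k * (vK powi k * E i1 j1))) 0"
      using const0_zero_mult_powi[OF sq[OF ij1(1,2)], of "- k"] by simp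
    moreover have "vK powi (- k) * (vK powi k * (vK powi k * E i1 j1)) = vK powi k * E i1 j1"
      by (simp add: power_int_minus)
    ultimately have "A i1 j1 = 0" using const0_unique[OF A[OF ij1(1,2)]] by simp
    then show False using ij1 by simp
  qed
  ultimately have k0: "k = 0" by simp
  have A': "const0 (E i j) (A i j)" if "i < m" "j < m" for i j using A[OF that] k0 by simp
  have AA: "A i j = (\<Sum>l<m. A i l * A l j)" if "i < m" "j < m" for i j
    using const0_unique[OF A'[OF that]] sq[OF that] k0 by simp
  have "const0 (trc m E) (\<Sum>i<m. A i i)" unfolding trc_def by (intro const0_sum A') auto
  moreover have "(\<Sum>i<m. A i i) > 0"
  proof -
    have "A i i \<ge> 0" if "i < m" for i
    proof -
      have "A i i = (\<Sum>l<m. (A i l)\<^sup>2)" unfolding AA[OF that that] by (rule sum.cong) (use Asym that in \<open>auto simp: power2_eq_square\<close>)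
      then show ?thesis by (simp add: sum_nonneg)
    qed
    moreover have "A i1 i1 > 0" using AA[OF ij1(1,1)] pos by simp
    ultimately show ?thesis using ij1 by (intro sum_pos2[of _ i1]) auto
  qed
  ultimately show ?thesis using A' by blast
qed

context reps
begin

text \<open>By \<open>reach\<close>, some h carries a nonzero column of y to a coordinate vector
  that x does not kill.\<close>

lemma rho_itw_nz: assumes nu: "nu \<in> Par n" and x: "hk x" "rho nu x \<noteq> (\<lambda>i j. 0)" and y: "hk y" "rho nu y \<noteq> (\<lambda>i j. 0)"
  shows "\<exists>h. hk h \<and> x \<star> (h \<star> y) \<noteq> (\<lambda>u. 0)"
proof -
  obtain i k where ik: "rho nu x i k \<noteq> 0" using x by (auto simp: fun_eq_iff)
  obtain i' j where ij: "rho nu y i' j \<noteq> 0" using y by (auto simp: fun_eq_iff)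
  have r: "i < d nu" "k < d nu" "i' < d nu" using ik ij by (auto simp: rho_def split: if_splits)
  obtain h where h: "hk h" "\<forall>i<d nu. mv (d nu) (rho nu h) (\<lambda>l. rho nu y l j) i = (if i = k then 1 else 0)"
    using reach[OF nu r(3), of "\<lambda>l. rho nu y l j" "\<lambda>i. if i = k then 1 else 0"] ij by blast
  have "rho nu (x \<star> (h \<star> y)) i j = (\<Sum>m<d nu. rho nu x i m * mm (d nu) (rho nu h) (rho nu y) m j)"
    unfolding rho_mult[OF nu x(1) hk_hm[OF y(1)]] rho_mult[OF nu h(1) y(1)] by (simp add: mm_def)
  also have "\<dots> = (\<Sum>m<d nu. if m = k then rho nu x i k else 0)"
    by (rule sum.cong) (use h(2) in \<open>auto simp: mm_def mv_def\<close>)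
  also have "\<dots> = rho nu x i k" using r by simp
  finally have "rho nu (x \<star> (h \<star> y)) i j \<noteq> 0" using ik by simp
  then have "x \<star> (h \<star> y) \<noteq> (\<lambda>u. 0)" by (metis rho_0)
  then show ?thesis using h(1) by blast
qed

definition up :: "nat list \<Rightarrow> nat" where "up lam = card {mu \<in> Par n. dominates lam mu}"

lemma up_less: assumes "lam \<in> Par n" "mu \<in> Par n" "dominates lam mu" "lam \<noteq> mu" shows "up mu < up lam"
  unfolding up_def
proof (rule psubset_card_mono)
  show "finite {mu \<in> Par n. dominates lam mu}" using finite_Par by simp
  have "lam \<notin> {nu \<in> Par n. dominates mu nu}" using assms dominates_antisym[of mu lam n] by blast
  moreover have "lam \<in> {nu \<in> Par n. dominates lam nu}" using assms dominates_refl by simp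
  moreover have "{nu \<in> Par n. dominates mu nu} \<subseteq> {nu \<in> Par n. dominates lam nu}" using assms dominates_trans by blast
  ultimately show "{nu \<in> Par n. dominates mu nu} \<subset> {nu \<in> Par n. dominates lam nu}" by blast
qed

text \<open>Faithfulness gives each mu a shape \<open>kap mu\<close>, above mu, in which
  \<open>g0 mu\<close> acts. Shapes with equal \<open>kap\<close> dominate each other through
  nonzero sandwiches, so \<open>kap\<close> is injective, and an injective map that only goes up on
  a finite order is the identity.\<close>

lemma rho_g0: assumes "lam \<in> Par n" shows "rho lam (g0 lam) \<noteq> (\<lambda>i j. 0)"
proof -
  have "\<exists>nu. nu \<in> Par n \<and> rho nu (g0 mu) \<noteq> (\<lambda>i j. 0)" if mu: "mu \<in> Par n" for mu
    using rho_faithful[OF hk_sandw[of mu mu "d0 n mu"]] g0_nonzero[OF mu] by blast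
  then obtain kap where kap: "\<And>mu. mu \<in> Par n \<Longrightarrow> kap mu \<in> Par n" "\<And>mu. mu \<in> Par n \<Longrightarrow> rho (kap mu) (g0 mu) \<noteq> (\<lambda>i j. 0)" by metis
  have nz: "rho (kap mu) (xs mu) \<noteq> (\<lambda>i j. 0)" "rho (kap mu) (xi mu) \<noteq> (\<lambda>i j. 0)" if mu: "mu \<in> Par n" for mu
  proof -
    have T: "hk (Tb (d0 n mu))" using d0_Wn by simp
    have e: "rho (kap mu) (g0 mu) = mm (d (kap mu)) (rho (kap mu) (xi mu)) (mm (d (kap mu)) (rho (kap mu) (Tb (d0 n mu))) (rho (kap mu) (xs mu)))"
      unfolding sandw_def rho_mult[OF kap(1)[OF mu] hk_xi hk_hm[OF hk_xs]] rho_mult[OF kap(1)[OF mu] T hk_xs] ..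
    show "rho (kap mu) (xs mu) \<noteq> (\<lambda>i j. 0)"
    proof
      assume z: "rho (kap mu) (xs mu) = (\<lambda>i j. 0)"
      show False using kap(2)[OF mu] unfolding e z mm_0_right by simp
    qed
    show "rho (kap mu) (xi mu) \<noteq> (\<lambda>i j. 0)"
    proof
      assume z: "rho (kap mu) (xi mu) = (\<lambda>i j. 0)"
      show False using kap(2)[OF mu] unfolding e z mm_0_left by simp
    qed
  qed
  have dom: "dominates mu (kap mu)" if mu: "mu \<in> Par n" for mu
    by (rule rho_xs_dominates[OF kap(1)[OF mu] mu nz(1)[OF mu]])
  have inj: "mu = nu" if m: "mu \<in> Par n" "nu \<in> Par n" "kap mu = kap nu" for mu nu
  proof -
    have *: "dominates nu mu" if m: "mu \<in> Par n" "nu \<in> Par n" "kap mu = kap nu" for mu nu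
    proof -
      have "rho (kap mu) (xs nu) \<noteq> (\<lambda>i j. 0)" using nz(1)[OF m(2)] m(3) by simp
      then obtain h where "hk h" "xi mu \<star> (h \<star> xs nu) \<noteq> (\<lambda>u. 0)"
        using rho_itw_nz[OF kap(1)[OF m(1)] hk_xi nz(2)[OF m(1)] hk_xs] by blast
      then show ?thesis using sandw_dominates[OF m(1,2)] by blast
    qed
    show ?thesis using *[OF m] *[OF m(2,1) m(3)[symmetric]] dominates_antisym[of nu mu n] m by blast
  qed
  \<comment> \<open>From the top down: a strictly larger \<open>kap lam\<close> is already known to
    be its own image, against injectivity.\<close>
  have "kap lam = lam" using assms
  proof (induction "up lam" arbitrary: lam rule: less_induct)
    case (less lam)
    show ?case
    proof (rule ccontr)
      assume ne: "kap lam \<noteq> lam"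
      have "up (kap lam) < up lam" using up_less[OF less(2) kap(1)[OF less(2)] dom[OF less(2)]] ne by simp
      then have "kap (kap lam) = kap lam" using less(1) kap(1)[OF less(2)] by blast
      then show False using inj[OF kap(1)[OF less(2)] less(2)] ne by blast
    qed
  qed
  then show ?thesis using kap(2)[OF assms] by simp
qed

context
  fixes a assumes a: "a \<in> Par n"
begin

abbreviation "Ea \<equiv> rho a (xs a)"
abbreviation "Pa \<equiv> PJ (Jl n a) qs"

lemma Pa_nz: "Pa \<noteq> 0" by (rule PJ_nz[OF Jl_S])

lemma xs_sq: "xs a \<star> xs a = (\<lambda>u. Pa * xs a u)" by (rule xJ_xJ[OF Jl_S qsign])

lemma Ea_sq: "mm (d a) Ea Ea = (\<lambda>i j. Pa * Ea i j)"
  using rho_mult[OF a hk_xs[of a] hk_xs[of a]] unfolding xs_sq rho_scale by simp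

definition Fa :: fm where "Fa = mm (d a) (rho a (xi a)) (rho a (Tb (d0 n a)))"

lemma Ga: "rho a (g0 a) = mm (d a) Fa Ea"
proof -
  have T: "hk (Tb (d0 n a))" using d0_Wn by simp
  show ?thesis unfolding sandw_def rho_mult[OF a hk_xi hk_hm[OF hk_xs]] rho_mult[OF a T hk_xs] Fa_def mm_assoc ..
qed

lemma Ga_1dim: assumes h: "hk h" shows "\<exists>c. mm (d a) Fa (mm (d a) Ea (mm (d a) (rho a h) Ea)) = (\<lambda>i j. c * rho a (g0 a) i j)"
proof -
  have T: "hk (Tb (d0 n a))" using d0_Wn by simp
  let ?y = "Tb (d0 n a) \<star> (xs a \<star> h)"
  have y: "hk ?y" by (intro hk_hm h)
  obtain c where "xi a \<star> (?y \<star> xs a) = (\<lambda>u. c * g0 a u)" using sandw_1dim[OF a y] by blast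
  then have "rho a (xi a \<star> (?y \<star> xs a)) = (\<lambda>i j. c * rho a (g0 a) i j)" using rho_scale by simp
  moreover have "rho a (xi a \<star> (?y \<star> xs a)) = mm (d a) Fa (mm (d a) Ea (mm (d a) (rho a h) Ea))"
    unfolding rho_mult[OF a hk_xi hk_hm[OF hk_xs]] rho_mult[OF a y hk_xs] rho_mult[OF a T hk_hm[OF h]] rho_mult[OF a hk_xs h] Fa_def
    by (simp only: mm_assoc)
  ultimately show ?thesis by metis
qed

lemma mv_col: "mv m A (\<lambda>k. B k j) i = mm m A B i j" by (simp add: mv_def mm_def)

lemma Ea_col: obtains i0 j0 where "rho a (g0 a) i0 j0 \<noteq> 0" "i0 < d a" "j0 < d a" "\<exists>k<d a. Ea k j0 \<noteq> 0"
proof -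
  obtain i0 j0 where ij: "rho a (g0 a) i0 j0 \<noteq> 0" using rho_g0[OF a] by (auto simp: fun_eq_iff)
  then have r: "i0 < d a" "j0 < d a" by (auto simp: rho_def split: if_splits)
  have "\<exists>k<d a. Ea k j0 \<noteq> 0"
  proof (rule ccontr)
    assume "\<not> (\<exists>k<d a. Ea k j0 \<noteq> 0)"
    then have "mm (d a) Fa Ea i0 j0 = 0" by (simp add: mm_def)
    then show False using ij Ga by simp
  qed
  then show ?thesis using that ij r by blast
qed

text \<open>Choose h that maps a column of \<open>Ea\<close> to its image under phi. The
  one-dimensional sandwich turns this into a scalar by which phi acts on a nonzero column of
  \<open>rho a (g0 a)\<close>; after subtracting the scalar a kernel appears. This replaces the
  eigenvalue argument over an algebraically closed field.\<close>

lemma itw_scalar: assumes phi: "itw a a phi" shows "\<exists>c. phi = (\<lambda>i j. c * one (d a) i j)"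
proof -
  obtain i0 j0 where ij: "rho a (g0 a) i0 j0 \<noteq> 0" "i0 < d a" "j0 < d a" "\<exists>k<d a. Ea k j0 \<noteq> 0" by (rule Ea_col)
  then obtain k where k: "k < d a" "Ea k j0 \<noteq> 0" by blast
  obtain h where h: "hk h" "\<forall>i<d a. mv (d a) (rho a h) (\<lambda>k. Ea k j0) i = mm (d a) phi Ea i j0"
    using reach[OF a k(1), of "\<lambda>k. Ea k j0" "\<lambda>i. mm (d a) phi Ea i j0"] k(2) by blast
  obtain c where c: "mm (d a) Fa (mm (d a) Ea (mm (d a) (rho a h) Ea)) = (\<lambda>i j. c * rho a (g0 a) i j)"
    using Ga_1dim[OF h(1)] by blast
  have com: "mm (d a) Ea phi = mm (d a) phi Ea" using phi hk_xs unfolding itw_def by blast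
  have xT: "hk (xi a)" "hk (Tb (d0 n a))" using d0_Wn by auto
  have comF: "mm (d a) Fa phi = mm (d a) phi Fa"
  proof -
    have 1: "mm (d a) (rho a (Tb (d0 n a))) phi = mm (d a) phi (rho a (Tb (d0 n a)))" using phi xT(2) unfolding itw_def by blast
    have 2: "mm (d a) (rho a (xi a)) phi = mm (d a) phi (rho a (xi a))" using phi xT(1) unfolding itw_def by blast
    have "mm (d a) Fa phi = mm (d a) (rho a (xi a)) (mm (d a) phi (rho a (Tb (d0 n a))))" unfolding Fa_def mm_assoc 1 ..
    also have "\<dots> = mm (d a) (mm (d a) (rho a (xi a)) phi) (rho a (Tb (d0 n a)))" by (rule mm_assoc[symmetric])
    also have "\<dots> = mm (d a) phi Fa" unfolding 2 Fa_def by (rule mm_assoc)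
    finally show ?thesis .
  qed
  have e1: "mm (d a) Ea (mm (d a) (rho a h) Ea) i j0 = Pa * mm (d a) phi Ea i j0" for i
  proof -
    have "mm (d a) Ea (mm (d a) (rho a h) Ea) i j0 = (\<Sum>k<d a. Ea i k * mm (d a) phi Ea k j0)"
      unfolding mm_def[of "d a" Ea "mm (d a) (rho a h) Ea"] by (rule sum.cong) (use h(2) in \<open>auto simp: mv_col\<close>)
    also have "\<dots> = mm (d a) Ea (mm (d a) phi Ea) i j0" by (simp add: mm_def)
    also have "mm (d a) Ea (mm (d a) phi Ea) = mm (d a) phi (mm (d a) Ea Ea)" by (simp only: mm_assoc[symmetric] com)
    also have "mm (d a) phi (mm (d a) Ea Ea) i j0 = Pa * mm (d a) phi Ea i j0"
      unfolding Ea_sq by (simp add: mm_def sum_distrib_left mult_ac)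
    finally show ?thesis .
  qed
  have e2: "c * rho a (g0 a) i j0 = Pa * mm (d a) phi (rho a (g0 a)) i j0" for i
  proof -
    have "c * rho a (g0 a) i j0 = mm (d a) Fa (mm (d a) Ea (mm (d a) (rho a h) Ea)) i j0" using c by (simp add: fun_eq_iff)
    also have "\<dots> = (\<Sum>k<d a. Fa i k * (Pa * mm (d a) phi Ea k j0))" unfolding mm_def[of "d a" Fa] by (simp add: e1)
    also have "\<dots> = Pa * mm (d a) Fa (mm (d a) phi Ea) i j0" by (simp add: mm_def[of "d a" Fa] sum_distrib_left mult_ac)
    also have "mm (d a) Fa (mm (d a) phi Ea) = mm (d a) phi (rho a (g0 a))" unfolding Ga by (simp only: mm_assoc[symmetric] comF)
    finally show ?thesis .
  qed
  have "(\<lambda>i j. phi i j - (c / Pa) * one (d a) i j) = (\<lambda>i j. 0)"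
  proof (rule itw_kernel[OF a itw_diff[OF phi itw_one] ij(2), of "\<lambda>i. rho a (g0 a) i j0"])
    show "rho a (g0 a) i0 j0 \<noteq> 0" by (rule ij)
    fix i assume i: "i < d a"
    have "mv (d a) (\<lambda>i j. phi i j - (c / Pa) * one (d a) i j) (\<lambda>i. rho a (g0 a) i j0) i
        = mm (d a) phi (rho a (g0 a)) i j0 - (c / Pa) * mm (d a) (one (d a)) (rho a (g0 a)) i j0"
      by (simp add: mv_def mm_def left_diff_distrib sum_subtractf sum_distrib_left mult.assoc)
    also have "\<dots> = 0" unfolding mm_one_left[OF sup2_rho] using e2[of i] Pa_nz by (simp add: field_simps)
    finally show "mv (d a) (\<lambda>i j. phi i j - (c / Pa) * one (d a) i j) (\<lambda>i. rho a (g0 a) i j0) i = 0" .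
  qed
  then have "phi = (\<lambda>i j. (c / Pa) * one (d a) i j)" by (simp add: fun_eq_iff)
  then show ?thesis by blast
qed

text \<open>\<open>Ea\<close> has rank one by the one-dimensional sandwich, and its square is
  \<open>Pa\<close> times itself, so its trace is \<open>Pa\<close>.\<close>

lemma chi_xs: "chi a (xs a) = Pa"
proof -
  obtain i0 j0 where ij: "rho a (g0 a) i0 j0 \<noteq> 0" "i0 < d a" "j0 < d a" "\<exists>k<d a. Ea k j0 \<noteq> 0" by (rule Ea_col)
  then obtain k0 where k0: "k0 < d a" "Ea k0 j0 \<noteq> 0" by blast
  have rk: "\<exists>b. \<forall>i. Ea i j = b * Ea i j0" for j
  proof -
    obtain h where h: "hk h" "\<forall>i<d a. mv (d a) (rho a h) (\<lambda>k. Ea k j0) i = Ea i j"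
      using reach[OF a k0(1), of "\<lambda>k. Ea k j0" "\<lambda>i. Ea i j"] k0(2) by blast
    obtain c where c: "mm (d a) Fa (mm (d a) Ea (mm (d a) (rho a h) Ea)) = (\<lambda>i j. c * rho a (g0 a) i j)"
      using Ga_1dim[OF h(1)] by blast
    have "mm (d a) Ea (mm (d a) (rho a h) Ea) i j0 = mm (d a) Ea Ea i j" for i
      unfolding mm_def[of "d a" Ea] by (rule sum.cong) (use h(2) in \<open>auto simp: mv_col\<close>)
    then have "mm (d a) Ea (mm (d a) (rho a h) Ea) i j0 = Pa * Ea i j" for i unfolding Ea_sq .
    then have "mm (d a) Fa (mm (d a) Ea (mm (d a) (rho a h) Ea)) i j0 = Pa * mm (d a) Fa Ea i j" for i
      by (simp add: mm_def[of "d a" Fa] sum_distrib_left mult_ac)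
    then have Gj: "Pa * rho a (g0 a) i j = c * rho a (g0 a) i j0" for i using c Ga by (simp add: fun_eq_iff)
    \<comment> \<open>The failure of column j to be a multiple of column \<open>j0\<close>. If
      nonzero, it could be mapped to column \<open>j0\<close>, where the sandwich is nonzero,
      whereas the scalar rule for sandwiches forces zero.\<close>
    define w where "w = (\<lambda>i. Ea i j - (c / Pa) * Ea i j0)"
    have "w i = 0" if i: "i < d a" for i
    proof (rule ccontr)
      assume "w i \<noteq> 0"
      then obtain h' where h': "hk h'" "\<forall>i<d a. mv (d a) (rho a h') w i = Ea i j0"
        using reach[OF a i, of w "\<lambda>i. Ea i j0"] by blast
      obtain c' where c': "mm (d a) Fa (mm (d a) Ea (mm (d a) (rho a h') Ea)) = (\<lambda>i j. c' * rho a (g0 a) i j)"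
        using Ga_1dim[OF h'(1)] by blast
      let ?M = "mm (d a) Fa (mm (d a) Ea (mm (d a) (rho a h') Ea))"
      have lin: "mm (d a) A Ea i j - (c / Pa) * mm (d a) A Ea i j0 = mv (d a) A w i" for A i
        unfolding mm_def mv_def w_def by (simp add: right_diff_distrib sum_subtractf sum_distrib_left mult_ac)
      have "?M i0 j - (c / Pa) * ?M i0 j0 = c' * (rho a (g0 a) i0 j - (c / Pa) * rho a (g0 a) i0 j0)"
        using c' by (simp add: fun_eq_iff algebra_simps)
      also have "\<dots> = 0" using Gj[of i0] Pa_nz by (simp add: field_simps)
      finally have 0: "?M i0 j - (c / Pa) * ?M i0 j0 = 0" .
      have "?M = mm (d a) (mm (d a) Fa (mm (d a) Ea (rho a h'))) Ea" by (simp only: mm_assoc)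
      then have "mv (d a) (mm (d a) Fa (mm (d a) Ea (rho a h'))) w i0 = 0"
        using 0 lin[of "mm (d a) Fa (mm (d a) Ea (rho a h'))" i0] by simp
      then have "mv (d a) (mm (d a) Fa Ea) (mv (d a) (rho a h') w) i0 = 0"
        by (simp add: mv_mm)
      moreover have "mv (d a) (mm (d a) Fa Ea) (mv (d a) (rho a h') w) i0 = mm (d a) (mm (d a) Fa Ea) Ea i0 j0"
        unfolding mv_def[of "d a" "mm (d a) Fa Ea"] mm_def[of "d a" "mm (d a) Fa Ea"] by (rule sum.cong) (use h'(2) in auto)
      moreover have "mm (d a) (mm (d a) Fa Ea) Ea i0 j0 = Pa * rho a (g0 a) i0 j0"
        unfolding mm_assoc Ea_sq Ga by (simp add: mm_def sum_distrib_left mult_ac)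
      ultimately show False using ij(1) Pa_nz by simp
    qed
    then have "Ea i j = (c / Pa) * Ea i j0" for i
      by (cases "i < d a") (auto simp: w_def rho_def)
    then show ?thesis by blast
  qed
  then obtain b where b: "\<And>j i. Ea i j = b j * Ea i j0" by metis
  have "Pa * Ea k0 j0 = mm (d a) Ea Ea k0 j0" unfolding Ea_sq ..
  also have "\<dots> = (\<Sum>k<d a. b k * Ea k0 j0 * Ea k j0)" unfolding mm_def
    by (rule sum.cong[OF refl]) (rule arg_cong[where f = "\<lambda>x. x * _", OF b])
  also have "\<dots> = Ea k0 j0 * (\<Sum>k<d a. b k * Ea k j0)" by (simp add: sum_distrib_left mult_ac)
  also have "(\<Sum>k<d a. b k * Ea k j0) = chi a (xs a)" unfolding chi_def[OF a] trc_def by (rule sum.cong[OF refl]) (rule b[symmetric])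
  finally show ?thesis using k0(2) by simp
qed

text \<open>The Schur element of a; the choice of indices is immaterial by
  \<open>sc_same\<close>.\<close>

definition cn :: K where "cn = sc a a 0 0 0 0"

lemma sc_swap: "sc a a i j k m = sc a a k m i j"
proof -
  have "sc a a k m i j = (\<Sum>w\<in>W. rho a (Tb (ivp w)) k m * rho a (Tb (ivp (ivp w))) i j)"
    unfolding sc_def by (rule sum_W_inv[of "\<lambda>w. rho a (Tb w) k m * rho a (Tb (ivp w)) i j", symmetric])
  also have "\<dots> = sc a a i j k m" unfolding sc_def by (rule sum.cong) (auto simp: mult.commute)
  finally show ?thesis ..
qed

text \<open>For fixed inner indices the sum is a scalar matrix in the outer ones. Exchanging w with
  its inverse interchanges the two pairs of indices, which makes it scalar in the inner ones too,
  with one common constant.\<close>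

lemma sc_same: assumes "i < d a" "j < d a" "k < d a" "m < d a"
  shows "sc a a i j k m = (if i = m \<and> j = k then cn else 0)"
proof -
  have "\<exists>c. (\<lambda>i m. sc a a i j k m) = (\<lambda>i j. c * one (d a) i j)" for j k by (rule itw_scalar[OF sc_itw[OF a a]])
  then obtain be where be: "\<And>j k. (\<lambda>i m. sc a a i j k m) = (\<lambda>i m. be j k * one (d a) i m)" by metis
  have s: "sc a a i j k m = be j k * one (d a) i m" for i j k m using be[of j k] by meson
  have z: "be j k = 0" if "j \<noteq> k" "j < d a" "k < d a" for j k
    using s[of 0 j k 0] s[of k 0 0 j] sc_swap[of 0 j k 0] that dpos[OF a] by (simp add: one_def)
  have e: "be j j = be 0 0" if "j < d a" for j
    using s[of 0 j j 0] s[of j 0 0 j] sc_swap[of 0 j j 0] that dpos[OF a] by (simp add: one_def)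
  have c: "cn = be 0 0" unfolding cn_def s using dpos[OF a] by (simp add: one_def)
  have v: "sc a a i j k m = be j k * one (d a) i m" by (rule s)
  show ?thesis
  proof (cases "i = m \<and> j = k")
    case True
    then have "be j k = cn" using e[OF assms(2)] c by (simp only:)
    then show ?thesis unfolding v using True assms(1) by (simp add: one_def)
  next
    case False
    then have "be j k * one (d a) i m = 0" using z[OF _ assms(2,3)] by (cases "j = k") (simp_all add: one_def)
    then show ?thesis unfolding v using False by (simp only: if_False)
  qed
qed

text \<open>On the diagonal, T_w and T_(w^-1) have equal entries, so this is a sum of squares to
  which the unit contributes 1.\<close>

lemma cn_pos: "pos0 cn"
proof -
  have "rho a (Tb (ivp w)) 0 0 = rho a (Tb w) 0 0" if w: "w \<in> W" for w
    using rho_star[OF a hk_Tb[OF w] dpos[OF a] dpos[OF a]] Pd_nz[OF a dpos[OF a]] w by (simp add: mult.commute)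
  then have "cn = (\<Sum>w\<in>W. rho a (Tb w) 0 0 * rho a (Tb w) 0 0)" unfolding cn_def sc_def by simp
  moreover have "pos0 (\<Sum>w\<in>W. rho a (Tb w) 0 0 * rho a (Tb w) 0 0)"
  proof (rule pos0_sum)
    have "rho a (Tb id) 0 0 = 1" unfolding rho_1[OF a] one_def using dpos[OF a] by simp
    then show "\<exists>w\<in>W. pos0 (rho a (Tb w) 0 0 * rho a (Tb w) 0 0)" by (intro bexI[of _ id]) (simp_all only: pos0_1 mult_1 id_Wn)
  qed (simp_all add: nonneg0_square)
  ultimately show ?thesis by simp
qed

lemma cn_nz: "cn \<noteq> 0" using cn_pos pos0_nz by blast

lemma rho_zz_same: "rho a (zz a) = (\<lambda>i j. cn * one (d a) i j)"
proof (intro ext)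
  fix i j
  show "rho a (zz a) i j = cn * one (d a) i j"
  proof (cases "i < d a \<and> j < d a")
    case True
    have "rho a (zz a) i j = (\<Sum>k<d a. if k = j then (if i = j then cn else 0) else 0)"
      unfolding rho_zz[OF a] by (rule sum.cong) (use True in \<open>auto simp: sc_same\<close>)
    then show ?thesis using True by (simp add: one_def)
  qed (auto simp: rho_def one_def)
qed

lemma tau_zz: assumes g: "hk g" shows "tau (zz a \<star> g) = chi a g"
proof -
  have "tau (zz a \<star> g) = (\<Sum>w\<in>W. zz a w * g (ivp w))" by (rule tau_hm[OF hk_zz g])
  also have "\<dots> = (\<Sum>w\<in>W. g (ivp w) * chi a (Tb (ivp w)))"
    by (rule sum.cong) (auto simp: zz_def Tb_def if_distrib mult.commute cong: if_cong)
  also have "\<dots> = (\<Sum>w\<in>W. g w * chi a (Tb w))" by (rule sum_W_inv[of "\<lambda>w. g w * chi a (Tb w)"])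
  finally show ?thesis using chi_expand[OF a g] by simp
qed

end

lemma rho_hN_same: assumes "a \<in> Par n" "k < d a" "m < d a"
  shows "rho a (hN a k m) = (\<lambda>i j. if i = m \<and> j = k then cn a else 0)"
proof (intro ext)
  fix i j
  show "rho a (hN a k m) i j = (if i = m \<and> j = k then cn a else 0)"
  proof (cases "i < d a \<and> j < d a")
    case True then show ?thesis using sc_same[OF assms(1), of i j k m] assms by (simp add: rho_hN)
  qed (use assms in \<open>auto simp: rho_def\<close>)
qed

text \<open>Both sides act alike in every shape, so faithfulness applies; pairing with the trace
  then expands it in characters (\<open>tau_chi\<close>).\<close>

lemma unit_zz: "Tb id = (\<lambda>u. \<Sum>a\<in>Par n. inverse (cn a) * zz a u)"
proof -
  let ?h = "\<lambda>u. Tb id u + (-1) * (\<Sum>a\<in>Par n. inverse (cn a) * zz a u)"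
  have "?h = (\<lambda>u. 0)"
  proof (rule rho_faithful)
    show "hk ?h" by (intro hk_add hk_scale hk_lc hk_zz hk_Tb id_Wn)
    fix b assume b: "b \<in> Par n"
    have "(\<Sum>a\<in>Par n. inverse (cn a) * rho b (zz a) i j) = (\<Sum>a\<in>Par n. if a = b then one (d b) i j else 0)" for i j
    proof (rule sum.cong[OF refl])
      fix a assume a: "a \<in> Par n"
      show "inverse (cn a) * rho b (zz a) i j = (if a = b then one (d b) i j else 0)"
      proof (cases "a = b")
        case True then show ?thesis using rho_zz_same[OF b] cn_nz[OF b] by simp
      next
        case False then show ?thesis using rho_zz_distinct[OF b a] by simp
      qed
    qed
    then have "(\<Sum>a\<in>Par n. inverse (cn a) * rho b (zz a) i j) = one (d b) i j" for i j
      using b finite_Par by simp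
    then show "rho b ?h = (\<lambda>i j. 0)" unfolding rho_add rho_scale rho_lc rho_1[OF b] by simp
  qed
  then show ?thesis by (simp add: fun_eq_iff)
qed

lemma tau_chi: assumes h: "hk h" shows "tau h = (\<Sum>a\<in>Par n. inverse (cn a) * chi a h)"
proof -
  have "h = Tb id \<star> h" using h by simp
  also have "\<dots> = (\<lambda>u. \<Sum>a\<in>Par n. inverse (cn a) * (zz a \<star> h) u)"
    by (subst unit_zz) (rule hm_lc_left)
  finally have "tau h = (\<Sum>a\<in>Par n. inverse (cn a) * (zz a \<star> h) id)" unfolding tau_def by (rule fun_cong)
  also have "\<dots> = (\<Sum>a\<in>Par n. inverse (cn a) * chi a h)"
    by (rule sum.cong) (use tau_zz[OF _ h] in \<open>auto simp: tau_def\<close>)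
  finally show ?thesis .
qed

section \<open>Leading coefficients at v = 0\<close>

abbreviation "al a \<equiv> aval n a"

text \<open>The leading coefficient written c with indices i j and w, lambda in the paper.\<close>
definition cf :: "nat list \<Rightarrow> perm \<Rightarrow> nat \<Rightarrow> nat \<Rightarrow> real" where
  "cf a w i j = (THE c. cval n a (X a) w i j c)"

lemma cval_unique: "cval n a (X a) w i j c \<Longrightarrow> cval n a (X a) w i j c' \<Longrightarrow> c = c'"
  unfolding cval_def using const0_unique by fastforce

lemma cf: assumes "a \<in> Par n" "w \<in> W" "i < d a" "j < d a"
  shows "cval n a (X a) w i j (cf a w i j)" "cf a w i j \<in> \<int>"
    "const0 (vK ^ al a * rho a (Tb w) i j) ((-1) ^ l w * cf a w i j)"
proof -
  obtain c where c: "cval n a (X a) w i j c" "c \<in> \<int>" using integral assms by blast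
  have e: "cf a w i j = c" unfolding cf_def by (rule the_equality) (use c cval_unique in auto)
  show "cval n a (X a) w i j (cf a w i j)" "cf a w i j \<in> \<int>" unfolding e by (rule c)+
  then show "const0 (vK ^ al a * rho a (Tb w) i j) ((-1) ^ l w * cf a w i j)"
    unfolding cval_def using rho_Tb[OF assms(2-4)] by simp
qed

lemma Rset_cf: assumes "a \<in> Par n" shows "Rset n a (d a) (X a) = {w \<in> W. \<exists>i<d a. \<exists>j<d a. cf a w i j \<noteq> 0}"
  unfolding Rset_def using cf(1)[OF assms] cval_unique by blast

lemma cf_inv: assumes "a \<in> Par n" "w \<in> W" "i < d a" "j < d a" shows "cf a (ivp w) i j = cf a w j i"
proof -
  have "const0 (Pd a i * (vK ^ al a * rho a (Tb (ivp w)) i j)) (1 * ((-1) ^ l (ivp w) * cf a (ivp w) i j))"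
    by (intro const0_mult Pd_const cf assms inv_Wn)
  moreover have "const0 ((vK ^ al a * rho a (Tb w) j i) * Pd a j) (((-1) ^ l w * cf a w j i) * 1)"
    by (intro const0_mult Pd_const cf assms)
  moreover have "Pd a i * (vK ^ al a * rho a (Tb (ivp w)) i j) = (vK ^ al a * rho a (Tb w) j i) * Pd a j"
    using rho_star[OF assms(1) hk_Tb[OF assms(2)] assms(3,4)] assms(2) by (simp add: mult_ac)
  ultimately have "(-1) ^ l (ivp w) * cf a (ivp w) i j = (-1) ^ l w * cf a w j i" using const0_unique by fastforce
  then show ?thesis using len_inv[OF assms(2)] by simp
qed

lemma sc_const: assumes a: "a \<in> Par n" "b \<in> Par n" and ij: "i < d a" "j < d a" "k < d b" "m < d b"
  shows "const0 (vK ^ (al a + al b) * sc a b i j k m) (\<Sum>w\<in>W. cf a w i j * cf b w m k)"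
proof -
  have "vK ^ (al a + al b) * sc a b i j k m = (\<Sum>w\<in>W. (vK ^ al a * rho a (Tb w) i j) * (vK ^ al b * rho b (Tb (ivp w)) k m))"
    by (simp add: sc_def sum_distrib_left power_add mult_ac)
  moreover have "const0 (\<Sum>w\<in>W. (vK ^ al a * rho a (Tb w) i j) * (vK ^ al b * rho b (Tb (ivp w)) k m))
     (\<Sum>w\<in>W. ((-1) ^ l w * cf a w i j) * ((-1) ^ l (ivp w) * cf b (ivp w) k m))"
    by (intro const0_sum const0_mult cf a ij inv_Wn)
  moreover have "(\<Sum>w\<in>W. ((-1) ^ l w * cf a w i j) * ((-1) ^ l (ivp w) * cf b (ivp w) k m)) = (\<Sum>w\<in>W. cf a w i j * cf b w m k)"
  proof (rule sum.cong[OF refl])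
    fix w assume w: "w \<in> W"
    have "(-1::real) ^ l w * (-1) ^ l w = 1" by (simp flip: power_mult_distrib)
    then show "((-1) ^ l w * cf a w i j) * ((-1) ^ l (ivp w) * cf b (ivp w) k m) = cf a w i j * cf b w m k"
      unfolding len_inv[OF w] cf_inv[OF a(2) w ij(3,4)] by (simp add: mult_ac)
  qed
  ultimately show ?thesis by simp
qed

text \<open>The leading coefficient of the Schur element cn.\<close>
definition fa :: "nat list \<Rightarrow> real" where "fa a = (\<Sum>w\<in>W. cf a w 0 0 * cf a w 0 0)"

lemma cn_const: assumes a: "a \<in> Par n" shows "const0 (vK ^ (al a + al a) * cn a) (fa a)"
  unfolding cn_def[OF a] fa_def by (rule sc_const[OF a a]) (use dpos[OF a] in auto)

text \<open>The leading term of the Schur relation \<open>sc_same\<close>; the middle indices are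
  exchanged because inverting w transposes the leading matrix.\<close>

lemma orth_cf: assumes a: "a \<in> Par n" and ij: "i < d a" "j < d a" "k < d a" "m < d a"
  shows "(\<Sum>w\<in>W. cf a w i j * cf a w k m) = (if i = k \<and> j = m then fa a else 0)"
proof -
  have "const0 (vK ^ (al a + al a) * sc a a i j m k) (\<Sum>w\<in>W. cf a w i j * cf a w k m)"
    by (rule sc_const[OF a a ij(1,2) ij(4,3)])
  moreover have "const0 (vK ^ (al a + al a) * sc a a i j m k) (if i = k \<and> j = m then fa a else 0)"
    using sc_same[OF a ij(1,2) ij(4,3)] cn_const[OF a] by auto
  ultimately show ?thesis using const0_unique by blast
qed

text \<open>All elements of the subgroup except the longest are suppressed by a positive power of v.
  The set J may come from another shape with the same \<open>aval\<close>, a case that arises in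
  \<open>fa_1\<close>.\<close>

lemma rho_xs_const: assumes a: "a \<in> Par n" and ij: "i < d a" "j < d a" and J: "J \<subseteq> S" and e: "l (wJ J) = al a"
  shows "const0 (vK ^ (al a + al a) * rho a (xJ J qs) i j) (cf a (wJ J) i j)"
proof -
  let ?w = "wJ J"
  have "vK ^ (al a + al a) * rho a (xJ J qs) i j = (\<Sum>u\<in>WJ J. ((-1) ^ l u * vK ^ (al a - l u)) * (vK ^ al a * rho a (Tb u) i j))"
    unfolding xJ_lc[OF J] rho_lc sum_distrib_left
  proof (rule sum.cong[OF refl])
    fix u assume u: "u \<in> WJ J"
    have "l u \<le> al a" using wJ(2)[OF J u] e by simp
    then have "vK ^ al a * qs ^ l u = (-1) ^ l u * vK ^ (al a - l u)"
      by (simp add: power_diff power_minus[of "inverse vK"] power_inverse divide_inverse)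
    then show "vK ^ (al a + al a) * (qs ^ l u * rho a (Tb u) i j) = ((-1) ^ l u * vK ^ (al a - l u)) * (vK ^ al a * rho a (Tb u) i j)"
      by (simp add: power_add mult_ac)
  qed
  moreover have "const0 (\<Sum>u\<in>WJ J. ((-1) ^ l u * vK ^ (al a - l u)) * (vK ^ al a * rho a (Tb u) i j))
     (\<Sum>u\<in>WJ J. ((-1) ^ l u * (if al a - l u = 0 then 1 else 0)) * ((-1) ^ l u * cf a u i j))"
    using WJ_W[OF J] by (intro const0_sum const0_mult cf a ij const0_nat_power_v const0_power const0_minus[OF const0_1]) auto
  moreover have "(\<Sum>u\<in>WJ J. ((-1) ^ l u * (if al a - l u = 0 then 1 else 0)) * ((-1) ^ l u * cf a u i j))
     = (\<Sum>u\<in>WJ J. if u = ?w then cf a ?w i j else 0)"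
  proof (rule sum.cong[OF refl])
    fix u assume u: "u \<in> WJ J"
    have "l u \<le> al a" using wJ(2)[OF J u] e by simp
    then have "al a - l u = 0 \<longleftrightarrow> u = ?w" using wJ_eq[OF J u] e by auto
    moreover have "(-1::real) ^ l u * ((-1) ^ l u * c) = c" for c by (simp add: mult.assoc[symmetric] power_mult_distrib[symmetric])
    ultimately show "((-1) ^ l u * (if al a - l u = 0 then 1 else 0)) * ((-1) ^ l u * cf a u i j) = (if u = ?w then cf a ?w i j else 0)" by auto
  qed
  ultimately show ?thesis using wJ(1)[OF J] finite_WJ[OF J] by simp
qed

abbreviation "wl a \<equiv> wJ (Jl n a)"

lemma wl_W: "wl a \<in> W" by (rule WJ_W[OF Jl_S wJ(1)[OF Jl_S]])

lemma P_const: "const0 (vK ^ (al a + al a) * Pa a) 1"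
  using PJ_const[OF Jl_S, of a] unfolding aval_wJ mult_2 .

text \<open>This is the leading matrix of the idempotent \<open>Ea\<close> divided by
  \<open>Pa\<close>: integral, symmetric, idempotent and of trace 1. Such a matrix is a single
  diagonal unit.\<close>

lemma wl_diag: assumes a: "a \<in> Par n"
  shows "\<exists>i0<d a. \<forall>i<d a. \<forall>j<d a. cf a (wl a) i j = (if i = i0 \<and> j = i0 then 1 else 0)"
proof -
  let ?c = "cf a (wl a)"
  let ?v = "vK ^ (al a + al a)"
  have E: "const0 (?v * Ea a i j) (?c i j)" if "i < d a" "j < d a" for i j
    by (rule rho_xs_const[OF a that Jl_S]) (simp add: aval_wJ)
  have tr: "(\<Sum>i<d a. ?c i i) = 1"
  proof -
    have "const0 (\<Sum>i<d a. ?v * Ea a i i) (\<Sum>i<d a. ?c i i)" by (intro const0_sum E) auto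
    moreover have "(\<Sum>i<d a. ?v * Ea a i i) = ?v * Pa a" using chi_xs[OF a] unfolding chi_def[OF a] trc_def by (simp flip: sum_distrib_left)
    ultimately show ?thesis using const0_unique[OF P_const[of a]] by simp
  qed
  have idem: "(\<Sum>k<d a. ?c i k * ?c k j) = ?c i j" if ij: "i < d a" "j < d a" for i j
  proof -
    have "const0 (\<Sum>k<d a. (?v * Ea a i k) * (?v * Ea a k j)) (\<Sum>k<d a. ?c i k * ?c k j)" by (intro const0_sum const0_mult E ij) auto
    moreover have "(\<Sum>k<d a. (?v * Ea a i k) * (?v * Ea a k j)) = (?v * Pa a) * (?v * Ea a i j)"
    proof -
      have "(\<Sum>k<d a. (?v * Ea a i k) * (?v * Ea a k j)) = ?v * ?v * mm (d a) (Ea a) (Ea a) i j" by (simp add: mm_def sum_distrib_left mult_ac)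
      then show ?thesis unfolding Ea_sq[OF a] by (simp add: mult_ac)
    qed
    moreover have "const0 ((?v * Pa a) * (?v * Ea a i j)) (1 * ?c i j)" by (intro const0_mult P_const E ij)
    ultimately show ?thesis using const0_unique by fastforce
  qed
  have sym: "?c i j = ?c j i" if "i < d a" "j < d a" for i j
    using cf_inv[OF a wl_W[of a] that] ivp_wJ[OF Jl_S, of a] by simp
  have sq: "?c i i = (\<Sum>k<d a. (?c i k)\<^sup>2)" if "i < d a" for i
    unfolding idem[OF that that, symmetric] by (rule sum.cong) (use sym that in \<open>auto simp: power2_eq_square\<close>)
  have int: "?c i j \<in> \<int>" if "i < d a" "j < d a" for i j by (rule cf(2)[OF a wl_W that])
  have "\<exists>i0<d a. ?c i0 i0 \<noteq> 0"
  proof (rule ccontr)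
    assume "\<not> ?thesis" then have "(\<Sum>i<d a. ?c i i) = 0" by simp
    then show False using tr by simp
  qed
  then obtain i0 where i0: "i0 < d a" "?c i0 i0 \<noteq> 0" by blast
  have nn: "?c i i \<ge> 0" if "i < d a" for i unfolding sq[OF that] by (simp add: sum_nonneg)
  have ge1: "?c i i \<ge> 1" if "i < d a" "?c i i \<noteq> 0" for i
    using int[OF that(1,1)] nn[OF that(1)] that(2) by (auto elim!: Ints_cases)
  have "(\<Sum>i<d a. ?c i i) = ?c i0 i0 + (\<Sum>i\<in>{..<d a} - {i0}. ?c i i)" using i0 by (simp add: sum.remove)
  moreover have rest: "(\<Sum>i\<in>{..<d a} - {i0}. ?c i i) \<ge> 0" using nn by (intro sum_nonneg) auto
  ultimately have c1: "?c i0 i0 = 1" and r0: "(\<Sum>i\<in>{..<d a} - {i0}. ?c i i) = 0" using tr ge1[OF i0] by linarith+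
  have z: "?c i i = 0" if "i < d a" "i \<noteq> i0" for i
  proof -
    have "\<forall>i\<in>{..<d a} - {i0}. ?c i i = 0" using r0 nn by (subst (asm) sum_nonneg_eq_0_iff) auto
    then show ?thesis using that by simp
  qed
  have z2: "?c i j = 0" if "i < d a" "j < d a" "i \<noteq> i0" for i j
  proof -
    have "(\<Sum>k<d a. (?c i k)\<^sup>2) = 0" using sq[OF that(1)] z[OF that(1,3)] by simp
    then have "\<forall>k\<in>{..<d a}. (?c i k)\<^sup>2 = 0" by (subst (asm) sum_nonneg_eq_0_iff) auto
    then show ?thesis using that by simp
  qed
  have "?c i j = (if i = i0 \<and> j = i0 then 1 else 0)" if "i < d a" "j < d a" for i j
    using z2[OF that] z2[OF that(2,1)] sym[OF that] c1 by auto
  then show ?thesis using i0 by blast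
qed

text \<open>By \<open>orth_cf\<close> the sum of squares may be taken at the position of
  \<open>wl a\<close>, which contributes 1.\<close>

lemma fa_ge1: assumes a: "a \<in> Par n" shows "fa a \<ge> 1" "fa a \<in> \<int>"
proof -
  obtain i0 where i0: "i0 < d a" "cf a (wl a) i0 i0 = 1" using wl_diag[OF a] by auto
  have "fa a = (\<Sum>w\<in>W. cf a w i0 i0 * cf a w i0 i0)" using orth_cf[OF a i0(1) i0(1) i0(1) i0(1)] by simp
  also have "\<dots> = 1 + (\<Sum>w\<in>W - {wl a}. cf a w i0 i0 * cf a w i0 i0)" using wl_W[of a] i0(2) by (simp add: sum.remove)
  moreover have "(\<Sum>w\<in>W - {wl a}. cf a w i0 i0 * cf a w i0 i0) \<ge> 0" by (intro sum_nonneg) auto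
  ultimately show "fa a \<ge> 1" by linarith
  show "fa a \<in> \<int>" unfolding fa_def using cf(2)[OF a] dpos[OF a] by (intro Ints_sum Ints_mult) auto
qed

end

section \<open>Leading coefficients and the basis C\<close>

lemma int_sum_squares_one:
  fixes c :: "'x \<Rightarrow> real"
  assumes "finite I" "\<And>x. x \<in> I \<Longrightarrow> c x \<in> \<int>" "(\<Sum>x\<in>I. c x * c x) = 1"
  shows "\<exists>x\<in>I. c x * c x = 1 \<and> (\<forall>y\<in>I. y \<noteq> x \<longrightarrow> c y = 0)"
proof -
  have "\<exists>x\<in>I. c x \<noteq> 0"
  proof (rule ccontr)
    assume "\<not> ?thesis" then have "(\<Sum>x\<in>I. c x * c x) = 0" by simp
    then show False using assms(3) by simp
  qed
  then obtain x where x: "x \<in> I" "c x \<noteq> 0" by blast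
  obtain z :: int where z: "c x = of_int z" using assms(2)[OF x(1)] by (auto elim: Ints_cases)
  then have "z \<noteq> 0" using x by simp
  then have "z * z \<ge> 1" by (metis int_one_le_iff_zero_less not_square_less_zero linorder_neqE_linordered_idom mult_eq_0_iff)
  then have "real_of_int (z * z) \<ge> 1" by (simp only: of_int_1_le_iff)
  then have 1: "c x * c x \<ge> 1" unfolding z by simp
  have s: "(\<Sum>x\<in>I. c x * c x) = c x * c x + (\<Sum>y\<in>I - {x}. c y * c y)" using assms(1) x by (simp add: sum.remove)
  have nn: "(\<Sum>y\<in>I - {x}. c y * c y) \<ge> 0" by (intro sum_nonneg) auto
  have e1: "c x * c x = 1" and e0: "(\<Sum>y\<in>I - {x}. c y * c y) = 0" using 1 s nn assms(3) by linarith+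
  have "\<forall>y\<in>I - {x}. c y * c y = 0" using e0 assms(1) by (subst (asm) sum_nonneg_eq_0_iff) auto
  then show ?thesis using e1 x by auto
qed

context reps
begin

text \<open>Division by \<open>PJ\<close> makes the antisymmetrizer idempotent, and being fixed by
  \<open>star\<close> it is symmetric for the invariant form.\<close>

lemma rho_idem: assumes a: "a \<in> Par n" and J: "J \<subseteq> S"
  defines "Eh \<equiv> \<lambda>i j. inverse (PJ J qs) * rho a (xJ J qs) i j"
  shows "Eh = (\<lambda>i j. 0) \<or> (\<exists>A r. (\<forall>i<d a. \<forall>j<d a. const0 (Eh i j) (A i j)) \<and> const0 (trc (d a) Eh) r \<and> r > 0)"
proof (cases "Eh = (\<lambda>i j. 0)")
  case False
  have P: "PJ J qs \<noteq> 0" by (rule PJ_nz[OF J])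
  have hkx: "hk (xJ J qs)" by (rule hk_xJ[OF J])
  have sq: "mm (d a) (rho a (xJ J qs)) (rho a (xJ J qs)) = (\<lambda>i j. PJ J qs * rho a (xJ J qs) i j)"
    using rho_mult[OF a hkx hkx] unfolding xJ_xJ[OF J qsign] rho_scale by simp
  have "mm (d a) Eh Eh i j = Eh i j" for i j
  proof -
    have "mm (d a) Eh Eh i j = inverse (PJ J qs) * inverse (PJ J qs) * mm (d a) (rho a (xJ J qs)) (rho a (xJ J qs)) i j"
      unfolding Eh_def mm_def by (simp add: sum_distrib_left mult_ac)
    then show ?thesis unfolding sq Eh_def using P by simp
  qed
  then have idem: "mm (d a) Eh Eh = Eh" by (intro ext)
  have sup: "sup2 (d a) (d a) Eh" unfolding Eh_def using sup2_rho by (simp add: sup2_def)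
  have sym: "Pd a i * Eh i j = Eh j i * Pd a j" if "i < d a" "j < d a" for i j
    using rho_star[OF a hkx that] unfolding star_xJ[OF J] Eh_def by (simp add: mult_ac)
  show ?thesis using const0_sym_idem[OF idem sup sym Pd_const[OF a] False] by blast
qed simp

text \<open>Evaluate the symmetrizing trace on the idempotent attached to lam: all terms are nonnegative at v = 0, those of larger
  shape have integral weight by induction, and the total is 1, so they vanish.\<close>
lemma fa_1: assumes "lam \<in> Par n" shows "fa lam = 1"
  using assms
proof (induction "up lam" arbitrary: lam rule: less_induct)
  case (less lam)
  note lam = less(2)
  let ?x = "xs lam" and ?P = "Pa lam" and ?b = "al lam + al lam"
  define tE where "tE = (\<lambda>a. inverse ?P * chi a ?x)"
  \<comment> \<open>Scaled so that the total is the inverse of \<open>vK ^ ?b * ?P\<close>, which is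
    1 at v = 0, and the term of lam is the inverse of the scaled Schur element.\<close>
  define t where "t = (\<lambda>a. inverse (cn a) * tE a * inverse (vK ^ ?b))"
  have P: "?P \<noteq> 0" by (rule Pa_nz[OF lam])
  have tE: "tE a = 0 \<or> ((\<exists>r>0. const0 (tE a) r) \<and> dominates lam a)" if a: "a \<in> Par n" for a
  proof -
    let ?Eh = "\<lambda>i j. inverse ?P * rho a ?x i j"
    have tr: "trc (d a) ?Eh = tE a" unfolding tE_def chi_def[OF a] trc_def by (simp add: sum_distrib_left)
    show ?thesis
    proof (cases "?Eh = (\<lambda>i j. 0)")
      case True
      then have "tE a = 0" unfolding tr[symmetric] by (simp only: trc_def) simp
      then show ?thesis ..
    next
      case False
      have "rho a ?x \<noteq> (\<lambda>i j. 0)"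
      proof
        assume "rho a ?x = (\<lambda>i j. 0)"
        then show False using False by simp
      qed
      then have "dominates lam a" by (rule rho_xs_dominates[OF a lam])
      then show ?thesis using rho_idem[OF a Jl_S, of lam] False unfolding tr by blast
    qed
  qed
  have nnt: "nonneg0 (t a)" if a: "a \<in> Par n" for a
  proof -
    have "nonneg0 (tE a)" using tE[OF a] pos0_const0 by (auto simp: nonneg0_def)
    then show ?thesis unfolding t_def
      by (intro nonneg0_mult pos0_nonneg0[OF pos0_inverse] pos0_inverse cn_pos a pos0_power pos0_vK)
  qed
  have "tau ?x = 1" unfolding tau_def xJ_def[OF Jl_S] using WJ_id[of "Jl n lam"] by simp
  then have "(\<Sum>a\<in>Par n. inverse (cn a) * chi a ?x) = 1" using tau_chi[OF hk_xs] by simp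
  moreover have "(\<Sum>a\<in>Par n. t a) = (\<Sum>a\<in>Par n. (inverse ?P * inverse (vK ^ ?b)) * (inverse (cn a) * chi a ?x))"
    unfolding t_def tE_def by (simp add: mult_ac)
  ultimately have "(\<Sum>a\<in>Par n. t a) = inverse ?P * inverse (vK ^ ?b)" by (simp only: mult_1_right flip: sum_distrib_left)
  then have tot: "(\<Sum>a\<in>Par n. t a) = inverse (vK ^ ?b * ?P)" by (simp add: mult_ac)
  have ctot: "const0 (\<Sum>a\<in>Par n. t a) 1" unfolding tot using const0_inverse[OF P_const] by simp
  have tl: "t lam = inverse (vK ^ ?b * cn lam)" unfolding t_def tE_def using chi_xs[OF lam] P by (simp add: mult_ac)
  have fnz: "fa lam \<noteq> 0" using fa_ge1(1)[OF lam] by simp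
  have ctl: "const0 (t lam) (inverse (fa lam))" unfolding tl by (rule const0_inverse[OF cn_const[OF lam] fnz])
  define rest where "rest = (\<Sum>a\<in>Par n - {lam}. t a)"
  have "(\<Sum>a\<in>Par n. t a) = t lam + rest" unfolding rest_def using lam finite_Par by (simp add: sum.remove)
  then have "rest = (\<Sum>a\<in>Par n. t a) - t lam" by simp
  then have crest: "const0 rest (1 - inverse (fa lam))" using const0_diff[OF ctot ctl] by simp
  have z: "const0 (t a) 0" if a: "a \<in> Par n - {lam}" for a
  proof -
    have aP: "a \<in> Par n" and ne: "a \<noteq> lam" using a by auto
    show ?thesis
    proof (cases "tE a = 0")
      case True then show ?thesis by (simp add: t_def)
    next
      case False
      then obtain r where r: "r > 0" "const0 (tE a) r" and dom: "dominates lam a" using tE[OF aP] by blast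
      have "up a < up lam" by (rule up_less[OF lam aP dom]) (use ne in simp)
      then have f1: "fa a = 1" using less(1) aP by blast
      define w where "w = inverse (vK ^ (al a + al a) * cn a) * tE a"
      have cw: "const0 w r" unfolding w_def using const0_mult[OF const0_inverse[OF cn_const[OF aP]] r(2)] f1 by simp
      have tw: "t a * vK ^ ?b = w * vK ^ (al a + al a)" unfolding t_def w_def by simp
      have nnr: "nonneg0 (rest - t a)"
      proof -
        have "rest = t a + (\<Sum>b\<in>Par n - {lam} - {a}. t b)" unfolding rest_def using a finite_Par by (simp add: sum.remove)
        moreover have "nonneg0 (\<Sum>b\<in>Par n - {lam} - {a}. t b)" by (rule nonneg0_sum) (use nnt in auto)
        ultimately show ?thesis by simp
      qed
      consider "al lam < al a" | "al a < al lam" | "al a = al lam" by linarith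
      then show ?thesis
      proof cases
        \<comment> \<open>A positive power of v remains in \<open>t a\<close>.\<close>
        case 1
        define e where "e = al a + al a - ?b - 1"
        have e: "al a + al a = ?b + Suc e" using 1 unfolding e_def by linarith
        have "t a = w * vK ^ Suc e"
        proof -
          have "t a * vK ^ ?b = (w * vK ^ Suc e) * vK ^ ?b" unfolding tw e unfolding power_add[of vK ?b "Suc e"] by (simp only: mult_ac)
          then show ?thesis by (simp only: mult_right_cancel[OF power_not_zero[OF vK_nz]])
        qed
        then show ?thesis using const0_mult[OF cw const0_nat_power_v[of "Suc e"]] by simp
      next
        \<comment> \<open>Here \<open>t a\<close> would have a pole with positive coefficient; this
          is impossible, as \<open>rest\<close> is regular and exceeds \<open>t a\<close> by a
          nonnegative amount.\<close>
        case 2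
        define e where "e = ?b - (al a + al a) - 1"
        have e: "?b = (al a + al a) + Suc e" using 2 unfolding e_def by linarith
        have "t a * vK ^ Suc e = w"
        proof -
          have "(t a * vK ^ Suc e) * vK ^ (al a + al a) = w * vK ^ (al a + al a)" using tw unfolding e unfolding power_add[of vK "al a + al a" "Suc e"] by (simp only: mult_ac)
          then show ?thesis by (simp only: mult_right_cancel[OF power_not_zero[OF vK_nz]])
        qed
        then have "(rest - t a) * vK ^ Suc e = rest * vK ^ Suc e - w" by (simp only: left_diff_distrib)
        moreover have "const0 (rest * vK ^ Suc e - w) ((1 - inverse (fa lam)) * 0 - r)"
          using const0_diff[OF const0_mult[OF crest const0_nat_power_v[of "Suc e"]] cw] by simp
        moreover have "nonneg0 ((rest - t a) * vK ^ Suc e)" by (intro nonneg0_mult nnr pos0_nonneg0 pos0_power pos0_vK)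
        ultimately have "(1 - inverse (fa lam)) * 0 - r \<ge> 0" using nonneg0_const0_ge by metis
        then show ?thesis using r by simp
      next
        \<comment> \<open>With equal exponents r is the trace of an integral leading matrix, hence
          at least 1, which would leave \<open>inverse (fa lam)\<close> nonpositive.\<close>
        case 3
        then have "t a = w" using tw by simp
        then have "const0 (rest - t a) ((1 - inverse (fa lam)) - r)" using const0_diff[OF crest cw] by simp
        then have ge: "(1 - inverse (fa lam)) - r \<ge> 0" by (rule nonneg0_const0_ge[OF nnr])
        have "r \<in> \<int>"
        proof -
          have "const0 (vK ^ ?b * rho a ?x i j) (cf a (wl lam) i j)" if "i < d a" "j < d a" for i j
            using rho_xs_const[OF aP that Jl_S[of lam]] 3 by (simp add: aval_wJ)
          then have "const0 (\<Sum>i<d a. vK ^ ?b * rho a ?x i i) (\<Sum>i<d a. cf a (wl lam) i i)" by (intro const0_sum) auto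
          moreover have "(\<Sum>i<d a. vK ^ ?b * rho a ?x i i) = (vK ^ ?b * ?P) * tE a"
            unfolding tE_def chi_def[OF aP] trc_def using P by (simp flip: sum_distrib_left)
          moreover have "const0 ((vK ^ ?b * ?P) * tE a) (1 * r)" by (intro const0_mult P_const r(2))
          ultimately have "r = (\<Sum>i<d a. cf a (wl lam) i i)" using const0_unique by fastforce
          then show ?thesis using cf(2)[OF aP wl_W] by (auto intro!: Ints_sum)
        qed
        then have "r \<ge> 1" using r(1) by (auto elim!: Ints_cases)
        then have "inverse (fa lam) \<le> 0" using ge by linarith
        then show ?thesis using fa_ge1(1)[OF lam] by (simp add: inverse_nonpositive_iff_nonpositive)
      qed
    qed
  qed
  have "const0 rest (\<Sum>a\<in>Par n - {lam}. 0)" unfolding rest_def by (rule const0_sum) (rule z)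
  then have "1 - inverse (fa lam) = 0" using const0_unique[OF crest] by simp
  then show ?case using fnz by simp
qed

lemma cn_const1: "a \<in> Par n \<Longrightarrow> const0 (vK ^ (al a + al a) * cn a) 1"
  using cn_const fa_1 by metis

lemma unique_word: assumes a: "a \<in> Par n" and ij: "i < d a" "j < d a"
  shows "\<exists>w\<in>W. cf a w i j * cf a w i j = 1 \<and> (\<forall>y\<in>W. y \<noteq> w \<longrightarrow> cf a y i j = 0)"
  by (rule int_sum_squares_one[OF finite_Wn]) (use cf(2)[OF a _ ij] orth_cf[OF a ij ij] fa_1[OF a] in auto)

text \<open>The trace of T_w T_(w^-1) is 1; expand it by \<open>tau_chi\<close> and take leading
  terms. This is the second orthogonality relation, for a fixed w and varying position.\<close>

lemma complete_cf: assumes w: "w \<in> W"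
  shows "(\<Sum>a\<in>Par n. \<Sum>i<d a. \<Sum>j<d a. cf a w i j * cf a w i j) = 1"
proof -
  have Ti: "hk (Tb w)" "hk (Tb (ivp w))" using w by auto
  have "tau (Tb w \<star> Tb (ivp w)) = 1" using tau_Tb_inv[OF Ti(1) w] by (simp add: Tb_def)
  then have 1: "(\<Sum>a\<in>Par n. inverse (cn a) * chi a (Tb w \<star> Tb (ivp w))) = 1" using tau_chi[OF hk_hm[OF Ti(2)], of "Tb w"] by simp
  have "const0 (inverse (cn a) * chi a (Tb w \<star> Tb (ivp w))) (\<Sum>i<d a. \<Sum>j<d a. cf a w i j * cf a w i j)" if a: "a \<in> Par n" for a
  proof -
    let ?v = "vK ^ al a"
    have "chi a (Tb w \<star> Tb (ivp w)) = (\<Sum>i<d a. \<Sum>j<d a. rho a (Tb w) i j * rho a (Tb (ivp w)) j i)"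
      unfolding chi_def[OF a] trc_def rho_mult[OF a Ti] mm_def ..
    then have "vK ^ (al a + al a) * chi a (Tb w \<star> Tb (ivp w)) = (\<Sum>i<d a. \<Sum>j<d a. (?v * rho a (Tb w) i j) * (?v * rho a (Tb (ivp w)) j i))"
      by (simp add: sum_distrib_left power_add mult_ac)
    moreover have "const0 (\<Sum>i<d a. \<Sum>j<d a. (?v * rho a (Tb w) i j) * (?v * rho a (Tb (ivp w)) j i))
       (\<Sum>i<d a. \<Sum>j<d a. ((-1) ^ l w * cf a w i j) * ((-1) ^ l (ivp w) * cf a (ivp w) j i))"
      by (intro const0_sum const0_mult cf a w inv_Wn) auto
    moreover have "(\<Sum>i<d a. \<Sum>j<d a. ((-1) ^ l w * cf a w i j) * ((-1) ^ l (ivp w) * cf a (ivp w) j i)) = (\<Sum>i<d a. \<Sum>j<d a. cf a w i j * cf a w i j)"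
    proof (intro sum.cong refl)
      fix i j assume ij: "i \<in> {..<d a}" "j \<in> {..<d a}"
      have "(-1::real) ^ l w * (-1) ^ l w = 1" by (simp flip: power_mult_distrib)
      then show "((-1) ^ l w * cf a w i j) * ((-1) ^ l (ivp w) * cf a (ivp w) j i) = cf a w i j * cf a w i j"
        using cf_inv[OF a w, of j i] ij unfolding len_inv[OF w] by (simp add: mult_ac)
    qed
    ultimately have 2: "const0 (vK ^ (al a + al a) * chi a (Tb w \<star> Tb (ivp w))) (\<Sum>i<d a. \<Sum>j<d a. cf a w i j * cf a w i j)" by simp
    have e: "inverse (cn a) * chi a (Tb w \<star> Tb (ivp w)) = (vK ^ (al a + al a) * chi a (Tb w \<star> Tb (ivp w))) * inverse (vK ^ (al a + al a) * cn a)"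
      by simp
    have "const0 (\<dots>) ((\<Sum>i<d a. \<Sum>j<d a. cf a w i j * cf a w i j) * inverse 1)"
      by (rule const0_mult[OF 2 const0_inverse[OF cn_const1[OF a]]]) simp
    then show ?thesis by (simp only: e inverse_1 mult_1_right)
  qed
  then have "const0 (\<Sum>a\<in>Par n. inverse (cn a) * chi a (Tb w \<star> Tb (ivp w))) (\<Sum>a\<in>Par n. \<Sum>i<d a. \<Sum>j<d a. cf a w i j * cf a w i j)" by (rule const0_sum)
  then show ?thesis unfolding 1 by (rule const0_unique[OF _ const0_1])
qed

lemma unique_position: assumes w: "w \<in> W"
  shows "\<exists>a i j. a \<in> Par n \<and> i < d a \<and> j < d a \<and> cf a w i j \<noteq> 0 \<and>
    (\<forall>b\<in>Par n. \<forall>k<d b. \<forall>m<d b. cf b w k m \<noteq> 0 \<longrightarrow> b = a \<and> k = i \<and> m = j)"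
proof -
  let ?I = "Sigma (Par n) (\<lambda>a. {..<d a} \<times> {..<d a})"
  let ?c = "\<lambda>p. cf (fst p) w (fst (snd p)) (snd (snd p))"
  have "(\<Sum>p\<in>?I. ?c p * ?c p) = (\<Sum>a\<in>Par n. \<Sum>q\<in>{..<d a} \<times> {..<d a}. cf a w (fst q) (snd q) * cf a w (fst q) (snd q))"
    by (subst sum.Sigma) (auto simp: finite_Par case_prod_beta)
  also have "\<dots> = (\<Sum>a\<in>Par n. \<Sum>i<d a. \<Sum>j<d a. cf a w i j * cf a w i j)"
    by (intro sum.cong refl) (simp add: sum.cartesian_product case_prod_beta)
  finally have s: "(\<Sum>p\<in>?I. ?c p * ?c p) = 1" using complete_cf[OF w] by simp
  have "\<exists>p\<in>?I. ?c p * ?c p = 1 \<and> (\<forall>q\<in>?I. q \<noteq> p \<longrightarrow> ?c q = 0)"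
    by (rule int_sum_squares_one[OF _ _ s]) (use cf(2)[OF _ w] finite_Par in auto)
  then obtain p where p: "p \<in> ?I" "?c p * ?c p = 1" "\<forall>q\<in>?I. q \<noteq> p \<longrightarrow> ?c q = 0" by blast
  obtain a i j where e: "p = (a, i, j)" by (cases p)
  have "b = a \<and> k = i \<and> m = j" if "b \<in> Par n" "k < d b" "m < d b" "cf b w k m \<noteq> 0" for b k m
  proof -
    have "(b, k, m) \<in> ?I" using that by auto
    moreover have "?c (b, k, m) \<noteq> 0" using that by simp
    ultimately have "(b, k, m) = p" using p(3) by blast
    then show ?thesis using e by simp
  qed
  moreover have "a \<in> Par n" "i < d a" "j < d a" "cf a w i j \<noteq> 0" using p(1,2) e by auto
  ultimately show ?thesis by blast
qed

section \<open>The sets of the theorem and the action of C_w\<close>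

abbreviation "RR a \<equiv> Rset n a (d a) (X a)"

lemma RR_W: "x \<in> RR a \<Longrightarrow> x \<in> W" by (simp add: Rset_def)

lemma RR_I: "a \<in> Par n \<Longrightarrow> w \<in> W \<Longrightarrow> i < d a \<Longrightarrow> j < d a \<Longrightarrow> cf a w i j \<noteq> 0 \<Longrightarrow> w \<in> RR a"
  unfolding Rset_cf by blast

lemma RR_cover: "w \<in> W \<Longrightarrow> \<exists>a\<in>Par n. w \<in> RR a" using unique_position RR_I by blast

lemma RR_disjoint: assumes "a \<in> Par n" "b \<in> Par n" "w \<in> RR a" "w \<in> RR b" shows "a = b"
  using assms unique_position[of w] RR_W[OF assms(3)] unfolding Rset_cf[OF assms(1)] Rset_cf[OF assms(2)] by blast

text \<open>The leading matrix of the inverse is the transpose.\<close>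

lemma RR_inv: assumes "a \<in> Par n" "w \<in> RR a" shows "ivp w \<in> RR a"
proof -
  obtain i j where w: "w \<in> W" "i < d a" "j < d a" "cf a w i j \<noteq> 0" using assms unfolding Rset_cf[OF assms(1)] by blast
  then have "cf a (ivp w) j i \<noteq> 0" using cf_inv[OF assms(1) w(1) w(3,2)] by simp
  then show ?thesis using RR_I[OF assms(1)] w by simp
qed

lemma wl_RR: assumes "a \<in> Par n" shows "wl a \<in> RR a"
proof -
  obtain i0 where "i0 < d a" "\<forall>i<d a. \<forall>j<d a. cf a (wl a) i j = (if i = i0 \<and> j = i0 then 1 else 0)" using wl_diag[OF assms] by blast
  then have "cf a (wl a) i0 i0 = 1" by simp
  then show ?thesis using RR_I[OF assms wl_W, of i0 i0] \<open>i0 < d a\<close> by simp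
qed

lemma rho_CC_const: assumes a: "a \<in> Par n" and w: "w \<in> W" and ij: "i < d a" "j < d a"
  shows "const0 (vK ^ al a * rho a (CC w) i j) ((-1) ^ l w * cf a w i j)"
proof -
  have "vK ^ al a * rho a (CC w) i j = (\<Sum>u\<in>W. CC w u * (vK ^ al a * rho a (Tb u) i j))"
    unfolding rho_expand[OF hk_CC[OF w]] by (simp add: sum_distrib_left mult_ac)
  moreover have "const0 (\<Sum>u\<in>W. CC w u * (vK ^ al a * rho a (Tb u) i j)) (\<Sum>u\<in>W. (if u = w then 1 else 0) * ((-1) ^ l u * cf a u i j))"
    by (intro const0_sum const0_mult CC_const w cf a ij)
  moreover have "(\<Sum>u\<in>W. (if u = w then 1 else 0) * ((-1) ^ l u * cf a u i j)) = (\<Sum>u\<in>W. if u = w then (-1) ^ l w * cf a w i j else 0)"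
    by (rule sum.cong) auto
  ultimately show ?thesis using w by simp
qed

lemma rho_CC_nz: assumes "a \<in> Par n" "w \<in> RR a" shows "rho a (CC w) \<noteq> (\<lambda>i j. 0)"
proof
  assume z: "rho a (CC w) = (\<lambda>i j. 0)"
  obtain i j where w: "w \<in> W" "i < d a" "j < d a" "cf a w i j \<noteq> 0" using assms unfolding Rset_cf[OF assms(1)] by blast
  have "const0 0 ((-1) ^ l w * cf a w i j)" using rho_CC_const[OF assms(1) w(1-3)] z by simp
  then have "(-1) ^ l w * cf a w i j = 0" by (rule const0_unique[OF _ const0_0])
  then show False using w(4) by simp
qed

lemma WJ_single: "WJ {k} = {id, gen k}"
proof
  show "WJ {k} \<subseteq> {id, gen k}"
  proof
    fix w assume "w \<in> WJ {k}"
    then show "w \<in> {id, gen k}"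
    proof (induction rule: WJ.induct)
      case (WJ_step w k')
      then have "k' = k" "w = id \<or> w = gen k" by auto
      then show ?case by (auto simp only: gen_gen comp_id insert_iff)
    qed (rule insertI1)
  qed
  show "{id, gen k} \<subseteq> WJ {k}" using WJ_id WJ_gen[of k "{k}"] by simp
qed

lemma gen_ne_id: "gen k \<noteq> id" by (metis gen_apply id_apply n_not_Suc_n)

text \<open>A is the leading matrix of the idempotent for the sign eigenspace of T_k. Multiplied by
  v^2 + 1, this idempotent is v^2 - v T_k; it takes T_w to T_w minus v T_(w s) at a right descent,
  and to v^2 T_w minus v T_(w s) otherwise.\<close>

lemma descent_matrix: assumes a: "a \<in> Par n" and k: "k \<in> S"
  shows "\<exists>A. \<forall>w\<in>W. \<forall>i<d a. \<forall>j<d a. (\<Sum>m<d a. cf a w i m * A m j) = (if w (Suc k) < w k then cf a w i j else 0)"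
proof -
  have J: "{k} \<subseteq> S" using k by simp
  let ?x = "xJ {k} qs" and ?v = "vK ^ al a"
  have x: "?x = (\<lambda>u. Tb id u + qs * Tb (gen k) u)"
    unfolding xJ_lc[OF J] WJ_single using gen_ne_id[of k] gen_ne_id[of k, symmetric] len_gen[OF k] by (intro ext) simp
  have P: "PJ {k} qs = 1 + qs * qs" unfolding PJ_def[OF J] WJ_single using gen_ne_id[of k] len_gen[OF k] by simp
  have vP: "vK * vK * PJ {k} qs = vK * vK + 1" unfolding P by (simp add: algebra_simps)
  have cP: "const0 (vK * vK * PJ {k} qs) 1" unfolding vP using const0_add[OF const0_mult[OF const0_vK const0_vK] const0_1] by simp
  obtain A where A: "\<And>i j. i < d a \<Longrightarrow> j < d a \<Longrightarrow> const0 (inverse (PJ {k} qs) * rho a ?x i j) (A i j)"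
  proof (cases "(\<lambda>i j. inverse (PJ {k} qs) * rho a ?x i j) = (\<lambda>i j. 0)")
    case True
    show ?thesis
    proof (rule that[of "\<lambda>i j. 0"])
      fix i j
      have e: "inverse (PJ {k} qs) * rho a ?x i j = 0" by (rule fun_cong[OF fun_cong[OF True, of i], of j])
      show "const0 (inverse (PJ {k} qs) * rho a ?x i j) 0" unfolding e by (rule const0_0)
    qed
  next
    case False
    then show ?thesis using rho_idem[OF a J] that by blast
  qed
  have A': "const0 (vK * vK * rho a ?x i j) (A i j)" if "i < d a" "j < d a" for i j
  proof -
    have e: "vK * vK * rho a ?x i j = (vK * vK * PJ {k} qs) * (inverse (PJ {k} qs) * rho a ?x i j)" using PJ_nz[OF J] by simp
    have "const0 (\<dots>) (1 * A i j)" by (rule const0_mult[OF cP A[OF that]])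
    then show ?thesis by (simp only: e mult_1_left)
  qed
  have "(\<Sum>m<d a. cf a w i m * A m j) = (if w (Suc k) < w k then cf a w i j else 0)" if w: "w \<in> W" and ij: "i < d a" "j < d a" for w i j
  proof -
    have Tw: "hk (Tb w)" "hk (Tb (w \<circ> gen k))" using w k by auto
    have wk: "w \<circ> gen k \<in> W" using w k by simp
    have hkx: "hk ?x" by (rule hk_xJ[OF J])
    have "const0 (\<Sum>m<d a. (?v * rho a (Tb w) i m) * (vK * vK * rho a ?x m j)) (\<Sum>m<d a. ((-1) ^ l w * cf a w i m) * A m j)"
      by (intro const0_sum const0_mult cf(3) A' a w ij) auto
    moreover have "(\<Sum>m<d a. (?v * rho a (Tb w) i m) * (vK * vK * rho a ?x m j)) = ?v * (vK * vK * rho a (Tb w \<star> ?x) i j)"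
      unfolding rho_mult[OF a Tw(1) hkx] mm_def by (simp add: sum_distrib_left mult_ac)
    ultimately have L: "const0 (?v * (vK * vK * rho a (Tb w \<star> ?x) i j)) ((-1) ^ l w * (\<Sum>m<d a. cf a w i m * A m j))"
      by (simp add: sum_distrib_left mult.assoc)
    have tx: "(Tb w \<star> ?x) u = Tb w u + qs * R k (Tb w) u" for u
      unfolding x hm_add_right hm_scale_right hm_1[OF Tw(1)] hm_gen_right[OF k Tw(1)] ..
    have c1: "const0 (?v * rho a (Tb w) i j) ((-1) ^ l w * cf a w i j)" by (rule cf(3)[OF a w ij])
    have c2: "const0 (?v * rho a (Tb (w \<circ> gen k)) i j) ((-1) ^ l (w \<circ> gen k) * cf a (w \<circ> gen k) i j)" by (rule cf(3)[OF a wk ij])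
    show ?thesis
    proof (cases "w (Suc k) < w k")
      case False
      then have "w k < w (Suc k)" using Wn_inj[OF w, of k "Suc k"] by auto
      then have "R k (Tb w) = Tb (w \<circ> gen k)" using R_Tb[OF w k] len_comp_gen(1)[OF w k] by simp
      then have "Tb w \<star> ?x = (\<lambda>u. Tb w u + qs * Tb (w \<circ> gen k) u)" using tx by (simp add: fun_eq_iff)
      then have rx: "rho a (Tb w \<star> ?x) i j = rho a (Tb w) i j + qs * rho a (Tb (w \<circ> gen k)) i j" by (simp only: rho_add rho_scale)
      have "?v * (vK * vK * rho a (Tb w \<star> ?x) i j) = vK * vK * (?v * rho a (Tb w) i j) - vK * (?v * rho a (Tb (w \<circ> gen k)) i j)"
        unfolding rx by (simp add: field_simps)
      moreover have "const0 (vK * vK * (?v * rho a (Tb w) i j) - vK * (?v * rho a (Tb (w \<circ> gen k)) i j)) 0"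
        using const0_diff[OF const0_mult[OF const0_mult[OF const0_vK const0_vK] c1] const0_mult[OF const0_vK c2]] by simp
      ultimately have "(-1) ^ l w * (\<Sum>m<d a. cf a w i m * A m j) = 0" using const0_unique[OF L] by simp
      then show ?thesis using False by simp
    next
      case True
      have "R k (Tb w) = (\<lambda>u. Tb (w \<circ> gen k) u + zt * Tb w u)"
      proof
        fix u
        have "u \<circ> gen k = w \<longleftrightarrow> u = w \<circ> gen k" by auto
        then show "R k (Tb w) u = Tb (w \<circ> gen k) u + zt * Tb w u"
          using len_comp_gen_less[OF w k] True by (auto simp: R_def Tb_def)
      qed
      then have "(Tb w \<star> ?x) u = (qs * qs) * Tb w u + qs * Tb (w \<circ> gen k) u" for u
        unfolding tx qsign by (simp add: algebra_simps)
      then have "Tb w \<star> ?x = (\<lambda>u. (qs * qs) * Tb w u + qs * Tb (w \<circ> gen k) u)" by (rule ext)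
      then have rx: "rho a (Tb w \<star> ?x) i j = (qs * qs) * rho a (Tb w) i j + qs * rho a (Tb (w \<circ> gen k)) i j" by (simp only: rho_add rho_scale)
      have "?v * (vK * vK * rho a (Tb w \<star> ?x) i j) = (?v * rho a (Tb w) i j) - vK * (?v * rho a (Tb (w \<circ> gen k)) i j)"
        unfolding rx by (simp add: field_simps)
      moreover have "const0 ((?v * rho a (Tb w) i j) - vK * (?v * rho a (Tb (w \<circ> gen k)) i j)) ((-1) ^ l w * cf a w i j)"
        using const0_diff[OF c1 const0_mult[OF const0_vK c2]] by simp
      ultimately have "(-1) ^ l w * (\<Sum>m<d a. cf a w i m * A m j) = (-1) ^ l w * cf a w i j" using const0_unique[OF L] by simp
      then show ?thesis using True by simp
    qed
  qed
  then show ?thesis by blast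
qed

text \<open>By \<open>descent_matrix\<close> the right descents of an element depend only on its
  column, and in its own column \<open>wl a\<close> has all descents from
  \<open>Jl n a\<close>.\<close>

lemma column_descent: assumes a: "a \<in> Par n" and i0: "i0 < d a" "cf a (wl a) i0 i0 \<noteq> 0"
  and x: "x \<in> W" "i < d a" "cf a x i i0 \<noteq> 0" and k: "k \<in> Jl n a"
  shows "x (Suc k) < x k"
proof (rule ccontr)
  assume na: "\<not> x (Suc k) < x k"
  have kS: "k \<in> S" using k Jl_S by blast
  obtain A where A: "\<And>w i j. w \<in> W \<Longrightarrow> i < d a \<Longrightarrow> j < d a \<Longrightarrow> (\<Sum>m<d a. cf a w i m * A m j) = (if w (Suc k) < w k then cf a w i j else 0)"
    using descent_matrix[OF a kS] by blast
  have one: "(\<Sum>m<d a. cf a w i m * A m i0) = cf a w i i0 * A i0 i0" if w: "w \<in> W" "i < d a" "cf a w i i0 \<noteq> 0" for w i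
  proof -
    have "cf a w i m = 0" if "m < d a" "m \<noteq> i0" for m using unique_position[OF w(1)] a w i0(1) that by metis
    then have "(\<Sum>m<d a. cf a w i m * A m i0) = (\<Sum>m<d a. if m = i0 then cf a w i i0 * A i0 i0 else 0)" by (intro sum.cong) auto
    then show ?thesis using i0(1) by simp
  qed
  have "wl a (Suc k) < wl a k" using wJ(3)[OF Jl_S, of a] k unfolding rmax_def[OF Jl_S] by blast
  then have "cf a (wl a) i0 i0 * A i0 i0 = cf a (wl a) i0 i0" using A[OF wl_W i0(1) i0(1), of a] one[OF wl_W i0(1) i0(2)] by simp
  then have A1: "A i0 i0 = 1" using i0(2) by simp
  have "cf a x i i0 * A i0 i0 = 0" using A[OF x(1,2) i0(1)] one[OF x] na by simp
  then show False using A1 x(3) by simp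
qed

text \<open>Rescale the unwanted coefficients so that a leading one survives, say at y. No other
  element occupies the position of y in its shape, so the leading term of that matrix entry is a
  nonzero multiple of this coefficient, although the entry vanishes.\<close>

lemma coeff_zero_outside:
  assumes U: "U \<subseteq> Par n"
    and F: "\<And>z nu mu. nu \<in> U \<Longrightarrow> z \<in> RR nu \<Longrightarrow> mu \<in> Par n - U \<Longrightarrow> rho mu (CC z) = (\<lambda>i j. 0)"
    and h: "\<And>mu. mu \<in> Par n - U \<Longrightarrow> rho mu (lw CC b) = (\<lambda>i j. 0)"
    and z: "z \<in> W" "\<And>nu. nu \<in> U \<Longrightarrow> z \<notin> RR nu"
  shows "b z = 0"
proof (rule ccontr)
  assume bz: "b z \<noteq> 0"
  \<comment> \<open>Elements belonging to U may be dropped, since by \<open>F\<close> they act as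
    zero in all shapes outside U.\<close>
  define b0 where "b0 = (\<lambda>z. if \<exists>nu\<in>U. z \<in> RR nu then 0 else b z)"
  have rl: "rho mu (lw CC f) = (\<lambda>i j. \<Sum>z\<in>W. f z * rho mu (CC z) i j)" for mu f unfolding lw_def by (rule rho_lc)
  have r0: "(\<Sum>z\<in>W. b0 z * rho mu (CC z) i j) = 0" if mu: "mu \<in> Par n - U" for mu i j
  proof -
    have "(\<Sum>z\<in>W. b0 z * rho mu (CC z) i j) = (\<Sum>z\<in>W. b z * rho mu (CC z) i j)"
    proof (rule sum.cong[OF refl])
      fix y
      show "b0 y * rho mu (CC y) i j = b y * rho mu (CC y) i j"
      proof (cases "\<exists>nu\<in>U. y \<in> RR nu")
        case True then show ?thesis using F mu by fastforce
      next
        case False then show ?thesis by (simp add: b0_def)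
      qed
    qed
    also have "\<dots> = rho mu (lw CC b) i j" unfolding rl ..
    finally show ?thesis using h[OF mu] by simp
  qed
  have "\<exists>y\<in>W. b0 y \<noteq> 0" using bz z unfolding b0_def by (intro bexI[of _ z]) auto
  then obtain k c where kc: "\<And>y. y \<in> W \<Longrightarrow> const0 (vK powi k * b0 y) (c y)" "\<exists>y\<in>W. c y \<noteq> 0"
    using const0_scale_family[OF finite_Wn, of n b0] by metis
  then obtain y where y: "y \<in> W" "c y \<noteq> 0" by blast
  have "b0 y \<noteq> 0"
  proof
    assume "b0 y = 0"
    then have "const0 0 (c y)" using kc(1)[OF y(1)] by simp
    then have "c y = 0" by (rule const0_unique[OF _ const0_0])
    then show False using y(2) by contradiction
  qed
  then have yU: "\<And>nu. nu \<in> U \<Longrightarrow> y \<notin> RR nu" unfolding b0_def by (auto split: if_splits)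
  obtain mu i j where m: "mu \<in> Par n" "i < d mu" "j < d mu" "cf mu y i j \<noteq> 0" using unique_position[OF y(1)] by blast
  then have "y \<in> RR mu" using RR_I y(1) by blast
  then have mU: "mu \<in> Par n - U" using yU m(1) by blast
  have cz: "cf mu w i j = 0" if "w \<in> W" "w \<noteq> y" for w
    using unique_word[OF m(1-3)] m(4) y(1) that by metis
  have "const0 (\<Sum>w\<in>W. (vK powi k * b0 w) * (vK ^ al mu * rho mu (CC w) i j)) (\<Sum>w\<in>W. c w * ((-1) ^ l w * cf mu w i j))"
    by (intro const0_sum const0_mult kc rho_CC_const m)
  moreover have "(\<Sum>w\<in>W. (vK powi k * b0 w) * (vK ^ al mu * rho mu (CC w) i j)) = vK powi k * vK ^ al mu * (\<Sum>w\<in>W. b0 w * rho mu (CC w) i j)"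
    unfolding sum_distrib_left by (rule sum.cong[OF refl]) (simp only: mult_ac)
  moreover have "(\<Sum>w\<in>W. c w * ((-1) ^ l w * cf mu w i j)) = (\<Sum>w\<in>W. if w = y then c y * ((-1) ^ l y * cf mu y i j) else 0)"
    by (rule sum.cong) (use cz in auto)
  ultimately have "const0 0 (c y * ((-1) ^ l y * cf mu y i j))" unfolding r0[OF mU] using y(1) by simp
  then have "c y * ((-1) ^ l y * cf mu y i j) = 0" by (rule const0_unique[OF _ const0_0])
  then show False using y(2) m(4) by simp
qed

lemma Tb_hm_A: "x \<in> W \<Longrightarrow> hk b \<Longrightarrow> (\<And>u. b u \<in> Aset) \<Longrightarrow> (Tb x \<star> b) u \<in> Aset"
proof (induction "l x" arbitrary: x u rule: less_induct)
  case less
  show ?case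
  proof (cases "x = id")
    case True
    have "Tb x \<star> b = b" unfolding True by (rule hm_1_left[OF less(3)])
    then show ?thesis using less(4) by simp
  next
    case False
    then obtain i where i: "i \<in> S" "l x = Suc (l (gen i \<circ> x))" using left_descent_exists less(2) by blast
    have gx: "gen i \<circ> x \<in> W" using less(2) i by simp
    have lt: "l (gen i \<circ> x) < l x" using i by simp
    have t: "Tb x = Tb (gen i) \<star> Tb (gen i \<circ> x)" using Tb_mult_gen[OF i(1) gx] i by simp
    have k: "hk (Tb (gen i))" "hk (Tb (gen i \<circ> x))" using i gx by auto
    have "Tb x \<star> b = Tb (gen i) \<star> (Tb (gen i \<circ> x) \<star> b)" unfolding t using k less(3) by (intro hm_assoc)
    also have "\<dots> = L i (Tb (gen i \<circ> x) \<star> b)" using i less(3) by (intro hm_gen hk_hm)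
    finally have e: "Tb x \<star> b = L i (Tb (gen i \<circ> x) \<star> b)" .
    have A: "(Tb (gen i \<circ> x) \<star> b) u \<in> Aset" for u by (rule less(1)[OF lt gx less(3,4)])
    show ?thesis unfolding e L_apply using A by (auto intro!: Aset_add Aset_mult Aset_diff)
  qed
qed

text \<open>With x and y in the column, respectively row, of the longest element of the Young subgroup, the product of C_x and C_y is
  a scalar p times a bar-invariant element m. The block of m belonging to lam is, at v = 0, plus or minus a single basis
  element C_z, and bar invariance makes this exact modulo the larger shapes, which are handled by induction.\<close>
lemma rho_CC_zero: "lam \<in> Par n \<Longrightarrow> z \<in> RR lam \<Longrightarrow> mu \<in> Par n \<Longrightarrow> \<not> dominates lam mu \<Longrightarrow> rho mu (CC z) = (\<lambda>i j. 0)"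
proof (induction "up lam" arbitrary: lam z mu rule: less_induct)
  case (less lam z0)
  note lam = less.prems(1)
  let ?J = "Jl n lam" and ?a = "al lam" and ?P = "Pa lam"
  obtain i j where ij: "z0 \<in> W" "i < d lam" "j < d lam" "cf lam z0 i j \<noteq> 0" using less.prems(2) unfolding Rset_cf[OF lam] by blast
  obtain i0 where i0: "i0 < d lam" "\<forall>i<d lam. \<forall>j<d lam. cf lam (wl lam) i j = (if i = i0 \<and> j = i0 then 1 else 0)"
    using wl_diag[OF lam] by blast
  then have wi: "cf lam (wl lam) i0 i0 \<noteq> 0" by simp
  \<comment> \<open>Positions (i, i0) and (i0, j) multiply to (i, j), the position of
    \<open>z0\<close>; the middle index is the one of \<open>wl lam\<close>.\<close>
  obtain x where x: "x \<in> W" "cf lam x i i0 * cf lam x i i0 = 1" using unique_word[OF lam ij(2) i0(1)] by blast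
  obtain y where y: "y \<in> W" "cf lam y i0 j * cf lam y i0 j = 1" using unique_word[OF lam i0(1) ij(3)] by blast
  have xnz: "cf lam x i i0 \<noteq> 0" and ynz: "cf lam y i0 j \<noteq> 0" using x(2) y(2) by auto
  have xo: "cf lam x k m = 0" if "k < d lam" "m < d lam" "\<not> (k = i \<and> m = i0)" for k m
    using unique_position[OF x(1)] lam that xnz ij(2) i0(1) by metis
  have yo: "cf lam y k m = 0" if "k < d lam" "m < d lam" "\<not> (k = i0 \<and> m = j)" for k m
    using unique_position[OF y(1)] lam that ynz ij(3) i0(1) by metis
  have zo: "cf lam w i j = 0" if "w \<in> W" "w \<noteq> z0" for w
    using unique_word[OF lam ij(2,3)] ij(1,4) that by metis
  have Rx: "R k (CC x) = (\<lambda>u. qs * CC x u)" if k: "k \<in> ?J" for k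
  proof -
    have kS: "k \<in> S" using k Jl_S by blast
    have "x (Suc k) < x k" by (rule column_descent[OF lam i0(1) wi x(1) ij(2) xnz k])
    then show ?thesis using R_CC[OF x(1) kS] len_comp_gen_less[OF x(1) kS] by simp
  qed
  have Ly: "L k (CC y) = (\<lambda>u. qs * CC y u)" if k: "k \<in> ?J" for k
  proof -
    have kS: "k \<in> S" using k Jl_S by blast
    have "cf lam (ivp y) j i0 \<noteq> 0" using cf_inv[OF lam y(1) ij(3) i0(1)] ynz by simp
    then have "ivp y (Suc k) < ivp y k" by (rule column_descent[OF lam i0(1) wi inv_Wn[OF y(1)] ij(3) _ k])
    then show ?thesis using L_CC[OF y(1) kS] len_gen_comp_less[OF y(1) kS] by simp
  qed
  have hkx: "hk (CC x)" and hky: "hk (CC y)" using hk_CC x(1) y(1) by auto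
  define co where "co = cofac ?J (CC x) (CC y)"
  have hkco: "hk co" unfolding co_def by (rule hk_cofac[OF Jl_S qsign hky])
  have xy: "CC x \<star> CC y = (\<lambda>u. ?P * co u)" unfolding co_def by (rule eigen_mult[OF Jl_S qsign hkx Rx hky Ly])
  \<comment> \<open>The power of v is divided out so that the remaining scalar \<open>p\<close> is
    invariant under the bar involution.\<close>
  define m where "m = (\<lambda>u. inverse vK ^ ?a * co u)"
  have hkm: "hk m" unfolding m_def by (rule hk_scale[OF hkco])
  define p where "p = vK ^ ?a * ?P"
  have pm: "CC x \<star> CC y = (\<lambda>u. p * m u)" unfolding xy m_def p_def by (simp add: power_inverse fun_eq_iff)
  have pbar: "barK p = p" unfolding p_def aval_wJ by (rule pJ_bar[OF Jl_S])
  have pnz: "p \<noteq> 0" unfolding p_def using Pa_nz[OF lam] by simp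
  have pc: "const0 (vK ^ ?a * p) 1" using P_const[of lam] unfolding p_def power_add by (simp add: mult.assoc)
  have mA: "m u \<in> Aset" for u
  proof -
    have "co u \<in> Aset" unfolding co_def cofac_def[OF Jl_S qsign]
      using Tb_hm_A[OF _ hky CC_A[OF y(1)]] CC_A[OF x(1)] by (intro Aset_sum Aset_mult) (auto simp: rmin_def[OF Jl_S])
    then show ?thesis unfolding m_def by (intro Aset_mult Aset_power Aset_inv_v)
  qed
  obtain g where g: "m = lw CC g" "\<And>z. g z \<in> Aset" using unitri_coords[OF unitri_CC hkm] mA by metis
  \<comment> \<open>Up to sign, \<open>p\<close> times a coordinate of m is a structure constant of
    C', and both are invariant.\<close>
  have gbar: "barK (g z) = g z" if z: "z \<in> W" for z
  proof -
    have "lw CC (\<lambda>z. p * g z) = (\<lambda>u. p * m u)" unfolding g(1) lw_def sum_distrib_left by (simp add: mult.assoc)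
    then have "lw CC (\<lambda>z. p * g z) = lw CC (\<lambda>z. sg x * sg y * sg z * hcoef n x y z)" using pm CC_mult[OF x(1) y(1)] by simp
    then have e: "p * g z = sg x * sg y * sg z * hcoef n x y z" by (rule unitri_unique[OF unitri_CC _ z])
    have "barK (p * g z) = p * g z" unfolding e by (simp add: barK_mult hcoef_bar[OF x(1) y(1) z])
    then show ?thesis using pnz by (simp add: barK_mult pbar)
  qed
  have rho_m_0: "rho mu m = (\<lambda>i j. 0)" if mu: "mu \<in> Par n" "\<not> dominates lam mu" for mu
  proof -
    have x0: "rho mu (xs lam) = (\<lambda>i j. 0)" using rho_xs_dominates[OF mu(1) lam] mu(2) by blast
    have "CC x = cofac ?J (CC x) (xs lam)" by (rule eigen_factor[OF Jl_S qsign hkx Rx Pa_nz[OF lam]])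
    then have "rho mu (CC x) = rho mu (cofac ?J (CC x) (xs lam))" by (rule arg_cong)
    also have "\<dots> = (\<lambda>i j. \<Sum>e\<in>Collect (rmin ?J). CC x e * rho mu (Tb e \<star> xs lam) i j)"
      unfolding cofac_def[OF Jl_S qsign] by (rule rho_lc)
    also have "\<dots> = (\<lambda>i j. 0)"
    proof (intro ext, rule sum.neutral, rule ballI)
      fix i j e assume "e \<in> Collect (rmin ?J)"
      then have "e \<in> W" by (simp add: rmin_def[OF Jl_S])
      then have "rho mu (Tb e \<star> xs lam) = (\<lambda>i j. 0)" using rho_mult[OF mu(1) hk_Tb[of e] hk_xs[of lam]] x0 mm_0_right by simp
      then show "CC x e * rho mu (Tb e \<star> xs lam) i j = 0" by simp
    qed
    finally have "rho mu (CC x) = (\<lambda>i j. 0)" .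
    then have "rho mu (CC x \<star> CC y) = (\<lambda>i j. 0)" using rho_mult[OF mu(1) hkx hky] mm_0_left by simp
    then have "(\<lambda>i j. p * rho mu m i j) = (\<lambda>i j. 0)" unfolding pm rho_scale .
    then show ?thesis using pnz by (simp add: fun_eq_iff)
  qed
  define kap where "kap = (-1) ^ l x * (-1) ^ l y * (cf lam x i i0 * cf lam y i0 j)"
  have rm: "const0 (vK ^ ?a * rho lam m k q) (if k = i \<and> q = j then kap else 0)" if kq: "k < d lam" "q < d lam" for k q
  proof -
    let ?v = "vK ^ ?a"
    have e: "p * rho lam m k q = mm (d lam) (rho lam (CC x)) (rho lam (CC y)) k q"
      using rho_mult[OF lam hkx hky] unfolding pm rho_scale by metis
    have "const0 (\<Sum>s<d lam. (?v * rho lam (CC x) k s) * (?v * rho lam (CC y) s q)) (\<Sum>s<d lam. ((-1) ^ l x * cf lam x k s) * ((-1) ^ l y * cf lam y s q))"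
      by (intro const0_sum const0_mult rho_CC_const lam x(1) y(1) kq) auto
    moreover have "(\<Sum>s<d lam. (?v * rho lam (CC x) k s) * (?v * rho lam (CC y) s q)) = ?v * ?v * (p * rho lam m k q)"
      unfolding e mm_def by (simp add: sum_distrib_left mult_ac)
    moreover have "(\<Sum>s<d lam. ((-1) ^ l x * cf lam x k s) * ((-1) ^ l y * cf lam y s q)) = (\<Sum>s<d lam. if s = i0 then (if k = i \<and> q = j then kap else 0) else 0)"
      by (rule sum.cong) (use xo[OF kq(1)] yo[OF _ kq(2)] in \<open>auto simp: kap_def\<close>)
    ultimately have c: "const0 (?v * ?v * (p * rho lam m k q)) (if k = i \<and> q = j then kap else 0)" using i0(1) by simp
    have e: "?v * rho lam m k q = (?v * ?v * (p * rho lam m k q)) * inverse (?v * p)" using pnz by (simp add: field_simps)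
    have "const0 (\<dots>) ((if k = i \<and> q = j then kap else 0) * inverse 1)" by (rule const0_mult[OF c const0_inverse[OF pc]]) simp
    then show ?thesis by (simp only: e inverse_1 mult_1_right)
  qed
  \<comment> \<open>The component of m in the block of lam: \<open>zz lam\<close> divided by the
    Schur element is the central idempotent.\<close>
  define ml where "ml = (\<lambda>u. inverse (cn lam) * (zz lam \<star> m) u)"
  have hkml: "hk ml" unfolding ml_def by (intro hk_scale hk_hm hkm)
  define ka where "ka = (\<lambda>w. kap * ((-1) ^ l w * cf lam w i j))"
  have mlc: "const0 (ml w) (ka w)" if w: "w \<in> W" for w
  proof -
    let ?v = "vK ^ ?a"
    have T: "hk (Tb (ivp w))" using w by simp
    have "(zz lam \<star> m) w = tau ((zz lam \<star> m) \<star> Tb (ivp w))" by (rule tau_Tb_inv[symmetric, OF hk_hm[OF hkm] w])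
    also have "\<dots> = tau (zz lam \<star> (m \<star> Tb (ivp w)))" using hm_assoc[OF hk_zz hkm T] by simp
    also have "\<dots> = chi lam (m \<star> Tb (ivp w))" by (rule tau_zz[OF lam hk_hm[OF T]])
    also have "\<dots> = (\<Sum>k<d lam. \<Sum>q<d lam. rho lam m k q * rho lam (Tb (ivp w)) q k)"
      unfolding chi_def[OF lam] trc_def rho_mult[OF lam hkm T] mm_def ..
    finally have e: "?v * ?v * (zz lam \<star> m) w = (\<Sum>k<d lam. \<Sum>q<d lam. (?v * rho lam m k q) * (?v * rho lam (Tb (ivp w)) q k))"
      by (simp add: sum_distrib_left mult_ac)
    have "const0 (?v * ?v * (zz lam \<star> m) w) (\<Sum>k<d lam. \<Sum>q<d lam. (if k = i \<and> q = j then kap else 0) * ((-1) ^ l (ivp w) * cf lam (ivp w) q k))"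
      unfolding e by (intro const0_sum const0_mult rm cf lam inv_Wn w) auto
    moreover have "(\<Sum>k<d lam. \<Sum>q<d lam. (if k = i \<and> q = j then kap else 0) * ((-1) ^ l (ivp w) * cf lam (ivp w) q k)) = ka w"
    proof -
      have "(\<Sum>k<d lam. \<Sum>q<d lam. (if k = i \<and> q = j then kap else 0) * ((-1) ^ l (ivp w) * cf lam (ivp w) q k))
         = (\<Sum>k<d lam. if k = i then (\<Sum>q<d lam. if q = j then ka w else 0) else 0)"
      proof (rule sum.cong[OF refl])
        fix k assume "k \<in> {..<d lam}"
        show "(\<Sum>q<d lam. (if k = i \<and> q = j then kap else 0) * ((-1) ^ l (ivp w) * cf lam (ivp w) q k)) = (if k = i then (\<Sum>q<d lam. if q = j then ka w else 0) else 0)"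
        proof (cases "k = i")
          case True
          have "(\<Sum>q<d lam. (if k = i \<and> q = j then kap else 0) * ((-1) ^ l (ivp w) * cf lam (ivp w) q k)) = (\<Sum>q<d lam. if q = j then ka w else 0)"
            by (rule sum.cong) (use True cf_inv[OF lam w ij(3,2)] len_inv[OF w] in \<open>auto simp: ka_def\<close>)
          then show ?thesis using True by simp
        qed simp
      qed
      then show ?thesis using ij(2,3) by simp
    qed
    ultimately have c: "const0 (?v * ?v * (zz lam \<star> m) w) (ka w)" by simp
    have "ml w = (?v * ?v * (zz lam \<star> m) w) * inverse (vK ^ (?a + ?a) * cn lam)" unfolding ml_def power_add using cn_nz[OF lam] by (simp add: field_simps)
    then show ?thesis using const0_mult[OF c const0_inverse[OF cn_const1[OF lam]]] by simp
  qed
  obtain a' where a': "ml = lw CC a'" using unitri_coords[OF unitri_CC hkml] by metis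
  have a'c: "const0 (a' w) (ka w)" if "w \<in> W" for w
    by (rule coord_const[OF _ that]) (use mlc a' in simp)
  let ?U = "{nu \<in> Par n. dominates lam nu \<and> nu \<noteq> lam}"
  have IH: "rho mu (CC z) = (\<lambda>i j. 0)" if "nu \<in> ?U" "z \<in> RR nu" "mu \<in> Par n" "\<not> dominates nu mu" for nu z mu
    using less.hyps[of nu z mu] up_less[OF lam, of nu] that by auto
  \<comment> \<open>m acts as zero in all shapes not above lam, so m and its component
    \<open>ml\<close> differ only in shapes strictly above lam; by induction this difference has no
    coordinates outside them.\<close>
  have b0: "g z - a' z = 0" if z: "z \<in> W" "\<And>nu. nu \<in> ?U \<Longrightarrow> z \<notin> RR nu" for z
  proof (rule coeff_zero_outside[of ?U _ z])
    show "?U \<subseteq> Par n" by blast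
    show "rho mu (CC y) = (\<lambda>i j. 0)" if h: "nu \<in> ?U" "y \<in> RR nu" "mu \<in> Par n - ?U" for y nu mu
    proof (rule IH[OF h(1,2)])
      show "mu \<in> Par n" using h by blast
      show "\<not> dominates nu mu"
      proof
        assume dn: "dominates nu mu"
        then have "dominates lam mu" using h(1) dominates_trans by blast
        then have "mu = lam" using h(3) by blast
        then show False using dn h(1) dominates_antisym[of nu lam n] lam by blast
      qed
    qed
    show "rho mu (lw CC (\<lambda>z. g z - a' z)) = (\<lambda>i j. 0)" if h: "mu \<in> Par n - ?U" for mu
    proof -
      have mu: "mu \<in> Par n" using h by blast
      have "lw CC (\<lambda>z. g z - a' z) = (\<lambda>u. m u + (-1) * ml u)" unfolding g(1) a' lw_def by (simp add: left_diff_distrib sum_subtractf)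
      then have e: "rho mu (lw CC (\<lambda>z. g z - a' z)) = (\<lambda>i j. rho mu m i j + (-1) * rho mu ml i j)" by (simp only: rho_add rho_scale)
      have "rho mu ml = (\<lambda>i j. inverse (cn lam) * mm (d mu) (rho mu (zz lam)) (rho mu m) i j)"
        unfolding ml_def rho_scale rho_mult[OF mu hk_zz hkm] ..
      moreover have "inverse (cn lam) * mm (d mu) (rho mu (zz lam)) (rho mu m) i j = rho mu m i j" for i j
      proof (cases "mu = lam")
        case True
        have "mm (d lam) (\<lambda>i j. cn lam * one (d lam) i j) (rho lam m) i j = cn lam * mm (d lam) (one (d lam)) (rho lam m) i j"
          unfolding mm_def by (simp add: sum_distrib_left mult.assoc)
        then show ?thesis unfolding True rho_zz_same[OF lam] using mm_one_left[OF sup2_rho] cn_nz[OF lam] by simp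
      next
        case False
        then have "\<not> dominates lam mu" using h by blast
        then have "rho mu m = (\<lambda>i j. 0)" by (rule rho_m_0[OF mu])
        then show ?thesis by (simp add: mm_def)
      qed
      ultimately have "rho mu ml = rho mu m" by (simp add: fun_eq_iff)
      then show ?thesis unfolding e by simp
    qed
    show "z \<in> W" by (rule z(1))
    show "z \<notin> RR nu" if "nu \<in> ?U" for nu by (rule z(2)[OF that])
  qed
  \<comment> \<open>Outside the larger shapes the coordinate of m is regular at v = 0, lies in A and
    is bar-invariant, so it equals its leading term.\<close>
  have gk: "g z = kc (ka z)" if z: "z \<in> W" "\<And>nu. nu \<in> ?U \<Longrightarrow> z \<notin> RR nu" for z
  proof -
    have "g z = a' z" using b0[OF z] by simp
    then have "const0 (g z) (ka z)" using a'c[OF z(1)] by simp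
    then show ?thesis by (rule Aset_bar_const[OF g(2) gbar[OF z(1)]])
  qed
  have z0U: "z0 \<notin> RR nu" if "nu \<in> ?U" for nu using RR_disjoint[OF lam _ less.prems(2), of nu] that by blast
  have "ka z0 \<noteq> 0" unfolding ka_def kap_def using xnz ynz ij(4) by simp
  then have gz0: "g z0 \<noteq> 0" using gk[OF ij(1) z0U] by simp
  have mu: "mu \<in> Par n" "\<not> dominates lam mu" using less.prems by auto
  show "rho mu (CC z0) = (\<lambda>i j. 0)"
  proof (intro ext)
    fix k q
    have "0 = rho mu m k q" using rho_m_0[OF mu] by simp
    also have "\<dots> = (\<Sum>z\<in>W. g z * rho mu (CC z) k q)" unfolding g(1) lw_def rho_lc ..
    \<comment> \<open>All other terms vanish: those in larger shapes by induction, the rest because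
      no element besides \<open>z0\<close> has position (i, j).\<close>
    also have "\<dots> = (\<Sum>z\<in>W. if z = z0 then g z0 * rho mu (CC z0) k q else 0)"
    proof (rule sum.cong[OF refl])
      fix z assume z: "z \<in> W"
      show "g z * rho mu (CC z) k q = (if z = z0 then g z0 * rho mu (CC z0) k q else 0)"
      proof (cases "z = z0")
        case False
        show ?thesis
        proof (cases "\<exists>nu\<in>?U. z \<in> RR nu")
          case True
          then obtain nu where nu: "nu \<in> ?U" "z \<in> RR nu" by blast
          have "\<not> dominates nu mu" using nu(1) mu(2) dominates_trans by blast
          then have "rho mu (CC z) = (\<lambda>i j. 0)" by (rule IH[OF nu mu(1)])
          then show ?thesis using False by simp
        next
          case nU: False
          then have "g z = kc (ka z)" by (intro gk[OF z]) blast
          then have "g z = 0" using zo[OF z False] by (simp add: ka_def)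
          then show ?thesis using False by simp
        qed
      qed simp
    qed
    finally have "g z0 * rho mu (CC z0) k q = 0" using ij(1) by simp
    then show "rho mu (CC z0) k q = 0" using gz0 by simp
  qed
qed

lemma CC_gen: assumes k: "k \<in> S" shows "CC (gen k) = (\<lambda>u. Tb (gen k) u + CC (gen k) id * Tb id u)"
proof
  fix u
  have gW: "gen k \<in> W" using k by simp
  have c1: "CC (gen k) (gen k) = 1" using unitri_CC gW unfolding unitri_def by blast
  show "CC (gen k) u = Tb (gen k) u + CC (gen k) id * Tb id u"
  proof (cases "u = gen k \<or> u = id")
    case True then show ?thesis using c1 gen_ne_id[of k] by (auto simp: Tb_def)
  next
    case False
    have "CC (gen k) u = 0"
    proof (rule ccontr)
      assume nz: "CC (gen k) u \<noteq> 0"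
      then have uW: "u \<in> W" using hkD[OF hk_CC[OF gW]] by blast
      have "u = gen k \<or> l u < l (gen k)" using nz unitri_CC gW unfolding unitri_def supp_le_def by blast
      then have "l u = 0" using False len_gen[OF k] by simp
      then show False using False len_0_iff[OF uW] by simp
    qed
    then show ?thesis using False by (auto simp: Tb_def)
  qed
qed

text \<open>The product of C_s and C_y acts as zero in every shape not above mu, so only elements of
  shapes above mu occur in it. A bound mu that stays fixed is what can be carried along a
  chain.\<close>

lemma arrL_closed: assumes mu: "mu \<in> Par n" and nu: "nu \<in> Par n" "dominates mu nu" "y \<in> RR nu" and ar: "arrL n x y"
  shows "\<exists>ta\<in>Par n. dominates mu ta \<and> x \<in> RR ta"
proof (rule ccontr)
  assume nt: "\<not> ?thesis"
  obtain k where k: "k \<in> S" "hcoef n (gen k) y x \<noteq> 0" and xW: "x \<in> W" and yW: "y \<in> W" using ar unfolding arrL_def by blast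
  have gW: "gen k \<in> W" using k(1) by simp
  let ?U = "{nu \<in> Par n. dominates mu nu}"
  have "sg (gen k) * sg y * sg x * hcoef n (gen k) y x = 0"
  proof (rule coeff_zero_outside[of ?U "\<lambda>z. sg (gen k) * sg y * sg z * hcoef n (gen k) y z" x])
    show "?U \<subseteq> Par n" by blast
    show z: "rho ta (CC z) = (\<lambda>i j. 0)" if h: "om \<in> ?U" "z \<in> RR om" "ta \<in> Par n - ?U" for z om ta
    proof (rule rho_CC_zero[of om z])
      show "om \<in> Par n" "z \<in> RR om" "ta \<in> Par n" using h by auto
      show "\<not> dominates om ta" using h dominates_trans by blast
    qed
    show "rho ta (lw CC (\<lambda>z. sg (gen k) * sg y * sg z * hcoef n (gen k) y z)) = (\<lambda>i j. 0)" if ta: "ta \<in> Par n - ?U" for ta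
    proof -
      have "rho ta (CC y) = (\<lambda>i j. 0)" by (rule z[OF _ nu(3) ta]) (use nu in blast)
      then have "rho ta (CC (gen k) \<star> CC y) = (\<lambda>i j. 0)"
        using rho_mult[of ta "CC (gen k)" "CC y"] ta hk_CC[OF gW] hk_CC[OF yW] mm_0_right by simp
      then show ?thesis unfolding CC_mult[OF gW yW] .
    qed
    show "x \<in> W" by (rule xW)
    show "x \<notin> RR om" if "om \<in> ?U" for om using nt that by blast
  qed
  then show False using k(2) by simp
qed

lemma leL_closed: assumes mu: "mu \<in> Par n" and "leL n x y" and nu: "\<exists>nu\<in>Par n. dominates mu nu \<and> y \<in> RR nu"
  shows "\<exists>ta\<in>Par n. dominates mu ta \<and> x \<in> RR ta"
proof -
  have "(arrL n)\<^sup>*\<^sup>* x y" using assms(2) by (simp add: leL_def)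
  then show ?thesis
  proof (induction rule: converse_rtranclp_induct)
    case base show ?case by (rule nu)
  next
    case (step x z)
    then obtain ta where "ta \<in> Par n" "dominates mu ta" "z \<in> RR ta" by blast
    then show ?case using arrL_closed[OF mu _ _ _ step(1)] by blast
  qed
qed

lemma leLR_closed: assumes mu: "mu \<in> Par n" and le: "leLR n x y" and nu: "\<exists>nu\<in>Par n. dominates mu nu \<and> y \<in> RR nu"
  shows "\<exists>ta\<in>Par n. dominates mu ta \<and> x \<in> RR ta"
proof -
  let ?Q = "\<lambda>x. \<exists>ta\<in>Par n. dominates mu ta \<and> x \<in> RR ta"
  have iv: "?Q (ivp x) \<longleftrightarrow> ?Q x" if "x \<in> W" for x
    using RR_inv[of _ x] RR_inv[of _ "ivp x"] inv_inv_Wn[OF that] by auto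
  have "(\<lambda>a b. leL n a b \<or> leR n a b)\<^sup>*\<^sup>* x y" and xW: "x \<in> W" and yW: "y \<in> W" using le by (simp_all add: leLR_def)
  \<comment> \<open>Intermediate elements of the chain need not lie in W, since leR only constrains inverses.\<close>
  from this(1) have "?Q (ivp x)"
  proof (induction rule: converse_rtranclp_induct)
    case base show ?case using nu iv[OF yW] by blast
  next
    case (step x z)
    have z: "?Q (ivp z)" by (rule step.IH)
    show ?case
    proof (cases "leL n x z")
      case True
      then have W: "x \<in> W" "z \<in> W" by (auto simp: leL_def)
      have "?Q z" using z iv[OF W(2)] by blast
      then have "?Q x" by (rule leL_closed[OF mu True])
      then show ?thesis using iv[OF W(1)] by blast
    next
      case False
      then have "leL n (ivp x) (ivp z)" using step(1) by (simp add: leR_def)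
      then show ?thesis using z by (rule leL_closed[OF mu])
    qed
  qed
  then show ?thesis using iv[OF xW] by blast
qed

lemma leLR_dominates: assumes "lam \<in> Par n" "mu \<in> Par n" "x \<in> RR lam" "y \<in> RR mu" "leLR n x y"
  shows "dominates mu lam"
proof -
  obtain ta where ta: "ta \<in> Par n" "dominates mu ta" "x \<in> RR ta"
    using leLR_closed[OF assms(2,5)] assms(2,4) dominates_refl by blast
  then show ?thesis using RR_disjoint[OF assms(1) ta(1) assms(3) ta(3)] by simp
qed

end

section \<open>Two-sided ideals\<close>

context reps
begin

lemma leLR_refl: "x \<in> W \<Longrightarrow> leLR n x x" by (simp add: leLR_def)

lemma leLR_trans: "leLR n x y \<Longrightarrow> leLR n y z \<Longrightarrow> leLR n x z"
  unfolding leLR_def by (meson rtranclp_trans)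

lemma leLR_arrL: "arrL n x y \<Longrightarrow> leLR n x y"
proof -
  assume a: "arrL n x y"
  then have W: "x \<in> W" "y \<in> W" by (auto simp: arrL_def)
  then have "leL n x y" unfolding leL_def using r_into_rtranclp[of "arrL n", OF a] by simp
  then show ?thesis unfolding leLR_def using W by (auto intro: r_into_rtranclp)
qed

lemma leLR_arrL_inv: "x \<in> W \<Longrightarrow> y \<in> W \<Longrightarrow> arrL n (ivp x) (ivp y) \<Longrightarrow> leLR n x y"
  unfolding leLR_def by (auto simp: leR_def leL_def intro!: r_into_rtranclp)

text \<open>The two-sided ideal spanned by the C_z with z below y.\<close>
definition idl :: "perm \<Rightarrow> hk \<Rightarrow> bool" where
  "idl y h \<longleftrightarrow> (\<exists>f. h = lw CC f \<and> (\<forall>z\<in>W. f z \<noteq> 0 \<longrightarrow> leLR n z y))"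

lemma idl_hk: "idl y h \<Longrightarrow> hk h" unfolding idl_def using hk_lw[OF unitri_CC] by blast

lemma idl_0: "idl y (\<lambda>u. 0)" unfolding idl_def by (rule exI[of _ "\<lambda>z. 0"]) (simp add: lw_def)

lemma idl_add: assumes "idl y g" "idl y h" shows "idl y (\<lambda>u. g u + h u)"
proof -
  obtain a where a: "g = lw CC a" "\<And>z. z \<in> W \<Longrightarrow> a z \<noteq> 0 \<Longrightarrow> leLR n z y" using assms(1) unfolding idl_def by blast
  obtain b where b: "h = lw CC b" "\<And>z. z \<in> W \<Longrightarrow> b z \<noteq> 0 \<Longrightarrow> leLR n z y" using assms(2) unfolding idl_def by blast
  have "(\<lambda>u. g u + h u) = lw CC (\<lambda>z. a z + b z)" unfolding a(1) b(1) lw_def by (simp add: distrib_right sum.distrib)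
  moreover have "leLR n z y" if z: "z \<in> W" "a z + b z \<noteq> 0" for z
  proof (cases "a z = 0")
    case True then show ?thesis using b(2) z by simp
  qed (use a(2) z in blast)
  ultimately show ?thesis unfolding idl_def by blast
qed

lemma idl_scale: assumes "c \<noteq> 0 \<Longrightarrow> idl y h" shows "idl y (\<lambda>u. c * h u)"
proof (cases "c = 0")
  case True then show ?thesis using idl_0 by simp
next
  case False
  then obtain a where a: "h = lw CC a" "\<And>z. z \<in> W \<Longrightarrow> a z \<noteq> 0 \<Longrightarrow> leLR n z y" using assms unfolding idl_def by blast
  have "(\<lambda>u. c * h u) = lw CC (\<lambda>z. c * a z)" unfolding a(1) lw_def by (simp add: sum_distrib_left mult_ac)
  moreover have "leLR n z y" if "z \<in> W" "c * a z \<noteq> 0" for z using a(2) that by simp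
  ultimately show ?thesis unfolding idl_def by blast
qed

lemma idl_lc: "(\<And>i. i \<in> I \<Longrightarrow> c i \<noteq> 0 \<Longrightarrow> idl y (b i)) \<Longrightarrow> idl y (\<lambda>u. \<Sum>i\<in>I. c i * b i u)"
proof (induction I rule: infinite_finite_induct)
  case (insert i I)
  have "idl y (\<lambda>u. c i * b i u + (\<Sum>i\<in>I. c i * b i u))"
    by (intro idl_add idl_scale insert.IH insert.prems) auto
  then show ?case using insert.hyps by simp
qed (simp_all add: idl_0)

lemma idl_CC: assumes z: "leLR n z y" shows "idl y (CC z)"
proof -
  have zW: "z \<in> W" using z by (simp add: leLR_def)
  have "lw CC (\<lambda>w. if w = z then 1 else 0) u = CC z u" for u
  proof -
    have "lw CC (\<lambda>w. if w = z then 1 else 0) u = (\<Sum>w\<in>W. if w = z then CC z u else 0)"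
      unfolding lw_def by (rule sum.cong) auto
    then show ?thesis using zW by simp
  qed
  then have "CC z = lw CC (\<lambda>w. if w = z then 1 else 0)" by (intro ext) simp
  then show ?thesis unfolding idl_def using z by (intro exI[of _ "\<lambda>w. if w = z then 1 else 0"]) auto
qed

lemma CC_gen_mult: assumes k: "k \<in> S" and z: "z \<in> W"
  shows "\<exists>g. CC (gen k) \<star> CC z = (\<lambda>u. \<Sum>x\<in>W. g x * CC x u) \<and> (\<forall>x\<in>W. g x \<noteq> 0 \<longrightarrow> arrL n x z)"
proof -
  have gW: "gen k \<in> W" using k by simp
  show ?thesis unfolding CC_mult[OF gW z] lw_def
    by (rule exI[of _ "\<lambda>x. sg (gen k) * sg z * sg x * hcoef n (gen k) z x"]) (use k z in \<open>auto simp: arrL_def\<close>)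
qed

lemma idl_CC_left: assumes k: "k \<in> S" and z: "leLR n z y" shows "idl y (CC (gen k) \<star> CC z)"
proof -
  have zW: "z \<in> W" using z by (simp add: leLR_def)
  obtain g where g: "CC (gen k) \<star> CC z = (\<lambda>u. \<Sum>x\<in>W. g x * CC x u)" "\<And>x. x \<in> W \<Longrightarrow> g x \<noteq> 0 \<Longrightarrow> arrL n x z"
    using CC_gen_mult[OF k zW] by blast
  show ?thesis unfolding g(1) by (intro idl_lc idl_CC leLR_trans[OF leLR_arrL z] g(2))
qed

text \<open>The anti-involution \<open>star\<close> inverts the indices of the basis C, which turns
  right multiplication into left multiplication and the left preorder into the right one.\<close>

lemma idl_CC_right: assumes k: "k \<in> S" and z: "leLR n z y" shows "idl y (CC z \<star> CC (gen k))"
proof -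
  have zW: "z \<in> W" using z by (simp add: leLR_def)
  have gW: "gen k \<in> W" using k by simp
  have iW: "ivp z \<in> W" using zW by simp
  obtain g where g: "CC (gen k) \<star> CC (ivp z) = (\<lambda>u. \<Sum>x\<in>W. g x * CC x u)" "\<And>x. x \<in> W \<Longrightarrow> g x \<noteq> 0 \<Longrightarrow> arrL n x (ivp z)"
    using CC_gen_mult[OF k iW] by blast
  have "CC z \<star> CC (gen k) = star (CC (ivp z)) \<star> star (CC (gen k))"
    unfolding star_CC[OF iW] star_CC[OF gW] inv_inv_Wn[OF zW] inv_gen ..
  also have "\<dots> = star (CC (gen k) \<star> CC (ivp z))" by (rule star_hm[symmetric, OF hk_CC[OF gW] hk_CC[OF iW]])
  also have "\<dots> = (\<lambda>u. \<Sum>x\<in>W. g x * star (CC x) u)" unfolding g(1) by (rule star_lc)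
  also have "\<dots> = (\<lambda>u. \<Sum>x\<in>W. g x * CC (ivp x) u)" by (intro ext sum.cong refl) (simp add: star_CC)
  finally have e: "CC z \<star> CC (gen k) = (\<lambda>u. \<Sum>x\<in>W. g x * CC (ivp x) u)" .
  have "leLR n (ivp x) z" if x: "x \<in> W" "g x \<noteq> 0" for x
    by (rule leLR_arrL_inv[OF inv_Wn[OF x(1)] zW]) (use g(2)[OF x] inv_inv_Wn[OF x(1)] in simp)
  then show ?thesis unfolding e by (intro idl_lc idl_CC) (rule leLR_trans[OF _ z])
qed

lemma Tb_gen_CC: assumes k: "k \<in> S" shows "Tb (gen k) = (\<lambda>u. CC (gen k) u + (- CC (gen k) id) * Tb id u)"
  by (subst CC_gen[OF k]) simp

lemma idl_gen: assumes k: "k \<in> S" and h: "idl y h" shows "idl y (Tb (gen k) \<star> h)" "idl y (h \<star> Tb (gen k))"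
proof -
  obtain f where f: "h = lw CC f" "\<And>z. z \<in> W \<Longrightarrow> f z \<noteq> 0 \<Longrightarrow> leLR n z y" using h unfolding idl_def by blast
  have "Tb (gen k) \<star> h = (\<lambda>u. \<Sum>z\<in>W. f z * (Tb (gen k) \<star> CC z) u)" unfolding f(1) lw_def by (rule hm_lc_right)
  moreover have "idl y (Tb (gen k) \<star> CC z)" if z: "z \<in> W" "f z \<noteq> 0" for z
  proof -
    have "Tb (gen k) \<star> CC z = (\<lambda>u. (CC (gen k) \<star> CC z) u + (- CC (gen k) id) * (CC z) u)"
      by (subst Tb_gen_CC[OF k]) (simp only: hm_add_left hm_scale_left hm_1_left[OF hk_CC[OF z(1)]])
    then show ?thesis by (simp only:) (intro idl_add idl_scale idl_CC_left idl_CC k f(2) z)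
  qed
  ultimately show "idl y (Tb (gen k) \<star> h)" by (simp only:) (intro idl_lc)
  have "h \<star> Tb (gen k) = (\<lambda>u. \<Sum>z\<in>W. f z * (CC z \<star> Tb (gen k)) u)" unfolding f(1) lw_def by (rule hm_lc_left)
  moreover have "idl y (CC z \<star> Tb (gen k))" if z: "z \<in> W" "f z \<noteq> 0" for z
  proof -
    have "CC z \<star> Tb (gen k) = (\<lambda>u. (CC z \<star> CC (gen k)) u + (- CC (gen k) id) * (CC z) u)"
      by (subst Tb_gen_CC[OF k]) (simp only: hm_add_right hm_scale_right hm_1[OF hk_CC[OF z(1)]])
    then show ?thesis by (simp only:) (intro idl_add idl_scale idl_CC_right idl_CC k f(2) z)
  qed
  ultimately show "idl y (h \<star> Tb (gen k))" by (simp only:) (intro idl_lc)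
qed

lemma idl_Tb_left: "x \<in> W \<Longrightarrow> idl y h \<Longrightarrow> idl y (Tb x \<star> h)"
proof (induction "l x" arbitrary: x rule: less_induct)
  case less
  show ?case
  proof (cases "x = id")
    case True
    then show ?thesis using hm_1_left[OF idl_hk[OF less(3)]] less(3) by simp
  next
    case False
    then obtain i where i: "i \<in> S" "l x = Suc (l (gen i \<circ> x))" using left_descent_exists less(2) by blast
    have gx: "gen i \<circ> x \<in> W" using less(2) i by simp
    have t: "Tb x = Tb (gen i) \<star> Tb (gen i \<circ> x)" using Tb_mult_gen[OF i(1) gx] i by simp
    have k: "hk (Tb (gen i))" "hk (Tb (gen i \<circ> x))" using i gx by auto
    have "Tb x \<star> h = Tb (gen i) \<star> (Tb (gen i \<circ> x) \<star> h)" unfolding t by (rule hm_assoc[OF k idl_hk[OF less(3)]])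
    moreover have "idl y (Tb (gen i) \<star> (Tb (gen i \<circ> x) \<star> h))"
      by (intro idl_gen(1) i(1) less(1) gx less(3)) (use i in simp)
    ultimately show ?thesis by simp
  qed
qed

lemma idl_Tb_right: "x \<in> W \<Longrightarrow> idl y h \<Longrightarrow> idl y (h \<star> Tb x)"
proof (induction "l x" arbitrary: x rule: less_induct)
  case less
  show ?case
  proof (cases "x = id")
    case True
    then show ?thesis using hm_1[OF idl_hk[OF less(3)]] less(3) by simp
  next
    case False
    then obtain i where i: "i \<in> S" "l x = Suc (l (x \<circ> gen i))" using right_descent_exists less(2) by blast
    have gx: "x \<circ> gen i \<in> W" using less(2) i by simp
    have "(x \<circ> gen i) \<circ> gen i = x" unfolding comp_assoc gen_gen by simp
    then have t: "Tb x = Tb (x \<circ> gen i) \<star> Tb (gen i)" using Tb_mult_gen_right[OF i(1) gx] i by simp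
    have k: "hk (Tb (x \<circ> gen i))" "hk (Tb (gen i))" using i gx by auto
    have "h \<star> Tb x = (h \<star> Tb (x \<circ> gen i)) \<star> Tb (gen i)" unfolding t by (rule hm_assoc[symmetric, OF idl_hk[OF less(3)] k])
    moreover have "idl y ((h \<star> Tb (x \<circ> gen i)) \<star> Tb (gen i))"
      by (intro idl_gen(2) i(1) less(1) gx less(3)) (use i in simp)
    ultimately show ?thesis by simp
  qed
qed

lemma idl_hm: assumes g: "hk g" and h: "idl y h" shows "idl y (g \<star> h)" "idl y (h \<star> g)"
proof -
  have "g \<star> h = (\<lambda>u. \<Sum>w\<in>W. g w * (Tb w \<star> h) u)" by (subst hk_expand[OF g]) (rule hm_lc_left)
  then show "idl y (g \<star> h)" by (simp only:) (intro idl_lc idl_Tb_left h)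
  have "h \<star> g = (\<lambda>u. \<Sum>w\<in>W. g w * (h \<star> Tb w) u)" by (subst hk_expand[OF g]) (rule hm_lc_right)
  then show "idl y (h \<star> g)" by (simp only:) (intro idl_lc idl_Tb_right h)
qed

text \<open>Between two matrix units, C_y becomes a nonzero multiple of the matrix unit at the
  position of x, which therefore lies in the ideal of y. Its leading coordinates in the basis C are
  the leading coefficients at that position, and the one at x is nonzero.\<close>

lemma RR_below: assumes lam: "lam \<in> Par n" and y: "y \<in> W" and nz: "rho lam (CC y) \<noteq> (\<lambda>i j. 0)" and x: "x \<in> RR lam"
  shows "leLR n x y"
proof -
  let ?H = "rho lam (CC y)"
  obtain p q where pq: "?H p q \<noteq> 0" using nz by (auto simp: fun_eq_iff)
  then have pd: "p < d lam" "q < d lam" by (auto simp: rho_def split: if_splits)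
  obtain i j where x: "x \<in> W" "i < d lam" "j < d lam" "cf lam x i j \<noteq> 0" using x unfolding Rset_cf[OF lam] by blast
  \<comment> \<open>The outer factors are multiples of the matrix units at (i, p) and (q, j), so the
    entry (p, q) of C_y is carried to position (i, j).\<close>
  define g where "g = hN lam p i \<star> (CC y \<star> hN lam j q)"
  define c where "c = cn lam * ?H p q"
  have cnz: "c \<noteq> 0" unfolding c_def using cn_nz[OF lam] pq by simp
  have hky: "hk (CC y)" by (rule hk_CC[OF y])
  have hkg: "hk g" unfolding g_def by (intro hk_hm hk_hN)
  have rg: "rho b g = mm (d b) (rho b (hN lam p i)) (mm (d b) (rho b (CC y)) (rho b (hN lam j q)))" if b: "b \<in> Par n" for b
    unfolding g_def rho_mult[OF b hk_hN hk_hm[OF hk_hN]] rho_mult[OF b hky hk_hN] ..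
  have "(\<lambda>u. g u + (- c) * hN lam j i u) = (\<lambda>u. 0)"
  proof (rule rho_faithful)
    show "hk (\<lambda>u. g u + (- c) * hN lam j i u)" by (intro hk_add hk_scale hkg hk_hN)
    fix b assume b: "b \<in> Par n"
    have "rho b g r s = c * rho b (hN lam j i) r s" for r s
    proof (cases "b = lam")
      case True
      have "rho lam g r s = (\<Sum>k<d lam. (if r = i \<and> k = p then cn lam else 0) * (\<Sum>m<d lam. ?H k m * (if m = q \<and> s = j then cn lam else 0)))"
        unfolding rg[OF lam] rho_hN_same[OF lam pd(1) x(2)] rho_hN_same[OF lam x(3) pd(2)] mm_def ..
      also have "\<dots> = (\<Sum>k<d lam. (if r = i \<and> k = p then cn lam else 0) * (\<Sum>m<d lam. if m = q then (if s = j then ?H k q * cn lam else 0) else 0))"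
        by (intro sum.cong refl arg_cong2[of _ _ _ _ times]) auto
      also have "\<dots> = (\<Sum>k<d lam. if k = p then (if r = i then cn lam * (if s = j then ?H p q * cn lam else 0) else 0) else 0)"
        using pd by (intro sum.cong refl) auto
      also have "\<dots> = c * (if r = i \<and> s = j then cn lam else 0)" using pd by (simp add: c_def mult_ac)
      finally show ?thesis unfolding True rho_hN_same[OF lam x(3,2)] .
    next
      case False
      then have z: "rho b (hN lam k m) = (\<lambda>i j. 0)" for k m using schur_distinct[OF b lam False] by (intro ext) (simp add: rho_hN)
      show ?thesis unfolding rg[OF b] z mm_0_left by simp
    qed
    then show "rho b (\<lambda>u. g u + (- c) * hN lam j i u) = (\<lambda>i j. 0)" unfolding rho_add rho_scale by simp
  qed
  then have "g u + (- c) * hN lam j i u = 0" for u by (rule fun_cong)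
  then have e: "g u = c * hN lam j i u" for u by (metis add.right_inverse add_right_cancel mult_minus_left)
  have "idl y g" unfolding g_def by (intro idl_hm hk_hN idl_CC leLR_refl y)
  then have "idl y (\<lambda>u. inverse c * g u)" by (rule idl_scale)
  moreover have "(\<lambda>u. inverse c * g u) = hN lam j i" unfolding e using cnz by (intro ext) simp
  ultimately have "idl y (hN lam j i)" by simp
  then obtain f where f: "hN lam j i = lw CC f" "\<And>z. z \<in> W \<Longrightarrow> f z \<noteq> 0 \<Longrightarrow> leLR n z y" unfolding idl_def by blast
  let ?v = "vK ^ al lam"
  have "const0 (?v * f x) ((-1) ^ l x * cf lam x i j)"
  proof (rule coord_const[OF _ x(1), of "\<lambda>w. ?v * f w"])
    fix w assume w: "w \<in> W"
    have "lw CC (\<lambda>w. ?v * f w) w = ?v * hN lam j i w" unfolding f(1) lw_def by (simp add: sum_distrib_left mult_ac)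
    moreover have "\<dots> = ?v * rho lam (Tb (ivp w)) j i" unfolding hN_apply[OF w] ..
    moreover have "const0 (?v * rho lam (Tb (ivp w)) j i) ((-1) ^ l (ivp w) * cf lam (ivp w) j i)"
      by (rule cf(3)[OF lam inv_Wn[OF w] x(3,2)])
    ultimately show "const0 (lw CC (\<lambda>w. ?v * f w) w) ((-1) ^ l w * cf lam w i j)"
      unfolding len_inv[OF w] cf_inv[OF lam w x(3,2)] by (simp only:)
  qed
  moreover have "f x \<noteq> 0" if c0: "const0 (?v * f x) ((-1) ^ l x * cf lam x i j)"
  proof
    assume "f x = 0"
    then have "const0 0 ((-1) ^ l x * cf lam x i j)" using c0 by simp
    then have "(-1) ^ l x * cf lam x i j = 0" by (rule const0_unique[OF _ const0_0])
    then show False using x(4) by simp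
  qed
  ultimately show ?thesis using f(2)[OF x(1)] by blast
qed

end

section \<open>Sign vectors and dominance\<close>

text \<open>A vector u on which a type A chain of generators acts by the sign eigenvalue c, except for its first member; the sum ff of
  c^j T_j ... T_1 u extends this to the full chain.\<close>
locale opseq =
  fixes A :: "nat \<Rightarrow> (nat \<Rightarrow> K) \<Rightarrow> nat \<Rightarrow> K" and V :: "(nat \<Rightarrow> K) \<Rightarrow> bool" and c z :: K and t D :: nat
    and u P :: "nat \<Rightarrow> K"
  assumes A_lc: "\<And>k s x. A k (\<lambda>i. \<Sum>j\<in>{..t}. s j * x j i) = (\<lambda>i. \<Sum>j\<in>{..t}. s j * A k (x j) i)"
    and A_scale: "\<And>k s x. A k (\<lambda>i. s * x i) = (\<lambda>i. s * A k x i)"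
    and V_A: "\<And>k x. k < t \<Longrightarrow> V (A k x)"
    and quad: "\<And>k x. k < t \<Longrightarrow> V x \<Longrightarrow> A k (A k x) = (\<lambda>i. x i + z * A k x i)"
    and comm: "\<And>j k x. j < t \<Longrightarrow> k < t \<Longrightarrow> Suc j < k \<Longrightarrow> A j (A k x) = A k (A j x)"
    and braid: "\<And>k x. Suc k < t \<Longrightarrow> A k (A (Suc k) (A k x)) = A (Suc k) (A k (A (Suc k) x))"
    and Vu: "V u" and eig: "\<And>j. 0 < j \<Longrightarrow> j < t \<Longrightarrow> A j u = (\<lambda>i. c * u i)"
    and cq: "c * c = z * c + 1"
    and adj: "\<And>k x y. k < t \<Longrightarrow> (\<Sum>i<D. P i * A k x i * y i) = (\<Sum>i<D. P i * x i * A k y i)"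
begin

primrec ws :: "nat \<Rightarrow> nat \<Rightarrow> K" where
  "ws 0 = u" | "ws (Suc j) = A j (ws j)"

definition ff :: "nat \<Rightarrow> K" where "ff = (\<lambda>i. \<Sum>j\<in>{..t}. c ^ j * ws j i)"

definition B :: "(nat \<Rightarrow> K) \<Rightarrow> (nat \<Rightarrow> K) \<Rightarrow> K" where "B x y = (\<Sum>i<D. P i * x i * y i)"

lemma V_ws: "j \<le> t \<Longrightarrow> V (ws j)" by (cases j) (use Vu V_A in auto)

lemma A_ws_above: "j < k \<Longrightarrow> k < t \<Longrightarrow> A k (ws j) = (\<lambda>i. c * ws j i)"
proof (induction j)
  case 0 then show ?case using eig[of k] by simp
next
  case (Suc j)
  have "A k (ws (Suc j)) = A j (A k (ws j))" using comm[of j k "ws j"] Suc.prems by simp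
  also have "\<dots> = A j (\<lambda>i. c * ws j i)" using Suc by simp
  finally show ?case by (simp add: A_scale)
qed

text \<open>The braid relation turns A_k into A_(k+1) acting on \<open>ws k\<close>, where it is
  already the scalar c.\<close>

lemma A_ws_below: "Suc k < j \<Longrightarrow> j \<le> t \<Longrightarrow> A k (ws j) = (\<lambda>i. c * ws j i)"
proof (induction j)
  case (Suc j)
  show ?case
  proof (cases "j = Suc k")
    case True
    have "A k (ws (Suc j)) = A (Suc k) (A k (A (Suc k) (ws k)))" unfolding True ws.simps using braid[of k "ws k"] Suc.prems True by simp
    also have "\<dots> = A (Suc k) (A k (\<lambda>i. c * ws k i))" using A_ws_above[of k "Suc k"] Suc.prems True by simp
    finally show ?thesis using True by (simp add: A_scale)
  next
    case False
    then have k: "Suc k < j" using Suc.prems by simp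
    have "A k (ws (Suc j)) = A j (A k (ws j))" using comm[of k j "ws j"] Suc.prems k by simp
    also have "\<dots> = A j (\<lambda>i. c * ws j i)" using Suc.IH[OF k] Suc.prems by simp
    finally show ?thesis by (simp add: A_scale)
  qed
qed simp

text \<open>Only the terms k and k + 1 are not eigenvectors of A_k, which maps one to the other; the
  quadratic relation for c cancels their defects.\<close>

lemma A_ff: assumes k: "k < t" shows "A k ff = (\<lambda>i. c * ff i)"
proof
  fix i
  let ?g = "\<lambda>j. c ^ j * (A k (ws j) i - c * ws j i)"
  have "A k ff i - c * ff i = (\<Sum>j\<in>{..t}. c ^ j * A k (ws j) i) - c * (\<Sum>j\<in>{..t}. c ^ j * ws j i)"
    unfolding ff_def A_lc ..
  also have "\<dots> = (\<Sum>j\<in>{..t}. ?g j)" by (simp add: sum_distrib_left right_diff_distrib sum_subtractf mult_ac)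
  also have "\<dots> = (\<Sum>j\<in>{k, Suc k}. ?g j)"
  proof (rule sum.mono_neutral_right)
    show "{k, Suc k} \<subseteq> {..t}" using k by auto
    show "\<forall>j\<in>{..t} - {k, Suc k}. ?g j = 0"
    proof
      fix j assume j: "j \<in> {..t} - {k, Suc k}"
      have "A k (ws j) = (\<lambda>i. c * ws j i)" using A_ws_above[of j k] A_ws_below[of k j] j k by (cases "j < k") auto
      then show "?g j = 0" by simp
    qed
  qed simp
  also have "\<dots> = c ^ k * (A k (ws k) i - c * ws k i) + c ^ k * (c * ((ws k i + z * A k (ws k) i) - c * A k (ws k) i))"
    using quad[OF k V_ws[of k]] k by (simp add: mult_ac)
  also have "\<dots> = c ^ k * A k (ws k) i * ((z * c + 1) - c * c)" by (simp add: algebra_simps)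
  also have "\<dots> = 0" unfolding cq by simp
  finally show "A k ff i = c * ff i" by simp
qed

lemma commuting_ff: assumes Q_lc: "\<And>s x. Q (\<lambda>i. \<Sum>j\<in>{..t}. s j * x j i) = (\<lambda>i. \<Sum>j\<in>{..t}. s j * Q (x j) i)"
  and com: "\<And>j x. j < t \<Longrightarrow> Q (A j x) = A j (Q x)" and u: "Q u = (\<lambda>i. c * u i)"
  shows "Q ff = (\<lambda>i. c * ff i)"
proof -
  have "j \<le> t \<Longrightarrow> Q (ws j) = (\<lambda>i. c * ws j i)" for j by (induction j) (simp_all add: u com A_scale)
  then have "Q ff = (\<lambda>i. \<Sum>j\<in>{..t}. c ^ j * (c * ws j i))" unfolding ff_def Q_lc by (intro ext sum.cong) auto
  then show ?thesis by (simp add: ff_def sum_distrib_left mult_ac)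
qed

lemma B_ff: "B x ff = (\<Sum>j\<in>{..t}. c ^ j * B x (ws j))"
  unfolding B_def ff_def sum_distrib_left by (subst sum.swap) (simp add: mult_ac)

lemma B_scale: "B (\<lambda>i. s * x i) y = s * B x y" unfolding B_def sum_distrib_left by (simp add: mult_ac)

lemma B_sym: "B x y = B y x" unfolding B_def by (simp add: mult_ac)

text \<open>Move the generators one by one to the left argument, where all except the first act on u
  by c.\<close>

lemma B_u_ws: "j < t \<Longrightarrow> B u (ws (Suc j)) = c ^ j * B u (A 0 u)"
proof (induction j)
  case (Suc j)
  have "B u (ws (Suc (Suc j))) = B (A (Suc j) u) (ws (Suc j))" using adj[OF Suc.prems, of u "ws (Suc j)"] unfolding B_def ws.simps by simp
  also have "\<dots> = c * B u (ws (Suc j))" unfolding eig[OF zero_less_Suc Suc.prems] B_scale ..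
  finally show ?case using Suc by simp
qed simp

lemma B_u_ff: "B u ff = B u u + (\<Sum>j<t. c ^ Suc j * c ^ j) * B u (A 0 u)"
proof -
  have "B u ff = B u u + (\<Sum>j<t. c ^ Suc j * B u (ws (Suc j)))"
    unfolding B_ff by (simp only: sum.atMost_shift power_0 mult_1_left ws.simps(1))
  also have "(\<Sum>j<t. c ^ Suc j * B u (ws (Suc j))) = (\<Sum>j<t. c ^ Suc j * c ^ j * B u (A 0 u))"
    by (rule sum.cong[OF refl]) (simp only: B_u_ws lessThan_iff mult.assoc)
  finally show ?thesis by (simp only: sum_distrib_right)
qed

text \<open>The same with \<open>ff\<close> in the left argument, on which every generator acts by
  c. So the norm of \<open>ff\<close> is a sum of squares times its product with u.\<close>

lemma B_ff_ff: "B ff ff = (\<Sum>j\<in>{..t}. c ^ j * c ^ j) * B u ff"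
proof -
  have "j \<le> t \<Longrightarrow> B ff (ws j) = c ^ j * B ff u" for j
  proof (induction j)
    case (Suc j)
    have j: "j < t" using Suc.prems by simp
    have "B ff (ws (Suc j)) = B (A j ff) (ws j)" using adj[OF j, of ff "ws j"] unfolding B_def ws.simps by simp
    also have "\<dots> = c * B ff (ws j)" unfolding A_ff[OF j] B_scale ..
    finally show ?case using Suc by simp
  qed simp
  then have "B ff ff = (\<Sum>j\<in>{..t}. c ^ j * c ^ j * B ff u)" unfolding B_ff by (intro sum.cong) (auto simp: mult.assoc)
  then show ?thesis unfolding B_sym[of ff u] by (simp only: sum_distrib_right)
qed

end

lemma Psum_concave: assumes "mu \<in> Par n" shows "Psum mu (Suc (Suc i)) + Psum mu i \<le> 2 * Psum mu (Suc i)"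
  using Par_sorted[OF assms, of i "Suc i"] by (auto simp: Psum_Suc)

text \<open>Otherwise A is convex wherever it exceeds the concave function \<open>Psum mu\<close>,
  so the excess, once positive, grows for ever, while both functions take the value n from n
  on.\<close>

lemma exists_move:
  assumes mu: "mu \<in> Par n" and A0: "A 0 = 0" and top: "\<And>i. n \<le> i \<Longrightarrow> A i = n"
    and ge: "\<And>i. Psum mu i \<le> A i" and ne: "A \<noteq> Psum mu"
  shows "\<exists>i. Psum mu (Suc i) < A (Suc i) \<and> A i + A (Suc (Suc i)) < 2 * A (Suc i)"
proof (rule ccontr)
  assume "\<not> ?thesis"
  then have conv: "2 * A (Suc i) \<le> A i + A (Suc (Suc i))" if "Psum mu (Suc i) < A (Suc i)" for i using that by (meson not_less)
  have "\<exists>i. Psum mu i < A i" using ge ne by (metis ext le_neq_implies_less)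
  then have "\<exists>i. Psum mu i < A i \<and> (\<forall>j<i. \<not> Psum mu j < A j)" by (rule exists_least_iff[THEN iffD1])
  then obtain i where i: "Psum mu i < A i" "\<And>j. j < i \<Longrightarrow> \<not> Psum mu j < A j" by blast
  then obtain i0 where i0: "i = Suc i0" using A0 by (cases i) auto
  have eq: "A i0 = Psum mu i0" using i(2)[of i0] ge[of i0] i0 by simp
  have "Psum mu (Suc (i0 + j)) < A (Suc (i0 + j)) \<and> Psum mu (Suc (i0 + j)) + A (i0 + j) < A (Suc (i0 + j)) + Psum mu (i0 + j)" for j
  proof (induction j)
    case 0 then show ?case using i i0 eq by simp
  next
    case (Suc j)
    then show ?case using conv[of "i0 + j"] Psum_concave[OF mu, of "i0 + j"] by simp
  qed
  from this[of n] show False using top[of "Suc (i0 + n)"] Psum_n[OF mu, of "Suc (i0 + n)"] by simp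
qed

lemma mv_lc: "mv m M (\<lambda>i. \<Sum>j\<in>I. s j * x j i) = (\<lambda>i. \<Sum>j\<in>I. s j * mv m M (x j) i)"
  unfolding mv_def sum_distrib_left by (intro ext, subst sum.swap) (simp add: mult_ac)
lemma mv_scale: "mv m M (\<lambda>i. s * x i) = (\<lambda>i. s * mv m M x i)"
  unfolding mv_def sum_distrib_left by (simp add: mult_ac)

lemma gen_comm: "Suc k < m \<Longrightarrow> gen k \<circ> gen m = gen m \<circ> gen k"
  by (rule ext) (simp add: gen_apply)
lemma gen_braid: "gen k \<circ> (gen (Suc k) \<circ> gen k) = gen (Suc k) \<circ> (gen k \<circ> gen (Suc k))"
  by (rule ext) (simp add: gen_apply)

context hecke
begin

lemma Tb_quad: assumes k: "k \<in> S" shows "Tb (gen k) \<star> Tb (gen k) = (\<lambda>u. Tb id u + zt * Tb (gen k) u)"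
proof -
  have h: "hk (Tb (gen k))" "hk (Tb id)" using k by auto
  have g: "L k (Tb id) = Tb (gen k)" unfolding hm_gen[OF k h(2), symmetric] by (rule hm_1[OF h(1)])
  have "Tb (gen k) \<star> Tb (gen k) = L k (L k (Tb id))" unfolding g by (rule hm_gen[OF k h(1)])
  also have "\<dots> = (\<lambda>u. Tb id u + zt * L k (Tb id) u)" by (intro ext L_L_hk[OF k h(2)])
  finally show ?thesis unfolding g .
qed

lemma Tb_comm: assumes km: "k \<in> S" "m \<in> S" "Suc k < m" shows "Tb (gen k) \<star> Tb (gen m) = Tb (gen m) \<star> Tb (gen k)"
proof -
  have W: "gen k \<in> W" "gen m \<in> W" using km by auto
  have "l (gen k \<circ> gen m) = Suc (l (gen m))" by (rule len_gen_comp(1)[OF W(2) km(1)]) (use km in \<open>simp add: gen_apply\<close>)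
  moreover have "l (gen m \<circ> gen k) = Suc (l (gen k))" by (rule len_gen_comp(1)[OF W(1) km(2)]) (use km in \<open>simp add: gen_apply\<close>)
  ultimately show ?thesis using Tb_mult_gen[OF km(1) W(2)] Tb_mult_gen[OF km(2) W(1)] gen_comm[OF km(3)] by (simp only:)
qed

lemma Tb_braid: assumes k: "k \<in> S" "Suc k \<in> S"
  shows "Tb (gen k) \<star> (Tb (gen (Suc k)) \<star> Tb (gen k)) = Tb (gen (Suc k)) \<star> (Tb (gen k) \<star> Tb (gen (Suc k)))"
proof -
  have W: "gen k \<in> W" "gen (Suc k) \<in> W" using k by auto
  have W2: "gen (Suc k) \<circ> gen k \<in> W" "gen k \<circ> gen (Suc k) \<in> W" using W by (blast intro: comp_Wn)+
  have i: "ivp (gen (Suc k) \<circ> gen k) = gen k \<circ> gen (Suc k)" "ivp (gen k \<circ> gen (Suc k)) = gen (Suc k) \<circ> gen k"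
    unfolding inv_comp_Wn[OF W(2,1)] inv_comp_Wn[OF W] inv_gen by (rule refl)+
  have 1: "Tb (gen (Suc k)) \<star> Tb (gen k) = Tb (gen (Suc k) \<circ> gen k)"
    by (rule Tb_mult_gen[OF k(2) W(1) len_gen_comp(1)[OF W(1) k(2)]]) (simp add: gen_apply)
  have 2: "Tb (gen k) \<star> Tb (gen (Suc k)) = Tb (gen k \<circ> gen (Suc k))"
    by (rule Tb_mult_gen[OF k(1) W(2) len_gen_comp(1)[OF W(2) k(1)]]) (simp add: gen_apply)
  have 3: "Tb (gen k) \<star> Tb (gen (Suc k) \<circ> gen k) = Tb (gen k \<circ> (gen (Suc k) \<circ> gen k))"
    by (rule Tb_mult_gen[OF k(1) W2(1) len_gen_comp(1)[OF W2(1) k(1)]]) (unfold i, simp add: gen_apply)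
  have 4: "Tb (gen (Suc k)) \<star> Tb (gen k \<circ> gen (Suc k)) = Tb (gen (Suc k) \<circ> (gen k \<circ> gen (Suc k)))"
    by (rule Tb_mult_gen[OF k(2) W2(2) len_gen_comp(1)[OF W2(2) k(2)]]) (unfold i, simp add: gen_apply)
  show ?thesis unfolding 1 2 3 4 gen_braid ..
qed

end

context reps
begin

definition Tv :: "nat list \<Rightarrow> nat \<Rightarrow> (nat \<Rightarrow> K) \<Rightarrow> nat \<Rightarrow> K" where "Tv a k u = mv (d a) (rho a (Tb (gen k))) u"

definition vsp :: "nat list \<Rightarrow> (nat \<Rightarrow> K) \<Rightarrow> bool" where "vsp a u \<longleftrightarrow> (\<forall>i. \<not> i < d a \<longrightarrow> u i = 0)"

lemma mv_hm: "a \<in> Par n \<Longrightarrow> hk g \<Longrightarrow> hk h \<Longrightarrow> mv (d a) (rho a g) (mv (d a) (rho a h) u) = mv (d a) (rho a (g \<star> h)) u"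
  by (simp only: rho_mult mv_mm)

lemma vsp_mv: "vsp a (mv (d a) (rho a h) u)" by (simp add: vsp_def mv_def rho_def)

lemma mv_one: "vsp a u \<Longrightarrow> mv (d a) (one (d a)) u = u"
proof
  fix i assume v: "vsp a u"
  have "mv (d a) (one (d a)) u i = (\<Sum>j<d a. if j = i then u i else 0)" unfolding mv_def one_def by (rule sum.cong) auto
  then show "mv (d a) (one (d a)) u i = u i" using v by (auto simp: vsp_def)
qed

lemma Tv_quad: assumes a: "a \<in> Par n" and k: "k \<in> S" and u: "vsp a u"
  shows "Tv a k (Tv a k u) = (\<lambda>i. u i + zt * Tv a k u i)"
proof -
  have h: "hk (Tb (gen k))" using k by simp
  have "Tv a k (Tv a k u) = mv (d a) (\<lambda>i j. one (d a) i j + zt * rho a (Tb (gen k)) i j) u"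
    unfolding Tv_def mv_hm[OF a h h] Tb_quad[OF k] rho_add rho_scale rho_1[OF a] ..
  also have "\<dots> = (\<lambda>i. mv (d a) (one (d a)) u i + zt * Tv a k u i)"
    unfolding mv_def Tv_def by (simp add: distrib_right sum.distrib sum_distrib_left mult.assoc)
  finally show ?thesis unfolding mv_one[OF u] .
qed

lemma Tv_comm: assumes a: "a \<in> Par n" and km: "k \<in> S" "m \<in> S" "Suc k < m \<or> Suc m < k"
  shows "Tv a k (Tv a m u) = Tv a m (Tv a k u)"
proof -
  have h: "hk (Tb (gen k))" "hk (Tb (gen m))" using km by auto
  have "Tb (gen k) \<star> Tb (gen m) = Tb (gen m) \<star> Tb (gen k)" using Tb_comm[OF km(1,2)] Tb_comm[OF km(2,1)] km(3) by metis
  then show ?thesis unfolding Tv_def mv_hm[OF a h] mv_hm[OF a h(2,1)] by (simp only:)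
qed

lemma Tv_braid: assumes a: "a \<in> Par n" and k: "k \<in> S" "Suc k \<in> S"
  shows "Tv a k (Tv a (Suc k) (Tv a k u)) = Tv a (Suc k) (Tv a k (Tv a (Suc k) u))"
proof -
  have h: "hk (Tb (gen k))" "hk (Tb (gen (Suc k)))" using k by auto
  show ?thesis unfolding Tv_def mv_hm[OF a h] mv_hm[OF a h(2,1)] mv_hm[OF a h(1) hk_hm[OF h(1)]] mv_hm[OF a h(2) hk_hm[OF h(2)]]
      Tb_braid[OF k] ..
qed

lemma Tv_adj: assumes a: "a \<in> Par n" and k: "k \<in> S"
  shows "(\<Sum>i<d a. Pd a i * Tv a k x i * y i) = (\<Sum>i<d a. Pd a i * x i * Tv a k y i)"
proof -
  have h: "hk (Tb (gen k))" "gen k \<in> W" using k by auto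
  have s: "Pd a i * rho a (Tb (gen k)) i j = rho a (Tb (gen k)) j i * Pd a j" if "i < d a" "j < d a" for i j
    using rho_star[OF a h(1) that] star_Tb[OF h(2)] by simp
  have "(\<Sum>i<d a. Pd a i * Tv a k x i * y i) = (\<Sum>i<d a. \<Sum>j<d a. (Pd a i * rho a (Tb (gen k)) i j) * (x j * y i))"
    unfolding Tv_def mv_def by (simp add: sum_distrib_left sum_distrib_right mult_ac)
  also have "\<dots> = (\<Sum>i<d a. \<Sum>j<d a. (rho a (Tb (gen k)) j i * Pd a j) * (x j * y i))"
    by (intro sum.cong refl) (simp only: s lessThan_iff)
  also have "\<dots> = (\<Sum>j<d a. \<Sum>i<d a. (rho a (Tb (gen k)) j i * Pd a j) * (x j * y i))" by (rule sum.swap)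
  also have "\<dots> = (\<Sum>i<d a. Pd a i * x i * Tv a k y i)"
    unfolding Tv_def mv_def by (simp add: sum_distrib_left mult_ac)
  finally show ?thesis .
qed

text \<open>The chain of generators may run upward or downward; \<open>sign_move\<close> uses one of
  each kind.\<close>

lemma opseq_Tv:
  assumes a: "a \<in> Par n" and S: "\<And>j. j < t \<Longrightarrow> idx j \<in> S"
    and nb: "\<And>j. Suc j < t \<Longrightarrow> idx (Suc j) = Suc (idx j) \<or> idx j = Suc (idx (Suc j))"
    and far: "\<And>j k. j < t \<Longrightarrow> k < t \<Longrightarrow> Suc j < k \<Longrightarrow> Suc (idx j) < idx k \<or> Suc (idx k) < idx j"
    and u: "vsp a u" and eig: "\<And>j. 0 < j \<Longrightarrow> j < t \<Longrightarrow> Tv a (idx j) u = (\<lambda>i. qs * u i)"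
  shows "opseq (\<lambda>j. Tv a (idx j)) (vsp a) qs zt t (d a) u (Pd a)"
proof (unfold_locales, goal_cases)
  case (1 k s x) show ?case unfolding Tv_def by (rule mv_lc)
next
  case (2 k s x) show ?case unfolding Tv_def by (rule mv_scale)
next
  case (3 k x) show ?case unfolding Tv_def by (rule vsp_mv)
next
  case (4 k x) then show ?case using Tv_quad[OF a S] by blast
next
  case (5 j k x) then show ?case using Tv_comm[OF a S S far] by blast
next
  case (6 k x)
  then have k: "idx k \<in> S" "idx (Suc k) \<in> S" using S by auto
  show ?case
  proof (cases "idx (Suc k) = Suc (idx k)")
    case True then show ?thesis using Tv_braid[OF a k(1), of x] k(2) by simp
  next
    case False
    then have "idx k = Suc (idx (Suc k))" using nb[OF 6] by simp
    then show ?thesis using Tv_braid[OF a k(2), of x] k(1) by simp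
  qed
next
  case 7 show ?case by (rule u)
next
  case (8 j) then show ?case by (rule eig)
next
  case 9 show ?case by (rule qsign)
next
  case (10 k x y) then show ?case by (intro Tv_adj a S)
qed

lemma form_pos: assumes a: "a \<in> Par n" shows "nonneg0 (\<Sum>i<d a. Pd a i * u i * u i)"
  "vsp a u \<Longrightarrow> u \<noteq> (\<lambda>i. 0) \<Longrightarrow> pos0 (\<Sum>i<d a. Pd a i * u i * u i)"
proof -
  have nn: "nonneg0 (Pd a i * u i * u i)" if "i < d a" for i
    unfolding mult.assoc by (intro nonneg0_mult nonneg0_square pos0_nonneg0 Pd_pos a that)
  then show "nonneg0 (\<Sum>i<d a. Pd a i * u i * u i)" by (intro nonneg0_sum) simp
  assume "vsp a u" "u \<noteq> (\<lambda>i. 0)"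
  then obtain i where i: "i < d a" "u i \<noteq> 0" unfolding vsp_def by blast
  have "pos0 (Pd a i * u i * u i)" unfolding mult.assoc by (intro pos0_mult pos0_square Pd_pos a i)
  then show "pos0 (\<Sum>i<d a. Pd a i * u i * u i)" using nn i(1) by (intro pos0_sum) auto
qed

text \<open>Moves a box from a block of length p to the adjacent block of length q < p. If the symmetrization ff over the short side
  vanished, the one over the long side would have negative square length.\<close>
lemma sign_move:
  assumes a: "a \<in> Par n" and pq: "0 < q" "q < p" "p \<le> m" "m + q \<le> n" and u: "vsp a u" "u \<noteq> (\<lambda>i. 0)"
    and left: "\<And>k. m < k + p \<Longrightarrow> k < m \<Longrightarrow> Tv a k u = (\<lambda>i. qs * u i)"
    and right: "\<And>k. m < k \<Longrightarrow> k < m + q \<Longrightarrow> Tv a k u = (\<lambda>i. qs * u i)"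
  shows "\<exists>u'. vsp a u' \<and> u' \<noteq> (\<lambda>i. 0) \<and> (\<forall>k. m \<le> k \<longrightarrow> k < m + q \<longrightarrow> Tv a k u' = (\<lambda>i. qs * u' i)) \<and>
    (\<forall>k\<in>S. Suc k < m \<or> m + q < k \<longrightarrow> Tv a k u = (\<lambda>i. qs * u i) \<longrightarrow> Tv a k u' = (\<lambda>i. qs * u' i))"
proof -
  have m: "0 < m" using pq by simp
  \<comment> \<open>F runs upward through the short block and G downward through the long one. Both
    begin with the generator m that separates the blocks.\<close>
  interpret F: opseq "\<lambda>j. Tv a (m + j)" "vsp a" qs zt q "d a" u "Pd a"
    by (rule opseq_Tv[OF a _ _ _ u(1)]) (use pq m right in auto)
  interpret G: opseq "\<lambda>j. Tv a (m - j)" "vsp a" qs zt p "d a" u "Pd a"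
    by (rule opseq_Tv[OF a _ _ _ u(1)]) (use pq m left in auto)
  define N where "N = F.B u u"
  define b where "b = F.B u (Tv a m u)"
  \<comment> \<open>The exponent of -1/v is odd, so b enters both products with negative
    coefficients.\<close>
  have qsq: "qs ^ Suc j * qs ^ j = - (inverse vK ^ (Suc j + j))" for j
  proof -
    have "qs ^ (Suc j + j) = - (inverse vK ^ (Suc j + j))" by (rule power_minus_odd) simp
    then show ?thesis by (simp only: power_add)
  qed
  define s where "s = (\<lambda>I. \<Sum>j\<in>I. inverse vK ^ (Suc j + j))"
  have sp: "pos0 (s I)" if "finite I" "I \<noteq> {}" for I
  proof -
    have "pos0 (inverse vK ^ (Suc j + j))" for j by (intro pos0_power pos0_inverse pos0_vK)
    then show ?thesis unfolding s_def using that by (intro pos0_sum pos0_nonneg0) blast+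
  qed
  have Fu: "F.B u F.ff = N - s {..<q} * b" and Gu: "F.B u G.ff = N - s {..<p} * b"
    unfolding F.B_u_ff G.B_u_ff N_def b_def qsq s_def by (simp_all add: sum_negf)
  have Npos: "pos0 N" unfolding N_def F.B_def by (rule form_pos(2)[OF a u])
  have nz: "F.ff \<noteq> (\<lambda>i. 0)"
  proof
    assume "F.ff = (\<lambda>i. 0)"
    then have "F.B u F.ff = 0" unfolding F.B_def by simp
    then have Nb: "N = s {..<q} * b" using Fu by simp
    have spq: "pos0 (s {..<q})" by (rule sp) (use pq in auto)
    then have "b = N * inverse (s {..<q})" using Nb pos0_nz by simp
    then have bpos: "pos0 b" using pos0_mult[OF Npos pos0_inverse[OF spq]] by simp
    have dis: "{..<q} \<inter> {q..<p} = {}" and un: "{..<p} = {..<q} \<union> {q..<p}" using pq by auto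
    have "s {..<p} = s {..<q} + s {q..<p}" unfolding s_def un
      by (rule sum.union_disjoint[OF finite_lessThan finite_atLeastLessThan dis])
    \<comment> \<open>The first q terms cancel the norm of u; the longer side has further terms, all
      negative.\<close>
    then have "- F.B u G.ff = s {q..<p} * b" unfolding Gu Nb by (simp add: algebra_simps)
    then have neg: "pos0 (- F.B u G.ff)" using pos0_mult[OF sp[of "{q..<p}"] bpos] pq by simp
    have "pos0 (\<Sum>j\<in>{..p}. qs ^ j * qs ^ j)" by (intro pos0_sum) (auto intro!: pos0_nonneg0 pos0_square)
    then have "pos0 ((\<Sum>j\<in>{..p}. qs ^ j * qs ^ j) * (- F.B u G.ff))" using neg by (rule pos0_mult)
    then have "pos0 (- F.B G.ff G.ff)" unfolding G.B_ff_ff by simp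
    moreover have "nonneg0 (F.B G.ff G.ff)" unfolding F.B_def by (rule form_pos(1)[OF a])
    ultimately show False using pos0_not_neg[of "- F.B G.ff G.ff"] by simp
  qed
  have v: "vsp a F.ff" using F.V_ws unfolding F.ff_def vsp_def by (intro allI impI sum.neutral) auto
  have "Tv a k F.ff = (\<lambda>i. qs * F.ff i)" if "m \<le> k" "k < m + q" for k
    using F.A_ff[of "k - m"] that by simp
  moreover have "Tv a k F.ff = (\<lambda>i. qs * F.ff i)" if k: "k \<in> S" "Suc k < m \<or> m + q < k" "Tv a k u = (\<lambda>i. qs * u i)" for k
  proof (rule F.commuting_ff)
    show "Tv a k (\<lambda>i. \<Sum>j\<le>q. s j * x j i) = (\<lambda>i. \<Sum>j\<le>q. s j * Tv a k (x j) i)" for s x unfolding Tv_def by (rule mv_lc)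
    show "Tv a k (Tv a (m + j) x) = Tv a (m + j) (Tv a k x)" if "j < q" for j x
      by (rule Tv_comm[OF a k(1)]) (use k pq that m in auto)
    show "Tv a k u = (\<lambda>i. qs * u i)" by (rule k(3))
  qed
  ultimately show ?thesis using nz v by blast
qed

definition sgv :: "nat list \<Rightarrow> nat set \<Rightarrow> bool" where
  "sgv a J \<longleftrightarrow> (\<exists>u. vsp a u \<and> u \<noteq> (\<lambda>i. 0) \<and> (\<forall>k\<in>J. Tv a k u = (\<lambda>i. qs * u i)))"

lemma mono_gap: assumes "mono (A :: nat \<Rightarrow> nat)" "A i < k" "k < A (Suc i)" shows "k \<notin> range A"
proof
  assume "k \<in> range A"
  then obtain j where j: "k = A j" by blast
  show False
  proof (cases "j \<le> i")
    case True then show ?thesis using monoD[OF assms(1) True] assms(2) j by simp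
  next
    case False
    then have "Suc i \<le> j" by simp
    then show ?thesis using monoD[OF assms(1), of "Suc i" j] assms(3) j by simp
  qed
qed

text \<open>A plays the part of the partial sums of a composition, not necessarily of a partition.
  Lowering one value by 1 moves a box to the next row, and the sum of the values is the
  measure.\<close>

lemma sgv_descend:
  assumes a: "a \<in> Par n" and mu: "mu \<in> Par n"
  shows "A 0 = 0 \<Longrightarrow> mono A \<Longrightarrow> (\<And>i. n \<le> i \<Longrightarrow> A i = n) \<Longrightarrow> (\<And>i. Psum mu i \<le> A i) \<Longrightarrow> sgv a {k \<in> S. k \<notin> range A} \<Longrightarrow> sgv a (Jl n mu)"
proof (induction "\<Sum>i<n. A i" arbitrary: A rule: less_induct)
  case less
  show ?case
  proof (cases "A = Psum mu")
    case True
    then show ?thesis using less.prems(5) by (simp add: Jl_def)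
  next
    case False
    obtain i where i: "Psum mu (Suc i) < A (Suc i)" "A i + A (Suc (Suc i)) < 2 * A (Suc i)"
      using exists_move[of mu n A, OF mu less.prems(1,3,4) False] by blast
    define m where "m = A (Suc i)"
    define p where "p = m - A i"
    define q where "q = A (Suc (Suc i)) - m"
    have mn: "A i \<le> m" "m \<le> A (Suc (Suc i))" unfolding m_def using less.prems(2) by (auto simp: mono_def)
    have pq: "q < p" "A i + p = m" "m + q = A (Suc (Suc i))" using i(2) mn unfolding p_def q_def m_def by auto
    have an: "A j \<le> n" for j using monoD[OF less.prems(2), of j "max j n"] less.prems(3)[of "max j n"] by simp
    have in_: "Suc i < n" using i(1) Psum_n[OF mu, of "Suc i"] less.prems(3)[of "Suc i"] by (cases "n \<le> Suc i") auto
    \<comment> \<open>The row that ends at m gives its last box to the next row.\<close>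
    let ?A = "A(Suc i := m - 1)"
    have mono: "mono ?A"
    proof (rule monoI)
      fix j k :: nat assume jk: "j \<le> k"
      have 1: "A j \<le> A i" if "j \<le> i" for j using that less.prems(2) by (simp add: mono_def)
      have 2: "A (Suc (Suc i)) \<le> A k" if "Suc (Suc i) \<le> k" for k using that less.prems(2) by (simp add: mono_def)
      have 3: "A j \<le> A k" using jk less.prems(2) by (simp add: mono_def)
      show "?A j \<le> ?A k" using 1[of j] 2[of k] 3 jk pq by (cases "j = Suc i"; cases "k = Suc i") auto
    qed
    have sgA: "sgv a {k \<in> S. k \<notin> range ?A}"
    proof -
      obtain u where u: "vsp a u" "u \<noteq> (\<lambda>i. 0)" "\<And>k. k \<in> S \<Longrightarrow> k \<notin> range A \<Longrightarrow> Tv a k u = (\<lambda>i. qs * u i)"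
        using less.prems(5) unfolding sgv_def by blast
      have rA: "k \<notin> range A \<or> k = m" "k \<noteq> m - 1" "k \<noteq> m + q" if k: "k \<notin> range ?A" for k
      proof -
        have ne: "k \<noteq> ?A j" for j using k by blast
        show "k \<noteq> m - 1" using ne[of "Suc i"] by simp
        show "k \<noteq> m + q" using ne[of "Suc (Suc i)"] pq(3) by simp
        show "k \<notin> range A \<or> k = m"
        proof (rule ccontr)
          assume "\<not> ?thesis"
          then obtain j where "k = A j" "k \<noteq> m" by blast
          then show False using ne[of j] m_def by (cases "j = Suc i") auto
        qed
      qed
      show ?thesis
      \<comment> \<open>If the next row is empty, the move only removes generators, and the old
        vector still serves.\<close>
      proof (cases "q = 0")
        case True
        have "Tv a k u = (\<lambda>i. qs * u i)" if "k \<in> S" "k \<notin> range ?A" for k using u(3) rA[OF that(2)] that(1) True by auto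
        then show ?thesis unfolding sgv_def using u by blast
      next
        case False
        have "\<exists>u'. vsp a u' \<and> u' \<noteq> (\<lambda>i. 0) \<and> (\<forall>k. m \<le> k \<longrightarrow> k < m + q \<longrightarrow> Tv a k u' = (\<lambda>i. qs * u' i)) \<and>
          (\<forall>k\<in>S. Suc k < m \<or> m + q < k \<longrightarrow> Tv a k u = (\<lambda>i. qs * u i) \<longrightarrow> Tv a k u' = (\<lambda>i. qs * u' i))"
        proof (rule sign_move[OF a _ pq(1) _ _ u(1,2)])
          show "0 < q" using False by simp
          show "p \<le> m" using pq by simp
          show "m + q \<le> n" using pq an by simp
          show "Tv a k u = (\<lambda>i. qs * u i)" if "m < k + p" "k < m" for k
          proof (rule u(3))
            show "k \<in> S" using that pq an[of "Suc i"] m_def by auto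
            show "k \<notin> range A" by (rule mono_gap[OF less.prems(2), of i]) (use that pq m_def in auto)
          qed
          show "Tv a k u = (\<lambda>i. qs * u i)" if "m < k" "k < m + q" for k
          proof (rule u(3))
            show "k \<in> S" using that pq an[of "Suc (Suc i)"] by auto
            show "k \<notin> range A" by (rule mono_gap[OF less.prems(2), of "Suc i"]) (use that pq m_def in auto)
          qed
        qed
        then obtain u' where u': "vsp a u'" "u' \<noteq> (\<lambda>i. 0)" "\<And>k. m \<le> k \<Longrightarrow> k < m + q \<Longrightarrow> Tv a k u' = (\<lambda>i. qs * u' i)"
          "\<And>k. k \<in> S \<Longrightarrow> Suc k < m \<or> m + q < k \<Longrightarrow> Tv a k u = (\<lambda>i. qs * u i) \<Longrightarrow> Tv a k u' = (\<lambda>i. qs * u' i)" by blast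
        have "Tv a k u' = (\<lambda>i. qs * u' i)" if k: "k \<in> S" "k \<notin> range ?A" for k
        proof (cases "m \<le> k \<and> k < m + q")
          case True then show ?thesis using u'(3) by blast
        next
          case nk: False
          then have "k \<notin> range A" using rA(1)[OF k(2)] False by auto
          moreover have "Suc k < m \<or> m + q < k" using nk rA(2,3)[OF k(2)] by linarith
          ultimately show ?thesis using u'(4) u(3) k(1) by blast
        qed
        then show ?thesis unfolding sgv_def using u'(1,2) by blast
      qed
    qed
    show ?thesis
    proof (rule less.hyps[OF _ _ mono _ _ sgA])
      show "(\<Sum>j<n. ?A j) < (\<Sum>j<n. A j)"
      proof (rule sum_strict_mono_ex1)
        show "\<forall>j\<in>{..<n}. ?A j \<le> A j" by (simp add: m_def)
        show "\<exists>j\<in>{..<n}. ?A j < A j" using in_ i(1) m_def by (intro bexI[of _ "Suc i"]) auto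
      qed simp
      show "?A 0 = 0" using less.prems(1) by simp
      show "?A j = n" if "n \<le> j" for j using less.prems(3)[OF that] in_ that by simp
      show "Psum mu j \<le> ?A j" for j using less.prems(4)[of j] i(1) m_def by (cases "j = Suc i") auto
    qed
  qed
qed

text \<open>The columns of the antisymmetrizer are sign vectors, and not all are zero since its
  trace is \<open>Pa\<close>.\<close>

lemma sgv_start: assumes a: "a \<in> Par n" shows "sgv a (Jl n a)"
proof -
  have "rho a (xs a) \<noteq> (\<lambda>i j. 0)"
  proof
    assume z: "rho a (xs a) = (\<lambda>i j. 0)"
    have "chi a (xs a) = 0" unfolding chi_def[OF a] z trc_def by simp
    then show False using chi_xs[OF a] Pa_nz[OF a] by simp
  qed
  then obtain i j where ij: "rho a (xs a) i j \<noteq> 0" by (auto simp: fun_eq_iff)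
  let ?u = "\<lambda>k. rho a (xs a) k j"
  have "Tv a k ?u = (\<lambda>i. qs * ?u i)" if k: "k \<in> Jl n a" for k
  proof
    fix i
    have h: "hk (Tb (gen k))" using k Jl_S by (intro hk_Tb gen_Wn) blast
    have "Tv a k ?u i = rho a (Tb (gen k) \<star> xs a) i j" unfolding Tv_def rho_mult[OF a h hk_xs] mv_def mm_def ..
    then show "Tv a k ?u i = qs * ?u i" unfolding Tb_gen_xs[OF k] rho_scale .
  qed
  moreover have "?u \<noteq> (\<lambda>i. 0)" using ij by (metis (full_types))
  moreover have "vsp a ?u" by (simp add: vsp_def rho_def)
  ultimately show ?thesis unfolding sgv_def by blast
qed

text \<open>On a sign vector the antisymmetrizer acts by the nonzero scalar
  \<open>PJ J qs\<close>.\<close>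

lemma sgv_xJ: assumes a: "a \<in> Par n" and J: "J \<subseteq> S" and s: "sgv a J" shows "rho a (xJ J qs) \<noteq> (\<lambda>i j. 0)"
proof
  assume z: "rho a (xJ J qs) = (\<lambda>i j. 0)"
  obtain u where u: "vsp a u" "u \<noteq> (\<lambda>i. 0)" "\<And>k. k \<in> J \<Longrightarrow> Tv a k u = (\<lambda>i. qs * u i)" using s unfolding sgv_def by blast
  have Tw: "w \<in> WJ J \<Longrightarrow> mv (d a) (rho a (Tb w)) u = (\<lambda>i. qs ^ l w * u i)" for w
  proof (induction "l w" arbitrary: w rule: less_induct)
    case less
    show ?case
    proof (cases "w = id")
      case True
      show ?thesis unfolding True rho_1[OF a] mv_one[OF u(1)] by simp
    next
      case False
      obtain k where k: "k \<in> J" "w (Suc k) < w k" by (rule WJ_descent[OF J less.prems False])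
      have kS: "k \<in> S" using k(1) J by blast
      have wW: "w \<in> W" by (rule WJ_W[OF J less.prems])
      have wk: "w \<circ> gen k \<in> WJ J" using WJ_comp_gen_iff[OF k(1)] less.prems by blast
      have wkW: "w \<circ> gen k \<in> W" by (rule WJ_W[OF J wk])
      have lw: "l w = Suc (l (w \<circ> gen k))" by (rule len_comp_gen(2)[OF wW kS k(2)])
      have e: "(w \<circ> gen k) \<circ> gen k = w" unfolding comp_assoc gen_gen by simp
      have "Tb (w \<circ> gen k) \<star> Tb (gen k) = Tb ((w \<circ> gen k) \<circ> gen k)" by (rule Tb_mult_gen_right[OF kS wkW]) (unfold e, rule lw)
      then have t: "Tb w = Tb (w \<circ> gen k) \<star> Tb (gen k)" unfolding e by simp
      have h: "hk (Tb (w \<circ> gen k))" "hk (Tb (gen k))" using wkW kS by auto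
      have "mv (d a) (rho a (Tb w)) u = mv (d a) (rho a (Tb (w \<circ> gen k))) (Tv a k u)" unfolding t Tv_def mv_hm[OF a h] ..
      also have "\<dots> = (\<lambda>i. qs * mv (d a) (rho a (Tb (w \<circ> gen k))) u i)" unfolding u(3)[OF k(1)] mv_scale ..
      also have "mv (d a) (rho a (Tb (w \<circ> gen k))) u = (\<lambda>i. qs ^ l (w \<circ> gen k) * u i)" by (rule less.hyps[OF _ wk]) (simp add: lw)
      finally show ?thesis unfolding lw by (simp add: mult.assoc)
    qed
  qed
  have "mv (d a) (rho a (xJ J qs)) u i = PJ J qs * u i" for i
  proof -
    have "mv (d a) (rho a (xJ J qs)) u i = (\<Sum>w\<in>WJ J. qs ^ l w * mv (d a) (rho a (Tb w)) u i)"
      unfolding xJ_lc[OF J] rho_lc mv_def sum_distrib_right sum_distrib_left by (subst sum.swap) (simp only: mult.assoc)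
    also have "\<dots> = (\<Sum>w\<in>WJ J. qs ^ l w * qs ^ l w * u i)" by (rule sum.cong[OF refl]) (simp only: Tw mult.assoc)
    finally show ?thesis unfolding PJ_def[OF J] by (simp only: sum_distrib_right)
  qed
  then have "PJ J qs * u i = 0" for i unfolding z mv_0 by metis
  then have "u i = 0" for i using PJ_nz[OF J] by (simp only: mult_eq_0_iff) blast
  then show False using u(2) by blast
qed

lemma rho_xs_nz: assumes a: "a \<in> Par n" and mu: "mu \<in> Par n" and dom: "dominates mu a" shows "rho a (xs mu) \<noteq> (\<lambda>i j. 0)"
proof (rule sgv_xJ[OF a Jl_S])
  show "sgv a (Jl n mu)"
  proof (rule sgv_descend[OF a mu, of "Psum a"])
    show "mono (Psum a)" by (rule monoI) (rule Psum_mono)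
    show "Psum a i = n" if "n \<le> i" for i by (rule Psum_n[OF a that])
    show "Psum mu i \<le> Psum a i" for i using dom unfolding dominates_Psum by blast
    show "sgv a {k \<in> S. k \<notin> range (Psum a)}" using sgv_start[OF a] unfolding Jl_def .
  qed simp
qed

text \<open>For the converse pass through \<open>wl mu\<close>: x is below it because
  \<open>CC (wl mu)\<close> is a multiple of the antisymmetrizer of mu, which acts nontrivially in
  shape lam, and it is below y because both lie in the set of mu.\<close>

lemma leLR_iff: assumes lam: "lam \<in> Par n" and mu: "mu \<in> Par n" and x: "x \<in> RR lam" and y: "y \<in> RR mu"
  shows "leLR n x y \<longleftrightarrow> dominates mu lam"
proof
  assume "leLR n x y" then show "dominates mu lam" by (rule leLR_dominates[OF lam mu x y])
next
  assume dom: "dominates mu lam"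
  obtain c where c: "c \<noteq> 0" "CC (wl mu) = (\<lambda>u. c * xs mu u)" using CC_wJ[OF Jl_S] by blast
  have "rho lam (CC (wl mu)) \<noteq> (\<lambda>i j. 0)"
  proof
    assume "rho lam (CC (wl mu)) = (\<lambda>i j. 0)"
    then have "c * rho lam (xs mu) i j = 0" for i j unfolding c(2) rho_scale by (rule fun_cong[OF fun_cong, of "\<lambda>i j. c * rho lam (xs mu) i j" "\<lambda>i j. 0"])
    then have "rho lam (xs mu) = (\<lambda>i j. 0)" using c(1) by (intro ext) simp
    then show False using rho_xs_nz[OF lam mu dom] by contradiction
  qed
  then have "leLR n x (wl mu)" by (rule RR_below[OF lam wl_W _ x])
  moreover have "leLR n (wl mu) y" by (rule RR_below[OF mu RR_W[OF y] rho_CC_nz[OF mu y] wl_RR[OF mu]])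
  ultimately show "leLR n x y" by (rule leLR_trans)
qed

lemma RR_cell: assumes lam: "lam \<in> Par n" and x: "x \<in> RR lam" shows "{y \<in> W. leLR n x y \<and> leLR n y x} = RR lam"
proof (intro Set.set_eqI iffI)
  fix y assume y: "y \<in> {y \<in> W. leLR n x y \<and> leLR n y x}"
  then obtain mu where mu: "mu \<in> Par n" "y \<in> RR mu" using RR_cover by blast
  have "dominates mu lam" "dominates lam mu" using y leLR_iff[OF lam mu(1) x mu(2)] leLR_iff[OF mu(1) lam mu(2) x] by blast+
  then have "mu = lam" using dominates_antisym[of lam mu n] lam mu(1) by blast
  then show "y \<in> RR lam" using mu(2) by simp
next
  fix y assume y: "y \<in> RR lam"
  then show "y \<in> {y \<in> W. leLR n x y \<and> leLR n y x}"
    using leLR_iff[OF lam lam x y] leLR_iff[OF lam lam y x] dominates_refl RR_W[OF y] by blast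
qed

lemma cells_RR: "RR ` Par n = two_sided_cells n"
proof (intro Set.set_eqI iffI)
  fix C assume "C \<in> RR ` Par n"
  then obtain lam where lam: "lam \<in> Par n" "C = RR lam" by blast
  have w: "wl lam \<in> RR lam" by (rule wl_RR[OF lam(1)])
  show "C \<in> two_sided_cells n" unfolding two_sided_cells_def lam(2) RR_cell[OF lam(1) w, symmetric] using wl_W by blast
next
  fix C assume "C \<in> two_sided_cells n"
  then obtain x where x: "x \<in> W" "C = {y \<in> W. leLR n x y \<and> leLR n y x}" unfolding two_sided_cells_def by blast
  obtain lam where lam: "lam \<in> Par n" "x \<in> RR lam" using RR_cover[OF x(1)] by blast
  show "C \<in> RR ` Par n" unfolding x(2) RR_cell[OF lam] using lam(1) by blast
qed

end

theorem theorem5p1: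
  fixes n :: nat
    and d :: "nat list \<Rightarrow> nat"
    and X :: "nat list \<Rightarrow> perm \<Rightarrow> K mat"
  assumes irr: "\<forall>lam\<in>Par n. irreducible_rep n (d lam) (X lam)"
    and orth: "\<forall>lam\<in>Par n. orthogonal_rep n (d lam) (X lam)"
    and distinct: "inj_on (\<lambda>lam. charX n (X lam)) (Par n)"
    and all_irr: "\<forall>e Y. irreducible_rep n e Y \<longrightarrow> (\<exists>lam\<in>Par n. charX n Y = charX n (X lam))"
    and labelling: "\<forall>lam\<in>Par n. \<exists>m :: nat list \<Rightarrow> nat. \<forall>w\<in>Wn n.
        indchar n lam w = charX n (X lam) w +
          (\<Sum>mu\<in>{mu\<in>Par n. dominates lam mu \<and> lam \<noteq> mu}. of_nat (m mu) * charX n (X mu) w)"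
    and integral: "\<forall>lam\<in>Par n. \<forall>w\<in>Wn n. \<forall>i<d lam. \<forall>j<d lam.
        \<exists>c. cval n lam (X lam) w i j c \<and> c \<in> \<int>"
  shows "(\<forall>lam\<in>Par n. \<forall>mu\<in>Par n. \<forall>x\<in>Rset n lam (d lam) (X lam). \<forall>y\<in>Rset n mu (d mu) (X mu).
            leLR n x y \<longleftrightarrow> dominates mu lam)
       \<and> (\<forall>lam\<in>Par n. \<forall>mu\<in>Par n. leLR n (wlam n lam) (wlam n mu) \<longleftrightarrow> dominates mu lam)
       \<and> (\<lambda>lam. Rset n lam (d lam) (X lam)) ` Par n = two_sided_cells n"
proof -
  interpret reps n d X by unfold_locales (rule irr, rule orth, rule distinct, rule labelling, rule integral)
  have "leLR n (wlam n lam) (wlam n mu) \<longleftrightarrow> dominates mu lam" if "lam \<in> Par n" "mu \<in> Par n" for lam mu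
    unfolding wlam_wJ by (rule leLR_iff[OF that wl_RR[OF that(1)] wl_RR[OF that(2)]])
  then show ?thesis using leLR_iff cells_RR by blast
qed

end
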